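(* Let $A\in\mathbb{R}^{n\times n}$ be symmetric, and let $\widetilde Q\in\mathbb{R}^{n\times n}$ be computed by either Algorithm O (orthogonalizing a low-precision eigenvector matrix) or Algorithm T (low-precision tridiagonalization) described in the context, with low precision $u_\ell$ and working precision $u<u_\ell$. Then $\widetilde Q$ satisfies (P1) $\|\widetilde Q^T\widetilde Q-I\|_2\le p_1u<1$, and (P2) $\mathrm{off}(\widetilde A)\le p_4u_\ell\|A\|_F$, where $\widetilde A=\widetilde Q^TA\widetilde Q$, where $p_1=p_1(n)$ and $p_4=p_4(n)$ are low-degree polynomials in $n$.
   Context: $u_\ell>u$ are the unit roundoffs of the low and working precision floating-point formats; arithmetic at precision $w$ obeys $\mathrm{fl}(x\ \mathrm{op}\ y)=(x\ \mathrm{op}\ y)(1+\delta)$, $|\delta|\le w$, and underflow and overflow are assumed not to occur. The inequality $p_1u<1$ in (P1) is a standing assumption on the size of $u$ relative to $n$. $\mathrm{off}(B)=\bigl(\sum_{i\ne j}b_{ij}^2\bigr)^{1/2}$, and $\|\cdot\|_F$ is the Frobenius norm. Symmetric eigensolvers used at precision $w$ are backward stable: for symmetric $B$ they return $Q,\Lambda$ ($\Lambda$ diagonal) for which there exist $\Delta B,\Delta Q$ with $B+\Delta B=(Q+\Delta Q)\Lambda(Q+\Delta Q)^T$, $Q+\Delta Q$ orthogonal, $\|\Delta B\|_2\le p(n)w\|B\|_2$, $\|\Delta Q\|_2\le p(n)w$, with $p(n)$ a low-degree polynomial. Algorithm O. (1) Compute a spectral decomposition $Q_\ell\Lambda_\ell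 Q_\ell^T$ of $A$ at precision $u_\ell$. (2) Orthogonalize $Q_\ell$ to $\widetilde Q$ at precision $u$, using one of: the modified Gram–Schmidt method; Householder QR factorization, $\widetilde Q$ being the computed orthogonal factor; or the Newton–Schulz iteration $X_0=Q_\ell$, $X_{k+1}=\tfrac12X_k(3I-X_k^TX_k)$, which computes the unitary polar factor. Algorithm T. (1) Tridiagonalize $A$ to $T_\ell$ by the Householder method at precision $u_\ell$, storing the Householder vectors $v$ as the columns of $V\in\mathbb{R}^{n\times(n-2)}$. (2) Promote $V$ to precision $u$. (3) Compute a spectral decomposition $Q_S\Lambda_\ell Q_S^T$ of $T_\ell$ at precision $u$. (4) Form $\widetilde Q$ by applying to $Q_S$, at precision $u$, the Householder reflectors $I-2vv^T/\|v\|_2^2$ constructed from the columns of $V$, so that $\widetilde Q$ approximates the product of the reflectors used in the reduction with $Q_S$.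
   Formalization: For modified Gram–Schmidt and Newton–Schulz, p(n)u_ℓ ≤ 1/2 is assumed (otherwise Q_ℓ = 0 is possible and P1 fails); Newton–Schulz is stopped within a fixed number m of steps after its exact iteration from Q_ℓ is orthogonal to within u, and p_1, p_4 may depend on m. *)

theory Defs
  imports "Jordan_Normal_Form.Matrix" "HOL-Computational_Algebra.Polynomial"
begin

section \<open>Norms and matrix classes\<close>

text \<open>Matrices are the explicitly dimensioned ones of \<^theory>\<open>Jordan_Normal_Form.Matrix\<close>, since the
  polynomials of the theorem are chosen before the dimension.\<close>

definition vec_norm2 :: "real vec \<Rightarrow> real" where
  "vec_norm2 x = sqrt (x \<bullet> x)"

definition spectral_norm :: "real mat \<Rightarrow> real" where
  "spectral_norm A = Sup {vec_norm2 (A *\<^sub>v x) | x. x \<in> carrier_vec (dim_col A) \<and> vec_norm2 x \<le> 1}"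

definition frobenius_norm :: "real mat \<Rightarrow> real" where
  "frobenius_norm A = sqrt (\<Sum>i<dim_row A. \<Sum>j<dim_col A. (A $$ (i,j))\<^sup>2)"

definition off :: "real mat \<Rightarrow> real" where
  "off B = sqrt (\<Sum>i<dim_row B. \<Sum>j \<in> {..<dim_col B} - {i}. (B $$ (i,j))\<^sup>2)"

definition symmetric_mat :: "real mat \<Rightarrow> bool" where
  "symmetric_mat A \<longleftrightarrow> transpose_mat A = A"

text \<open>The library's \<^const>\<open>orthogonal_mat\<close> does not normalise the columns, hence a separate notion.\<close>

definition orthonormal_mat :: "nat \<Rightarrow> real mat \<Rightarrow> bool" where
  "orthonormal_mat n Q \<longleftrightarrow> Q \<in> carrier_mat n n \<and> transpose_mat Q * Q = 1\<^sub>m n"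


section \<open>Floating-point arithmetic\<close>

text \<open>The computed operations are arbitrary functions obeying the standard model. They act on all
  reals (no underflow or overflow), so low-precision numbers are operands of the working-precision
  operations without change: promotion is the identity. \<open>fround\<close> stores a real number in the
  format.\<close>

record fparith =
  fround :: "real \<Rightarrow> real"
  fadd :: "real \<Rightarrow> real \<Rightarrow> real"
  fsub :: "real \<Rightarrow> real \<Rightarrow> real"
  fmul :: "real \<Rightarrow> real \<Rightarrow> real"
  fdiv :: "real \<Rightarrow> real \<Rightarrow> real"
  fsqrt :: "real \<Rightarrow> real"

definition approx :: "real \<Rightarrow> real \<Rightarrow> real \<Rightarrow> bool" where
  "approx w z x \<longleftrightarrow> (\<exists>\<delta>. \<bar>\<delta>\<bar> \<le> w \<and> z = x * (1 + \<delta>))"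

definition standard_model :: "real \<Rightarrow> fparith \<Rightarrow> bool" where
  "standard_model w F \<longleftrightarrow>
     (\<forall>x. approx w (fround F x) x) \<and>
     (\<forall>x y. approx w (fadd F x y) (x + y)) \<and>
     (\<forall>x y. approx w (fsub F x y) (x - y)) \<and>
     (\<forall>x y. approx w (fmul F x y) (x * y)) \<and>
     (\<forall>x y. y \<noteq> 0 \<longrightarrow> approx w (fdiv F x y) (x / y)) \<and>
     (\<forall>x. 0 \<le> x \<longrightarrow> approx w (fsqrt F x) (sqrt x))"

fun fl_sum :: "fparith \<Rightarrow> real list \<Rightarrow> real" where
  "fl_sum F [] = 0"
| "fl_sum F (x # xs) = foldl (fadd F) x xs"

definition fl_dot :: "fparith \<Rightarrow> (nat \<Rightarrow> real) \<Rightarrow> (nat \<Rightarrow> real) \<Rightarrow> nat list \<Rightarrow> real" where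
  "fl_dot F x y ks = fl_sum F (map (\<lambda>k. fmul F (x k) (y k)) ks)"

definition fl_mat_mult :: "fparith \<Rightarrow> real mat \<Rightarrow> real mat \<Rightarrow> real mat" where
  "fl_mat_mult F A B = mat (dim_row A) (dim_col B)
     (\<lambda>(i,j). fl_dot F (\<lambda>k. A $$ (i,k)) (\<lambda>k. B $$ (k,j)) [0..<dim_col A])"


section \<open>Backward stable symmetric eigensolvers\<close>

definition backward_stable_eigensolver ::
    "real poly \<Rightarrow> nat \<Rightarrow> real \<Rightarrow> (real mat \<Rightarrow> real mat \<times> real mat) \<Rightarrow> bool" where
  "backward_stable_eigensolver p n w eig \<longleftrightarrow>
     (\<forall>B \<in> carrier_mat n n. symmetric_mat B \<longrightarrow>
        (\<exists>Q \<Lambda> \<Delta>B \<Delta>Q. eig B = (Q, \<Lambda>) \<and>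
           Q \<in> carrier_mat n n \<and> \<Lambda> \<in> carrier_mat n n \<and> diagonal_mat \<Lambda> \<and>
           \<Delta>B \<in> carrier_mat n n \<and> \<Delta>Q \<in> carrier_mat n n \<and>
           B + \<Delta>B = (Q + \<Delta>Q) * \<Lambda> * transpose_mat (Q + \<Delta>Q) \<and>
           orthonormal_mat n (Q + \<Delta>Q) \<and>
           spectral_norm \<Delta>B \<le> poly p (real n) * w * spectral_norm B \<and>
           spectral_norm \<Delta>Q \<le> poly p (real n) * w))"


section \<open>Householder reflectors\<close>

text \<open>Vectors are functions on indices; \<open>k\<close> is the pivot and only the entries \<open>k, \<dots>, n - 1\<close> of
  \<open>x\<close> are used. The reflector \<open>I - 2 v v\<^sup>T / (v\<^sup>T v)\<close> maps that part of \<open>x\<close> to \<open>house_pivot\<close> times the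
  unit vector \<open>e\<^sub>k\<close>, with the usual sign choice avoiding cancellation. If that part is zero, so is
  \<open>v\<close>; the reflector of \<open>v = 0\<close> is the identity.\<close>

definition house_pivot :: "fparith \<Rightarrow> nat \<Rightarrow> nat \<Rightarrow> (nat \<Rightarrow> real) \<Rightarrow> real" where
  "house_pivot F n k x =
     (let s = fsqrt F (fl_dot F x x [k..<n]) in if 0 \<le> x k then - s else s)"

definition house_vec :: "fparith \<Rightarrow> nat \<Rightarrow> nat \<Rightarrow> (nat \<Rightarrow> real) \<Rightarrow> nat \<Rightarrow> real" where
  "house_vec F n k x = (\<lambda>i.
     if i < k then 0
     else if i = k then fsub F (x k) (house_pivot F n k x)
     else x i)"

definition fl_reflect :: "fparith \<Rightarrow> nat \<Rightarrow> nat \<Rightarrow> (nat \<Rightarrow> real) \<Rightarrow> real mat \<Rightarrow> real mat" where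
  "fl_reflect F n k v C =
     (if \<forall>i \<in> {k..<n}. v i = 0 then C
      else
        let \<beta> = fdiv F 2 (fl_dot F v v [k..<n]);
            t = (\<lambda>j. fmul F \<beta> (fl_dot F v (\<lambda>i. C $$ (i,j)) [k..<n]))
        in mat n (dim_col C)
             (\<lambda>(i,j). if i < k then C $$ (i,j) else fsub F (C $$ (i,j)) (fmul F (v i) (t j))))"


section \<open>Orthogonalization\<close>

definition mgs_step :: "fparith \<Rightarrow> nat \<Rightarrow> nat \<Rightarrow> real mat \<Rightarrow> real mat" where
  "mgs_step F n k M =
     (let r = fsqrt F (fl_dot F (\<lambda>i. M $$ (i,k)) (\<lambda>i. M $$ (i,k)) [0..<n]);
          q = (\<lambda>i. fdiv F (M $$ (i,k)) r);
          s = (\<lambda>j. fl_dot F q (\<lambda>i. M $$ (i,j)) [0..<n])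
      in mat n n (\<lambda>(i,j).
           if j < k then M $$ (i,j)
           else if j = k then q i
           else fsub F (M $$ (i,j)) (fmul F (s j) (q i))))"

primrec mgs_iter :: "fparith \<Rightarrow> nat \<Rightarrow> real mat \<Rightarrow> nat \<Rightarrow> real mat" where
  "mgs_iter F n X 0 = X"
| "mgs_iter F n X (Suc k) = mgs_step F n k (mgs_iter F n X k)"

definition mgs :: "fparith \<Rightarrow> real mat \<Rightarrow> real mat" where
  "mgs F X = mgs_iter F (dim_row X) X (dim_row X)"

definition hqr_step :: "fparith \<Rightarrow> nat \<Rightarrow> nat \<Rightarrow> real mat \<Rightarrow> real mat" where
  "hqr_step F n k R =
     (let x = (\<lambda>i. R $$ (i,k));
          R' = fl_reflect F n k (house_vec F n k x) R
      in mat n n (\<lambda>(i,j).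
           if i < k \<or> j < k then R $$ (i,j)
           else if j = k then (if i = k then house_pivot F n k x else 0)
           else R' $$ (i,j)))"

primrec hqr_iter :: "fparith \<Rightarrow> nat \<Rightarrow> real mat \<Rightarrow> nat \<Rightarrow> real mat" where
  "hqr_iter F n X 0 = X"
| "hqr_iter F n X (Suc k) = hqr_step F n k (hqr_iter F n X k)"

text \<open>The explicit orthogonal factor is accumulated backwards: \<open>H\<^sub>0 (H\<^sub>1 (\<dots> (H\<^sub>n\<^sub>-\<^sub>2 I)))\<close>.\<close>

definition householder_qr_Q :: "fparith \<Rightarrow> real mat \<Rightarrow> real mat" where
  "householder_qr_Q F X =
     (let n = dim_row X
      in foldr (\<lambda>k. fl_reflect F n k (house_vec F n k (\<lambda>i. hqr_iter F n X k $$ (i,k))))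
           [0..<n - 1] (1\<^sub>m n))"

definition newton_schulz_step :: "fparith \<Rightarrow> real mat \<Rightarrow> real mat" where
  "newton_schulz_step F X =
     (let n = dim_row X;
          G = fl_mat_mult F (transpose_mat X) X;
          S = mat n n (\<lambda>(i,j). fsub F (if i = j then 3 else 0) (G $$ (i,j)))
      in map_mat (fmul F (1/2)) (fl_mat_mult F X S))"

definition newton_schulz_exact_step :: "real mat \<Rightarrow> real mat" where
  "newton_schulz_exact_step X =
     (1/2) \<cdot>\<^sub>m (X * (3 \<cdot>\<^sub>m 1\<^sub>m (dim_row X) - transpose_mat X * X))"

definition orthogonality_defect :: "real mat \<Rightarrow> real" where
  "orthogonality_defect X = spectral_norm (transpose_mat X * X - 1\<^sub>m (dim_col X))"

text \<open>The number of Newton--Schulz steps that counts as having computed the unitary polar factor at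
  precision \<open>u\<close>: the same number of steps in exact arithmetic reaches a matrix orthogonal to within
  \<open>u\<close>, and at most \<open>m\<close> steps were made after that was first the case. (The exact
  iteration only selects the step count; the algorithm returns the computed iterate. An upper limit
  is needed because rounding errors make the computed iterates drift, without bound, along the
  orthogonal matrices.)\<close>

definition newton_schulz_count :: "nat \<Rightarrow> real \<Rightarrow> real mat \<Rightarrow> nat \<Rightarrow> bool" where
  "newton_schulz_count m u X k \<longleftrightarrow>
     orthogonality_defect ((newton_schulz_exact_step ^^ k) X) \<le> u \<and>
     (\<forall>j. j + m < k \<longrightarrow> u < orthogonality_defect ((newton_schulz_exact_step ^^ j) X))"

datatype orth_method = MGS | Householder_QR | Newton_Schulz nat

primrec orthogonalize :: "fparith \<Rightarrow> orth_method \<Rightarrow> real mat \<Rightarrow> real mat" where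
  "orthogonalize F MGS X = mgs F X"
| "orthogonalize F Householder_QR X = householder_qr_Q F X"
| "orthogonalize F (Newton_Schulz k) X = (newton_schulz_step F ^^ k) X"

text \<open>Modified Gram--Schmidt and Newton--Schulz presuppose that the matrix to be orthogonalized is
  safely nonsingular (and, for Newton--Schulz, of norm below \<open>\<surd>3\<close>). The eigensolver provides
  this only if \<open>p(n) u\<^sub>l\<close> is bounded away from 1: the bound 1 on the norm of \<open>\<Delta>Q\<close> would admit
  \<open>Q\<^sub>l = 0\<close>. Here \<open>c\<close> stands for \<open>p(n) u\<^sub>l\<close>. Householder QR needs no such assumption.\<close>

primrec method_applicable :: "orth_method \<Rightarrow> nat \<Rightarrow> real \<Rightarrow> real \<Rightarrow> real mat \<Rightarrow> bool" where
  "method_applicable MGS m u c X \<longleftrightarrow> c \<le> 1/2"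
| "method_applicable Householder_QR m u c X \<longleftrightarrow> True"
| "method_applicable (Newton_Schulz k) m u c X \<longleftrightarrow> c \<le> 1/2 \<and> newton_schulz_count m u X k"

definition algorithm_O ::
    "fparith \<Rightarrow> (real mat \<Rightarrow> real mat \<times> real mat) \<Rightarrow> orth_method \<Rightarrow> real mat \<Rightarrow> real mat" where
  "algorithm_O F eig\<^sub>l meth A = orthogonalize F meth (fst (eig\<^sub>l A))"


section \<open>Low-precision tridiagonalization\<close>

text \<open>Step \<open>k\<close> annihilates the entries below the subdiagonal of column \<open>k\<close>. With
  \<open>\<beta> = 2 / (v\<^sup>T v)\<close>, \<open>p = \<beta> B v\<close> and \<open>w = p - (\<beta> / 2) (p\<^sup>T v) v\<close>, the two-sided product with the
  reflector is the rank-two update \<open>B - v w\<^sup>T - w v\<^sup>T\<close>, applied to the trailing block; only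
  its lower triangle is computed, so that the result is symmetric.\<close>

definition tridiag_step :: "fparith \<Rightarrow> nat \<Rightarrow> nat \<Rightarrow> real mat \<Rightarrow> real mat" where
  "tridiag_step F n k B =
     (let x = (\<lambda>i. B $$ (i,k));
          v = house_vec F n (k+1) x
      in if \<forall>i \<in> {k+1..<n}. v i = 0 then B
         else
           let \<beta> = fdiv F 2 (fl_dot F v v [k+1..<n]);
               p = (\<lambda>i. fmul F \<beta> (fl_dot F (\<lambda>j. B $$ (i,j)) v [k+1..<n]));
               K = fmul F (fdiv F \<beta> 2) (fl_dot F p v [k+1..<n]);
               w = (\<lambda>i. fsub F (p i) (fmul F K (v i)));
               upd = (\<lambda>i j. fsub F (fsub F (B $$ (i,j)) (fmul F (v i) (w j))) (fmul F (w i) (v j)))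
           in mat n n (\<lambda>(i,j).
                if k < i \<and> k < j then upd (max i j) (min i j)
                else if i \<noteq> k \<and> j \<noteq> k \<or> min i j < k \<or> i = j then B $$ (i,j)
                else if max i j = k + 1 then house_pivot F n (k+1) x
                else 0))"

primrec tridiag_iter :: "fparith \<Rightarrow> nat \<Rightarrow> real mat \<Rightarrow> nat \<Rightarrow> real mat" where
  "tridiag_iter F n A 0 = A"
| "tridiag_iter F n A (Suc k) = tridiag_step F n k (tridiag_iter F n A k)"

definition tridiag_T :: "fparith \<Rightarrow> real mat \<Rightarrow> real mat" where
  "tridiag_T F A = (let n = dim_row A in tridiag_iter F n A (n - 2))"

definition tridiag_V :: "fparith \<Rightarrow> real mat \<Rightarrow> real mat" where
  "tridiag_V F A =
     (let n = dim_row A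
      in mat n (n - 2) (\<lambda>(i,j). house_vec F n (j+1) (\<lambda>l. tridiag_iter F n A j $$ (l,j)) i))"

text \<open>\<open>F\<^sub>l\<close> is the low-precision and \<open>F\<close> the working-precision arithmetic; \<open>A\<close> is first stored in
  low precision. The reflectors are applied in the order that forms
  \<open>H\<^sub>0 (H\<^sub>1 (\<dots> (H\<^sub>n\<^sub>-\<^sub>3 Q\<^sub>S)))\<close>, where \<open>T\<^sub>l \<approx> H\<^sub>n\<^sub>-\<^sub>3 \<dots> H\<^sub>0 A H\<^sub>0 \<dots> H\<^sub>n\<^sub>-\<^sub>3\<close>.\<close>

definition algorithm_T ::
    "fparith \<Rightarrow> fparith \<Rightarrow> (real mat \<Rightarrow> real mat \<times> real mat) \<Rightarrow> real mat \<Rightarrow> real mat" where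
  "algorithm_T F\<^sub>l F eig A =
     (let n = dim_row A;
          A\<^sub>l = map_mat (fround F\<^sub>l) A;
          T\<^sub>l = tridiag_T F\<^sub>l A\<^sub>l;
          V = tridiag_V F\<^sub>l A\<^sub>l;
          Q\<^sub>S = fst (eig T\<^sub>l)
      in foldr (\<lambda>j. fl_reflect F n (j+1) (\<lambda>i. V $$ (i,j))) [0..<n - 2] Q\<^sub>S)"


section \<open>The properties of the computed matrix\<close>

definition property_P1 :: "real poly \<Rightarrow> nat \<Rightarrow> real \<Rightarrow> real mat \<Rightarrow> bool" where
  "property_P1 p\<^sub>1 n u Q \<longleftrightarrow>
     spectral_norm (transpose_mat Q * Q - 1\<^sub>m n) \<le> poly p\<^sub>1 (real n) * u \<and> poly p\<^sub>1 (real n) * u < 1"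

definition property_P2 :: "real poly \<Rightarrow> nat \<Rightarrow> real \<Rightarrow> real mat \<Rightarrow> real mat \<Rightarrow> bool" where
  "property_P2 p\<^sub>4 n u\<^sub>l A Q \<longleftrightarrow>
     off (transpose_mat Q * A * Q) \<le> poly p\<^sub>4 (real n) * u\<^sub>l * frobenius_norm A"

end

theory Submission
  imports Defs "HOL-Analysis.L2_Norm" "Jordan_Normal_Form.Determinant"
begin

text \<open>Every method produces a matrix close to an exactly orthonormal \<open>W\<close> for which \<open>W\<^sup>T A W\<close> is diagonal
  up to \<open>O(u\<^sub>l)\<parallel>A\<parallel>\<close>; both bounds follow from this. If \<open>u\<^sub>l\<close> is
  not small, the second bound is a consequence of \<open>\<parallel>Q\<parallel> \<le> 3/2\<close>.

  For the Householder methods \<open>W\<close> is built from the exact reflectors with the computed vectors. A triangular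
  factor of a nearly orthonormal matrix is nearly a diagonal matrix of signs, hence QR factorization changes
  the eigenvector matrix only in signs. Modified Gram--Schmidt gives \<open>U R\<close> small, where \<open>U\<close> is the strictly
  upper triangular part of \<open>Q\<^sup>T Q\<close>, and \<open>R\<close> is well conditioned.

  For Newton--Schulz the defect \<open>E = I - X\<^sup>T X\<close> evolves by \<open>E \<mapsto> 3/4 E\<^sup>2 + 1/4 E\<^sup>3\<close>, independently of \<open>X\<close>.
  This map contracts near 0, so computed and exact defects stay within \<open>O(u)\<close> of each other although the
  iterates themselves drift apart. The drift is one rounding error per step, and the number \<open>k\<close> of steps satisfies
  \<open>k u \<le> (m + 1) u + 3 \<epsilon>\<close> when the start has distance \<open>\<epsilon> = O(u\<^sub>l)\<close> from orthonormality, since the exact defects exceed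
  \<open>u\<close> until the last \<open>m\<close> steps but decrease at least like \<open>3 \<epsilon> / 4\<^sup>k\<close>.\<close>

section \<open>Matrix norms\<close>

text \<open>Smallness is available for \<open>u\<close> only: the hypothesis bounds
  \<open>poly p\<^sub>1 (real n) * u\<close>, while the low-precision roundoff may be anything above
  \<open>u\<close>. Hence (P1) has to come out of the working-precision arithmetic, and every
  comparison of \<open>Q\<close> with exact eigenvectors is confined to the range where a polynomial
  in \<open>n\<close> times the low-precision roundoff is at most 1. For Householder methods (P1) is
  automatic, because a reflector is exactly orthonormal for every vector. Gram--Schmidt loses
  orthogonality in proportion to the conditioning of its input, and Newton--Schulz converges only
  from a bounded range of singular values; both are served by the applicability condition, which
  puts the singular values of the eigenvector matrix into [1/2, 3/2]. Singular values never occur as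
  such: they are replaced by bounds on |X z| and on quadratic forms. No first-order asymptotics are
  used either. Every error bound is an explicit inequality in which \<gamma> = 2 n w absorbs the
  higher-order terms, and constants are rounded up generously, since only polynomial dependence on
  \<open>n\<close> matters.\<close>

declare minus_carrier_mat [simp]

section \<open>Euclidean norm of vectors\<close>

lemma vec_norm2_L2_set: "vec_norm2 x = L2_set (\<lambda>i. x $ i) {..<dim_vec x}"
  by (simp add: vec_norm2_def L2_set_def scalar_prod_def power2_eq_square atLeast0LessThan)

lemma vec_norm2_nonneg [simp]: "0 \<le> vec_norm2 x"
  by (simp add: vec_norm2_L2_set)

lemma vec_norm2_square: "(vec_norm2 x)\<^sup>2 = x \<bullet> x"
proof -
  have "0 \<le> x \<bullet> x"
    by (simp add: scalar_prod_def sum_nonneg)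
  then show ?thesis
    by (simp add: vec_norm2_def)
qed

lemma vec_norm2_eq_0_iff:
  assumes "x \<in> carrier_vec n" shows "vec_norm2 x = 0 \<longleftrightarrow> x = 0\<^sub>v n"
  using assms by (auto simp: vec_norm2_L2_set L2_set_eq_0_iff)

lemma vec_norm2_triangle:
  assumes "x \<in> carrier_vec n" "y \<in> carrier_vec n"
  shows "vec_norm2 (x + y) \<le> vec_norm2 x + vec_norm2 y"
proof -
  have "vec_norm2 (x + y) = L2_set (\<lambda>i. x $ i + y $ i) {..<n}"
    using assms unfolding vec_norm2_L2_set by (auto intro!: L2_set_cong)
  also have "\<dots> \<le> vec_norm2 x + vec_norm2 y"
    using L2_set_triangle_ineq[of "\<lambda>i. x $ i" "\<lambda>i. y $ i" "{..<n}"] assms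
    by (simp add: vec_norm2_L2_set)
  finally show ?thesis .
qed

lemma vec_norm2_smult: "vec_norm2 (c \<cdot>\<^sub>v x) = \<bar>c\<bar> * vec_norm2 x"
proof -
  have "(c \<cdot>\<^sub>v x) \<bullet> (c \<cdot>\<^sub>v x) = c\<^sup>2 * (x \<bullet> x)"
    by (simp add: scalar_prod_def sum_distrib_left power2_eq_square algebra_simps)
  then show ?thesis
    by (simp add: vec_norm2_def real_sqrt_mult)
qed

lemma vec_norm2_uminus: "vec_norm2 (- x) = vec_norm2 x"
  by (simp add: vec_norm2_def scalar_prod_def)

lemma vec_norm2_minus_triangle:
  assumes "x \<in> carrier_vec n" "y \<in> carrier_vec n"
  shows "vec_norm2 (x - y) \<le> vec_norm2 x + vec_norm2 y"
  using vec_norm2_triangle[of x n "- y"] assms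
  by (simp add: minus_add_uminus_vec[symmetric] vec_norm2_uminus)

lemma vec_norm2_triangle_rev:
  assumes "x \<in> carrier_vec n" "y \<in> carrier_vec n"
  shows "\<bar>vec_norm2 x - vec_norm2 y\<bar> \<le> vec_norm2 (x - y)"
proof -
  have "x = (x - y) + y" "y = x - (x - y)"
    using assms by auto
  then show ?thesis
    using vec_norm2_triangle[of "x - y" n y] vec_norm2_minus_triangle[of x n "x - y"] assms
    by auto
qed

lemma scalar_prod_le_vec_norm2:
  assumes "x \<in> carrier_vec n" "y \<in> carrier_vec n"
  shows "\<bar>x \<bullet> y\<bar> \<le> vec_norm2 x * vec_norm2 y"
proof -
  have "\<bar>x \<bullet> y\<bar> \<le> (\<Sum>i<n. \<bar>x $ i\<bar> * \<bar>y $ i\<bar>)"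
    using assms unfolding scalar_prod_def
    by (auto simp: abs_mult[symmetric] atLeast0LessThan)
  also have "\<dots> \<le> vec_norm2 x * vec_norm2 y"
    using L2_set_mult_ineq[of "\<lambda>i. x $ i" "\<lambda>i. y $ i" "{..<n}"] assms
    by (simp add: vec_norm2_L2_set)
  finally show ?thesis .
qed

lemma vec_norm2_le_1_unit: "vec_norm2 (unit_vec n i) \<le> 1"
  by (cases "i < n") (auto simp: vec_norm2_def scalar_prod_def unit_vec_def if_distrib cong: if_cong)

lemma vec_norm2_col: "C \<in> carrier_mat n m \<Longrightarrow> j < m \<Longrightarrow> vec_norm2 (col C j) = L2_set (\<lambda>i. C $$ (i,j)) {..<n}"
  by (auto simp: vec_norm2_L2_set intro!: L2_set_cong)

section \<open>Frobenius norm\<close>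

lemma frobenius_norm_L2_set:
  "frobenius_norm A = L2_set (\<lambda>(i,j). A $$ (i,j)) ({..<dim_row A} \<times> {..<dim_col A})"
  by (simp add: frobenius_norm_def L2_set_def sum.cartesian_product split_def)

lemma frobenius_norm_cols: "frobenius_norm A = L2_set (\<lambda>j. vec_norm2 (col A j)) {..<dim_col A}"
proof -
  have "(vec_norm2 (col A j))\<^sup>2 = (\<Sum>i<dim_row A. (A $$ (i,j))\<^sup>2)" if "j < dim_col A" for j
    using that by (simp add: vec_norm2_square scalar_prod_def power2_eq_square[of "A $$ _"] atLeast0LessThan)
  then show ?thesis
    unfolding frobenius_norm_def L2_set_def by (subst sum.swap) simp
qed

lemma frobenius_norm_nonneg [simp]: "0 \<le> frobenius_norm A"
  by (simp add: frobenius_norm_L2_set)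

lemma frobenius_norm_transpose: "frobenius_norm (transpose_mat A) = frobenius_norm A"
  unfolding frobenius_norm_def by (subst sum.swap) simp

lemma frobenius_norm_uminus: "frobenius_norm (- A) = frobenius_norm A"
  by (simp add: frobenius_norm_def)

lemma frobenius_norm_triangle:
  assumes "A \<in> carrier_mat nr nc" "B \<in> carrier_mat nr nc"
  shows "frobenius_norm (A + B) \<le> frobenius_norm A + frobenius_norm B"
proof -
  have "frobenius_norm (A + B) = L2_set (\<lambda>x. (case x of (i,j) \<Rightarrow> A $$ (i,j)) + (case x of (i,j) \<Rightarrow> B $$ (i,j))) ({..<nr} \<times> {..<nc})"
    using assms unfolding frobenius_norm_L2_set by (auto intro!: L2_set_cong)
  also have "\<dots> \<le> frobenius_norm A + frobenius_norm B"
    using assms unfolding frobenius_norm_L2_set by (auto intro!: L2_set_triangle_ineq)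
  finally show ?thesis .
qed

lemma frobenius_norm_minus_triangle:
  assumes "A \<in> carrier_mat nr nc" "B \<in> carrier_mat nr nc"
  shows "frobenius_norm (A - B) \<le> frobenius_norm A + frobenius_norm B"
  using frobenius_norm_triangle[of A nr nc "- B"] assms
  by (simp add: minus_add_uminus_mat frobenius_norm_uminus)

lemma frobenius_norm_minus_commute:
  assumes "A \<in> carrier_mat nr nc" "B \<in> carrier_mat nr nc"
  shows "frobenius_norm (A - B) = frobenius_norm (B - A)"
  using assms by (simp add: frobenius_norm_def power2_commute)

lemma frobenius_norm_triangle_diff:
  assumes "A \<in> carrier_mat nr nc" "B \<in> carrier_mat nr nc" "C \<in> carrier_mat nr nc"
  shows "frobenius_norm (A - C) \<le> frobenius_norm (A - B) + frobenius_norm (B - C)"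
proof -
  have "A - C = (A - B) + (B - C)"
    using assms by auto
  then show ?thesis
    using frobenius_norm_triangle[of "A - B" nr nc "B - C"] assms by simp
qed

lemma frobenius_norm_le_add_diff:
  assumes "A \<in> carrier_mat nr nc" "B \<in> carrier_mat nr nc"
  shows "frobenius_norm A \<le> frobenius_norm B + frobenius_norm (A - B)"
proof -
  have "A = B + (A - B)"
    using assms by auto
  then show ?thesis
    using frobenius_norm_triangle[of B nr nc "A - B"] assms by simp
qed

lemma frobenius_norm_le_entries:
  assumes "A \<in> carrier_mat n n" "0 \<le> c" "\<And>i j. i < n \<Longrightarrow> j < n \<Longrightarrow> \<bar>A $$ (i,j)\<bar> \<le> c"
  shows "frobenius_norm A \<le> real n * c"
proof -
  have "(\<Sum>i<n. \<Sum>j<n. (A $$ (i,j))\<^sup>2) \<le> (\<Sum>i<n. \<Sum>j<n. c\<^sup>2)"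
    using assms(3) by (intro sum_mono) (auto simp: abs_le_square_iff[symmetric] assms(2))
  also have "\<dots> = (real n * c)\<^sup>2"
    by (simp add: power2_eq_square)
  finally have "sqrt (\<Sum>i<n. \<Sum>j<n. (A $$ (i,j))\<^sup>2) \<le> sqrt ((real n * c)\<^sup>2)"
    by (rule real_sqrt_le_mono)
  then show ?thesis
    using assms by (simp add: frobenius_norm_def)
qed

lemma frobenius_norm_le_cols:
  assumes "A \<in> carrier_mat nr n" "B \<in> carrier_mat nr' n" "0 \<le> c"
    "\<And>j. j < n \<Longrightarrow> vec_norm2 (col A j) \<le> c * vec_norm2 (col B j)"
  shows "frobenius_norm A \<le> c * frobenius_norm B"
proof -
  have "frobenius_norm A \<le> L2_set (\<lambda>j. c * vec_norm2 (col B j)) {..<n}"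
    using assms unfolding frobenius_norm_cols by (auto intro!: L2_set_mono)
  also have "\<dots> = c * frobenius_norm B"
    using assms unfolding frobenius_norm_cols by (simp add: L2_set_right_distrib)
  finally show ?thesis .
qed

lemma vec_norm2_mult_le_frobenius:
  assumes A: "A \<in> carrier_mat nr nc" and x: "x \<in> carrier_vec nc"
  shows "vec_norm2 (A *\<^sub>v x) \<le> frobenius_norm A * vec_norm2 x"
proof -
  have "vec_norm2 (A *\<^sub>v x) = L2_set (\<lambda>i. row A i \<bullet> x) {..<nr}"
    using A unfolding vec_norm2_L2_set by (auto intro!: L2_set_cong)
  also have "\<dots> = L2_set (\<lambda>i. \<bar>row A i \<bullet> x\<bar>) {..<nr}"
    by (simp add: L2_set_def)
  also have "\<dots> \<le> L2_set (\<lambda>i. vec_norm2 (col (transpose_mat A) i) * vec_norm2 x) {..<nr}"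
    using A x by (intro L2_set_mono) (auto intro!: scalar_prod_le_vec_norm2[of _ nc])
  also have "\<dots> = frobenius_norm (transpose_mat A) * vec_norm2 x"
    unfolding frobenius_norm_cols using A by (simp add: L2_set_left_distrib)
  finally show ?thesis
    by (simp add: frobenius_norm_transpose)
qed

section \<open>Spectral norm, and its interplay with the Frobenius norm\<close>

lemma spectral_norm_bdd:
  assumes "A \<in> carrier_mat nr nc"
  shows "bdd_above {vec_norm2 (A *\<^sub>v x) | x. x \<in> carrier_vec (dim_col A) \<and> vec_norm2 x \<le> 1}"
proof (rule bdd_aboveI)
  fix y assume "y \<in> {vec_norm2 (A *\<^sub>v x) | x. x \<in> carrier_vec (dim_col A) \<and> vec_norm2 x \<le> 1}"
  then obtain x where x: "y = vec_norm2 (A *\<^sub>v x)" "x \<in> carrier_vec nc" "vec_norm2 x \<le> 1"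
    using assms by auto
  have "y \<le> frobenius_norm A * vec_norm2 x"
    using vec_norm2_mult_le_frobenius[OF assms x(2)] x(1) by simp
  also have "\<dots> \<le> frobenius_norm A"
    using x(3) by (simp add: mult_left_le)
  finally show "y \<le> frobenius_norm A" .
qed

lemma spectral_norm_upper:
  assumes "A \<in> carrier_mat nr nc" "x \<in> carrier_vec nc" "vec_norm2 x \<le> 1"
  shows "vec_norm2 (A *\<^sub>v x) \<le> spectral_norm A"
  unfolding spectral_norm_def
  by (rule cSup_upper[OF _ spectral_norm_bdd[OF assms(1)]]) (use assms in auto)

lemma spectral_norm_nonneg:
  assumes "A \<in> carrier_mat nr nc" shows "0 \<le> spectral_norm A"
proof -
  have "vec_norm2 (0\<^sub>v nc) = 0"
    by (simp add: vec_norm2_def)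
  then have "vec_norm2 (A *\<^sub>v 0\<^sub>v nc) \<le> spectral_norm A"
    by (intro spectral_norm_upper[OF assms]) auto
  then show ?thesis
    using vec_norm2_nonneg[of "A *\<^sub>v 0\<^sub>v nc"] by linarith
qed

lemma vec_norm2_mult_le_spectral:
  assumes A: "A \<in> carrier_mat nr nc" and x: "x \<in> carrier_vec nc"
  shows "vec_norm2 (A *\<^sub>v x) \<le> spectral_norm A * vec_norm2 x"
proof (cases "vec_norm2 x = 0")
  case True
  have "vec_norm2 (A *\<^sub>v x) \<le> frobenius_norm A * vec_norm2 x"
    by (rule vec_norm2_mult_le_frobenius[OF A x])
  then show ?thesis
    using True by simp
next
  case False
  then have pos: "0 < vec_norm2 x"
    using vec_norm2_nonneg[of x] by linarith
  have "vec_norm2 (A *\<^sub>v ((1 / vec_norm2 x) \<cdot>\<^sub>v x)) \<le> spectral_norm A"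
    using A x pos by (intro spectral_norm_upper) (auto simp: vec_norm2_smult)
  also have "A *\<^sub>v ((1 / vec_norm2 x) \<cdot>\<^sub>v x) = (1 / vec_norm2 x) \<cdot>\<^sub>v (A *\<^sub>v x)"
    using A x by (simp add: mult_mat_vec)
  finally show ?thesis
    using pos by (simp add: vec_norm2_smult field_simps)
qed

lemma spectral_norm_leI:
  assumes A: "A \<in> carrier_mat nr nc" and c: "0 \<le> c"
    and le: "\<And>x. x \<in> carrier_vec nc \<Longrightarrow> vec_norm2 (A *\<^sub>v x) \<le> c * vec_norm2 x"
  shows "spectral_norm A \<le> c"
  unfolding spectral_norm_def
proof (rule cSup_least)
  have "vec_norm2 (0\<^sub>v nc) = 0"
    by (simp add: vec_norm2_def)
  then show "{vec_norm2 (A *\<^sub>v x) | x. x \<in> carrier_vec (dim_col A) \<and> vec_norm2 x \<le> 1} \<noteq> {}"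
    using A by (auto intro!: exI[of _ "0\<^sub>v nc"])
next
  fix y assume "y \<in> {vec_norm2 (A *\<^sub>v x) | x. x \<in> carrier_vec (dim_col A) \<and> vec_norm2 x \<le> 1}"
  then obtain x where x: "y = vec_norm2 (A *\<^sub>v x)" "x \<in> carrier_vec nc" "vec_norm2 x \<le> 1"
    using A by auto
  have "y \<le> c * vec_norm2 x"
    using le x by simp
  also have "\<dots> \<le> c"
    using x(3) c by (simp add: mult_left_le)
  finally show "y \<le> c" .
qed

lemma spectral_norm_le_frobenius:
  "A \<in> carrier_mat nr nc \<Longrightarrow> spectral_norm A \<le> frobenius_norm A"
  by (rule spectral_norm_leI) (auto intro: vec_norm2_mult_le_frobenius)

lemma spectral_norm_triangle:
  assumes "A \<in> carrier_mat nr nc" "B \<in> carrier_mat nr nc"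
  shows "spectral_norm (A + B) \<le> spectral_norm A + spectral_norm B"
proof (rule spectral_norm_leI)
  fix x :: "real vec" assume x: "x \<in> carrier_vec nc"
  have "vec_norm2 ((A + B) *\<^sub>v x) \<le> vec_norm2 (A *\<^sub>v x) + vec_norm2 (B *\<^sub>v x)"
    using assms x by (auto simp: add_mult_distrib_mat_vec intro!: vec_norm2_triangle[of _ nr])
  also have "\<dots> \<le> (spectral_norm A + spectral_norm B) * vec_norm2 x"
    using vec_norm2_mult_le_spectral[OF assms(1) x] vec_norm2_mult_le_spectral[OF assms(2) x]
    by (simp add: algebra_simps)
  finally show "vec_norm2 ((A + B) *\<^sub>v x) \<le> (spectral_norm A + spectral_norm B) * vec_norm2 x" .
qed (use assms spectral_norm_nonneg in auto)

lemma spectral_norm_mult: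
  assumes A: "A \<in> carrier_mat nr n" and B: "B \<in> carrier_mat n nc"
  shows "spectral_norm (A * B) \<le> spectral_norm A * spectral_norm B"
proof (rule spectral_norm_leI)
  fix x :: "real vec" assume x: "x \<in> carrier_vec nc"
  have "vec_norm2 ((A * B) *\<^sub>v x) \<le> spectral_norm A * vec_norm2 (B *\<^sub>v x)"
    using assms x by (auto simp: assoc_mult_mat_vec intro!: vec_norm2_mult_le_spectral)
  also have "\<dots> \<le> spectral_norm A * (spectral_norm B * vec_norm2 x)"
    using vec_norm2_mult_le_spectral[OF B x] spectral_norm_nonneg[OF A]
    by (intro mult_left_mono)
  finally show "vec_norm2 ((A * B) *\<^sub>v x) \<le> spectral_norm A * spectral_norm B * vec_norm2 x"
    by (simp add: mult.assoc)
qed (use assms spectral_norm_nonneg in auto)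

lemma spectral_norm_smult_le:
  assumes "A \<in> carrier_mat nr nc" shows "spectral_norm (c \<cdot>\<^sub>m A) \<le> \<bar>c\<bar> * spectral_norm A"
proof (rule spectral_norm_leI)
  fix x :: "real vec" assume x: "x \<in> carrier_vec nc"
  have "(c \<cdot>\<^sub>m A) *\<^sub>v x = c \<cdot>\<^sub>v (A *\<^sub>v x)"
    using assms x by (intro eq_vecI) (auto simp: scalar_prod_def sum_distrib_left algebra_simps)
  then show "vec_norm2 ((c \<cdot>\<^sub>m A) *\<^sub>v x) \<le> \<bar>c\<bar> * spectral_norm A * vec_norm2 x"
    using vec_norm2_mult_le_spectral[OF assms x]
    by (simp add: vec_norm2_smult mult_left_mono mult.assoc)
qed (use assms spectral_norm_nonneg in auto)

lemma spectral_norm_uminus: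
  assumes "A \<in> carrier_mat nr nc" shows "spectral_norm (- A) = spectral_norm A"
proof -
  have "vec_norm2 (- A *\<^sub>v x) = vec_norm2 (A *\<^sub>v x)" if "x \<in> carrier_vec (dim_col A)" for x
    using that by (simp add: vec_norm2_uminus)
  then have "{vec_norm2 (- A *\<^sub>v x) | x. x \<in> carrier_vec (dim_col (- A)) \<and> vec_norm2 x \<le> 1}
      = {vec_norm2 (A *\<^sub>v x) | x. x \<in> carrier_vec (dim_col A) \<and> vec_norm2 x \<le> 1}"
    by (metis (no_types, opaque_lifting) index_uminus_mat(3))
  then show ?thesis
    by (simp only: spectral_norm_def)
qed

lemma spectral_norm_minus_triangle:
  assumes "A \<in> carrier_mat nr nc" "B \<in> carrier_mat nr nc"
  shows "spectral_norm (A - B) \<le> spectral_norm A + spectral_norm B"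
  using spectral_norm_triangle[of A nr nc "- B"] assms spectral_norm_uminus[of B nr nc]
  by (simp add: minus_add_uminus_mat)

lemma spectral_norm_le_add_diff:
  assumes "A \<in> carrier_mat nr nc" "B \<in> carrier_mat nr nc"
  shows "spectral_norm A \<le> spectral_norm B + spectral_norm (A - B)"
proof -
  have "A = B + (A - B)"
    using assms by auto
  then show ?thesis
    using spectral_norm_triangle[of B nr nc "A - B"] assms by simp
qed

lemma spectral_norm_triangle_diff:
  assumes "A \<in> carrier_mat nr nc" "B \<in> carrier_mat nr nc" "C \<in> carrier_mat nr nc"
  shows "spectral_norm (A - C) \<le> spectral_norm (A - B) + spectral_norm (B - C)"
proof -
  have "A - C = (A - B) + (B - C)"
    using assms by auto
  then show ?thesis
    using spectral_norm_triangle[of "A - B" nr nc "B - C"] assms by simp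
qed

lemma spectral_norm_minus_commute:
  assumes "A \<in> carrier_mat nr nc" "B \<in> carrier_mat nr nc"
  shows "spectral_norm (A - B) = spectral_norm (B - A)"
proof -
  have "B - A = - (A - B)"
    using assms by auto
  then show ?thesis
    using spectral_norm_uminus[of "A - B" nr nc] assms by simp
qed

lemma scalar_prod_transpose:
  assumes "A \<in> carrier_mat nr nc" "x \<in> carrier_vec nc" "y \<in> carrier_vec nr"
  shows "(A *\<^sub>v x) \<bullet> y = x \<bullet> (transpose_mat A *\<^sub>v (y :: real vec))"
  using assms transpose_vec_mult_scalar[of A nr nc x y] comm_scalar_prod[of "A *\<^sub>v x" nr y]
    comm_scalar_prod[of x nc "transpose_mat A *\<^sub>v y"]
  by simp

text \<open>For y = A^T x one has |y|^2 = (A y) . x, which is at most |A| |y| |x|; one factor |y|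
  cancels.\<close>

lemma spectral_norm_transpose_le:
  assumes A: "A \<in> carrier_mat nr nc" shows "spectral_norm (transpose_mat A) \<le> spectral_norm A"
proof (rule spectral_norm_leI[of _ nc nr])
  fix x :: "real vec" assume x: "x \<in> carrier_vec nr"
  let ?y = "transpose_mat A *\<^sub>v x"
  have y: "?y \<in> carrier_vec nc"
    using A x by simp
  have "(vec_norm2 ?y)\<^sup>2 = (A *\<^sub>v ?y) \<bullet> x"
    using scalar_prod_transpose[OF A y x] by (simp add: vec_norm2_square)
  also have "\<dots> \<le> vec_norm2 (A *\<^sub>v ?y) * vec_norm2 x"
    using scalar_prod_le_vec_norm2[of "A *\<^sub>v ?y" nr x] A x y by auto
  also have "\<dots> \<le> (spectral_norm A * vec_norm2 ?y) * vec_norm2 x"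
    using vec_norm2_mult_le_spectral[OF A y] by (intro mult_right_mono) auto
  finally have "vec_norm2 ?y * vec_norm2 ?y \<le> vec_norm2 ?y * (spectral_norm A * vec_norm2 x)"
    by (simp add: power2_eq_square algebra_simps)
  then show "vec_norm2 ?y \<le> spectral_norm A * vec_norm2 x"
    using spectral_norm_nonneg[OF A] vec_norm2_nonneg[of ?y]
    by (cases "vec_norm2 ?y = 0") (auto simp: mult_le_cancel_left)
qed (use A spectral_norm_nonneg in auto)

lemma spectral_norm_transpose:
  assumes "A \<in> carrier_mat nr nc" shows "spectral_norm (transpose_mat A) = spectral_norm A"
  using spectral_norm_transpose_le[OF assms] spectral_norm_transpose_le[of "transpose_mat A" nc nr] assms
  by (simp add: transpose_transpose)

lemma frobenius_norm_mult_left: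
  assumes A: "A \<in> carrier_mat nr n" and B: "B \<in> carrier_mat n nc"
  shows "frobenius_norm (A * B) \<le> spectral_norm A * frobenius_norm B"
proof (rule frobenius_norm_le_cols)
  fix j assume j: "j < nc"
  have "col (A * B) j = A *\<^sub>v col B j"
    by (rule col_mult2[OF A B j])
  then show "vec_norm2 (col (A * B) j) \<le> spectral_norm A * vec_norm2 (col B j)"
    using vec_norm2_mult_le_spectral[OF A, of "col B j"] B j by simp
qed (use assms spectral_norm_nonneg in auto)

lemma frobenius_norm_mult_right:
  assumes A: "A \<in> carrier_mat nr n" and B: "B \<in> carrier_mat n nc"
  shows "frobenius_norm (A * B) \<le> frobenius_norm A * spectral_norm B"
proof -
  have "frobenius_norm (A * B) = frobenius_norm (transpose_mat B * transpose_mat A)"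
    using A B by (simp add: transpose_mult[symmetric] frobenius_norm_transpose)
  also have "\<dots> \<le> spectral_norm (transpose_mat B) * frobenius_norm (transpose_mat A)"
    using A B by (intro frobenius_norm_mult_left) auto
  finally show ?thesis
    using B by (simp add: spectral_norm_transpose frobenius_norm_transpose mult.commute)
qed

lemma frobenius_norm_mult:
  assumes A: "A \<in> carrier_mat nr n" and B: "B \<in> carrier_mat n nc"
  shows "frobenius_norm (A * B) \<le> frobenius_norm A * frobenius_norm B"
  using frobenius_norm_mult_left[OF A B] spectral_norm_le_frobenius[OF A]
    mult_right_mono[of "spectral_norm A" "frobenius_norm A" "frobenius_norm B"]
  by simp

lemma vec_norm2_col_le_spectral:
  assumes A: "A \<in> carrier_mat nr n" and j: "j < n"
  shows "vec_norm2 (col A j) \<le> spectral_norm A"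
proof -
  have "col A j = A *\<^sub>v unit_vec n j"
    using A j by (intro eq_vecI) auto
  then show ?thesis
    using spectral_norm_upper[OF A, of "unit_vec n j"] vec_norm2_le_1_unit by simp
qed

text \<open>The optimal factor is the square root of \<open>n\<close>. The coarser \<open>n\<close>
  costs only a power of \<open>n\<close> in the final polynomials and keeps roots out of
  them.\<close>

lemma frobenius_norm_le_spectral:
  assumes A: "A \<in> carrier_mat nr n"
  shows "frobenius_norm A \<le> real n * spectral_norm A"
proof -
  have "(\<Sum>j<n. vec_norm2 (col A j)) \<le> (\<Sum>j<n. spectral_norm A)"
    using vec_norm2_col_le_spectral[OF A] by (intro sum_mono) auto
  moreover have "frobenius_norm A \<le> (\<Sum>j<n. vec_norm2 (col A j))"
    using A unfolding frobenius_norm_cols by (auto intro!: L2_set_le_sum)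
  ultimately show ?thesis
    by simp
qed

lemma frobenius_norm_one_le: "frobenius_norm (1\<^sub>m n) \<le> real n"
  using frobenius_norm_le_entries[of "1\<^sub>m n" n 1] by simp

section \<open>Orthonormal matrices\<close>

lemma orthonormal_mat_carrier: "orthonormal_mat n Q \<Longrightarrow> Q \<in> carrier_mat n n"
  by (simp add: orthonormal_mat_def)

lemma orthonormal_mat_transpose_mult: "orthonormal_mat n Q \<Longrightarrow> transpose_mat Q * Q = 1\<^sub>m n"
  by (simp add: orthonormal_mat_def)

lemma orthonormal_mat_mult_transpose: "orthonormal_mat n Q \<Longrightarrow> Q * transpose_mat Q = 1\<^sub>m n"
  unfolding orthonormal_mat_def
  using mat_mult_left_right_inverse[of "transpose_mat Q" n Q] by simp

lemma orthonormal_mat_one [simp]: "orthonormal_mat n (1\<^sub>m n)"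
  by (simp add: orthonormal_mat_def)

lemma orthonormal_mat_transpose: "orthonormal_mat n Q \<Longrightarrow> orthonormal_mat n (transpose_mat Q)"
  using orthonormal_mat_mult_transpose[of n Q]
  by (simp add: orthonormal_mat_def)

lemma orthonormal_mat_mult:
  assumes "orthonormal_mat n P" "orthonormal_mat n Q" shows "orthonormal_mat n (P * Q)"
proof -
  have [simp]: "P \<in> carrier_mat n n" "Q \<in> carrier_mat n n"
    using assms by (auto simp: orthonormal_mat_def)
  have "transpose_mat (P * Q) * (P * Q) = transpose_mat Q * (transpose_mat P * P) * Q"
    by (simp add: transpose_mult[of P n n Q n] assoc_mult_mat[of _ n n _ n _ n] mult_carrier_mat[of _ n n])
  also have "\<dots> = 1\<^sub>m n"
    using assms by (simp add: orthonormal_mat_def left_mult_one_mat[of _ n n] right_mult_one_mat[of _ n n])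
  finally show ?thesis
    by (auto simp: orthonormal_mat_def intro!: mult_carrier_mat[of _ n n])
qed

lemma orthonormal_mat_preserves_norm:
  assumes Q: "orthonormal_mat n Q" and x: "x \<in> carrier_vec n"
  shows "vec_norm2 (Q *\<^sub>v x) = vec_norm2 x"
proof -
  have [simp]: "Q \<in> carrier_mat n n"
    using Q by (simp add: orthonormal_mat_def)
  have "(vec_norm2 (Q *\<^sub>v x))\<^sup>2 = x \<bullet> (transpose_mat Q *\<^sub>v (Q *\<^sub>v x))"
    using x scalar_prod_transpose[of Q n n x "Q *\<^sub>v x"] mult_mat_vec_carrier[of Q n n x]
    by (simp add: vec_norm2_square)
  also have "transpose_mat Q *\<^sub>v (Q *\<^sub>v x) = (transpose_mat Q * Q) *\<^sub>v x"
    using x by (simp add: assoc_mult_mat_vec[of _ n n _ n])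
  also have "x \<bullet> \<dots> = (vec_norm2 x)\<^sup>2"
    using x Q by (simp add: vec_norm2_square orthonormal_mat_def)
  finally show ?thesis
    by (simp add: power2_eq_iff_nonneg)
qed

lemma spectral_norm_orthonormal: "orthonormal_mat n Q \<Longrightarrow> spectral_norm Q \<le> 1"
  by (rule spectral_norm_leI[of _ n n]) (auto simp: orthonormal_mat_preserves_norm orthonormal_mat_carrier)

lemma frobenius_norm_orthonormal_mult_le:
  assumes "orthonormal_mat n Q" "B \<in> carrier_mat n nc"
  shows "frobenius_norm (Q * B) \<le> frobenius_norm B"
proof -
  have "frobenius_norm (Q * B) \<le> spectral_norm Q * frobenius_norm B"
    using assms by (intro frobenius_norm_mult_left) (auto simp: orthonormal_mat_def)
  also have "\<dots> \<le> 1 * frobenius_norm B"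
    using assms by (intro mult_right_mono spectral_norm_orthonormal) auto
  finally show ?thesis by simp
qed

lemma frobenius_norm_mult_orthonormal_le:
  assumes "orthonormal_mat n Q" "B \<in> carrier_mat nr n"
  shows "frobenius_norm (B * Q) \<le> frobenius_norm B"
proof -
  have "frobenius_norm (B * Q) \<le> frobenius_norm B * spectral_norm Q"
    using assms by (intro frobenius_norm_mult_right) (auto simp: orthonormal_mat_def)
  also have "\<dots> \<le> frobenius_norm B * 1"
    using assms by (intro mult_left_mono spectral_norm_orthonormal) auto
  finally show ?thesis by simp
qed

lemma frobenius_norm_orthonormal_le:
  assumes "orthonormal_mat n Q"
  shows "frobenius_norm Q \<le> real n"
proof -
  have "frobenius_norm Q = frobenius_norm (Q * 1\<^sub>m n)"
    using orthonormal_mat_carrier[OF assms] by simp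
  also have "\<dots> \<le> frobenius_norm (1\<^sub>m n)"
    using assms by (intro frobenius_norm_orthonormal_mult_le) auto
  also have "\<dots> \<le> n"
    by (rule frobenius_norm_one_le)
  finally show ?thesis .
qed

section \<open>Rounding errors\<close>

lemma L2_set_square: "(L2_set f A)\<^sup>2 = (\<Sum>i\<in>A. (f i)\<^sup>2)"
  by (simp add: L2_set_def sum_nonneg)

lemma L2_set_mono_abs:
  "(\<And>i. i \<in> A \<Longrightarrow> \<bar>f i\<bar> \<le> g i) \<Longrightarrow> L2_set f A \<le> L2_set g A"
  unfolding L2_set_def
  by (intro real_sqrt_le_mono sum_mono) (metis abs_ge_zero abs_of_nonneg abs_le_square_iff order_trans)

lemma L2_set_scale: "L2_set (\<lambda>i. c * f i) A = \<bar>c\<bar> * L2_set f A"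
  by (simp add: L2_set_def power_mult_distrib sum_distrib_left[symmetric] real_sqrt_mult)

lemma L2_set_abs: "L2_set (\<lambda>i. \<bar>f i\<bar>) A = L2_set f A"
  by (simp add: L2_set_def)

lemma L2_set_Cauchy_Schwarz: "\<bar>\<Sum>i\<in>A. f i * g i\<bar> \<le> L2_set f A * L2_set g A"
proof -
  have "\<bar>\<Sum>i\<in>A. f i * g i\<bar> \<le> (\<Sum>i\<in>A. \<bar>f i\<bar> * \<bar>g i\<bar>)"
    by (simp add: abs_mult[symmetric])
  also have "\<dots> \<le> L2_set f A * L2_set g A"
    by (rule L2_set_mult_ineq)
  finally show ?thesis .
qed

lemma L2_set_single: "finite A \<Longrightarrow> k \<in> A \<Longrightarrow> L2_set (\<lambda>i. if i = k then e else 0) A = \<bar>e\<bar>"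
  by (simp add: L2_set_def if_distrib[of power2] cong: if_cong)

lemma L2_set_mono_set: "finite B \<Longrightarrow> A \<subseteq> B \<Longrightarrow> L2_set f A \<le> L2_set f B"
  unfolding L2_set_def by (intro real_sqrt_le_mono sum_mono2) auto

lemma abs_mult_diff_le: "\<bar>a * b - a' * b'\<bar> \<le> \<bar>a - a'\<bar> * \<bar>b\<bar> + \<bar>a'\<bar> * \<bar>b - (b'::real)\<bar>"
proof -
  have "a * b - a' * b' = (a - a') * b + a' * (b - b')"
    by (simp add: algebra_simps)
  then show ?thesis
    by (metis abs_mult abs_triangle_ineq)
qed

text \<open>As long as 2 k w is at most 1, each further factor adds at most 2 w. This turns compound
  growth factors into explicit constants of first order; it is the origin of the factor 2 in
  \<gamma> and in the accumulated bounds.\<close>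

lemma one_plus_power_le:
  fixes w :: real
  assumes "0 \<le> w" "2 * real k * w \<le> 1"
  shows "(1 + w) ^ k \<le> 1 + 2 * real k * w"
  using assms
proof (induction k)
  case (Suc k)
  have kw: "2 * real k * w \<le> 1"
    using Suc.prems by (simp add: algebra_simps)
  have "(1 + w) ^ Suc k \<le> (1 + w) * (1 + 2 * real k * w)"
    using Suc kw by (simp add: mult_left_mono)
  also have "\<dots> = 1 + w + 2 * real k * w + w * (2 * real k * w)"
    by (simp add: algebra_simps)
  also have "\<dots> \<le> 1 + w + 2 * real k * w + w * 1"
    using mult_left_mono[OF kw Suc.prems(1)] by linarith
  finally show ?case
    by (simp add: algebra_simps)
qed simp

section \<open>Rounding errors of sums and inner products\<close>

lemma approx_error: "approx w z x \<Longrightarrow> \<bar>z - x\<bar> \<le> w * \<bar>x\<bar>"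
proof -
  assume "approx w z x"
  then obtain \<delta> where d: "\<bar>\<delta>\<bar> \<le> w" "z = x * (1 + \<delta>)"
    by (auto simp: approx_def)
  have "z - x = \<delta> * x"
    using d(2) by (simp add: algebra_simps)
  then show ?thesis
    using mult_right_mono[OF d(1), of "\<bar>x\<bar>"] by (simp add: abs_mult)
qed

text \<open>The bound is relative to the sum of absolute values, since cancellation rules out one
  relative to the sum. Generalising over the accumulator \<open>a\<close> absorbs the first rounded
  addition into the start value of the remaining fold.\<close>

lemma foldl_fadd_error:
  assumes F: "\<And>x y. \<bar>fadd F x y - (x + y)\<bar> \<le> w * \<bar>x + y\<bar>" and w: "0 \<le> w"
  shows "\<bar>foldl (fadd F) a xs - (a + sum_list xs)\<bar>
    \<le> ((1 + w) ^ length xs - 1) * (\<bar>a\<bar> + sum_list (map abs xs))"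
proof (induction xs arbitrary: a)
  case (Cons x xs)
  define b where "b = fadd F a x"
  define P where "P = (1 + w) ^ length xs - 1"
  define S where "S = sum_list (map abs xs)"
  have P: "0 \<le> P"
    using w by (simp add: P_def)
  have S: "0 \<le> S"
    by (auto simp: S_def intro!: sum_list_nonneg)
  have b: "\<bar>b - (a + x)\<bar> \<le> w * (\<bar>a\<bar> + \<bar>x\<bar>)"
    using F[of a x] mult_left_mono[OF abs_triangle_ineq[of a x] w] by (simp add: b_def)
  then have b': "\<bar>b\<bar> \<le> (1 + w) * (\<bar>a\<bar> + \<bar>x\<bar>)"
    by (simp add: algebra_simps)
  have IH: "\<bar>foldl (fadd F) b xs - (b + sum_list xs)\<bar> \<le> P * (\<bar>b\<bar> + S)"
    using Cons.IH[of b] by (simp add: P_def S_def)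
  have "P * (\<bar>b\<bar> + S) \<le> P * ((1 + w) * (\<bar>a\<bar> + \<bar>x\<bar>) + S)"
    using b' P by (intro mult_left_mono) auto
  then have "\<bar>foldl (fadd F) b xs - (a + (x + sum_list xs))\<bar>
      \<le> P * ((1 + w) * (\<bar>a\<bar> + \<bar>x\<bar>) + S) + w * (\<bar>a\<bar> + \<bar>x\<bar>)"
    using IH b by linarith
  also have "\<dots> = ((1 + w) * (P + 1) - 1) * (\<bar>a\<bar> + \<bar>x\<bar>) + P * S"
    by (simp add: algebra_simps)
  also have "\<dots> \<le> ((1 + w) * (P + 1) - 1) * (\<bar>a\<bar> + \<bar>x\<bar>) + ((1 + w) * (P + 1) - 1) * S"
    using w P S by (intro add_left_mono mult_right_mono) (auto simp: algebra_simps)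
  finally show ?case
    by (simp add: P_def S_def b_def algebra_simps)
qed simp

text \<open>Each product is rounded once and then takes part in at most \<open>length ks - 1\<close>
  rounded additions, because \<open>fl_sum\<close> starts from the first product and not from 0.
  Together this gives the exponent \<open>length ks\<close>.\<close>

lemma fl_dot_error_power:
  assumes F: "standard_model w F" and w: "0 \<le> w"
  shows "\<bar>fl_dot F x y ks - (\<Sum>k\<leftarrow>ks. x k * y k)\<bar>
    \<le> ((1 + w) ^ length ks - 1) * (\<Sum>k\<leftarrow>ks. \<bar>x k * y k\<bar>)"
proof (cases ks)
  case Nil
  then show ?thesis
    by (simp add: fl_dot_def)
next
  case (Cons l ls)
  define S where "S = (\<Sum>k\<leftarrow>ks. \<bar>x k * y k\<bar>)"
  define P where "P = (1 + w) ^ length ls - 1"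
  have P: "0 \<le> P"
    using w by (simp add: P_def)
  have mul: "\<bar>fmul F a b - a * b\<bar> \<le> w * \<bar>a * b\<bar>" for a b
    using F approx_error by (simp add: standard_model_def)
  have add: "\<bar>fadd F a b - (a + b)\<bar> \<le> w * \<bar>a + b\<bar>" for a b
    using F approx_error by (simp add: standard_model_def)
  have 1: "\<bar>(\<Sum>k\<leftarrow>ks. fmul F (x k) (y k)) - (\<Sum>k\<leftarrow>ks. x k * y k)\<bar> \<le> w * S"
    unfolding S_def
  proof (induction ks)
    case (Cons a ks)
    show ?case
      using Cons mul[of "x a" "y a"] by (simp add: algebra_simps)
  qed simp
  have 2: "(\<Sum>k\<leftarrow>ks. \<bar>fmul F (x k) (y k)\<bar>) \<le> (1 + w) * S"
    unfolding S_def
  proof (induction ks)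
    case (Cons a ks)
    have "\<bar>fmul F (x a) (y a)\<bar> \<le> (1 + w) * \<bar>x a * y a\<bar>"
      using mul[of "x a" "y a"] by (simp add: algebra_simps)
    with Cons show ?case
      by (simp add: algebra_simps)
  qed simp
  have "\<bar>fl_dot F x y ks - (\<Sum>k\<leftarrow>ks. fmul F (x k) (y k))\<bar> \<le> P * (\<Sum>k\<leftarrow>ks. \<bar>fmul F (x k) (y k)\<bar>)"
    using foldl_fadd_error[of F w "fmul F (x l) (y l)" "map (\<lambda>k. fmul F (x k) (y k)) ls", OF add w]
    by (simp add: Cons fl_dot_def P_def comp_def)
  also have "\<dots> \<le> P * ((1 + w) * S)"
    by (rule mult_left_mono[OF 2 P])
  finally have "\<bar>fl_dot F x y ks - (\<Sum>k\<leftarrow>ks. x k * y k)\<bar> \<le> P * ((1 + w) * S) + w * S"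
    using 1 by linarith
  also have "\<dots> = ((1 + w) ^ length ks - 1) * S"
    by (simp add: P_def Cons algebra_simps)
  finally show ?thesis
    by (simp add: S_def)
qed

text \<open>No inner product is longer than \<open>n\<close>, so \<gamma> = 2 n w is, by
  \<open>one_plus_power_le\<close>, a uniform error bound for all of them. The limit 1/100 leaves
  room to absorb all terms of higher order in \<gamma> into rounded-up constants.\<close>

locale fl_model =
  fixes F :: fparith and w :: real and n :: nat and \<gamma> :: real
  assumes model: "standard_model w F" and w_nonneg: "0 \<le> w" and n_pos: "1 \<le> n"
    and \<gamma>_def: "\<gamma> = 2 * real n * w" and \<gamma>_small: "\<gamma> \<le> 1/100"
begin

lemma \<gamma>_nonneg: "0 \<le> \<gamma>"
  using w_nonneg by (simp add: \<gamma>_def)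

lemma w_le: "w \<le> \<gamma> / 2"
proof -
  have "1 * w \<le> real n * w"
    using w_nonneg n_pos by (intro mult_right_mono) auto
  then show ?thesis
    by (simp add: \<gamma>_def)
qed

lemma fround_error: "\<bar>fround F x - x\<bar> \<le> w * \<bar>x\<bar>"
  using model approx_error by (simp add: standard_model_def)
lemma fsub_error: "\<bar>fsub F x y - (x - y)\<bar> \<le> w * \<bar>x - y\<bar>"
  using model approx_error by (simp add: standard_model_def)
lemma fmul_error: "\<bar>fmul F x y - x * y\<bar> \<le> w * \<bar>x * y\<bar>"
  using model approx_error by (simp add: standard_model_def)
lemma fdiv_error: "y \<noteq> 0 \<Longrightarrow> \<bar>fdiv F x y - x / y\<bar> \<le> w * \<bar>x / y\<bar>"
  using model approx_error unfolding standard_model_def by blast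
lemma fsqrt_error: "0 \<le> x \<Longrightarrow> \<bar>fsqrt F x - sqrt x\<bar> \<le> w * sqrt x"
  using model approx_error[of w "fsqrt F x" "sqrt x"] by (simp add: standard_model_def)

lemma fl_dot_error_sum:
  "\<bar>fl_dot F x y [k..<n] - (\<Sum>i\<in>{k..<n}. x i * y i)\<bar> \<le> \<gamma> * (\<Sum>i\<in>{k..<n}. \<bar>x i * y i\<bar>)"
proof -
  have "2 * real (n - k) * w \<le> \<gamma>"
    using w_nonneg by (auto simp: \<gamma>_def intro!: mult_right_mono)
  then have "(1 + w) ^ (n - k) - 1 \<le> \<gamma>"
    using one_plus_power_le[of w "n - k"] w_nonneg \<gamma>_small by linarith
  then have "((1 + w) ^ (n - k) - 1) * (\<Sum>i\<in>{k..<n}. \<bar>x i * y i\<bar>) \<le> \<gamma> * (\<Sum>i\<in>{k..<n}. \<bar>x i * y i\<bar>)"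
    by (intro mult_right_mono sum_nonneg) auto
  then show ?thesis
    using fl_dot_error_power[OF model w_nonneg, of x y "[k..<n]"]
    by (simp add: interv_sum_list_conv_sum_set_nat)
qed

lemma fl_dot_error:
  "\<bar>fl_dot F x y [k..<n] - (\<Sum>i\<in>{k..<n}. x i * y i)\<bar> \<le> \<gamma> * (L2_set x {k..<n} * L2_set y {k..<n})"
proof -
  have "(\<Sum>i\<in>{k..<n}. \<bar>x i * y i\<bar>) \<le> L2_set x {k..<n} * L2_set y {k..<n}"
    using L2_set_mult_ineq[of x y "{k..<n}"] by (simp add: abs_mult)
  then show ?thesis
    using fl_dot_error_sum[of x y k] \<gamma>_nonneg
    by (meson mult_left_mono order_trans)
qed

lemma fl_dot_self_error:
  "\<bar>fl_dot F x x [k..<n] - (L2_set x {k..<n})\<^sup>2\<bar> \<le> \<gamma> * (L2_set x {k..<n})\<^sup>2"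
  using fl_dot_error[of x x k] by (simp add: L2_set_square power2_eq_square[of "x _"] power2_eq_square[of "L2_set x _", symmetric])

lemma fl_norm_error:
  defines "s \<equiv> \<lambda>x k. fsqrt F (fl_dot F x x [k..<n])"
  shows "\<bar>s x k - L2_set x {k..<n}\<bar> \<le> 2 * \<gamma> * L2_set x {k..<n}"
proof -
  define d where "d = fl_dot F x x [k..<n]"
  define \<sigma> where "\<sigma> = L2_set x {k..<n}"
  have \<sigma>: "0 \<le> \<sigma>"
    by (simp add: \<sigma>_def)
  have d: "\<bar>d - \<sigma>\<^sup>2\<bar> \<le> \<gamma> * \<sigma>\<^sup>2"
    unfolding d_def \<sigma>_def by (rule fl_dot_self_error)
  have "\<gamma> * \<sigma>\<^sup>2 \<le> 1 * \<sigma>\<^sup>2"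
    using \<gamma>_small by (intro mult_right_mono) auto
  then have d0: "0 \<le> d"
    using d by linarith
  \<comment> \<open>Multiplication by sqrt d + \<sigma>, which is at least \<sigma>, replaces the
    difference of roots by d - \<sigma>^2, whose error is known.\<close>
  have *: "\<bar>sqrt d - \<sigma>\<bar> \<le> \<gamma> * \<sigma>"
  proof (cases "\<sigma> = 0")
    case True
    then show ?thesis using d by simp
  next
    case False
    have "\<bar>sqrt d - \<sigma>\<bar> * \<sigma> \<le> \<bar>sqrt d - \<sigma>\<bar> * (sqrt d + \<sigma>)"
      using d0 by (intro mult_left_mono) auto
    also have "\<dots> = \<bar>(sqrt d - \<sigma>) * (sqrt d + \<sigma>)\<bar>"
      using d0 \<sigma> by (simp add: abs_mult)
    also have "(sqrt d - \<sigma>) * (sqrt d + \<sigma>) = d - \<sigma>\<^sup>2"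
      using d0 by (simp add: algebra_simps power2_eq_square)
    also have "\<bar>\<dots>\<bar> \<le> (\<gamma> * \<sigma>) * \<sigma>"
      using d by (simp add: power2_eq_square mult.assoc)
    finally show ?thesis
      using False \<sigma> by simp
  qed
  have "sqrt d \<le> 2 * \<sigma>"
  proof -
    have "\<gamma> * \<sigma> \<le> 1 * \<sigma>"
      using \<gamma>_small \<sigma> by (intro mult_right_mono) auto
    then show ?thesis using * by linarith
  qed
  then have "w * sqrt d \<le> (\<gamma> / 2) * (2 * \<sigma>)"
    using w_le w_nonneg d0 \<gamma>_nonneg by (intro mult_mono) auto
  then have "\<bar>fsqrt F d - \<sigma>\<bar> \<le> 2 * \<gamma> * \<sigma>"
    using * fsqrt_error[OF d0] by (simp add: abs_le_iff)
  then show ?thesis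
    by (simp add: s_def d_def \<sigma>_def)
qed

end

section \<open>Householder reflectors\<close>

text \<open>The exact reflector of an arbitrary, in particular of a computed, vector. Division by
  zero yields 0, so a vector vanishing on \<open>{k..<n}\<close> gives the identity, and
  orthonormality holds for every \<open>v\<close>.\<close>

definition reflector :: "nat \<Rightarrow> nat \<Rightarrow> (nat \<Rightarrow> real) \<Rightarrow> real mat" where
  "reflector n k v = mat n n (\<lambda>(i,j). (if i = j then 1 else 0) -
     (if i < k \<or> j < k then 0 else v i * v j * (2 / (L2_set v {k..<n})\<^sup>2)))"

lemma reflector_carrier [simp]: "reflector n k v \<in> carrier_mat n n"
  by (simp add: reflector_def)

lemma reflector_dim [simp]: "dim_row (reflector n k v) = n" "dim_col (reflector n k v) = n"
  by (simp_all add: reflector_def)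

lemma reflector_transpose [simp]: "transpose_mat (reflector n k v) = reflector n k v"
  by (rule eq_matI) (auto simp: reflector_def)

lemma reflector_zero:
  assumes "\<forall>i\<in>{k..<n}. v i = 0" shows "reflector n k v = 1\<^sub>m n"
  using assms by (intro eq_matI) (auto simp: reflector_def)

lemma reflector_cong: "(\<And>i. k \<le> i \<Longrightarrow> i < n \<Longrightarrow> v i = v' i) \<Longrightarrow> reflector n k v = reflector n k v'"
proof -
  assume *: "\<And>i. k \<le> i \<Longrightarrow> i < n \<Longrightarrow> v i = v' i"
  have "L2_set v {k..<n} = L2_set v' {k..<n}"
    using * by (intro L2_set_cong) auto
  then show ?thesis
    using * unfolding reflector_def by (intro cong_mat) auto
qed

lemma reflector_mult_index:
  assumes C: "C \<in> carrier_mat n m" and i: "i < n" and j: "j < m"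
  shows "(reflector n k v * C) $$ (i,j) = (if i < k then C $$ (i,j)
     else C $$ (i,j) - v i * (2 / (L2_set v {k..<n})\<^sup>2 * (\<Sum>l\<in>{k..<n}. v l * C $$ (l,j))))"
proof -
  let ?c = "2 / (L2_set v {k..<n})\<^sup>2"
  have "(reflector n k v * C) $$ (i,j) = (\<Sum>l\<in>{0..<n}. reflector n k v $$ (i,l) * C $$ (l,j))"
    using C i j by (simp add: scalar_prod_def reflector_def)
  also have "\<dots> = (\<Sum>l\<in>{0..<n}. (if l = i then C $$ (i,j) else 0) -
      (if l \<in> {k..<n} then (if i < k then 0 else v i * v l * ?c * C $$ (l,j)) else 0))"
    using i by (intro sum.cong) (auto simp: reflector_def algebra_simps)
  also have "\<dots> = C $$ (i,j) - (\<Sum>l\<in>{k..<n}. if i < k then 0 else v i * v l * ?c * C $$ (l,j))"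
  proof -
    have "{0..<n} \<inter> {l. l \<in> {k..<n}} = {k..<n}"
      by auto
    moreover have "(\<Sum>l\<in>{0..<n}. if l = i then C $$ (i,j) else 0) = C $$ (i,j)"
      using i by simp
    ultimately show ?thesis
      by (simp only: sum_subtractf sum.inter_restrict[symmetric] finite_atLeastLessThan Collect_mem_eq
          Int_absorb1 Int_def[symmetric] sum.If_cases sum.neutral_const add_0_right)
  qed
  also have "(\<Sum>l\<in>{k..<n}. if i < k then 0 else v i * v l * ?c * C $$ (l,j))
      = (if i < k then 0 else v i * (?c * (\<Sum>l\<in>{k..<n}. v l * C $$ (l,j))))"
    by (simp add: sum_distrib_left sum_divide_distrib mult_ac)
  finally show ?thesis
    by simp
qed

lemma reflector_orthonormal: "orthonormal_mat n (reflector n k v)"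
proof -
  let ?H = "reflector n k v"
  let ?s = "(L2_set v {k..<n})\<^sup>2"
  have "?H * ?H = 1\<^sub>m n"
  proof (rule eq_matI)
    fix i j assume ij: "i < dim_row (1\<^sub>m n :: real mat)" "j < dim_col (1\<^sub>m n :: real mat)"
    then have ij: "i < n" "j < n" by auto
    \<comment> \<open>The row v^T H. It is -v^T in general; if v vanishes on \<open>{k..<n}\<close>,
      then 2 / 0 = 0 makes \<open>?H\<close> the identity and the row is v^T.\<close>
    have sum: "(\<Sum>l\<in>{k..<n}. v l * ?H $$ (l,j)) = (if j < k then 0 else if ?s = 0 then v j else - v j)"
    proof -
      have "(\<Sum>l\<in>{k..<n}. v l * ?H $$ (l,j)) =
         (\<Sum>l\<in>{k..<n}. (if l = j then v j else 0) - (if j < k then 0 else (v l)\<^sup>2 * (v j * (2 / ?s))))"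
        using ij by (intro sum.cong) (auto simp: reflector_def algebra_simps power2_eq_square)
      also have "\<dots> = (if j < k then 0 else v j - (\<Sum>l\<in>{k..<n}. (v l)\<^sup>2) * (v j * (2 / ?s)))"
        using ij by (auto simp: sum_subtractf sum_distrib_right simp del: times_divide_eq_right)
      also have "(\<Sum>l\<in>{k..<n}. (v l)\<^sup>2) = ?s"
        by (simp add: L2_set_square)
      finally show ?thesis
        by simp
    qed
    show "(?H * ?H) $$ (i,j) = (1\<^sub>m n :: real mat) $$ (i,j)"
      unfolding reflector_mult_index[OF reflector_carrier ij] sum using ij by (auto simp: reflector_def)
  qed (auto simp: reflector_def)
  then show ?thesis
    by (simp add: orthonormal_mat_def)
qed

section \<open>Application and construction of a single reflector in floating-point
  arithmetic\<close>

context fl_model begin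

text \<open>The coefficient times the squared norm of \<open>v\<close>: its exact value is 2 for
  every scaling of \<open>v\<close>, so its absolute error is meaningful.\<close>

definition scaled_coeff :: "nat \<Rightarrow> (nat \<Rightarrow> real) \<Rightarrow> real" where
  "scaled_coeff k v = fdiv F 2 (fl_dot F v v [k..<n]) * (L2_set v {k..<n})\<^sup>2"

lemma scaled_coeff_error:
  assumes "L2_set v {k..<n} \<noteq> 0"
  shows "\<bar>scaled_coeff k v - 2\<bar> \<le> 4 * \<gamma>"
proof -
  define \<nu> where "\<nu> = L2_set v {k..<n}"
  define d where "d = fl_dot F v v [k..<n]"
  have \<nu>: "0 < \<nu>"
    using assms L2_set_nonneg[of v "{k..<n}"] unfolding \<nu>_def by linarith
  have d: "\<bar>d - \<nu>\<^sup>2\<bar> \<le> \<gamma> * \<nu>\<^sup>2"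
    unfolding d_def \<nu>_def by (rule fl_dot_self_error)
  have "\<gamma> * \<nu>\<^sup>2 \<le> (1/100) * \<nu>\<^sup>2"
    using \<gamma>_small by (intro mult_right_mono) auto
  then have d': "99/100 * \<nu>\<^sup>2 \<le> d"
    using d by linarith
  moreover have "0 < \<nu>\<^sup>2"
    using \<nu> by simp
  ultimately have d0: "0 < d"
    by linarith
  define b where "b = fdiv F 2 d"
  have b: "\<bar>b - 2 / d\<bar> \<le> w * (2 / d)"
    using fdiv_error[of d 2] d0 by (simp add: b_def)
  have "b * d - 2 = (b - 2 / d) * d"
    using d0 by (simp add: field_simps)
  then have "\<bar>b * d - 2\<bar> = \<bar>b - 2 / d\<bar> * d"
    using d0 by (simp add: abs_mult)
  also have "\<dots> \<le> 2 * w"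
    using mult_right_mono[OF b, of d] d0 by simp
  finally have bd: "\<bar>b * d - 2\<bar> \<le> \<gamma>"
    using w_le by linarith
  have "\<bar>b * \<nu>\<^sup>2 - b * d\<bar> = \<bar>b\<bar> * \<bar>d - \<nu>\<^sup>2\<bar>"
    by (simp add: abs_mult[symmetric] algebra_simps abs_minus_commute)
  also have "\<dots> \<le> \<bar>b\<bar> * (\<gamma> * \<nu>\<^sup>2)"
    by (intro mult_left_mono d) auto
  also have "\<dots> \<le> \<bar>b\<bar> * (\<gamma> * (100/99 * d))"
    using d' \<gamma>_nonneg by (intro mult_left_mono) auto
  also have "\<dots> = (100/99 * \<gamma>) * (\<bar>b\<bar> * d)"
    by simp
  finally have 1: "\<bar>b * \<nu>\<^sup>2 - b * d\<bar> \<le> (100/99 * \<gamma>) * (\<bar>b\<bar> * d)" .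
  have "\<bar>b\<bar> * d = \<bar>b * d\<bar>"
    using d0 by (simp add: abs_mult)
  also have "\<dots> \<le> 201/100"
    using bd \<gamma>_small by linarith
  finally have "(100/99 * \<gamma>) * (\<bar>b\<bar> * d) \<le> (100/99 * \<gamma>) * (201/100)"
    using \<gamma>_nonneg by (intro mult_left_mono) auto
  then have "\<bar>b * \<nu>\<^sup>2 - 2\<bar> \<le> 4 * \<gamma>"
    using 1 bd \<gamma>_nonneg by linarith
  then show ?thesis
    by (simp add: scaled_coeff_def b_def d_def \<nu>_def)
qed

text \<open>The quantities of the reflector application are scaled by powers of \<open>\<nu> = \<parallel>v\<parallel>\<close>, which turns all
  error bounds into multiples of \<open>\<gamma> \<parallel>c\<parallel>\<close>.\<close>

lemma reflect_coeff_error: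
  fixes v :: "nat \<Rightarrow> real" and k :: nat
  defines "\<nu> \<equiv> L2_set v {k..<n}"
  defines "\<beta> \<equiv> fdiv F 2 (fl_dot F v v [k..<n])"
  assumes \<nu>: "\<nu> \<noteq> 0" and S: "\<bar>S - s\<bar> \<le> \<gamma> * (\<nu> * c)" and s: "\<bar>s\<bar> \<le> \<nu> * c" and c: "0 \<le> c"
  shows "\<bar>fmul F \<beta> S * \<nu> - 2 * (s / \<nu>)\<bar> \<le> 8 * \<gamma> * c"
proof -
  have \<nu>0: "0 < \<nu>"
    using \<nu> L2_set_nonneg[of v "{k..<n}"] unfolding \<nu>_def by linarith
  define b where "b = \<beta> * \<nu>\<^sup>2"
  have b: "\<bar>b - 2\<bar> \<le> 4 * \<gamma>"
    using scaled_coeff_error[of v k] \<nu> by (simp add: scaled_coeff_def b_def \<beta>_def \<nu>_def)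
  define S' where "S' = S / \<nu>"
  define s' where "s' = s / \<nu>"
  have Ss: "\<bar>S' - s'\<bar> \<le> \<gamma> * c"
  proof -
    have "\<bar>S' - s'\<bar> = \<bar>S - s\<bar> / \<nu>"
      using \<nu>0 by (simp add: S'_def s'_def diff_divide_distrib[symmetric])
    also have "\<dots> \<le> \<gamma> * c"
      using S \<nu>0 by (simp add: field_simps)
    finally show ?thesis .
  qed
  have s': "\<bar>s'\<bar> \<le> c"
    using s \<nu>0 by (simp add: s'_def field_simps)
  have \<gamma>c: "\<gamma> * c \<le> 1/100 * c"
    using \<gamma>_small c by (intro mult_right_mono)
  have S': "\<bar>S'\<bar> \<le> 101/100 * c"
    using Ss s' \<gamma>c by linarith
  have bS: "\<bar>b * S' - 2 * s'\<bar> \<le> 4 * \<gamma> * (101/100 * c) + 2 * (\<gamma> * c)"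
  proof -
    have "\<bar>b * S' - 2 * s'\<bar> \<le> \<bar>b - 2\<bar> * \<bar>S'\<bar> + \<bar>2\<bar> * \<bar>S' - s'\<bar>"
      by (rule abs_mult_diff_le)
    also have "\<dots> \<le> 4 * \<gamma> * (101/100 * c) + 2 * (\<gamma> * c)"
      using b S' Ss \<gamma>_nonneg by (intro add_mono mult_mono) auto
    finally show ?thesis .
  qed
  have bS': "\<bar>b * S'\<bar> \<le> 3 * c"
    using bS s' \<gamma>c by linarith
  have eq: "\<beta> * S * \<nu> = b * S'"
    using \<nu>0 by (simp add: b_def S'_def power2_eq_square)
  have "fmul F \<beta> S * \<nu> - b * S' = (fmul F \<beta> S - \<beta> * S) * \<nu>"
    by (simp add: eq[symmetric] left_diff_distrib)
  then have "\<bar>fmul F \<beta> S * \<nu> - b * S'\<bar> = \<bar>fmul F \<beta> S - \<beta> * S\<bar> * \<nu>"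
    using \<nu>0 by (simp add: abs_mult)
  also have "\<dots> \<le> w * \<bar>\<beta> * S\<bar> * \<nu>"
    using \<nu>0 by (intro mult_right_mono fmul_error) auto
  also have "\<dots> = w * \<bar>b * S'\<bar>"
    using \<nu>0 by (simp add: eq[symmetric] abs_mult)
  also have "\<dots> \<le> \<gamma> / 2 * (3 * c)"
    using bS' w_le w_nonneg \<gamma>_nonneg by (intro mult_mono) auto
  finally have "\<bar>fmul F \<beta> S * \<nu> - 2 * s'\<bar> \<le> \<gamma> / 2 * (3 * c) + (4 * \<gamma> * (101/100 * c) + 2 * (\<gamma> * c))"
    using bS by linarith
  also have "\<dots> \<le> 8 * (\<gamma> * c)"
    using mult_nonneg_nonneg[OF \<gamma>_nonneg c] by linarith
  finally show ?thesis
    by (simp add: s'_def mult.assoc)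
qed

text \<open>The uncertainty \<open>e\<close> of the multiplier and the rounding of product and
  difference are treated together. With t = t' and e = 0 the bound is the pure rounding error; the
  rank-two update and Gram--Schmidt use it in that form as well.\<close>

lemma fl_axpy_error:
  assumes t: "\<bar>t - t'\<bar> \<le> e"
  shows "\<bar>fsub F c (fmul F v t) - (c - v * t')\<bar> \<le> \<gamma> * \<bar>c\<bar> + \<bar>v\<bar> * (2 * \<gamma> * \<bar>t'\<bar> + 2 * e)"
proof -
  define m where "m = fmul F v t"
  have e: "0 \<le> e"
    using t by linarith
  have m: "\<bar>m - v * t\<bar> \<le> w * \<bar>v * t\<bar>"
    unfolding m_def by (rule fmul_error)
  have w1: "w \<le> 1/200"
    using w_le \<gamma>_small by linarith
  have 1: "\<bar>fsub F c m - (c - m)\<bar> \<le> w * (\<bar>c\<bar> + \<bar>m\<bar>)"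
    using fsub_error[of c m] mult_left_mono[OF abs_triangle_ineq4[of c m] w_nonneg] by linarith
  have vt0: "\<bar>v * t - v * t'\<bar> \<le> \<bar>v\<bar> * e"
    using mult_left_mono[OF t, of "\<bar>v\<bar>"] by (simp add: abs_mult[symmetric] right_diff_distrib)
  have m2: "\<bar>m\<bar> \<le> 2 * \<bar>v * t\<bar>"
  proof -
    have "w * \<bar>v * t\<bar> \<le> 1 * \<bar>v * t\<bar>"
      using w1 by (intro mult_right_mono) auto
    then show ?thesis using m by linarith
  qed
  have "w * \<bar>m\<bar> \<le> w * (2 * \<bar>v * t\<bar>)"
    by (rule mult_left_mono[OF m2 w_nonneg])
  then have "\<bar>fsub F c m - (c - v * t')\<bar> \<le> w * \<bar>c\<bar> + 3 * w * \<bar>v * t\<bar> + \<bar>v\<bar> * e"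
  proof -
    have "\<bar>fsub F c m - (c - v * t')\<bar> \<le> \<bar>fsub F c m - (c - m)\<bar> + \<bar>m - v * t\<bar> + \<bar>v * t - v * t'\<bar>"
      by linarith
    moreover have "w * (\<bar>c\<bar> + \<bar>m\<bar>) = w * \<bar>c\<bar> + w * \<bar>m\<bar>" "w * (2 * \<bar>v * t\<bar>) = 2 * (w * \<bar>v * t\<bar>)"
      "3 * w * \<bar>v * t\<bar> = 3 * (w * \<bar>v * t\<bar>)"
      by (simp_all add: distrib_left)
    ultimately show ?thesis
      using 1 m vt0 \<open>w * \<bar>m\<bar> \<le> w * (2 * \<bar>v * t\<bar>)\<close> by linarith
  qed
  also have "3 * w * \<bar>v * t\<bar> \<le> 3 * w * (\<bar>v\<bar> * \<bar>t'\<bar> + \<bar>v\<bar> * e)"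
  proof (intro mult_left_mono)
    have "\<bar>v * t\<bar> \<le> \<bar>v * t'\<bar> + \<bar>v\<bar> * e"
      using vt0 by linarith
    then show "\<bar>v * t\<bar> \<le> \<bar>v\<bar> * \<bar>t'\<bar> + \<bar>v\<bar> * e"
      by (simp add: abs_mult)
  qed (use w_nonneg in auto)
  also have "\<dots> \<le> 2 * \<gamma> * (\<bar>v\<bar> * \<bar>t'\<bar>) + 1 * (\<bar>v\<bar> * e)"
  proof -
    have "3 * w \<le> 2 * \<gamma>" "3 * w \<le> 1"
      using w_le w1 \<gamma>_nonneg by auto
    then have "3 * w * (\<bar>v\<bar> * \<bar>t'\<bar>) \<le> 2 * \<gamma> * (\<bar>v\<bar> * \<bar>t'\<bar>)" "3 * w * (\<bar>v\<bar> * e) \<le> 1 * (\<bar>v\<bar> * e)"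
      using e mult_right_mono[of "3 * w" "2 * \<gamma>" "\<bar>v\<bar> * \<bar>t'\<bar>"] mult_right_mono[of "3 * w" 1 "\<bar>v\<bar> * e"]
      by auto
    then show ?thesis
      by (simp add: distrib_left)
  qed
  also have "w * \<bar>c\<bar> \<le> \<gamma> * \<bar>c\<bar>"
    using w_le \<gamma>_nonneg by (intro mult_right_mono) auto
  finally show ?thesis
    by (simp add: m_def algebra_simps)
qed

lemma reflect_column_error:
  fixes v c :: "nat \<Rightarrow> real" and k :: nat
  defines "t \<equiv> fmul F (fdiv F 2 (fl_dot F v v [k..<n])) (fl_dot F v c [k..<n])"
    and "t' \<equiv> 2 / (L2_set v {k..<n})\<^sup>2 * (\<Sum>l\<in>{k..<n}. v l * c l)"
  assumes \<nu>: "L2_set v {k..<n} \<noteq> 0"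
  shows "L2_set (\<lambda>i. fsub F (c i) (fmul F (v i) t) - (c i - v i * t')) {k..<n}
    \<le> 25 * \<gamma> * L2_set c {k..<n}"
proof -
  define \<nu> where "\<nu> = L2_set v {k..<n}"
  define q where "q = L2_set c {k..<n}"
  have \<nu>0: "0 < \<nu>"
    using \<nu> L2_set_nonneg[of v "{k..<n}"] unfolding \<nu>_def by linarith
  have q: "0 \<le> q"
    by (simp add: q_def)
  have "\<bar>t * \<nu> - 2 * ((\<Sum>l\<in>{k..<n}. v l * c l) / \<nu>)\<bar> \<le> 8 * \<gamma> * q"
    unfolding t_def \<nu>_def
    by (rule reflect_coeff_error) (use \<nu> q fl_dot_error[of v c k] L2_set_Cauchy_Schwarz[of v c "{k..<n}"] in \<open>auto simp: q_def\<close>)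
  also have "t * \<nu> - 2 * ((\<Sum>l\<in>{k..<n}. v l * c l) / \<nu>) = (t - t') * \<nu>"
    using \<nu>0 by (simp add: t'_def \<nu>_def[symmetric] power2_eq_square field_simps)
  finally have tt: "\<bar>t - t'\<bar> \<le> 8 * \<gamma> * q / \<nu>"
    using \<nu>0 by (simp only: abs_mult abs_of_pos pos_le_divide_eq)
  have "\<bar>t'\<bar> = 2 / \<nu>\<^sup>2 * \<bar>\<Sum>l\<in>{k..<n}. v l * c l\<bar>"
    by (simp add: t'_def \<nu>_def[symmetric] abs_mult)
  also have "\<dots> \<le> 2 / \<nu>\<^sup>2 * (\<nu> * q)"
    using L2_set_Cauchy_Schwarz[of v c "{k..<n}"] by (intro mult_left_mono) (auto simp: \<nu>_def q_def)
  also have "\<dots> = 2 * q / \<nu>"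
    using \<nu>0 by (simp add: power2_eq_square)
  finally have t': "\<bar>t'\<bar> \<le> 2 * q / \<nu>" .
  have "L2_set (\<lambda>i. fsub F (c i) (fmul F (v i) t) - (c i - v i * t')) {k..<n}
      \<le> L2_set (\<lambda>i. \<gamma> * \<bar>c i\<bar> + 20 * \<gamma> * q / \<nu> * \<bar>v i\<bar>) {k..<n}"
  proof (rule L2_set_mono_abs)
    fix i
    have "2 * \<gamma> * \<bar>t'\<bar> + 2 * (8 * \<gamma> * q / \<nu>) \<le> 2 * \<gamma> * (2 * q / \<nu>) + 2 * (8 * \<gamma> * q / \<nu>)"
      using t' \<gamma>_nonneg by (intro add_right_mono mult_left_mono) auto
    \<comment> \<open>4 comes from rounding the product, as |t'| is at most 2 q / \<nu>, and 16 from
      the error 8 \<gamma> q / \<nu> of the computed multiplier.\<close>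
    also have "\<dots> = 20 * \<gamma> * q / \<nu>"
      by (simp add: field_simps)
    finally have "\<bar>v i\<bar> * (2 * \<gamma> * \<bar>t'\<bar> + 2 * (8 * \<gamma> * q / \<nu>)) \<le> \<bar>v i\<bar> * (20 * \<gamma> * q / \<nu>)"
      by (intro mult_left_mono) auto
    then show "\<bar>fsub F (c i) (fmul F (v i) t) - (c i - v i * t')\<bar> \<le> \<gamma> * \<bar>c i\<bar> + 20 * \<gamma> * q / \<nu> * \<bar>v i\<bar>"
      using fl_axpy_error[OF tt, of "c i" "v i"] by (simp add: mult.commute)
  qed
  also have "\<dots> \<le> L2_set (\<lambda>i. \<gamma> * \<bar>c i\<bar>) {k..<n} + L2_set (\<lambda>i. 20 * \<gamma> * q / \<nu> * \<bar>v i\<bar>) {k..<n}"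
    by (rule L2_set_triangle_ineq)
  also have "\<dots> = \<bar>\<gamma>\<bar> * q + \<bar>20 * \<gamma> * q / \<nu>\<bar> * \<nu>"
    by (simp only: L2_set_scale L2_set_abs q_def \<nu>_def)
  also have "\<dots> = \<gamma> * q + 20 * \<gamma> * q / \<nu> * \<nu>"
    using \<gamma>_nonneg q \<nu>0 by simp
  also have "\<dots> \<le> 25 * \<gamma> * q"
    using \<nu>0 mult_nonneg_nonneg[OF \<gamma>_nonneg q] by simp
  finally show ?thesis
    by (simp add: q_def)
qed

lemma fl_reflect_carrier: "C \<in> carrier_mat n m \<Longrightarrow> fl_reflect F n k v C \<in> carrier_mat n m"
  by (auto simp: fl_reflect_def Let_def)

lemma fl_reflect_column_error:
  assumes C: "C \<in> carrier_mat n m" and j: "j < m"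
  shows "vec_norm2 (col (fl_reflect F n k v C - reflector n k v * C) j) \<le> 25 * \<gamma> * vec_norm2 (col C j)"
proof (cases "\<forall>i\<in>{k..<n}. v i = 0")
  case True
  then have "fl_reflect F n k v C - reflector n k v * C = 0\<^sub>m n m"
    using C by (simp add: fl_reflect_def reflector_zero)
  moreover have "vec_norm2 (col (0\<^sub>m n m) j) = 0"
    using j by (simp add: vec_norm2_def)
  ultimately show ?thesis
    using \<gamma>_nonneg by simp
next
  case False
  define c where "c = (\<lambda>i. C $$ (i,j))"
  define t where "t = fmul F (fdiv F 2 (fl_dot F v v [k..<n])) (fl_dot F v c [k..<n])"
  define t' where "t' = 2 / (L2_set v {k..<n})\<^sup>2 * (\<Sum>l\<in>{k..<n}. v l * c l)"
  define D where "D = fl_reflect F n k v C - reflector n k v * C"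
  have D: "D \<in> carrier_mat n m"
    using C by (auto simp: D_def intro!: minus_carrier_mat mult_carrier_mat[of _ n n])
  have entry: "D $$ (i,j) = (if i < k then 0 else fsub F (c i) (fmul F (v i) t) - (c i - v i * t'))" if i: "i < n" for i
  proof -
    have "fl_reflect F n k v C $$ (i,j) = (if i < k then c i else fsub F (c i) (fmul F (v i) t))"
      using C i j by (simp only: fl_reflect_def False if_False Let_def) (simp add: t_def c_def)
    moreover have "(reflector n k v * C) $$ (i,j) = (if i < k then c i else c i - v i * t')"
      using reflector_mult_index[OF C i j] by (simp add: t'_def c_def)
    ultimately show ?thesis
      using C i j by (simp add: D_def)
  qed
  have "vec_norm2 (col D j) = L2_set (\<lambda>i. if i < k then 0 else fsub F (c i) (fmul F (v i) t) - (c i - v i * t')) {..<n}"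
    unfolding vec_norm2_col[OF D j] using entry by (intro L2_set_cong) auto
  also have "\<dots> = L2_set (\<lambda>i. fsub F (c i) (fmul F (v i) t) - (c i - v i * t')) {k..<n}"
    unfolding L2_set_def by (intro arg_cong[of _ _ sqrt] sum.mono_neutral_cong_right) auto
  also have "\<dots> \<le> 25 * \<gamma> * L2_set c {k..<n}"
    unfolding t_def t'_def using False by (intro reflect_column_error) (simp add: L2_set_eq_0_iff)
  also have "\<dots> \<le> 25 * \<gamma> * L2_set c {..<n}"
    using \<gamma>_nonneg by (intro mult_left_mono L2_set_mono_set) auto
  finally show ?thesis
    by (simp add: vec_norm2_col[OF C j] c_def D_def)
qed

lemma fl_reflect_error:
  assumes C: "C \<in> carrier_mat n m"
  shows "frobenius_norm (fl_reflect F n k v C - reflector n k v * C) \<le> 25 * \<gamma> * frobenius_norm C"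
proof (rule frobenius_norm_le_cols[of _ n m])
  show "fl_reflect F n k v C - reflector n k v * C \<in> carrier_mat n m"
    using C by (auto intro!: minus_carrier_mat mult_carrier_mat[of _ n n])
qed (use C \<gamma>_nonneg fl_reflect_column_error[OF C] in auto)

text \<open>The pivot has the sign opposite to \<open>x k\<close>, so the only rounded entry of the
  vector, x_k minus the pivot, adds quantities of equal sign and has size at least 0.95 \<sigma>.
  Hence the exact reflector of the computed vector maps \<open>x\<close> to the computed pivot up to
  O(\<gamma> \<sigma>), and the vector can vanish only if there is nothing to annihilate, which
  justifies skipping the reflector in that case.\<close>

lemma house_error:
  fixes x :: "nat \<Rightarrow> real" and k :: nat
  defines "\<sigma> \<equiv> L2_set x {k..<n}" and "v \<equiv> house_vec F n k x" and "\<rho> \<equiv> house_pivot F n k x"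
  assumes k: "k < n"
  shows "L2_set (\<lambda>i. x i - v i * (2 / (L2_set v {k..<n})\<^sup>2 * (\<Sum>l\<in>{k..<n}. v l * x l))
      - (if i = k then \<rho> else 0)) {k..<n} \<le> 15 * \<gamma> * \<sigma>" (is ?err)
    and "(\<forall>i\<in>{k..<n}. v i = 0) \<Longrightarrow> \<sigma> = 0"
proof -
  define a where "a = x k"
  define s where "s = fsqrt F (fl_dot F x x [k..<n])"
  define sg :: real where "sg = (if 0 \<le> a then 1 else -1)"
  define R where "R = (\<Sum>i\<in>{Suc k..<n}. (x i)\<^sup>2)"
  define \<nu> where "\<nu> = L2_set v {k..<n}"
  define q where "q = (\<Sum>l\<in>{k..<n}. v l * x l)"
  have \<sigma>: "0 \<le> \<sigma>"
    by (simp add: \<sigma>_def)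
  have \<gamma>\<sigma>: "0 \<le> \<gamma> * \<sigma>" "\<gamma> * \<sigma> \<le> 1/100 * \<sigma>"
    using \<sigma> \<gamma>_nonneg mult_right_mono[OF \<gamma>_small \<sigma>] by auto
  have s: "\<bar>s - \<sigma>\<bar> \<le> 2 * (\<gamma> * \<sigma>)"
    using fl_norm_error[of x k] by (simp add: s_def \<sigma>_def)
  have \<rho>: "\<rho> = - sg * s"
    by (simp add: \<rho>_def house_pivot_def s_def sg_def a_def Let_def)
  have vk: "v k = fsub F a \<rho>" and vi: "\<And>i. i \<in> {Suc k..<n} \<Longrightarrow> v i = x i"
    by (auto simp: v_def house_vec_def a_def \<rho>_def)
  have sq: "\<sigma>\<^sup>2 = a\<^sup>2 + R"
    using k by (simp add: \<sigma>_def L2_set_square sum.atLeast_Suc_lessThan a_def R_def)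
  have nq: "\<nu>\<^sup>2 = (v k)\<^sup>2 + R"
    using k vi by (simp add: \<nu>_def L2_set_square sum.atLeast_Suc_lessThan R_def)
  have qq: "q = v k * a + R"
    using k vi by (simp add: q_def sum.atLeast_Suc_lessThan R_def a_def power2_eq_square)
  have R: "0 \<le> R"
    by (simp add: R_def sum_nonneg)
  have a: "\<bar>a\<bar> \<le> \<sigma>"
    using member_le_L2_set[of "{k..<n}" k x] k L2_set_mono_abs[of "{k}" x "\<lambda>i. \<bar>x i\<bar>"]
    by (metis L2_set_abs \<sigma>_def a_def atLeastLessThan_iff finite_atLeastLessThan le_refl member_le_L2_set)
  have "\<bar>v k - (a - \<rho>)\<bar> \<le> w * \<bar>a - \<rho>\<bar>"
    unfolding vk by (rule fsub_error)
  also have "\<dots> \<le> \<gamma> / 2 * (21/10 * \<sigma>)"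
  proof (intro mult_mono)
    show "\<bar>a - \<rho>\<bar> \<le> 21/10 * \<sigma>"
    proof -
      have "\<bar>a - \<rho>\<bar> \<le> \<bar>a\<bar> + \<bar>s\<bar>"
        by (auto simp: \<rho> sg_def)
      then show ?thesis
        using s a \<gamma>\<sigma> \<sigma> by linarith
    qed
  qed (use w_le \<gamma>_nonneg in auto)
  finally have v1: "\<bar>v k - (a - \<rho>)\<bar> \<le> 11/10 * (\<gamma> * \<sigma>)"
    using \<gamma>\<sigma> by simp
  \<comment> \<open>Deviation of the computed pivot entry of \<open>v\<close> from its exact value a
    + sg \<sigma>.\<close>
  define \<tau> where "\<tau> = v k - a - sg * \<sigma>"
  have \<tau>: "\<bar>\<tau>\<bar> \<le> 4 * (\<gamma> * \<sigma>)"
  proof -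
    have "\<tau> = (v k - (a - \<rho>)) + sg * (s - \<sigma>)"
      by (simp add: \<tau>_def \<rho> algebra_simps)
    moreover have "\<bar>sg * (s - \<sigma>)\<bar> = \<bar>s - \<sigma>\<bar>"
      by (simp add: sg_def abs_minus_commute)
    ultimately show ?thesis
      using v1 s \<gamma>\<sigma>(1) by linarith
  qed
  have vkge: "95/100 * \<sigma> \<le> \<bar>v k\<bar>"
  proof -
    have "\<bar>a + sg * \<sigma>\<bar> = \<bar>a\<bar> + \<sigma>"
      using \<sigma> by (simp add: sg_def)
    moreover have "v k = (a + sg * \<sigma>) + \<tau>"
      by (simp add: \<tau>_def)
    ultimately show ?thesis
      using \<tau> \<gamma>\<sigma> \<sigma> by linarith
  qed
  have \<nu>0: "0 \<le> \<nu>"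
    by (simp add: \<nu>_def)
  have \<nu>ge: "95/100 * \<sigma> \<le> \<nu>"
  proof -
    have "\<bar>v k\<bar>\<^sup>2 \<le> \<nu>\<^sup>2"
      using nq R by simp
    then have "\<bar>v k\<bar> \<le> \<nu>"
      using \<nu>0 power2_le_imp_le by blast
    then show ?thesis using vkge by linarith
  qed
  show "\<sigma> = 0" if "\<forall>i\<in>{k..<n}. v i = 0"
  proof -
    have "\<nu> = 0"
      using that by (simp add: \<nu>_def L2_set_eq_0_iff)
    then show ?thesis
      using \<nu>ge \<sigma> by simp
  qed
  show ?err
  proof (cases "\<sigma> = 0")
    case True
    then have "x i = 0" if "i \<in> {k..<n}" for i
      using that by (auto simp: \<sigma>_def L2_set_eq_0_iff)
    then have q0: "q = 0" and x0: "\<And>i. i \<in> {k..<n} \<Longrightarrow> x i = 0"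
      by (auto simp: q_def)
    have "\<rho> = 0"
      using s True by (simp add: \<rho>)
    then have "L2_set (\<lambda>i. x i - v i * (2 / \<nu>\<^sup>2 * q) - (if i = k then \<rho> else 0)) {k..<n} = 0"
      using x0 q0 by (auto simp: L2_set_eq_0_iff)
    then show ?thesis
      using True by (simp add: \<nu>_def q_def)
  next
    case False
    then have \<sigma>0: "0 < \<sigma>" using \<sigma> by simp
    then have \<nu>0: "0 < \<nu>" using \<nu>ge by linarith
    \<comment> \<open>The reflected vector is x - (1 + \<kappa>) v. Below the pivot x and v agree,
      so the residual there is -\<kappa> v; only the pivot entry has a further term. The identity
      that follows expresses \<kappa> through \<sigma>^2 - (v_k - a)^2, which vanishes for the exact
      v_k.\<close>
    define \<kappa> where "\<kappa> = 2 / \<nu>\<^sup>2 * q - 1"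
    have "2 * q - \<nu>\<^sup>2 = \<sigma>\<^sup>2 - (v k - a)\<^sup>2"
      using nq sq by (simp add: qq power2_eq_square algebra_simps)
    also have "v k - a = sg * \<sigma> + \<tau>"
      by (simp add: \<tau>_def)
    also have "\<sigma>\<^sup>2 - (sg * \<sigma> + \<tau>)\<^sup>2 = - \<tau> * (2 * sg * \<sigma> + \<tau>)"
      by (simp add: sg_def power2_eq_square algebra_simps)
    also have "\<bar>\<dots>\<bar> \<le> (4 * (\<gamma> * \<sigma>)) * (21/10 * \<sigma>)"
      unfolding abs_mult
    proof (intro mult_mono)
      have "\<bar>2 * sg * \<sigma>\<bar> = 2 * \<sigma>"
        using \<sigma> by (simp add: sg_def)
      then show "\<bar>2 * sg * \<sigma> + \<tau>\<bar> \<le> 21/10 * \<sigma>"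
        using \<tau> \<gamma>\<sigma> \<sigma> by linarith
    qed (use \<tau> \<gamma>\<sigma> in auto)
    finally have k1: "\<bar>2 * q - \<nu>\<^sup>2\<bar> \<le> (84/10 * (\<gamma> * \<sigma>)) * \<sigma>"
      by simp
    have "2 * q - \<nu>\<^sup>2 = \<kappa> * \<nu> * \<nu>"
      using \<nu>0 by (simp add: \<kappa>_def power2_eq_square field_simps)
    then have "\<bar>\<kappa>\<bar> * \<nu> * \<nu> = \<bar>2 * q - \<nu>\<^sup>2\<bar>"
      using \<nu>0 by (simp add: abs_mult)
    also have "\<dots> \<le> (84/10 * (\<gamma> * \<sigma>)) * (100/95 * \<nu>)"
      using k1 \<gamma>\<sigma> \<nu>ge by (intro order_trans[OF k1] mult_left_mono) auto
    finally have "\<bar>\<kappa>\<bar> * \<nu> * \<nu> \<le> (84/10 * (\<gamma> * \<sigma>) * (100/95)) * \<nu>"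
      by (simp add: mult_ac)
    then have "\<bar>\<kappa>\<bar> * \<nu> \<le> 84/10 * (\<gamma> * \<sigma>) * (100/95)"
      using \<nu>0 by (simp only: mult_le_cancel_right)
    then have \<kappa>: "\<bar>\<kappa>\<bar> * \<nu> \<le> 9 * (\<gamma> * \<sigma>)"
      using \<gamma>\<sigma> by linarith
    have "L2_set (\<lambda>i. x i - v i * (2 / \<nu>\<^sup>2 * q) - (if i = k then \<rho> else 0)) {k..<n}
        = L2_set (\<lambda>i. - \<kappa> * v i + (if i = k then a - v k - \<rho> else 0)) {k..<n}"
    proof (rule L2_set_cong)
      fix i assume "i \<in> {k..<n}"
      then have "i = k \<or> v i = x i"
        using vi[of i] by fastforce
      then show "x i - v i * (2 / \<nu>\<^sup>2 * q) - (if i = k then \<rho> else 0) = - \<kappa> * v i + (if i = k then a - v k - \<rho> else 0)"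
        by (auto simp: \<kappa>_def a_def algebra_simps)
    qed simp
    also have "\<dots> \<le> L2_set (\<lambda>i. - \<kappa> * v i) {k..<n} + L2_set (\<lambda>i. if i = k then a - v k - \<rho> else 0) {k..<n}"
      by (rule L2_set_triangle_ineq)
    also have "\<dots> = \<bar>\<kappa>\<bar> * \<nu> + \<bar>a - v k - \<rho>\<bar>"
      using k by (simp add: L2_set_scale L2_set_single \<nu>_def del: mult_minus_left)
    also have "\<dots> \<le> 15 * (\<gamma> * \<sigma>)"
      using \<kappa> v1 \<gamma>\<sigma> by linarith
    finally show ?thesis
      by (simp add: \<nu>_def q_def mult.assoc)
  qed
qed

end

section \<open>Householder QR\<close>

text \<open>Later factors stand on the left: this is the transformation applied to a matrix by
  successive steps. Its transpose, for symmetric factors H_0 H_1 ... H_{k-1}, is what the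
  \<open>foldr\<close> of the algorithms forms.\<close>

primrec rev_prod :: "nat \<Rightarrow> (nat \<Rightarrow> real mat) \<Rightarrow> nat \<Rightarrow> real mat" where
  "rev_prod n H 0 = 1\<^sub>m n"
| "rev_prod n H (Suc k) = H k * rev_prod n H k"

lemma rev_prod_orthonormal:
  "(\<And>i. i < k \<Longrightarrow> orthonormal_mat n (H i)) \<Longrightarrow> orthonormal_mat n (rev_prod n H k)"
  by (induction k) (auto intro: orthonormal_mat_mult)

lemma rev_prod_cong:
  "(\<And>i. i < k \<Longrightarrow> H i = H' i) \<Longrightarrow> rev_prod n H k = rev_prod n H' k"
  by (induction k) auto

text \<open>Orthonormal factors do not amplify earlier errors, so relative errors \<open>g\<close>
  per step compound to (1 + g)^k - 1. The norm of \<open>X k\<close> is carried along in the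
  induction because each step error is relative to the current iterate, not to
  \<open>X 0\<close>.\<close>

lemma perturbed_left_products:
  assumes H: "\<And>i. i < N \<Longrightarrow> orthonormal_mat n (H i)"
    and X: "\<And>i. i \<le> N \<Longrightarrow> X i \<in> carrier_mat n m"
    and g: "0 \<le> g"
    and step: "\<And>i. i < N \<Longrightarrow> frobenius_norm (X (Suc i) - H i * X i) \<le> g * frobenius_norm (X i)"
    and k: "k \<le> N"
  shows "frobenius_norm (X k) \<le> (1 + g) ^ k * frobenius_norm (X 0) \<and>
    frobenius_norm (X k - rev_prod n H k * X 0) \<le> ((1 + g) ^ k - 1) * frobenius_norm (X 0)"
  using k
proof (induction k)
  case 0
  have "X 0 - rev_prod n H 0 * X 0 = 0\<^sub>m n m"
    using X[of 0] by simp
  then show ?case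
    by (simp add: frobenius_norm_def)
next
  case (Suc k)
  let ?P = "rev_prod n H k"
  have k: "k < N"
    using Suc.prems by simp
  have IH: "frobenius_norm (X k) \<le> (1 + g) ^ k * frobenius_norm (X 0)"
    "frobenius_norm (X k - ?P * X 0) \<le> ((1 + g) ^ k - 1) * frobenius_norm (X 0)"
    using Suc by auto
  have P: "orthonormal_mat n ?P"
    by (rule rev_prod_orthonormal) (use H k in auto)
  have [simp]: "?P \<in> carrier_mat n n" "H k \<in> carrier_mat n n" "X 0 \<in> carrier_mat n m" "X k \<in> carrier_mat n m"
    "X (Suc k) \<in> carrier_mat n m"
    using P H[OF k] X k by (auto simp: orthonormal_mat_def)
  have [simp]: "H k * X k \<in> carrier_mat n m" "?P * X 0 \<in> carrier_mat n m" "H k * (?P * X 0) \<in> carrier_mat n m"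
    by (auto intro!: mult_carrier_mat[of _ n n])
  have HX: "frobenius_norm (H k * X k) \<le> frobenius_norm (X k)"
    by (rule frobenius_norm_orthonormal_mult_le[OF H[OF k], of _ m]) simp
  have "frobenius_norm (X (Suc k)) \<le> frobenius_norm (H k * X k) + frobenius_norm (X (Suc k) - H k * X k)"
    by (rule frobenius_norm_le_add_diff[of _ n m]) auto
  also have "\<dots> \<le> (1 + g) * frobenius_norm (X k)"
    using HX step[OF k] by (simp add: algebra_simps)
  also have "\<dots> \<le> (1 + g) * ((1 + g) ^ k * frobenius_norm (X 0))"
    using g IH by (intro mult_left_mono) auto
  finally have 1: "frobenius_norm (X (Suc k)) \<le> (1 + g) ^ Suc k * frobenius_norm (X 0)"
    by (simp add: mult.assoc)
  have "frobenius_norm (H k * X k - H k * (?P * X 0)) = frobenius_norm (H k * (X k - ?P * X 0))"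
    by (subst mult_minus_distrib_mat[of _ n n _ m]) auto
  also have "\<dots> \<le> frobenius_norm (X k - ?P * X 0)"
    by (rule frobenius_norm_orthonormal_mult_le[OF H[OF k], of _ m]) simp
  finally have 2: "frobenius_norm (H k * X k - H k * (?P * X 0)) \<le> ((1 + g) ^ k - 1) * frobenius_norm (X 0)"
    using IH(2) by linarith
  have "frobenius_norm (X (Suc k) - H k * (?P * X 0))
      \<le> frobenius_norm (X (Suc k) - H k * X k) + frobenius_norm (H k * X k - H k * (?P * X 0))"
    by (rule frobenius_norm_triangle_diff[of _ n m]) auto
  also have "\<dots> \<le> g * ((1 + g) ^ k * frobenius_norm (X 0)) + ((1 + g) ^ k - 1) * frobenius_norm (X 0)"
    using step[OF k] mult_left_mono[OF IH(1) g] 2 by linarith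
  also have "\<dots> = ((1 + g) ^ Suc k - 1) * frobenius_norm (X 0)"
    by (simp add: algebra_simps)
  also have "H k * (?P * X 0) = rev_prod n H (Suc k) * X 0"
    by (simp add: assoc_mult_mat[of _ n n _ n _ m])
  finally show ?case
    using 1 by simp
qed

text \<open>The two-sided analogue: conjugation by an orthonormal matrix does not increase the
  Frobenius norm either, so the errors compound at the same rate.\<close>

lemma perturbed_conjugations:
  assumes H: "\<And>i. i < N \<Longrightarrow> orthonormal_mat n (H i)"
    and X: "\<And>i. i \<le> N \<Longrightarrow> X i \<in> carrier_mat n n"
    and g: "0 \<le> g"
    and step: "\<And>i. i < N \<Longrightarrow> frobenius_norm (X (Suc i) - H i * X i * transpose_mat (H i)) \<le> g * frobenius_norm (X i)"
    and k: "k \<le> N"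
  shows "frobenius_norm (X k) \<le> (1 + g) ^ k * frobenius_norm (X 0) \<and>
    frobenius_norm (X k - rev_prod n H k * X 0 * transpose_mat (rev_prod n H k)) \<le> ((1 + g) ^ k - 1) * frobenius_norm (X 0)"
  using k
proof (induction k)
  case 0
  have "X 0 - rev_prod n H 0 * X 0 * transpose_mat (rev_prod n H 0) = 0\<^sub>m n n"
    using X[of 0] by simp
  then show ?case
    by (simp add: frobenius_norm_def)
next
  case (Suc k)
  let ?P = "rev_prod n H k"
  let ?Y = "?P * X 0 * transpose_mat ?P"
  let ?h = "H k" let ?ht = "transpose_mat (H k)"
  have k: "k < N"
    using Suc.prems by simp
  have IH: "frobenius_norm (X k) \<le> (1 + g) ^ k * frobenius_norm (X 0)"
    "frobenius_norm (X k - ?Y) \<le> ((1 + g) ^ k - 1) * frobenius_norm (X 0)"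
    using Suc by auto
  have P: "orthonormal_mat n ?P"
    by (rule rev_prod_orthonormal) (use H k in auto)
  have h: "orthonormal_mat n ?h" "orthonormal_mat n ?ht"
    using H[OF k] by (auto intro: orthonormal_mat_transpose)
  have [simp]: "?P \<in> carrier_mat n n" "H k \<in> carrier_mat n n" "X 0 \<in> carrier_mat n n" "X k \<in> carrier_mat n n"
    "X (Suc k) \<in> carrier_mat n n"
    using P h X k by (auto simp: orthonormal_mat_def)
  note [simp] = mult_carrier_mat[of _ n n _ n]
  have conj: "frobenius_norm (?h * Z * ?ht) \<le> frobenius_norm Z" if "Z \<in> carrier_mat n n" for Z
  proof -
    have "frobenius_norm (?h * Z * ?ht) \<le> frobenius_norm (?h * Z)"
      by (rule frobenius_norm_mult_orthonormal_le[OF h(2), of _ n]) (use that in simp)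
    also have "\<dots> \<le> frobenius_norm Z"
      by (rule frobenius_norm_orthonormal_mult_le[OF h(1) that])
    finally show ?thesis .
  qed
  have "frobenius_norm (X (Suc k)) \<le> frobenius_norm (?h * X k * ?ht) + frobenius_norm (X (Suc k) - ?h * X k * ?ht)"
    by (rule frobenius_norm_le_add_diff[of _ n n]) auto
  also have "\<dots> \<le> (1 + g) * frobenius_norm (X k)"
    using conj[of "X k"] step[OF k] by (simp add: algebra_simps)
  also have "\<dots> \<le> (1 + g) * ((1 + g) ^ k * frobenius_norm (X 0))"
    using g IH by (intro mult_left_mono) auto
  finally have 1: "frobenius_norm (X (Suc k)) \<le> (1 + g) ^ Suc k * frobenius_norm (X 0)"
    by (simp add: mult.assoc)
  have "?h * X k * ?ht - ?h * ?Y * ?ht = ?h * (X k - ?Y) * ?ht"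
    by (simp add: mult_minus_distrib_mat[of _ n n _ n] minus_mult_distrib_mat[of _ n n _ _ n])
  then have 2: "frobenius_norm (?h * X k * ?ht - ?h * ?Y * ?ht) \<le> ((1 + g) ^ k - 1) * frobenius_norm (X 0)"
    using conj[of "X k - ?Y"] IH(2) by simp
  have "frobenius_norm (X (Suc k) - ?h * ?Y * ?ht)
      \<le> frobenius_norm (X (Suc k) - ?h * X k * ?ht) + frobenius_norm (?h * X k * ?ht - ?h * ?Y * ?ht)"
    by (rule frobenius_norm_triangle_diff[of _ n n]) auto
  also have "\<dots> \<le> g * ((1 + g) ^ k * frobenius_norm (X 0)) + ((1 + g) ^ k - 1) * frobenius_norm (X 0)"
    using step[OF k] mult_left_mono[OF IH(1) g] 2 by linarith
  also have "\<dots> = ((1 + g) ^ Suc k - 1) * frobenius_norm (X 0)"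
    by (simp add: algebra_simps)
  also have "?h * ?Y * ?ht = rev_prod n H (Suc k) * X 0 * transpose_mat (rev_prod n H (Suc k))"
    by (simp add: assoc_mult_mat[of _ n n _ n _ n] transpose_mult[of _ n n _ n])
  finally show ?case
    using 1 by simp
qed

text \<open>The fold applies the function of highest index first. The induction therefore peels off
  \<open>f k\<close> at the inside and needs \<open>C\<close> arbitrary; symmetry of the factors
  identifies the exact product with the transpose of \<open>rev_prod\<close>.\<close>

lemma perturbed_foldr:
  assumes H: "\<And>i. i < N \<Longrightarrow> orthonormal_mat n (H i)" and sym: "\<And>i. i < N \<Longrightarrow> transpose_mat (H i) = H i"
    and f: "\<And>i C. i < N \<Longrightarrow> C \<in> carrier_mat n m \<Longrightarrow> f i C \<in> carrier_mat n m"
    and g: "0 \<le> g"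
    and step: "\<And>i C. i < N \<Longrightarrow> C \<in> carrier_mat n m \<Longrightarrow> frobenius_norm (f i C - H i * C) \<le> g * frobenius_norm C"
    and k: "k \<le> N" and C: "C \<in> carrier_mat n m"
  shows "foldr f [0..<k] C \<in> carrier_mat n m \<and>
    frobenius_norm (foldr f [0..<k] C - transpose_mat (rev_prod n H k) * C) \<le> ((1 + g) ^ k - 1) * frobenius_norm C"
  using k C
proof (induction k arbitrary: C)
  case 0
  then have "C - transpose_mat (rev_prod n H 0) * C = 0\<^sub>m n m"
    by simp
  then show ?case
    using 0 by (simp add: frobenius_norm_def)
next
  case (Suc k)
  let ?P = "transpose_mat (rev_prod n H k)"
  have k: "k < N"
    using Suc.prems by simp
  have P: "orthonormal_mat n ?P"
    by (intro orthonormal_mat_transpose rev_prod_orthonormal) (use H k in auto)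
  have [simp]: "rev_prod n H k \<in> carrier_mat n n" "H k \<in> carrier_mat n n" "C \<in> carrier_mat n m" "f k C \<in> carrier_mat n m"
    using P H[OF k] f[OF k] Suc.prems by (auto simp: orthonormal_mat_def)
  have [simp]: "H k * C \<in> carrier_mat n m" "?P * f k C \<in> carrier_mat n m" "?P * (H k * C) \<in> carrier_mat n m"
    by (auto intro!: mult_carrier_mat[of _ n n])
  have IH: "foldr f [0..<k] (f k C) \<in> carrier_mat n m"
    "frobenius_norm (foldr f [0..<k] (f k C) - ?P * f k C) \<le> ((1 + g) ^ k - 1) * frobenius_norm (f k C)"
    using Suc.IH[of "f k C"] Suc.prems by auto
  have st: "frobenius_norm (f k C - H k * C) \<le> g * frobenius_norm C"
    using step k by simp
  have "frobenius_norm (f k C) \<le> frobenius_norm (H k * C) + frobenius_norm (f k C - H k * C)"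
    by (rule frobenius_norm_le_add_diff[of _ n m]) auto
  also have "\<dots> \<le> (1 + g) * frobenius_norm C"
    using frobenius_norm_orthonormal_mult_le[OF H[OF k], of C m] st by (simp add: algebra_simps)
  finally have fC: "frobenius_norm (f k C) \<le> (1 + g) * frobenius_norm C" .
  have "frobenius_norm (?P * f k C - ?P * (H k * C)) = frobenius_norm (?P * (f k C - H k * C))"
    by (subst mult_minus_distrib_mat[of _ n n _ m]) auto
  also have "\<dots> \<le> g * frobenius_norm C"
    using frobenius_norm_orthonormal_mult_le[OF P, of "f k C - H k * C" m] st by simp
  finally have 2: "frobenius_norm (?P * f k C - ?P * (H k * C)) \<le> g * frobenius_norm C" .
  have "1 \<le> (1 + g) ^ k"
    using g by simp
  then have 3: "((1 + g) ^ k - 1) * frobenius_norm (f k C) \<le> ((1 + g) ^ k - 1) * ((1 + g) * frobenius_norm C)"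
    using fC by (intro mult_left_mono) auto
  have "frobenius_norm (foldr f [0..<k] (f k C) - ?P * (H k * C))
      \<le> frobenius_norm (foldr f [0..<k] (f k C) - ?P * f k C) + frobenius_norm (?P * f k C - ?P * (H k * C))"
    by (rule frobenius_norm_triangle_diff[of _ n m]) (use IH in auto)
  also have "\<dots> \<le> ((1 + g) ^ k - 1) * ((1 + g) * frobenius_norm C) + g * frobenius_norm C"
    using IH(2) 2 3 by linarith
  also have "\<dots> = ((1 + g) ^ Suc k - 1) * frobenius_norm C"
    by (simp add: algebra_simps)
  also have "?P * (H k * C) = transpose_mat (rev_prod n H (Suc k)) * C"
    by (simp add: transpose_mult[of _ n n _ n] sym[OF k] assoc_mult_mat[of _ n n _ n _ m])
  finally show ?case
    using IH(1) by simp
qed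

section \<open>Error of Householder QR and of the back-transformation\<close>

context fl_model begin

lemma fl_reflect_index_less:
  "C \<in> carrier_mat n m \<Longrightarrow> i < n \<Longrightarrow> j < m \<Longrightarrow> i < k \<Longrightarrow> fl_reflect F n k v C $$ (i,j) = C $$ (i,j)"
  by (simp add: fl_reflect_def Let_def)

text \<open>Three kinds of columns. Those before \<open>k\<close> are stored unchanged, and the
  exact reflector fixes them too, because they vanish from row \<open>k\<close> on. Column
  \<open>k\<close> is not computed but overwritten by pivot and zeros, which
  \<open>house_error\<close> justifies. The remaining columns are ordinary reflector
  applications.\<close>

lemma hqr_step_error:
  fixes R :: "real mat" and k :: nat
  defines "v \<equiv> house_vec F n k (\<lambda>i. R $$ (i,k))"
  assumes R: "R \<in> carrier_mat n n" and k: "k < n"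
    and zero: "\<And>i j. j < k \<Longrightarrow> j < i \<Longrightarrow> i < n \<Longrightarrow> R $$ (i,j) = 0"
  shows "frobenius_norm (hqr_step F n k R - reflector n k v * R) \<le> 25 * \<gamma> * frobenius_norm R"
proof (rule frobenius_norm_le_cols[of _ n n])
  define x where "x = (\<lambda>i. R $$ (i,k))"
  define D where "D = hqr_step F n k R - reflector n k v * R"
  let ?R' = "fl_reflect F n k v R"
  let ?HR = "reflector n k v * R"
  have HR [simp]: "?HR \<in> carrier_mat n n"
    by (rule mult_carrier_mat[of _ n n]) (use R in auto)
  have D [simp]: "D \<in> carrier_mat n n"
    by (simp add: D_def)
  then show "hqr_step F n k R - reflector n k v * R \<in> carrier_mat n n"
    by (simp add: D_def)
  fix j assume j: "j < n"
  have Dij: "D $$ (i,j) = (if i < k \<or> j < k then R $$ (i,j)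
           else if j = k then (if i = k then house_pivot F n k x else 0)
           else ?R' $$ (i,j)) - ?HR $$ (i,j)" if "i < n" for i
  proof -
    have "D $$ (i,j) = hqr_step F n k R $$ (i,j) - ?HR $$ (i,j)"
      unfolding D_def by (rule index_minus_mat(1)) (use that j R in auto)
    then show ?thesis
      using that j by (simp only: hqr_step_def Let_def) (simp add: x_def v_def del: index_mult_mat(1))
  qed
  have HRij: "?HR $$ (i,j) = (if i < k then R $$ (i,j)
     else R $$ (i,j) - v i * (2 / (L2_set v {k..<n})\<^sup>2 * (\<Sum>l\<in>{k..<n}. v l * R $$ (l,j))))" if "i < n" for i
    by (rule reflector_mult_index[OF R that j])
  have "vec_norm2 (col D j) \<le> 25 * \<gamma> * vec_norm2 (col R j)"
  proof -
    consider "j < k" | "j = k" | "k < j" by linarith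
    then show ?thesis
    proof cases
      case 1
      have "(\<Sum>l\<in>{k..<n}. v l * R $$ (l,j)) = 0"
        using zero 1 by (intro sum.neutral) auto
      then have "D $$ (i,j) = 0" if "i < n" for i
        using Dij[OF that] HRij[OF that] 1 by auto
      then have "vec_norm2 (col D j) = 0"
        using j by (simp add: vec_norm2_col[OF D] L2_set_eq_0_iff)
      then show ?thesis
        using \<gamma>_nonneg by simp
    next
      case 2
      have "vec_norm2 (col D j) = L2_set (\<lambda>i. D $$ (i,j)) {k..<n}"
        unfolding vec_norm2_col[OF D j] L2_set_def using Dij HRij
        by (intro arg_cong[of _ _ sqrt] sum.mono_neutral_right) auto
      also have "\<dots> \<le> L2_set (\<lambda>i. \<bar>x i - v i * (2 / (L2_set v {k..<n})\<^sup>2 * (\<Sum>l\<in>{k..<n}. v l * x l))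
          - (if i = k then house_pivot F n k x else 0)\<bar>) {k..<n}"
      proof (rule L2_set_mono_abs)
        fix i assume i: "i \<in> {k..<n}"
        have "D $$ (i,j) = - (x i - v i * (2 / (L2_set v {k..<n})\<^sup>2 * (\<Sum>l\<in>{k..<n}. v l * x l))
          - (if i = k then house_pivot F n k x else 0))"
          using Dij[of i] HRij[of i] i by (simp add: x_def 2)
        then show "\<bar>D $$ (i,j)\<bar> \<le> \<bar>x i - v i * (2 / (L2_set v {k..<n})\<^sup>2 * (\<Sum>l\<in>{k..<n}. v l * x l))
          - (if i = k then house_pivot F n k x else 0)\<bar>"
          by (simp only: abs_minus_cancel)
      qed
      also have "\<dots> \<le> 15 * \<gamma> * L2_set x {k..<n}"
        unfolding L2_set_abs using house_error(1)[OF k, of x] by (simp add: v_def x_def)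
      also have "\<dots> \<le> 25 * \<gamma> * L2_set x {..<n}"
        using \<gamma>_nonneg by (intro mult_mono L2_set_mono_set) auto
      finally show ?thesis
        by (simp add: vec_norm2_col[OF R k] x_def 2)
    next
      case 3
      have "vec_norm2 (col D j) \<le> vec_norm2 (col (?R' - ?HR) j)"
      proof -
        have c: "?R' - ?HR \<in> carrier_mat n n" by simp
        show ?thesis
          unfolding vec_norm2_col[OF D j] vec_norm2_col[OF c j]
        proof (intro eq_refl L2_set_cong refl)
          fix i assume "i \<in> {..<n}"
          then have i: "i < n" by simp
          have "(?R' - ?HR) $$ (i,j) = ?R' $$ (i,j) - ?HR $$ (i,j)"
            by (rule index_minus_mat(1)) (use i j R in auto)
          then show "D $$ (i,j) = (?R' - ?HR) $$ (i,j)"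
            using Dij[OF i] 3 fl_reflect_index_less[OF R i j, of k v] by auto
        qed
      qed
      also have "\<dots> \<le> 25 * \<gamma> * vec_norm2 (col R j)"
        by (rule fl_reflect_column_error[OF R j])
      finally show ?thesis .
    qed
  qed
  then show "vec_norm2 (col (hqr_step F n k R - reflector n k v * R) j) \<le> 25 * \<gamma> * vec_norm2 (col R j)"
    by (simp add: D_def)
qed (use assms \<gamma>_nonneg in auto)

lemma hqr_iter_carrier: "X \<in> carrier_mat n n \<Longrightarrow> hqr_iter F n X k \<in> carrier_mat n n"
  by (cases k) (auto simp: hqr_step_def Let_def)

lemma hqr_iter_zero:
  "k \<le> n \<Longrightarrow> j < k \<Longrightarrow> j < i \<Longrightarrow> i < n \<Longrightarrow> hqr_iter F n X k $$ (i,j) = 0"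
  by (induction k) (auto simp: hqr_step_def Let_def)

text \<open>\<open>W\<close> is built from the exact reflectors of the computed vectors, hence
  exactly orthonormal, and the same \<open>W\<close> governs both the triangular iterate and the
  accumulated factor. There are \<open>n - 1\<close> reflectors since the last column has nothing to
  annihilate; 50 is twice the 25 of a single application.\<close>

lemma householder_qr_error:
  assumes X: "X \<in> carrier_mat n n" and small: "50 * real n * \<gamma> \<le> 1"
  obtains W R where "orthonormal_mat n W" "R \<in> carrier_mat n n" "upper_triangular R"
    "householder_qr_Q F X \<in> carrier_mat n n"
    "frobenius_norm (householder_qr_Q F X - W) \<le> 50 * (real n)\<^sup>2 * \<gamma>"
    "frobenius_norm (R - transpose_mat W * X) \<le> 50 * real n * \<gamma> * frobenius_norm X"
proof -
  define v where "v = (\<lambda>k. house_vec F n k (\<lambda>i. hqr_iter F n X k $$ (i,k)))"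
  define H where "H = (\<lambda>k. reflector n k (v k))"
  define P where "P = rev_prod n H (n - 1)"
  have H: "orthonormal_mat n (H i)" "transpose_mat (H i) = H i" for i
    by (auto simp: H_def reflector_orthonormal)
  have P: "orthonormal_mat n P"
    unfolding P_def by (rule rev_prod_orthonormal) (use H in auto)
  have pow: "(1 + 25 * \<gamma>) ^ (n - 1) - 1 \<le> 50 * real n * \<gamma>"
  proof -
    have "2 * real (n - 1) * (25 * \<gamma>) \<le> 50 * real n * \<gamma>"
      using \<gamma>_nonneg by (auto intro!: mult_right_mono)
    then show ?thesis
      using one_plus_power_le[of "25 * \<gamma>" "n - 1"] \<gamma>_nonneg small by linarith
  qed
  have "frobenius_norm (hqr_iter F n X (n - 1) - P * hqr_iter F n X 0)
      \<le> ((1 + 25 * \<gamma>) ^ (n - 1) - 1) * frobenius_norm (hqr_iter F n X 0)"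
    unfolding P_def
  proof (rule perturbed_left_products[where N = "n - 1" and m = n, THEN conjunct2])
    fix i assume i: "i < n - 1"
    show "frobenius_norm (hqr_iter F n X (Suc i) - H i * hqr_iter F n X i) \<le> 25 * \<gamma> * frobenius_norm (hqr_iter F n X i)"
      using hqr_step_error[of "hqr_iter F n X i" i] i hqr_iter_carrier[OF X] hqr_iter_zero[of i]
      by (simp add: H_def v_def)
  qed (use H \<gamma>_nonneg hqr_iter_carrier[OF X] in auto)
  also have "\<dots> \<le> 50 * real n * \<gamma> * frobenius_norm X"
    using pow by (simp add: mult_right_mono)
  finally have 1: "frobenius_norm (hqr_iter F n X (n - 1) - P * X) \<le> 50 * real n * \<gamma> * frobenius_norm X"
    by simp
  have Q: "householder_qr_Q F X = foldr (\<lambda>k. fl_reflect F n k (v k)) [0..<n - 1] (1\<^sub>m n)"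
    using X by (simp add: householder_qr_Q_def v_def)
  have "householder_qr_Q F X \<in> carrier_mat n n \<and> frobenius_norm (householder_qr_Q F X - transpose_mat P * 1\<^sub>m n)
      \<le> ((1 + 25 * \<gamma>) ^ (n - 1) - 1) * frobenius_norm (1\<^sub>m n)"
    unfolding Q P_def
    by (rule perturbed_foldr[where N = "n - 1"])
      (use H \<gamma>_nonneg fl_reflect_carrier fl_reflect_error in \<open>auto simp: H_def\<close>)
  moreover have "((1 + 25 * \<gamma>) ^ (n - 1) - 1) * frobenius_norm (1\<^sub>m n) \<le> (50 * real n * \<gamma>) * real n"
    using pow \<gamma>_nonneg frobenius_norm_one_le by (intro mult_mono) auto
  ultimately have 2: "householder_qr_Q F X \<in> carrier_mat n n" "frobenius_norm (householder_qr_Q F X - transpose_mat P) \<le> 50 * (real n)\<^sup>2 * \<gamma>"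
    using orthonormal_mat_carrier[OF P] by (auto simp: power2_eq_square mult_ac)
  have "upper_triangular (hqr_iter F n X (n - 1))"
    using hqr_iter_zero[of "n - 1"] hqr_iter_carrier[OF X, of "n - 1"] by (intro upper_triangularI) auto
  then show ?thesis
    using that[of "transpose_mat P" "hqr_iter F n X (n - 1)"] 1 2 P orthonormal_mat_transpose[OF P] hqr_iter_carrier[OF X]
    by simp
qed

lemma apply_reflectors_error:
  fixes v :: "nat \<Rightarrow> nat \<Rightarrow> real"
  assumes small: "50 * real n * \<gamma> \<le> 1" and N: "N \<le> n" and C: "C \<in> carrier_mat n n"
  defines "Y \<equiv> foldr (\<lambda>j. fl_reflect F n (j+1) (v j)) [0..<N] C"
  shows "Y \<in> carrier_mat n n"
    "frobenius_norm (Y - transpose_mat (rev_prod n (\<lambda>j. reflector n (j+1) (v j)) N) * C)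
      \<le> 50 * real n * \<gamma> * frobenius_norm C"
proof -
  have "2 * real N * (25 * \<gamma>) \<le> 50 * real n * \<gamma>"
    using \<gamma>_nonneg N by (auto intro!: mult_right_mono)
  then have pow: "(1 + 25 * \<gamma>) ^ N - 1 \<le> 50 * real n * \<gamma>"
    using one_plus_power_le[of "25 * \<gamma>" N] \<gamma>_nonneg small by linarith
  have "Y \<in> carrier_mat n n \<and>
    frobenius_norm (Y - transpose_mat (rev_prod n (\<lambda>j. reflector n (j+1) (v j)) N) * C)
      \<le> ((1 + 25 * \<gamma>) ^ N - 1) * frobenius_norm C"
    unfolding Y_def
    by (rule perturbed_foldr[where N = N])
      (use \<gamma>_nonneg C fl_reflect_carrier fl_reflect_error reflector_orthonormal in auto)
  moreover have "((1 + 25 * \<gamma>) ^ N - 1) * frobenius_norm C \<le> 50 * real n * \<gamma> * frobenius_norm C"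
    using pow by (intro mult_right_mono) auto
  ultimately show "Y \<in> carrier_mat n n"
    "frobenius_norm (Y - transpose_mat (rev_prod n (\<lambda>j. reflector n (j+1) (v j)) N) * C)
      \<le> 50 * real n * \<gamma> * frobenius_norm C"
    by auto
qed

end

section \<open>Tridiagonalization\<close>

text \<open>The Frobenius norm of a rank-one matrix, used to evaluate the error terms of the
  rank-two update.\<close>

lemma L2_set_product:
  "L2_set (\<lambda>(i,j). f i * g j) (A \<times> B) = L2_set f A * L2_set g B"
proof -
  have "(\<Sum>(i,j)\<in>A \<times> B. (f i * g j)\<^sup>2) = (\<Sum>i\<in>A. (f i)\<^sup>2) * (\<Sum>j\<in>B. (g j)\<^sup>2)"
    by (simp add: sum_product sum.cartesian_product power_mult_distrib)
  then show ?thesis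
    by (simp add: L2_set_def real_sqrt_mult split_def)
qed

lemma L2_set_rows:
  "L2_set (\<lambda>i. L2_set (b i) B) A = L2_set (\<lambda>(i,j). b i j) (A \<times> B)"
proof -
  have "(\<Sum>i\<in>A. (L2_set (b i) B)\<^sup>2) = (\<Sum>(i,j)\<in>A \<times> B. (b i j)\<^sup>2)"
    by (simp add: L2_set_square sum.cartesian_product)
  then show ?thesis
    by (simp add: L2_set_def split_def)
qed

lemma L2_set_extend_zero:
  fixes m n :: nat
  shows "L2_set (\<lambda>i. if m \<le> i then f i else 0) {..<n} = L2_set f {m..<n}"
  unfolding L2_set_def by (intro arg_cong[of _ _ sqrt] sum.mono_neutral_cong_right) auto

text \<open>With G = B v and S = v^T B v, on the trailing block H B H = B - c v G^T - c G v^T + c^2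
  S v v^T. Symmetry of \<open>B\<close> makes the left and the right factor produce the same
  \<open>G\<close>. Splitting the last term evenly between the two middle ones gives the rank-two
  form of the algorithm.\<close>

lemma reflector_conj_index:
  fixes B :: "real mat" and v :: "nat \<Rightarrow> real" and k n :: nat
  defines "c \<equiv> 2 / (L2_set v {k..<n})\<^sup>2" and "G \<equiv> \<lambda>j. \<Sum>l\<in>{k..<n}. v l * B $$ (l,j)"
    and "H \<equiv> reflector n k v"
  assumes B: "B \<in> carrier_mat n n" and sym: "symmetric_mat B" and i: "i < n" and j: "j < n"
  shows "(H * B * H) $$ (i,j) = B $$ (i,j) - (if i < k then 0 else c * v i * G j) - (if j < k then 0 else c * v j * G i)
     + (if i < k \<or> j < k then 0 else c\<^sup>2 * v i * v j * (\<Sum>l\<in>{k..<n}. v l * G l))"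
proof -
  have Bsym: "B $$ (a,b) = B $$ (b,a)" if "a < n" "b < n" for a b
    using sym B that unfolding symmetric_mat_def by (metis carrier_matD index_transpose_mat(1))
  have [simp]: "H \<in> carrier_mat n n" "transpose_mat H = H"
    by (auto simp: H_def)
  have HB: "H * B \<in> carrier_mat n n" "transpose_mat (H * B) \<in> carrier_mat n n"
    using B by (auto intro!: mult_carrier_mat[of _ n n])
  have HBij: "(H * B) $$ (a,b) = (if a < k then B $$ (a,b) else B $$ (a,b) - v a * (c * G b))"
    if "a < n" "b < n" for a b
    unfolding H_def reflector_mult_index[OF B that] c_def G_def ..
  have Gsym: "(\<Sum>l\<in>{k..<n}. v l * B $$ (i,l)) = G i"
    unfolding G_def using Bsym i by (intro sum.cong) auto
  have "(H * B * H) $$ (i,j) = (transpose_mat (H * transpose_mat (H * B))) $$ (i,j)"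
    using HB by (simp add: transpose_mult[of _ n n _ n] transpose_transpose del: index_mult_mat(1))
  also have "\<dots> = (H * transpose_mat (H * B)) $$ (j,i)"
    using i j HB by (simp add: H_def del: index_mult_mat(1))
  also have "\<dots> = (if j < k then (H * B) $$ (i,j) else (H * B) $$ (i,j) - v j * (c * (\<Sum>l\<in>{k..<n}. v l * (H * B) $$ (i,l))))"
  proof -
    have *: "transpose_mat (H * B) $$ (l,i) = (H * B) $$ (i,l)" if "l < n" for l
      by (rule index_transpose_mat(1)) (use B i that in \<open>auto simp: H_def\<close>)
    have "(\<Sum>l\<in>{k..<n}. v l * transpose_mat (H * B) $$ (l,i)) = (\<Sum>l\<in>{k..<n}. v l * (H * B) $$ (i,l))"
      using * by (intro sum.cong) auto
    then show ?thesis
      using reflector_mult_index[OF HB(2) j i, of k v] *[OF j] by (simp only: H_def c_def)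
  qed
  also have "(\<Sum>l\<in>{k..<n}. v l * (H * B) $$ (i,l)) = (if i < k then G i else G i - v i * c * (\<Sum>l\<in>{k..<n}. v l * G l))"
  proof -
    have "(\<Sum>l\<in>{k..<n}. v l * (H * B) $$ (i,l)) = (\<Sum>l\<in>{k..<n}. v l * B $$ (i,l) - (if i < k then 0 else v i * c * (v l * G l)))"
      using HBij[OF i] by (intro sum.cong) (auto simp: algebra_simps)
    then show ?thesis
      by (simp add: sum_subtractf Gsym sum_distrib_left)
  qed
  finally show ?thesis
    using HBij[OF i j] by (auto simp: algebra_simps power2_eq_square)
qed

lemma tridiag_step_carrier: "B \<in> carrier_mat n n \<Longrightarrow> tridiag_step F n k B \<in> carrier_mat n n"
  by (simp add: tridiag_step_def Let_def)

lemma tridiag_step_symmetric: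
  assumes "B \<in> carrier_mat n n" "symmetric_mat B"
  shows "symmetric_mat (tridiag_step F n k B)"
proof -
  have Bsym: "B $$ (a,b) = B $$ (b,a)" if "a < n" "b < n" for a b
    using assms that unfolding symmetric_mat_def by (metis carrier_matD index_transpose_mat(1))
  show ?thesis
    unfolding symmetric_mat_def
  proof (rule eq_matI)
    show "transpose_mat (tridiag_step F n k B) $$ (i,j) = tridiag_step F n k B $$ (i,j)"
      if "i < dim_row (tridiag_step F n k B)" "j < dim_col (tridiag_step F n k B)" for i j
      using that tridiag_step_carrier[OF assms(1), of F k] Bsym[of i j] assms(1)
      by (auto simp: tridiag_step_def Let_def max.commute min.commute)
  qed (use tridiag_step_carrier[OF assms(1), of F k] in auto)
qed

section \<open>Error of the tridiagonalization\<close>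

context fl_model begin

text \<open>Primed quantities are exact, and each computed quantity is scaled by the power of \<nu>
  that makes its size independent of \<open>v\<close>. The bound consists of a multiple of the entry
  itself and two rank-one terms in the normalised vector \<open>a\<close> and the error profile
  \<open>h\<close>, so that its Frobenius norm can be summed without loss.\<close>

lemma rank2_update_error:
  fixes v :: "nat \<Rightarrow> real" and b :: "nat \<Rightarrow> nat \<Rightarrow> real" and k :: nat
  defines "\<nu> \<equiv> L2_set v {k..<n}" and "\<beta> \<equiv> fdiv F 2 (fl_dot F v v [k..<n])"
  defines "p \<equiv> \<lambda>i. fmul F \<beta> (fl_dot F (b i) v [k..<n])"
  defines "K \<equiv> fmul F (fdiv F \<beta> 2) (fl_dot F p v [k..<n])"
  defines "q \<equiv> \<lambda>i. fsub F (p i) (fmul F K (v i))"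
  defines "p' \<equiv> \<lambda>i. 2 * ((\<Sum>l\<in>{k..<n}. b i l * v l) / \<nu>)"
  defines "\<kappa>' \<equiv> (\<Sum>l\<in>{k..<n}. p' l * v l) / \<nu>"
  defines "q' \<equiv> \<lambda>i. (p' i - \<kappa>' * v i / \<nu>) / \<nu>"
  defines "r \<equiv> \<lambda>i. L2_set (b i) {k..<n}"
  defines "\<beta>\<^sub>0 \<equiv> L2_set r {k..<n}"
  defines "a \<equiv> \<lambda>i. \<bar>v i\<bar> / \<nu>"
  defines "h \<equiv> \<lambda>i. \<gamma> * (41 * r i + 92 * \<beta>\<^sub>0 * a i)"
  assumes \<nu>: "\<nu> \<noteq> 0"
  shows "\<bar>fsub F (fsub F (b i j) (fmul F (v i) (q j))) (fmul F (q i) (v j)) - (b i j - v i * q' j - q' i * v j)\<bar>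
    \<le> 3 * \<gamma> * \<bar>b i j\<bar> + a i * h j + h i * a j"
proof -
  have \<nu>0: "0 < \<nu>"
    using \<nu> L2_set_nonneg[of v "{k..<n}"] unfolding \<nu>_def by linarith
  have \<gamma>0: "0 \<le> \<gamma>" and \<gamma>1: "\<gamma> \<le> 1/100"
    using \<gamma>_nonneg \<gamma>_small by auto
  have r0: "0 \<le> r i" for i
    by (simp add: r_def)
  have \<beta>0: "0 \<le> \<beta>\<^sub>0"
    by (simp add: \<beta>\<^sub>0_def)
  have a0: "0 \<le> a i" for i
    using \<nu>0 by (simp add: a_def)
  have av: "\<bar>v i\<bar> = a i * \<nu>" for i
    using \<nu>0 by (simp add: a_def)
  have small: "\<gamma> * x \<le> x / 100" if "0 \<le> x" for x
    using mult_right_mono[OF \<gamma>1 that] by simp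
  define g where "g = (\<lambda>i. (\<Sum>l\<in>{k..<n}. b i l * v l) / \<nu>)"
  have CS: "\<bar>\<Sum>l\<in>{k..<n}. b i l * v l\<bar> \<le> \<nu> * r i" for i
    using L2_set_Cauchy_Schwarz[of "b i" v "{k..<n}"] by (simp add: r_def \<nu>_def mult.commute)
  have p'r: "\<bar>p' i\<bar> \<le> 2 * r i" for i
  proof -
    have "\<bar>(\<Sum>l\<in>{k..<n}. b i l * v l) / \<nu>\<bar> \<le> r i"
      using CS[of i] \<nu>0 by (simp add: pos_divide_le_eq mult.commute)
    then show ?thesis
      by (simp add: p'_def)
  qed
  have pp: "\<bar>p i * \<nu> - p' i\<bar> \<le> 8 * (\<gamma> * r i)" for i
    using reflect_coeff_error[of v k "fl_dot F (b i) v [k..<n]" "\<Sum>l\<in>{k..<n}. b i l * v l" "r i"]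
      fl_dot_error[of "b i" v k] CS[of i] r0[of i] \<nu>
    by (simp add: p_def p'_def \<beta>_def \<nu>_def r_def mult_ac)
  have pr: "\<bar>p i * \<nu>\<bar> \<le> 3 * r i" for i
    using pp[of i] p'r[of i] small[OF r0[of i]] r0[of i] by linarith
  have p'\<beta>: "L2_set p' {k..<n} \<le> 2 * \<beta>\<^sub>0"
    using L2_set_mono_abs[of "{k..<n}" p' "\<lambda>i. 2 * r i"] p'r by (simp add: L2_set_scale \<beta>\<^sub>0_def)
  have p\<beta>: "L2_set (\<lambda>i. p i * \<nu>) {k..<n} \<le> 3 * \<beta>\<^sub>0"
    using L2_set_mono_abs[of "{k..<n}" "\<lambda>i. p i * \<nu>" "\<lambda>i. 3 * r i"] pr by (simp add: L2_set_scale \<beta>\<^sub>0_def)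
  have pp\<beta>: "L2_set (\<lambda>i. p i * \<nu> - p' i) {k..<n} \<le> 8 * \<gamma> * \<beta>\<^sub>0"
    using L2_set_mono_abs[of "{k..<n}" "\<lambda>i. p i * \<nu> - p' i" "\<lambda>i. 8 * \<gamma> * r i"] pp \<gamma>0
    by (simp add: L2_set_scale \<beta>\<^sub>0_def mult.assoc)
  have L\<nu>: "L2_set p {k..<n} * \<nu> = L2_set (\<lambda>i. p i * \<nu>) {k..<n}"
    using L2_set_left_distrib[of \<nu> p "{k..<n}"] \<nu>0 by simp
  define f where "f = fl_dot F p v [k..<n]"
  have \<kappa>': "\<bar>\<kappa>'\<bar> \<le> 2 * \<beta>\<^sub>0"
  proof -
    have "\<bar>\<Sum>l\<in>{k..<n}. p' l * v l\<bar> \<le> L2_set p' {k..<n} * \<nu>"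
      unfolding \<nu>_def by (rule L2_set_Cauchy_Schwarz)
    also have "\<dots> \<le> 2 * \<beta>\<^sub>0 * \<nu>"
      using p'\<beta> \<nu>0 by (intro mult_right_mono) auto
    finally show ?thesis
      using \<nu>0 by (simp add: \<kappa>'_def pos_divide_le_eq)
  qed
  have f: "\<bar>f - \<kappa>'\<bar> \<le> 11 * (\<gamma> * \<beta>\<^sub>0)"
  proof -
    have "\<bar>f - (\<Sum>l\<in>{k..<n}. p l * v l)\<bar> \<le> \<gamma> * (L2_set p {k..<n} * \<nu>)"
      unfolding f_def \<nu>_def by (rule fl_dot_error)
    also have "\<dots> \<le> \<gamma> * (3 * \<beta>\<^sub>0)"
      unfolding L\<nu> using p\<beta> \<gamma>0 by (intro mult_left_mono) auto
    finally have 1: "\<bar>f - (\<Sum>l\<in>{k..<n}. p l * v l)\<bar> \<le> 3 * (\<gamma> * \<beta>\<^sub>0)"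
      by simp
    have "(\<Sum>l\<in>{k..<n}. p l * v l) - \<kappa>' = (\<Sum>l\<in>{k..<n}. (p l * \<nu> - p' l) * v l) / \<nu>"
      using \<nu>0 by (simp add: \<kappa>'_def sum_subtractf left_diff_distrib diff_divide_distrib sum_divide_distrib)
    moreover have "\<bar>\<Sum>l\<in>{k..<n}. (p l * \<nu> - p' l) * v l\<bar> \<le> 8 * \<gamma> * \<beta>\<^sub>0 * \<nu>"
    proof (rule order_trans[OF _ mult_right_mono[OF pp\<beta> less_imp_le[OF \<nu>0]]])
      show "\<bar>\<Sum>l\<in>{k..<n}. (p l * \<nu> - p' l) * v l\<bar> \<le> L2_set (\<lambda>i. p i * \<nu> - p' i) {k..<n} * \<nu>"
        using L2_set_Cauchy_Schwarz[of "\<lambda>l. p l * \<nu> - p' l" v "{k..<n}"] by (simp only: \<nu>_def)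
    qed
    ultimately have "\<bar>(\<Sum>l\<in>{k..<n}. p l * v l) - \<kappa>'\<bar> \<le> 8 * \<gamma> * \<beta>\<^sub>0"
      using \<nu>0 by (simp add: pos_divide_le_eq)
    with 1 show ?thesis by linarith
  qed
  have \<gamma>\<beta>: "0 \<le> \<gamma> * \<beta>\<^sub>0" "\<gamma> * \<beta>\<^sub>0 \<le> \<beta>\<^sub>0 / 100"
    using \<gamma>0 \<beta>0 small[OF \<beta>0] by auto
  have f3: "\<bar>f\<bar> \<le> 3 * \<beta>\<^sub>0"
    using f \<kappa>' \<gamma>\<beta> \<beta>0 by linarith
  define b2 where "b2 = fdiv F \<beta> 2 * \<nu>\<^sup>2"
  have b2: "\<bar>b2 - 1\<bar> \<le> 3 * \<gamma>"
  proof -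
    have b: "\<bar>\<beta> * \<nu>\<^sup>2 - 2\<bar> \<le> 4 * \<gamma>"
      using scaled_coeff_error[of v k] \<nu> by (simp add: scaled_coeff_def \<beta>_def \<nu>_def)
    have b2': "\<bar>\<beta> * \<nu>\<^sup>2 / 2\<bar> \<le> 2"
      using b \<gamma>1 by (simp add: abs_le_iff)
    have "b2 - \<beta> * \<nu>\<^sup>2 / 2 = (fdiv F \<beta> 2 - \<beta> / 2) * \<nu>\<^sup>2"
      by (simp add: b2_def left_diff_distrib)
    then have "\<bar>b2 - \<beta> * \<nu>\<^sup>2 / 2\<bar> = \<bar>fdiv F \<beta> 2 - \<beta> / 2\<bar> * \<nu>\<^sup>2"
      by (simp add: abs_mult)
    also have "\<dots> \<le> w * \<bar>\<beta> / 2\<bar> * \<nu>\<^sup>2"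
      using fdiv_error[of 2 \<beta>] by (intro mult_right_mono) auto
    also have "\<dots> = w * \<bar>\<beta> * \<nu>\<^sup>2 / 2\<bar>"
      by (simp add: abs_mult)
    also have "\<dots> \<le> (\<gamma> / 2) * 2"
      using b2' w_le w_nonneg \<gamma>0 by (intro mult_mono) auto
    finally show ?thesis
      using b by (simp add: abs_le_iff)
  qed
  define \<kappa> where "\<kappa> = K * \<nu>\<^sup>2"
  \<comment> \<open>20 = 9 + 11 from the errors of coefficient and inner product, and 2 from
    rounding their product.\<close>
  have \<kappa>: "\<bar>\<kappa> - \<kappa>'\<bar> \<le> 22 * (\<gamma> * \<beta>\<^sub>0)"
  proof -
    have "\<bar>b2 * f - 1 * \<kappa>'\<bar> \<le> \<bar>b2 - 1\<bar> * \<bar>f\<bar> + \<bar>1\<bar> * \<bar>f - \<kappa>'\<bar>"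
      by (rule abs_mult_diff_le)
    also have "\<dots> \<le> 3 * \<gamma> * (3 * \<beta>\<^sub>0) + 1 * (11 * (\<gamma> * \<beta>\<^sub>0))"
      using b2 f3 f \<gamma>0 by (intro add_mono mult_mono) auto
    finally have 1: "\<bar>b2 * f - \<kappa>'\<bar> \<le> 20 * (\<gamma> * \<beta>\<^sub>0)"
      by (simp add: mult_ac)
    have b2f: "\<bar>b2 * f\<bar> \<le> 4 * \<beta>\<^sub>0"
      using 1 \<kappa>' \<gamma>\<beta> \<beta>0 by linarith
    have "\<kappa> - b2 * f = (fmul F (fdiv F \<beta> 2) f - fdiv F \<beta> 2 * f) * \<nu>\<^sup>2"
      by (simp add: \<kappa>_def b2_def K_def f_def left_diff_distrib)
    then have "\<bar>\<kappa> - b2 * f\<bar> = \<bar>fmul F (fdiv F \<beta> 2) f - fdiv F \<beta> 2 * f\<bar> * \<nu>\<^sup>2"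
      by (simp add: abs_mult)
    also have "\<dots> \<le> w * \<bar>fdiv F \<beta> 2 * f\<bar> * \<nu>\<^sup>2"
      by (intro mult_right_mono fmul_error) auto
    also have "\<dots> = w * \<bar>b2 * f\<bar>"
      by (simp add: b2_def abs_mult)
    also have "\<dots> \<le> (\<gamma> / 2) * (4 * \<beta>\<^sub>0)"
      using b2f w_le w_nonneg \<gamma>0 by (intro mult_mono) auto
    finally show ?thesis
      using 1 by linarith
  qed
  have \<kappa>3: "\<bar>\<kappa>\<bar> \<le> 3 * \<beta>\<^sub>0"
    using \<kappa> \<kappa>' \<gamma>\<beta> \<beta>0 by linarith
  \<comment> \<open>11 = 8 + 3 is the error of \<open>p\<close> and the rounding of the difference;
    28 = 22 + 6 is the error of \<kappa> and the same rounding.\<close>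
  define e where "e = (\<lambda>i. 11 * (\<gamma> * r i) + 28 * (\<gamma> * \<beta>\<^sub>0 * a i))"
  have Q': "q' i * \<nu> = p' i - \<kappa>' * v i / \<nu>" for i
    using \<nu>0 by (simp add: q'_def)
  have Q: "\<bar>q i * \<nu> - q' i * \<nu>\<bar> \<le> e i" for i
  proof -
    have "\<bar>q i - (p i - K * v i)\<bar> \<le> \<gamma> * \<bar>p i\<bar> + \<bar>K\<bar> * (2 * \<gamma> * \<bar>v i\<bar>)"
      unfolding q_def using fl_axpy_error[of "v i" "v i" 0 "p i" K] by simp
    then have "\<bar>q i - (p i - K * v i)\<bar> * \<nu> \<le> (\<gamma> * \<bar>p i\<bar> + \<bar>K\<bar> * (2 * \<gamma> * \<bar>v i\<bar>)) * \<nu>"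
      using \<nu>0 by (intro mult_right_mono) auto
    also have "\<bar>q i - (p i - K * v i)\<bar> * \<nu> = \<bar>q i * \<nu> - (p i * \<nu> - \<kappa> * v i / \<nu>)\<bar>"
    proof -
      have "(q i - (p i - K * v i)) * \<nu> = q i * \<nu> - (p i * \<nu> - \<kappa> * v i / \<nu>)"
        using \<nu>0 by (simp add: \<kappa>_def power2_eq_square algebra_simps)
      then show ?thesis
        using \<nu>0 by (metis abs_mult_pos less_imp_le mult.commute)
    qed
    also have "(\<gamma> * \<bar>p i\<bar> + \<bar>K\<bar> * (2 * \<gamma> * \<bar>v i\<bar>)) * \<nu> = \<gamma> * \<bar>p i * \<nu>\<bar> + 2 * \<gamma> * \<bar>\<kappa>\<bar> * a i"
      using \<nu>0 by (simp add: \<kappa>_def a_def abs_mult power2_eq_square algebra_simps)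
    also have "\<dots> \<le> \<gamma> * (3 * r i) + 2 * \<gamma> * (3 * \<beta>\<^sub>0) * a i"
      using pr[of i] \<kappa>3 \<gamma>0 a0[of i] by (intro add_mono mult_left_mono mult_right_mono) auto
    finally have 1: "\<bar>q i * \<nu> - (p i * \<nu> - \<kappa> * v i / \<nu>)\<bar> \<le> 3 * (\<gamma> * r i) + 6 * (\<gamma> * \<beta>\<^sub>0 * a i)"
      by (simp add: mult_ac)
    have "\<kappa> * v i / \<nu> - \<kappa>' * v i / \<nu> = (\<kappa> - \<kappa>') * (v i / \<nu>)"
      by (simp add: algebra_simps diff_divide_distrib)
    then have "\<bar>\<kappa> * v i / \<nu> - \<kappa>' * v i / \<nu>\<bar> = \<bar>\<kappa> - \<kappa>'\<bar> * a i"
      using \<nu>0 by (simp add: abs_mult a_def)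
    also have "\<dots> \<le> 22 * (\<gamma> * \<beta>\<^sub>0) * a i"
      using \<kappa> a0 by (intro mult_right_mono) auto
    finally show ?thesis
      using 1 pp[of i] unfolding Q' e_def by (simp add: abs_le_iff)
  qed
  have Q'b: "\<bar>q' i * \<nu>\<bar> \<le> 2 * r i + 2 * (\<beta>\<^sub>0 * a i)" for i
  proof -
    have "\<bar>\<kappa>' * v i / \<nu>\<bar> = \<bar>\<kappa>'\<bar> * a i"
      using \<nu>0 by (simp add: abs_mult a_def)
    also have "\<dots> \<le> 2 * \<beta>\<^sub>0 * a i"
      using \<kappa>' a0 by (intro mult_right_mono) auto
    finally show ?thesis
      using p'r[of i] unfolding Q' by linarith
  qed
  have e0: "0 \<le> e i" for i
    using \<gamma>0 r0 a0 \<beta>0 by (simp add: e_def)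
  \<comment> \<open>With |q' \<nu>| at most 2 r + 2 \<open>\<beta>\<^sub>0\<close> a, the
    coefficients of \<open>h\<close> are 8 + 3 times 11 = 41 and 8 + 3 times 28 = 92.\<close>
  have h: "4 * \<gamma> * \<bar>q' i * \<nu>\<bar> + 3 * e i \<le> h i" for i
  proof -
    have "4 * \<gamma> * \<bar>q' i * \<nu>\<bar> \<le> 4 * \<gamma> * (2 * r i + 2 * (\<beta>\<^sub>0 * a i))"
      using Q'b \<gamma>0 by (intro mult_left_mono) auto
    then show ?thesis
      by (simp add: h_def e_def algebra_simps)
  qed
  define x1 where "x1 = fsub F (b i j) (fmul F (v i) (q j))"
  define z where "z = \<bar>q' j * \<nu>\<bar>"
  define y where "y = \<bar>q' i * \<nu>\<bar>"
  have qq: "\<bar>q j - q' j\<bar> \<le> e j / \<nu>"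
  proof -
    have "\<bar>q j - q' j\<bar> * \<nu> \<le> e j"
      using Q[of j] \<nu>0 by (metis abs_mult_pos left_diff_distrib less_imp_le)
    then show ?thesis
      using \<nu>0 by (simp add: pos_le_divide_eq)
  qed
  have x1: "\<bar>x1 - (b i j - v i * q' j)\<bar> \<le> \<gamma> * \<bar>b i j\<bar> + a i * (2 * \<gamma> * z + 2 * e j)"
    unfolding x1_def using fl_axpy_error[OF qq, of "b i j" "v i"] \<nu>0
    by (simp add: av z_def abs_mult algebra_simps)
  have vq: "\<bar>v i * q' j\<bar> = a i * z"
    using \<nu>0 by (simp add: av z_def abs_mult)
  have x1b: "\<bar>x1\<bar> \<le> 2 * \<bar>b i j\<bar> + a i * (2 * z + 2 * e j)"
  proof -
    have "\<gamma> * \<bar>b i j\<bar> \<le> \<bar>b i j\<bar> / 100"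
      by (rule small) simp
    moreover have "2 * \<gamma> * z \<le> z"
      using small[of z] by (simp add: z_def)
    then have "a i * (2 * \<gamma> * z + 2 * e j) \<le> a i * (z + 2 * e j)"
      using a0 by (intro mult_left_mono) auto
    ultimately show ?thesis
      using x1 vq abs_ge_zero[of "b i j"] by (simp add: distrib_left)
  qed
  have "\<gamma> * \<bar>x1\<bar> \<le> \<gamma> * (2 * \<bar>b i j\<bar> + a i * (2 * z + 2 * e j))"
    using x1b \<gamma>0 by (rule mult_left_mono)
  also have "\<dots> = 2 * (\<gamma> * \<bar>b i j\<bar>) + a i * (2 * (\<gamma> * z) + 2 * (\<gamma> * e j))"
    by (simp add: algebra_simps)
  also have "\<dots> \<le> 2 * (\<gamma> * \<bar>b i j\<bar>) + a i * (2 * (\<gamma> * z) + e j)"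
    using small[OF e0[of j]] e0[of j] a0[of i] by (intro add_left_mono mult_left_mono) auto
  finally have x2: "\<gamma> * \<bar>x1\<bar> \<le> 2 * (\<gamma> * \<bar>b i j\<bar>) + a i * (2 * (\<gamma> * z) + e j)" .
  define x3 where "x3 = fsub F x1 (fmul F (q i) (v j))"
  have qi: "\<bar>q i\<bar> * \<bar>v j\<bar> \<le> a j * (y + e i)"
  proof -
    have "\<bar>q i * \<nu>\<bar> \<le> y + e i"
      using Q[of i] unfolding y_def by linarith
    then have "\<bar>q i * \<nu>\<bar> * a j \<le> (y + e i) * a j"
      using a0 by (intro mult_right_mono)
    then show ?thesis
      using \<nu>0 by (simp add: av abs_mult mult_ac)
  qed
  have "\<bar>x3 - (x1 - q i * v j)\<bar> \<le> \<gamma> * \<bar>x1\<bar> + \<bar>q i\<bar> * (2 * \<gamma> * \<bar>v j\<bar>)"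
    unfolding x3_def using fl_axpy_error[of "v j" "v j" 0 x1 "q i"] by simp
  also have "\<bar>q i\<bar> * (2 * \<gamma> * \<bar>v j\<bar>) = 2 * \<gamma> * (\<bar>q i\<bar> * \<bar>v j\<bar>)"
    by simp
  also have "\<dots> \<le> 2 * \<gamma> * (a j * (y + e i))"
    using qi \<gamma>0 by (intro mult_left_mono) auto
  also have "\<dots> = a j * (2 * (\<gamma> * y) + 2 * (\<gamma> * e i))"
    by (simp add: algebra_simps)
  also have "\<dots> \<le> a j * (2 * (\<gamma> * y) + e i)"
    using small[OF e0[of i]] e0[of i] a0[of j] by (intro mult_left_mono) auto
  finally have x3: "\<bar>x3 - (x1 - q i * v j)\<bar> \<le> \<gamma> * \<bar>x1\<bar> + a j * (2 * (\<gamma> * y) + e i)" by simp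
  have x4: "\<bar>q i * v j - q' i * v j\<bar> \<le> a j * e i"
  proof -
    have "\<bar>q i * v j - q' i * v j\<bar> = \<bar>q i * \<nu> - q' i * \<nu>\<bar> * a j"
      using \<nu>0 by (simp add: left_diff_distrib[symmetric] abs_mult av)
    also have "\<dots> \<le> e i * a j"
      using Q a0 by (intro mult_right_mono)
    finally show ?thesis by (simp add: mult.commute)
  qed
  have "\<bar>x3 - (b i j - v i * q' j - q' i * v j)\<bar>
    \<le> \<bar>x3 - (x1 - q i * v j)\<bar> + \<bar>x1 - (b i j - v i * q' j)\<bar> + \<bar>q i * v j - q' i * v j\<bar>"
    by linarith
  also have "\<dots> \<le> 3 * (\<gamma> * \<bar>b i j\<bar>) + a i * (4 * \<gamma> * z + 3 * e j) + a j * (2 * (\<gamma> * y) + 2 * e i)"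
    using x1 x2 x3 x4 by (simp add: algebra_simps)
  also have "\<dots> \<le> 3 * (\<gamma> * \<bar>b i j\<bar>) + a i * h j + a j * h i"
  proof -
    have "a i * (4 * \<gamma> * z + 3 * e j) \<le> a i * h j"
      using h[of j] a0[of i] by (intro mult_left_mono) (auto simp: z_def)
    moreover have "2 * (\<gamma> * y) + 2 * e i \<le> h i"
    proof -
      have "0 \<le> \<gamma> * y"
        using \<gamma>0 by (simp add: y_def)
      moreover have "4 * (\<gamma> * y) + 3 * e i \<le> h i"
        using h[of i] by (simp add: y_def mult.assoc)
      ultimately show ?thesis
        using e0[of i] by linarith
    qed
    then have "a j * (2 * (\<gamma> * y) + 2 * e i) \<le> a j * h i"
      using a0[of j] by (intro mult_left_mono)
    ultimately show ?thesis by linarith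
  qed
  finally show ?thesis
    by (simp add: x3_def x1_def mult_ac)
qed


text \<open>If the Householder vector vanishes, the step returns \<open>B\<close> unchanged; the
  second part of \<open>house_error\<close> shows that column \<open>k\<close> then already has the
  required zeros.\<close>

lemma tridiag_step_zero:
  assumes B: "B \<in> carrier_mat n n" and k: "k + 1 < n"
    and zero: "\<And>i j. j < k \<Longrightarrow> j + 1 < i \<Longrightarrow> i < n \<Longrightarrow> B $$ (i,j) = 0"
    and ij: "j < Suc k" "j + 1 < i" "i < n"
  shows "tridiag_step F n k B $$ (i,j) = 0"
proof (cases "\<forall>i\<in>{k+1..<n}. house_vec F n (k+1) (\<lambda>i. B $$ (i,k)) i = 0")
  case True
  have "L2_set (\<lambda>i. B $$ (i,k)) {k+1..<n} = 0"
    by (rule house_error(2)[OF k True])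
  then have "B $$ (i,k) = 0" if "k + 1 < i" "i < n" for i
    using that by (auto simp: L2_set_eq_0_iff)
  then have "B $$ (i,j) = 0"
    using zero ij by (cases "j = k") auto
  then show ?thesis
    unfolding tridiag_step_def Let_def if_P[OF True] .
next
  case False
  show ?thesis
    unfolding tridiag_step_def Let_def if_not_P[OF False]
    using ij zero[of j i] by (auto simp: min_def max_def)
qed

text \<open>The trailing block is covered by \<open>rank2_update_error\<close>, column and row
  \<open>k\<close> by \<open>house_error\<close>, and everything before them is left alone by the
  exact transformation as well. Computed and exact result are both symmetric, so in the trailing
  block it suffices to compare the lower triangle.\<close>

lemma tridiag_step_error:
  fixes B :: "real mat" and k :: nat
  defines "v \<equiv> house_vec F n (k+1) (\<lambda>i. B $$ (i,k))"
  assumes B: "B \<in> carrier_mat n n" and sym: "symmetric_mat B" and k: "k + 1 < n"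
    and zero: "\<And>i j. j < k \<Longrightarrow> j + 1 < i \<Longrightarrow> i < n \<Longrightarrow> B $$ (i,j) = 0"
  shows "frobenius_norm (tridiag_step F n k B - reflector n (k+1) v * B * reflector n (k+1) v) \<le> 300 * \<gamma> * frobenius_norm B"
proof (cases "\<forall>i\<in>{k+1..<n}. v i = 0")
  case True
  then have "tridiag_step F n k B = B"
    unfolding tridiag_step_def Let_def v_def by (rule if_P)
  moreover have "reflector n (k+1) v = 1\<^sub>m n"
    by (rule reflector_zero[OF True])
  ultimately have "tridiag_step F n k B - reflector n (k+1) v * B * reflector n (k+1) v = 0\<^sub>m n n"
    using B by simp
  moreover have "frobenius_norm (0\<^sub>m n n) = 0"
    by (simp add: frobenius_norm_def)
  ultimately show ?thesis
    using \<gamma>_nonneg by simp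
next
  case False
  define m where "m = k + 1"
  let ?J = "{m..<n}"
  define x where "x = (\<lambda>i. B $$ (i,k))"
  define b where "b = (\<lambda>i j. B $$ (i,j))"
  define \<nu> where "\<nu> = L2_set v ?J"
  have \<nu>: "\<nu> \<noteq> 0"
    using False by (auto simp: \<nu>_def m_def L2_set_eq_0_iff)
  then have \<nu>0: "0 < \<nu>"
    using L2_set_nonneg[of v ?J] unfolding \<nu>_def by linarith
  define H where "H = reflector n m v"
  define c where "c = 2 / \<nu>\<^sup>2"
  define G where "G = (\<lambda>j. \<Sum>l\<in>?J. v l * B $$ (l,j))"
  define S where "S = (\<Sum>l\<in>?J. v l * G l)"
  define \<beta> where "\<beta> = fdiv F 2 (fl_dot F v v [m..<n])"
  define p where "p = (\<lambda>i. fmul F \<beta> (fl_dot F (b i) v [m..<n]))"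
  define K where "K = fmul F (fdiv F \<beta> 2) (fl_dot F p v [m..<n])"
  define q where "q = (\<lambda>i. fsub F (p i) (fmul F K (v i)))"
  define r where "r = (\<lambda>i. L2_set (b i) ?J)"
  define \<beta>\<^sub>0 where "\<beta>\<^sub>0 = L2_set r ?J"
  define a where "a = (\<lambda>i. \<bar>v i\<bar> / \<nu>)"
  define h where "h = (\<lambda>i. \<gamma> * (41 * r i + 92 * \<beta>\<^sub>0 * a i))"
  define \<rho> where "\<rho> = house_pivot F n m x"
  define er where "er = (\<lambda>i. x i - v i * (c * (\<Sum>l\<in>?J. v l * x l)) - (if i = m then \<rho> else 0))"
  define upd where "upd = (\<lambda>i j. fsub F (fsub F (b i j) (fmul F (v i) (q j))) (fmul F (q i) (v j)))"
  define T where "T = tridiag_step F n k B"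
  define D where "D = T - H * B * H"
  have Bsym: "B $$ (i,j) = B $$ (j,i)" if "i < n" "j < n" for i j
    using sym B that unfolding symmetric_mat_def by (metis carrier_matD index_transpose_mat(1))
  have T: "T \<in> carrier_mat n n"
    unfolding T_def by (rule tridiag_step_carrier[OF B])
  have H: "H \<in> carrier_mat n n"
    by (simp add: H_def)
  have Tij: "T $$ (i,j) = (if k < i \<and> k < j then upd (max i j) (min i j)
                else if i \<noteq> k \<and> j \<noteq> k \<or> min i j < k \<or> i = j then B $$ (i,j)
                else if max i j = m then \<rho>
                else 0)" if "i < n" "j < n" for i j
  proof -
    have "\<not> (\<forall>i\<in>{k + 1..<n}. house_vec F n (k + 1) (\<lambda>i. B $$ (i, k)) i = 0)"
      using False by (simp add: v_def)
    note * = if_not_P[OF this]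
    show ?thesis
      unfolding T_def tridiag_step_def Let_def * index_mat(1)[OF that] split
      by (simp only: upd_def q_def K_def p_def \<beta>_def v_def b_def x_def m_def \<rho>_def)
  qed
  have Dij: "D $$ (i,j) = T $$ (i,j) - (H * B * H) $$ (i,j)" if "i < n" "j < n" for i j
    unfolding D_def by (rule index_minus_mat(1)) (use that H in auto)
  have HBH: "(H * B * H) $$ (i,j) = B $$ (i,j) - (if i < m then 0 else c * v i * G j) - (if j < m then 0 else c * v j * G i)
     + (if i < m \<or> j < m then 0 else c\<^sup>2 * v i * v j * S)" if "i < n" "j < n" for i j
    unfolding H_def c_def G_def S_def \<nu>_def by (rule reflector_conj_index[OF B sym that])
  have r0: "0 \<le> r i" for i by (simp add: r_def)
  have \<beta>0: "0 \<le> \<beta>\<^sub>0" by (simp add: \<beta>\<^sub>0_def)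
  have a0: "0 \<le> a i" for i using \<nu>0 by (simp add: a_def)
  have h0: "0 \<le> h i" for i
    using \<gamma>_nonneg r0 \<beta>0 a0 by (simp add: h_def)
  have upd: "\<bar>upd i j - (H * B * H) $$ (i,j)\<bar> \<le> 3 * \<gamma> * \<bar>B $$ (i,j)\<bar> + a i * h j + h i * a j"
    if "i \<in> ?J" "j \<in> ?J" for i j
  proof -
    define p' where "p' = (\<lambda>i. 2 * ((\<Sum>l\<in>?J. b i l * v l) / \<nu>))"
    define \<kappa>' where "\<kappa>' = (\<Sum>l\<in>?J. p' l * v l) / \<nu>"
    define q' where "q' = (\<lambda>i. (p' i - \<kappa>' * v i / \<nu>) / \<nu>)"
    have E: "\<bar>upd i j - (b i j - v i * q' j - q' i * v j)\<bar> \<le> 3 * \<gamma> * \<bar>b i j\<bar> + a i * h j + h i * a j"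
      using rank2_update_error[of v m b i j] \<nu>
      unfolding upd_def q_def K_def p_def \<beta>_def q'_def \<kappa>'_def p'_def h_def a_def \<beta>\<^sub>0_def r_def \<nu>_def
      by blast
    have p': "p' i = c * \<nu> * G i" if "i \<in> ?J" for i
    proof -
      have "(\<Sum>l\<in>?J. b i l * v l) = G i"
        unfolding G_def b_def using Bsym that by (intro sum.cong) auto
      then show ?thesis
        using \<nu>0 by (simp add: p'_def c_def power2_eq_square)
    qed
    have "(\<Sum>l\<in>?J. p' l * v l) = (\<Sum>l\<in>?J. c * \<nu> * (v l * G l))"
      using p' by (intro sum.cong) auto
    also have "\<dots> = c * \<nu> * S"
      by (simp add: S_def sum_distrib_left)
    finally have \<kappa>': "\<kappa>' = c * S"
      using \<nu>0 by (simp add: \<kappa>'_def)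
    have q': "q' i = c * G i - c\<^sup>2 / 2 * S * v i" if "i \<in> ?J" for i
      using \<nu>0 by (simp add: q'_def p'[OF that] \<kappa>' c_def field_simps power2_eq_square)
    have "b i j - v i * q' j - q' i * v j = (H * B * H) $$ (i,j)"
      using that by (simp add: HBH q' b_def algebra_simps del: index_mult_mat(1))
    then show ?thesis
      using E by (simp add: b_def del: index_mult_mat(1))
  qed
  define a' where "a' = (\<lambda>i. if m \<le> i then a i else 0)"
  define h' where "h' = (\<lambda>i. if m \<le> i then h i else 0)"
  define er' where "er' = (\<lambda>i. if m \<le> i then \<bar>er i\<bar> else 0)"
  define dl :: "nat \<Rightarrow> real" where "dl = (\<lambda>i. if i = k then 1 else 0)"
  have nn: "0 \<le> 3 * \<gamma> * \<bar>B $$ (i,j)\<bar>" "0 \<le> a' i" "0 \<le> h' i" "0 \<le> er' i" "0 \<le> dl i" for i j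
    using \<gamma>_nonneg a0 h0 by (auto simp: a'_def h'_def er'_def dl_def)
  have col: "\<bar>T $$ (i,k) - (H * B * H) $$ (i,k)\<bar> \<le> \<bar>er i\<bar>" if "i \<in> ?J" for i
  proof -
    have "T $$ (i,k) = (if i = m then \<rho> else 0)"
      using Tij[of i k] that k by (auto simp: m_def)
    moreover have "(H * B * H) $$ (i,k) = x i - v i * (c * (\<Sum>l\<in>?J. v l * x l))"
      using HBH[of i k] that k by (simp add: m_def x_def G_def mult_ac del: index_mult_mat(1))
    ultimately have "T $$ (i,k) - (H * B * H) $$ (i,k) = - er i"
      by (simp add: er_def)
    then show ?thesis
      by simp
  qed
  have sT: "T $$ (i,j) = T $$ (j,i)" "(H * B * H) $$ (i,j) = (H * B * H) $$ (j,i)" if "i < n" "j < n" for i j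
    using that Bsym[OF that] Tij[OF that] Tij[OF that(2,1)] HBH[OF that] HBH[OF that(2,1)]
    by (auto simp: max.commute min.commute simp del: index_mult_mat(1))
  \<comment> \<open>Column and row \<open>k\<close> enter as rank-one matrices with the unit vector
    \<open>dl\<close>. All pieces but the first thus have product form and are evaluated by
    \<open>L2_set_product\<close>.\<close>
  have pt: "\<bar>D $$ (i,j)\<bar> \<le> 3 * \<gamma> * \<bar>B $$ (i,j)\<bar> + a' i * h' j + h' i * a' j + dl i * er' j + er' i * dl j"
    if ij: "i < n" "j < n" for i j
  proof -
    note nn' = nn(1)[of i j] mult_nonneg_nonneg[OF nn(2)[of i] nn(3)[of j]] mult_nonneg_nonneg[OF nn(3)[of i] nn(2)[of j]]
      mult_nonneg_nonneg[OF nn(5)[of i] nn(4)[of j]] mult_nonneg_nonneg[OF nn(4)[of i] nn(5)[of j]]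
    consider "i \<in> ?J" "j \<in> ?J" | "i \<in> ?J" "j = k" | "i = k" "j \<in> ?J" | "i \<in> ?J" "j < k" | "i < k" "j \<in> ?J" | "i \<le> k" "j \<le> k"
      using ij by (fastforce simp: m_def)
    then show ?thesis
    proof cases
      case 1
      define M where "M = max i j"
      define N where "N = min i j"
      have MN: "M \<in> ?J" "N \<in> ?J" and MN': "M = i \<and> N = j \<or> M = j \<and> N = i"
        using 1 by (auto simp: M_def N_def max_def min_def)
      have eq1: "T $$ (i,j) = upd M N"
        using 1 Tij[OF ij] by (simp add: m_def M_def N_def)
      have eq2: "(H * B * H) $$ (i,j) = (H * B * H) $$ (M, N)" and eq3: "B $$ (i,j) = B $$ (M,N)"
        using MN' sT(2)[OF ij] Bsym[OF ij] by metis+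
      have "\<bar>D $$ (i,j)\<bar> \<le> 3 * \<gamma> * \<bar>B $$ (i,j)\<bar> + a M * h N + h M * a N"
        unfolding Dij[OF ij] eq1 eq2 eq3 by (rule upd[OF MN])
      also have "\<dots> = 3 * \<gamma> * \<bar>B $$ (i,j)\<bar> + a' i * h' j + h' i * a' j"
        using 1 MN' by (auto simp: a'_def h'_def)
      finally show ?thesis
        using nn' by linarith
    next
      case 2
      then have "\<bar>D $$ (i,j)\<bar> \<le> er' i * dl j"
        using col[of i] Dij[OF ij] by (simp add: er'_def dl_def del: index_mult_mat(1))
      then show ?thesis
        using nn' by linarith
    next
      case 3
      then have "\<bar>D $$ (i,j)\<bar> \<le> dl i * er' j"
        using col[of j] Dij[OF ij] sT[OF ij] by (simp add: er'_def dl_def del: index_mult_mat(1))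
      then show ?thesis
        using nn' by linarith
    next
      case 4
      \<comment> \<open>Column \<open>j\<close> was eliminated earlier and has exact zeros in all
        rows where \<open>v\<close> acts.\<close>
      have "G j = 0"
        unfolding G_def using zero 4 by (intro sum.neutral) (auto simp: m_def)
      then have "D $$ (i,j) = 0"
        using Dij[OF ij] Tij[OF ij] HBH[OF ij] 4 by (auto simp: m_def)
      then show ?thesis
        using nn' by simp
    next
      case 5
      have "G i = 0"
        unfolding G_def using zero 5 by (intro sum.neutral) (auto simp: m_def)
      then have "D $$ (i,j) = 0"
        using Dij[OF ij] Tij[OF ij] HBH[OF ij] 5 by (auto simp: m_def)
      then show ?thesis
        using nn' by simp
    next
      case 6
      then have "D $$ (i,j) = 0"
        using Dij[OF ij] Tij[OF ij] HBH[OF ij] by (auto simp: m_def)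
      then show ?thesis
        using nn' by simp
    qed
  qed
  let ?P = "{..<n} \<times> {..<n}"
  define f1 where "f1 = (\<lambda>(i,j). 3 * \<gamma> * \<bar>B $$ (i,j)\<bar>)"
  define f2 where "f2 = (\<lambda>(i,j). a' i * h' j)"
  define f3 where "f3 = (\<lambda>(i,j). h' i * a' j)"
  define f4 where "f4 = (\<lambda>(i,j). dl i * er' j)"
  define f5 where "f5 = (\<lambda>(i,j). er' i * dl j)"
  have F: "frobenius_norm B = L2_set (\<lambda>(i,j). B $$ (i,j)) ?P"
    using B by (simp add: frobenius_norm_L2_set)
  have "frobenius_norm D = L2_set (\<lambda>(i,j). D $$ (i,j)) ?P"
    using T H by (simp add: D_def frobenius_norm_L2_set del: index_minus_mat)
       (simp add: H_def)
  also have "\<dots> \<le> L2_set (\<lambda>z. f1 z + f2 z + f3 z + f4 z + f5 z) ?P"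
    using pt by (intro L2_set_mono_abs) (auto simp: f1_def f2_def f3_def f4_def f5_def)
  also have "\<dots> \<le> L2_set f1 ?P + L2_set f2 ?P + L2_set f3 ?P + L2_set f4 ?P + L2_set f5 ?P"
    by (intro order_trans[OF L2_set_triangle_ineq] add_right_mono order_refl)
  also have "L2_set f1 ?P = 3 * \<gamma> * frobenius_norm B"
    using \<gamma>_nonneg L2_set_scale[of "3 * \<gamma>" "\<lambda>z. \<bar>case z of (i,j) \<Rightarrow> B $$ (i,j)\<bar>" ?P]
    by (simp add: F f1_def L2_set_abs split_def)
  also have "L2_set f2 ?P = L2_set a' {..<n} * L2_set h' {..<n}"
    unfolding f2_def by (rule L2_set_product)
  also have "L2_set f3 ?P = L2_set h' {..<n} * L2_set a' {..<n}"
    unfolding f3_def by (rule L2_set_product)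
  also have "L2_set f4 ?P = L2_set dl {..<n} * L2_set er' {..<n}"
    unfolding f4_def by (rule L2_set_product)
  also have "L2_set f5 ?P = L2_set er' {..<n} * L2_set dl {..<n}"
    unfolding f5_def by (rule L2_set_product)
  also have "L2_set dl {..<n} = 1"
    using k unfolding dl_def by (subst L2_set_single) auto
  also have "L2_set a' {..<n} = 1"
  proof -
    have "L2_set a' {..<n} = L2_set (\<lambda>i. 1 / \<nu> * \<bar>v i\<bar>) ?J"
      unfolding a'_def L2_set_extend_zero by (simp add: a_def)
    also have "\<dots> = \<bar>1 / \<nu>\<bar> * \<nu>"
      by (simp only: L2_set_scale L2_set_abs \<nu>_def)
    finally show ?thesis
      using \<nu>0 by simp
  qed
  also have "L2_set er' {..<n} = L2_set er ?J"
    unfolding er'_def L2_set_extend_zero by (rule L2_set_abs)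
  finally have D1: "frobenius_norm D \<le> 3 * \<gamma> * frobenius_norm B + 2 * L2_set h' {..<n} + 2 * L2_set er ?J"
    by simp
  have "L2_set (\<lambda>i. a i) ?J = 1"
    using \<open>L2_set a' {..<n} = 1\<close> unfolding a'_def L2_set_extend_zero .
  then have aJ: "L2_set a ?J = 1" by simp
  have "L2_set h' {..<n} = L2_set (\<lambda>i. \<gamma> * (41 * r i + 92 * \<beta>\<^sub>0 * a i)) ?J"
    unfolding h'_def L2_set_extend_zero by (simp add: h_def)
  also have "\<dots> = \<gamma> * L2_set (\<lambda>i. 41 * r i + 92 * \<beta>\<^sub>0 * a i) ?J"
    using \<gamma>_nonneg by (simp add: L2_set_scale)
  also have "\<dots> \<le> \<gamma> * (L2_set (\<lambda>i. 41 * r i) ?J + L2_set (\<lambda>i. 92 * \<beta>\<^sub>0 * a i) ?J)"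
    using \<gamma>_nonneg by (intro mult_left_mono L2_set_triangle_ineq)
  also have "\<dots> = \<gamma> * (133 * \<beta>\<^sub>0)"
    using \<beta>0 by (simp add: L2_set_scale aJ \<beta>\<^sub>0_def[symmetric])
  also have "\<dots> \<le> \<gamma> * (133 * frobenius_norm B)"
  proof -
    have "\<beta>\<^sub>0 = L2_set (\<lambda>(i,j). B $$ (i,j)) (?J \<times> ?J)"
      unfolding \<beta>\<^sub>0_def r_def L2_set_rows b_def ..
    also have "\<dots> \<le> frobenius_norm B"
      unfolding F by (rule L2_set_mono_set) auto
    finally show ?thesis
      using \<gamma>_nonneg by (intro mult_left_mono) auto
  qed
  finally have h'': "L2_set h' {..<n} \<le> 133 * (\<gamma> * frobenius_norm B)" by simp
  have "L2_set er ?J \<le> 15 * \<gamma> * L2_set x ?J"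
    using house_error(1)[of m x] k unfolding er_def m_def v_def x_def c_def \<nu>_def \<rho>_def by simp
  also have "\<dots> \<le> 15 * \<gamma> * frobenius_norm B"
  proof (rule mult_left_mono)
    have "L2_set x ?J \<le> L2_set x {..<n}"
      by (rule L2_set_mono_set) auto
    also have "\<dots> = vec_norm2 (col B k)"
      using k by (subst vec_norm2_col[OF B]) (auto simp: x_def)
    also have "\<dots> \<le> frobenius_norm B"
      unfolding frobenius_norm_cols
      by (rule member_le_L2_set) (use k B in auto)
    finally show "L2_set x ?J \<le> frobenius_norm B" .
  qed (use \<gamma>_nonneg in auto)
  \<comment> \<open>3 from the entries of \<open>B\<close>, 2 times 133 = 2 times (41 + 92) from the
    trailing block, 2 times 15 from row and column \<open>k\<close>.\<close>
  finally have "frobenius_norm D \<le> 299 * (\<gamma> * frobenius_norm B)"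
    using D1 h'' by simp
  moreover have "0 \<le> \<gamma> * frobenius_norm B"
    using \<gamma>_nonneg by simp
  ultimately show ?thesis
    by (simp add: D_def T_def H_def m_def)
qed

text \<open>The zeros have to be exact, since later steps neither recompute the eliminated columns
  nor are charged any error for them.\<close>

lemma tridiag_iter_invariant:
  assumes A: "A \<in> carrier_mat n n" "symmetric_mat A" and k: "k \<le> n - 2"
  shows "tridiag_iter F n A k \<in> carrier_mat n n \<and> symmetric_mat (tridiag_iter F n A k) \<and>
    (\<forall>i j. j < k \<longrightarrow> j + 1 < i \<longrightarrow> i < n \<longrightarrow> tridiag_iter F n A k $$ (i,j) = 0)"
  using k
proof (induction k)
  case (Suc k)
  then have IH: "tridiag_iter F n A k \<in> carrier_mat n n" "symmetric_mat (tridiag_iter F n A k)"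
    "\<And>i j. j < k \<Longrightarrow> j + 1 < i \<Longrightarrow> i < n \<Longrightarrow> tridiag_iter F n A k $$ (i,j) = 0"
    by auto
  show ?case
    using tridiag_step_carrier[OF IH(1), of F k] tridiag_step_symmetric[OF IH(1,2), of F k]
      tridiag_step_zero[OF IH(1) _ IH(3)] Suc.prems
    by auto
qed (use A in auto)

text \<open>\<open>P\<close> is formed from the stored columns of \<open>tridiag_V\<close>, so the
  same exactly orthonormal matrix also describes the back-transformation at working
  precision.\<close>

lemma tridiag_error:
  fixes A :: "real mat"
  defines "P \<equiv> rev_prod n (\<lambda>j. reflector n (j+1) (\<lambda>i. tridiag_V F A $$ (i,j))) (n - 2)"
  assumes A: "A \<in> carrier_mat n n" "symmetric_mat A" and small: "600 * real n * \<gamma> \<le> 1"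
  shows "frobenius_norm (tridiag_T F A - P * A * transpose_mat P) \<le> 600 * real n * \<gamma> * frobenius_norm A"
proof -
  have T: "tridiag_T F A = tridiag_iter F n A (n - 2)"
    using A by (simp add: tridiag_T_def)
  define H where "H = (\<lambda>j. reflector n (j+1) (house_vec F n (j+1) (\<lambda>l. tridiag_iter F n A j $$ (l,j))))"
  have P: "P = rev_prod n H (n - 2)"
    unfolding P_def H_def
  proof (rule rev_prod_cong, rule reflector_cong)
    fix j i assume "j < n - 2" "j + 1 \<le> i" "i < n"
    then show "tridiag_V F A $$ (i,j) = house_vec F n (j+1) (\<lambda>l. tridiag_iter F n A j $$ (l,j)) i"
      using A by (simp add: tridiag_V_def)
  qed
  have "2 * real (n - 2) * (300 * \<gamma>) \<le> 600 * real n * \<gamma>"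
    using \<gamma>_nonneg by (auto intro!: mult_right_mono)
  then have pow: "(1 + 300 * \<gamma>) ^ (n - 2) - 1 \<le> 600 * real n * \<gamma>"
    using one_plus_power_le[of "300 * \<gamma>" "n - 2"] \<gamma>_nonneg small by linarith
  have "frobenius_norm (tridiag_iter F n A (n - 2) - P * tridiag_iter F n A 0 * transpose_mat P)
      \<le> ((1 + 300 * \<gamma>) ^ (n - 2) - 1) * frobenius_norm (tridiag_iter F n A 0)"
    unfolding P
  proof (rule perturbed_conjugations[where N = "n - 2", THEN conjunct2])
    fix i assume i: "i < n - 2"
    have "transpose_mat (H i) = H i"
      by (simp add: H_def)
    then show "frobenius_norm (tridiag_iter F n A (Suc i) - H i * tridiag_iter F n A i * transpose_mat (H i))
        \<le> 300 * \<gamma> * frobenius_norm (tridiag_iter F n A i)"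
      using tridiag_step_error[of "tridiag_iter F n A i" i] tridiag_iter_invariant[OF A, of i] i
      by (simp add: H_def)
  qed (use tridiag_iter_invariant[OF A] \<gamma>_nonneg reflector_orthonormal in \<open>auto simp: H_def\<close>)
  also have "\<dots> \<le> 600 * real n * \<gamma> * frobenius_norm A"
    using pow by (auto intro!: mult_right_mono)
  finally show "frobenius_norm (tridiag_T F A - P * A * transpose_mat P) \<le> 600 * real n * \<gamma> * frobenius_norm A"
    by (simp add: T)
qed

end

section \<open>Gram--Schmidt\<close>

lemma entry_le_frobenius:
  assumes "A \<in> carrier_mat nr nc" "i < nr" "j < nc" shows "\<bar>A $$ (i,j)\<bar> \<le> frobenius_norm A"
  using assms member_le_L2_set[of "{..<nr} \<times> {..<nc}" "(i,j)" "\<lambda>(i,j). \<bar>A $$ (i,j)\<bar>"]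
    L2_set_abs[of "\<lambda>(i,j). A $$ (i,j)" "{..<nr} \<times> {..<nc}"]
  by (simp add: frobenius_norm_L2_set split_def)

lemma sum_upto_row:
  fixes f :: "nat \<Rightarrow> real"
  assumes "i < n" "\<And>l. i < l \<Longrightarrow> l < n \<Longrightarrow> f l = 0"
  shows "(\<Sum>l<n. f l) = (\<Sum>l<i. f l) + f i"
proof -
  have "(\<Sum>l<n. f l) = (\<Sum>l<Suc i. f l)"
    using assms by (intro sum.mono_neutral_right) auto
  then show ?thesis by simp
qed

text \<open>The Cholesky factor of a perturbed identity, up to row signs. Induction over the rows:
  the (i,j) entry of R^T R consists of R_ii R_ij and products of off-diagonal entries of earlier
  rows, which are already of second order.\<close>

lemma upper_triangular_near_orthonormal:
  assumes R: "R \<in> carrier_mat n n" and tri: "upper_triangular R"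
    and gram: "frobenius_norm (transpose_mat R * R - 1\<^sub>m n) \<le> \<phi>" and small: "8 * real n * \<phi> \<le> 1"
  obtains D where "orthonormal_mat n D" "diagonal_mat D" "transpose_mat D = D"
    "frobenius_norm (R - D) \<le> 2 * real n * \<phi>"
proof -
  have \<phi>: "0 \<le> \<phi>"
    using gram frobenius_norm_nonneg order_trans by blast
  have G: "\<bar>(\<Sum>l<n. R $$ (l,i) * R $$ (l,j)) - (if i = j then 1 else 0)\<bar> \<le> \<phi>" if "i < n" "j < n" for i j
  proof -
    have "(transpose_mat R * R - 1\<^sub>m n) $$ (i,j) = (\<Sum>l<n. R $$ (l,i) * R $$ (l,j)) - (if i = j then 1 else 0)"
      using R that by (simp add: scalar_prod_def atLeast0LessThan)
    moreover have "\<bar>(transpose_mat R * R - 1\<^sub>m n) $$ (i,j)\<bar> \<le> frobenius_norm (transpose_mat R * R - 1\<^sub>m n)"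
      using that by (intro entry_le_frobenius) auto
    ultimately show ?thesis
      using gram by linarith
  qed
  have zero: "R $$ (i,j) = 0" if "j < i" "i < n" for i j
    using tri that R by (auto simp: upper_triangular_def)
  have main: "(\<forall>j. i < j \<longrightarrow> j < n \<longrightarrow> \<bar>R $$ (i,j)\<bar> \<le> 2 * \<phi>) \<and> \<bar>\<bar>R $$ (i,i)\<bar> - 1\<bar> \<le> 2 * \<phi>" if "i < n" for i
    using that
  proof (induction i rule: less_induct)
    case (less i)
    have \<phi>8: "\<phi> \<le> 1/8"
    proof -
      have "1 * \<phi> \<le> real n * \<phi>"
        using less.prems \<phi> by (intro mult_right_mono) auto
      then show ?thesis using small by linarith
    qed
    \<comment> \<open>At most \<open>n\<close> products of two entries bounded by 2 \<phi>; since 8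
      n \<phi> is at most 1, their sum 4 n \<phi>^2 is at most \<phi> / 2. This is where the
      smallness hypothesis is consumed.\<close>
    have tail: "\<bar>\<Sum>l<i. R $$ (l,i) * R $$ (l,j)\<bar> \<le> \<phi> / 2" if j: "i \<le> j" "j < n" for j
    proof -
      have "\<bar>\<Sum>l<i. R $$ (l,i) * R $$ (l,j)\<bar> \<le> (\<Sum>l<i. \<bar>R $$ (l,i) * R $$ (l,j)\<bar>)"
        by (rule sum_abs)
      also have "\<dots> \<le> (\<Sum>l<i. (2 * \<phi>) * (2 * \<phi>))"
        unfolding abs_mult using less.IH j less.prems \<phi> by (intro sum_mono mult_mono) auto
      also have "\<dots> = real i * \<phi> * (4 * \<phi>)"
        by simp
      also have "\<dots> \<le> real n * \<phi> * (4 * \<phi>)"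
        using less.prems \<phi> by (intro mult_right_mono) auto
      also have "\<dots> \<le> (1/8) * (4 * \<phi>)"
        using small \<phi> by (intro mult_right_mono) auto
      finally show ?thesis by simp
    qed
    have row: "(\<Sum>l<n. R $$ (l,i) * R $$ (l,j)) = (\<Sum>l<i. R $$ (l,i) * R $$ (l,j)) + R $$ (i,i) * R $$ (i,j)" for j
      using less.prems zero by (intro sum_upto_row) auto
    define d where "d = \<bar>R $$ (i,i)\<bar>"
    have "\<bar>R $$ (i,i) * R $$ (i,i) - 1\<bar> \<le> 3/2 * \<phi>"
    proof -
      have "\<bar>(\<Sum>l<i. R $$ (l,i) * R $$ (l,i)) + R $$ (i,i) * R $$ (i,i) - 1\<bar> \<le> \<phi>"
        using G[OF less.prems less.prems] row[of i] by simp
      moreover have "\<bar>\<Sum>l<i. R $$ (l,i) * R $$ (l,i)\<bar> \<le> \<phi> / 2"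
        using tail[of i] less.prems by simp
      ultimately show ?thesis
        unfolding abs_le_iff by linarith
    qed
    then have d2: "\<bar>d * d - 1\<bar> \<le> 3/2 * \<phi>"
      by (simp add: d_def)
    have d0: "0 \<le> d" by (simp add: d_def)
    have dd: "\<bar>d - 1\<bar> \<le> 3/2 * \<phi>"
    proof -
      have "\<bar>d - 1\<bar> * 1 \<le> \<bar>d - 1\<bar> * (d + 1)"
        using d0 by (intro mult_left_mono) auto
      also have "\<dots> = \<bar>(d - 1) * (d + 1)\<bar>"
        using d0 by (simp add: abs_mult)
      also have "(d - 1) * (d + 1) = d * d - 1"
        by (simp add: algebra_simps)
      finally show ?thesis using d2 by simp
    qed
    have "\<bar>R $$ (i,j)\<bar> \<le> 2 * \<phi>" if j: "i < j" "j < n" for j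
    proof -
      have "\<bar>R $$ (i,i) * R $$ (i,j)\<bar> \<le> 3/2 * \<phi>"
      proof -
        have "\<bar>(\<Sum>l<i. R $$ (l,i) * R $$ (l,j)) + R $$ (i,i) * R $$ (i,j)\<bar> \<le> \<phi>"
          using G[OF less.prems j(2)] row[of j] j by simp
        moreover have "\<bar>\<Sum>l<i. R $$ (l,i) * R $$ (l,j)\<bar> \<le> \<phi> / 2"
          using tail[of j] j by simp
        ultimately show ?thesis
          unfolding abs_le_iff by linarith
      qed
      then have "d * \<bar>R $$ (i,j)\<bar> \<le> 3/2 * \<phi>"
        by (simp add: d_def abs_mult)
      moreover have "3/4 * \<bar>R $$ (i,j)\<bar> \<le> d * \<bar>R $$ (i,j)\<bar>"
      proof (rule mult_right_mono)
        show "3/4 \<le> d"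
          using dd \<phi>8 by linarith
      qed auto
      ultimately show ?thesis by linarith
    qed
    then show ?case
      using dd \<phi> unfolding d_def by auto
  qed
  define D where "D = mat n n (\<lambda>(i,j). if i = j then (if 0 \<le> R $$ (i,i) then 1 else - 1 :: real) else 0)"
  have D: "D \<in> carrier_mat n n"
    by (simp add: D_def)
  have DT: "transpose_mat D = D"
    by (rule eq_matI) (auto simp: D_def)
  have "D * D = 1\<^sub>m n"
  proof (rule eq_matI)
    fix i j assume "i < dim_row (1\<^sub>m n :: real mat)" "j < dim_col (1\<^sub>m n :: real mat)"
    then have ij: "i < n" "j < n" by auto
    have "(D * D) $$ (i,j) = (\<Sum>l\<in>{0..<n}. D $$ (i,l) * D $$ (l,j))"
      using ij by (simp add: D_def scalar_prod_def)
    also have "\<dots> = (\<Sum>l\<in>{0..<n}. if l = i then (if i = j then 1 else 0) else 0)"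
      using ij by (intro sum.cong) (auto simp: D_def)
    also have "\<dots> = (if i = j then 1 else 0)"
      using ij by simp
    finally show "(D * D) $$ (i,j) = (1\<^sub>m n :: real mat) $$ (i,j)"
      using ij by simp
  qed (use D in auto)
  then have orth: "orthonormal_mat n D"
    using D DT by (simp add: orthonormal_mat_def)
  have "frobenius_norm (R - D) \<le> real n * (2 * \<phi>)"
  proof (rule frobenius_norm_le_entries)
    fix i j assume ij: "i < n" "j < n"
    consider "i = j" | "i < j" | "j < i" by linarith
    then show "\<bar>(R - D) $$ (i,j)\<bar> \<le> 2 * \<phi>"
    proof cases
      case 1
      then have "\<bar>(R - D) $$ (i,j)\<bar> = \<bar>\<bar>R $$ (i,i)\<bar> - 1\<bar>"
        using ij by (auto simp: D_def)
      then show ?thesis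
        using main[OF ij(1)] by simp
    next
      case 2
      then have "(R - D) $$ (i,j) = R $$ (i,j)"
        using ij by (simp add: D_def)
      then show ?thesis
        using main[OF ij(1)] 2 ij by simp
    next
      case 3
      then have "(R - D) $$ (i,j) = 0"
        using ij zero by (simp add: D_def)
      then show ?thesis
        using \<phi> by simp
    qed
  qed (use D \<phi> in auto)
  moreover have "diagonal_mat D"
    by (auto simp: diagonal_mat_def D_def)
  ultimately show ?thesis
    using that[OF orth _ DT] by simp
qed

section \<open>Combinations of columns and the strictly upper part of the Gram matrix\<close>

lemma sum_abs_le_L2_set: "(\<Sum>i<N. \<bar>z i\<bar>) \<le> real N * L2_set z {..<N}"
proof -
  have "(\<Sum>i<N. \<bar>z i\<bar>) \<le> (\<Sum>i<N. L2_set z {..<N})"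
  proof (rule sum_mono)
    fix i assume "i \<in> {..<N}"
    then show "\<bar>z i\<bar> \<le> L2_set z {..<N}"
      using member_le_L2_set[of "{..<N}" i "\<lambda>i. \<bar>z i\<bar>"] L2_set_abs[of z "{..<N}"] by simp
  qed
  then show ?thesis by simp
qed

lemma L2_set_sum_le: "finite B \<Longrightarrow> L2_set (\<lambda>i. \<Sum>j\<in>B. f j i) A \<le> (\<Sum>j\<in>B. L2_set (f j) A)"
proof (induction B rule: finite_induct)
  case empty
  then show ?case by (simp add: L2_set_def)
next
  case (insert b B)
  then show ?case
    using L2_set_triangle_ineq[of "f b" "\<lambda>i. \<Sum>j\<in>B. f j i" A] by simp
qed

lemma sum_symmetric_split:
  fixes a :: "nat \<Rightarrow> nat \<Rightarrow> real"
  assumes sym: "\<And>i j. a i j = a j i"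
  shows "(\<Sum>i<N. \<Sum>j<N. a i j) = (\<Sum>i<N. a i i) + 2 * (\<Sum>i<N. \<Sum>j\<in>{i<..<N}. a i j)"
proof (induction N)
  case (Suc N)
  have "(\<Sum>i<Suc N. \<Sum>j<Suc N. a i j) = (\<Sum>i<N. \<Sum>j<N. a i j) + (\<Sum>i<N. a i N) + (\<Sum>j<N. a N j) + a N N"
    by (simp add: sum.distrib)
  also have "(\<Sum>j<N. a N j) = (\<Sum>i<N. a i N)"
    using sym by simp
  finally have 1: "(\<Sum>i<Suc N. \<Sum>j<Suc N. a i j) = (\<Sum>i<N. \<Sum>j<N. a i j) + 2 * (\<Sum>i<N. a i N) + a N N"
    by simp
  have "{i<..<Suc N} = insert N {i<..<N}" if "i < N" for i
    using that by auto
  then have "(\<Sum>i<N. \<Sum>j\<in>{i<..<Suc N}. a i j) = (\<Sum>i<N. a i N + (\<Sum>j\<in>{i<..<N}. a i j))"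
    by (intro sum.cong) auto
  then have "(\<Sum>i<Suc N. \<Sum>j\<in>{i<..<Suc N}. a i j) = (\<Sum>i<N. a i N) + (\<Sum>i<N. \<Sum>j\<in>{i<..<N}. a i j)"
    using sum.neutral[of "{N<..<Suc N}" "a N"] by (simp add: sum.distrib)
  then show ?case
    using 1 Suc.IH by simp
qed simp

abbreviation ip :: "nat \<Rightarrow> (nat \<Rightarrow> real) \<Rightarrow> (nat \<Rightarrow> real) \<Rightarrow> real" where
  "ip n f g \<equiv> (\<Sum>i<n. f i * g i)"

abbreviation nrm :: "nat \<Rightarrow> (nat \<Rightarrow> real) \<Rightarrow> real" where
  "nrm n f \<equiv> L2_set f {..<n}"

text \<open>Only inner products with i < l remain on the right: these are the entries that
  Gram--Schmidt controls after multiplication by the triangular factor.\<close>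

lemma nrm_lincomb_square:
  fixes q :: "nat \<Rightarrow> nat \<Rightarrow> real"
  shows "(nrm n (\<lambda>i. \<Sum>l<N. y l * q l i))\<^sup>2 = (\<Sum>l<N. (y l)\<^sup>2 * ip n (q l) (q l))
     + 2 * (\<Sum>i<N. y i * (\<Sum>l\<in>{i<..<N}. y l * ip n (q i) (q l)))"
proof -
  have "(nrm n (\<lambda>i. \<Sum>l<N. y l * q l i))\<^sup>2 = (\<Sum>i<n. \<Sum>l<N. \<Sum>m<N. y l * y m * (q l i * q m i))"
    by (subst L2_set_square) (simp add: power2_eq_square sum_product mult_ac)
  also have "\<dots> = (\<Sum>l<N. \<Sum>i<n. \<Sum>m<N. y l * y m * (q l i * q m i))"
    by (rule sum.swap)
  also have "\<dots> = (\<Sum>l<N. \<Sum>m<N. \<Sum>i<n. y l * y m * (q l i * q m i))"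
    by (rule sum.cong[OF refl sum.swap])
  also have "\<dots> = (\<Sum>l<N. \<Sum>m<N. y l * y m * ip n (q l) (q m))"
    by (simp add: sum_distrib_left)
  also have "\<dots> = (\<Sum>l<N. y l * y l * ip n (q l) (q l)) + 2 * (\<Sum>l<N. \<Sum>m\<in>{l<..<N}. y l * y m * ip n (q l) (q m))"
    by (rule sum_symmetric_split[of "\<lambda>l m. y l * y m * ip n (q l) (q m)"]) (simp add: mult_ac)
  finally show ?thesis
    by (simp add: power2_eq_square sum_distrib_left mult_ac)
qed

text \<open>With \<open>U\<close> the strictly upper triangular part of \<open>Q\<^sup>T Q\<close>, the vectors \<open>y = R z\<close> satisfy
  \<open>\<parallel>Q y\<parallel>\<^sup>2 \<approx> \<parallel>y\<parallel>\<^sup>2 + 2 y\<^sup>T (U R) z\<close>. Gram--Schmidt makes \<open>U R\<close> small independently of the conditioning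
  of \<open>R\<close>, so \<open>R\<close> inherits its lower bound from \<open>Q R\<close> before \<open>Q\<close> is known to be nearly orthonormal.\<close>

lemma gram_schmidt_factor_lower_bound:
  fixes q x e :: "nat \<Rightarrow> nat \<Rightarrow> real" and R :: "nat \<Rightarrow> nat \<Rightarrow> real"
  assumes QR: "\<And>i j. i < n \<Longrightarrow> j < N \<Longrightarrow> x j i + e j i = (\<Sum>l<N. R l j * q l i)"
    and e: "\<And>j. j < N \<Longrightarrow> nrm n (e j) \<le> \<epsilon>"
    and d: "\<And>l. l < N \<Longrightarrow> \<bar>ip n (q l) (q l) - 1\<bar> \<le> \<epsilon>"
    and U: "\<And>i j. i < N \<Longrightarrow> j < N \<Longrightarrow> \<bar>\<Sum>l\<in>{i<..<N}. R l j * ip n (q i) (q l)\<bar> \<le> \<epsilon>"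
    and X: "\<And>z. L2_set z {..<N} / 2 \<le> nrm n (\<lambda>i. \<Sum>j<N. z j * x j i)"
    and small: "20 * (real N)\<^sup>2 * \<epsilon> \<le> 1" and \<epsilon>: "0 \<le> \<epsilon>"
  shows "L2_set z {..<N} \<le> 4 * L2_set (\<lambda>l. \<Sum>j<N. R l j * z j) {..<N}"
proof (rule ccontr)
  define y where "y = (\<lambda>l. \<Sum>j<N. R l j * z j)"
  define Y where "Y = L2_set y {..<N}"
  define Z where "Z = L2_set z {..<N}"
  define V where "V = (\<lambda>i. \<Sum>l<N. y l * q l i)"
  assume "\<not> L2_set z {..<N} \<le> 4 * L2_set (\<lambda>l. \<Sum>j<N. R l j * z j) {..<N}"
  then have YZ: "4 * Y < Z"
    by (simp add: Y_def Z_def y_def)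
  have Y0: "0 \<le> Y" and Z0: "0 < Z"
    using YZ by (auto simp: Y_def) (use L2_set_nonneg[of y "{..<N}"] Y_def in linarith)
  have N: "1 \<le> N"
  proof (rule ccontr)
    assume "\<not> 1 \<le> N"
    then have "N = 0" by simp
    then show False
      using Z0 by (simp add: Z_def)
  qed
  have N2: "real N \<le> (real N)\<^sup>2" "1 \<le> (real N)\<^sup>2"
    using N mult_left_mono[of 1 "real N" "real N"] by (auto simp: power2_eq_square intro: order_trans[of _ "real N"])
  have \<epsilon>1: "real N * \<epsilon> \<le> 1/20" "\<epsilon> \<le> 1/20" "(real N)\<^sup>2 * \<epsilon> \<le> 1/20"
    using small mult_right_mono[OF N2(1) \<epsilon>] mult_right_mono[OF N2(2) \<epsilon>] by auto
  have V: "V i = (\<Sum>j<N. z j * x j i) + (\<Sum>j<N. z j * e j i)" if "i < n" for i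
  proof -
    have "V i = (\<Sum>l<N. \<Sum>j<N. z j * (R l j * q l i))"
      by (simp add: V_def y_def sum_distrib_left sum_distrib_right mult_ac)
    also have "\<dots> = (\<Sum>j<N. \<Sum>l<N. z j * (R l j * q l i))"
      by (rule sum.swap)
    also have "\<dots> = (\<Sum>j<N. z j * (x j i + e j i))"
      using QR[OF that] by (simp add: sum_distrib_left)
    finally show ?thesis
      by (simp add: distrib_left sum.distrib)
  qed
  have "nrm n (\<lambda>i. \<Sum>j<N. z j * e j i) \<le> (\<Sum>j<N. nrm n (\<lambda>i. z j * e j i))"
    by (rule L2_set_sum_le) simp
  also have "\<dots> \<le> (\<Sum>j<N. \<bar>z j\<bar> * \<epsilon>)"
    using e by (intro sum_mono) (auto simp: L2_set_scale intro!: mult_left_mono)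
  also have "\<dots> \<le> real N * Z * \<epsilon>"
    unfolding sum_distrib_right[symmetric] Z_def
    by (intro mult_right_mono sum_abs_le_L2_set \<epsilon>)
  also have "\<dots> = (real N * \<epsilon>) * Z"
    by simp
  also have "\<dots> \<le> 1/20 * Z"
    using \<epsilon>1 Z0 by (intro mult_right_mono) auto
  finally have eZ: "nrm n (\<lambda>i. \<Sum>j<N. z j * e j i) \<le> Z / 20" by simp
  have "nrm n (\<lambda>i. \<Sum>j<N. z j * x j i) = nrm n (\<lambda>i. V i + (- (\<Sum>j<N. z j * e j i)))"
    using V by (intro L2_set_cong) auto
  also have "\<dots> \<le> nrm n V + nrm n (\<lambda>i. - (\<Sum>j<N. z j * e j i))"
    by (rule L2_set_triangle_ineq)
  also have "nrm n (\<lambda>i. - (\<Sum>j<N. z j * e j i)) = nrm n (\<lambda>i. \<Sum>j<N. z j * e j i)"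
    by (simp add: L2_set_def)
  finally have "9/20 * Z \<le> nrm n V"
    using X[of z] eZ by (simp add: Z_def)
  then have lower: "(9/20 * Z)\<^sup>2 \<le> (nrm n V)\<^sup>2"
    using Z0 by (intro power_mono) auto
  have 1: "(\<Sum>l<N. (y l)\<^sup>2 * ip n (q l) (q l)) \<le> 21/20 * Y\<^sup>2"
  proof -
    have "(\<Sum>l<N. (y l)\<^sup>2 * ip n (q l) (q l)) \<le> (\<Sum>l<N. (y l)\<^sup>2 * (21/20))"
    proof (intro sum_mono mult_left_mono)
      fix l assume "l \<in> {..<N}"
      then show "ip n (q l) (q l) \<le> 21/20"
        using d[of l] \<epsilon>1(2) by auto
    qed auto
    also have "\<dots> = 21/20 * Y\<^sup>2"
      by (simp only: sum_distrib_right[symmetric] Y_def L2_set_square mult.commute)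
    finally show ?thesis .
  qed
  have 2: "\<bar>\<Sum>l\<in>{i<..<N}. y l * ip n (q i) (q l)\<bar> \<le> \<epsilon> * (real N * Z)" if "i < N" for i
  proof -
    have "(\<Sum>l\<in>{i<..<N}. y l * ip n (q i) (q l)) = (\<Sum>l\<in>{i<..<N}. \<Sum>j<N. z j * (R l j * ip n (q i) (q l)))"
      by (simp add: y_def sum_distrib_right mult_ac)
    also have "\<dots> = (\<Sum>j<N. \<Sum>l\<in>{i<..<N}. z j * (R l j * ip n (q i) (q l)))"
      by (rule sum.swap)
    also have "\<dots> = (\<Sum>j<N. z j * (\<Sum>l\<in>{i<..<N}. R l j * ip n (q i) (q l)))"
      by (simp add: sum_distrib_left)
    also have "\<bar>\<dots>\<bar> \<le> (\<Sum>j<N. \<bar>z j * (\<Sum>l\<in>{i<..<N}. R l j * ip n (q i) (q l))\<bar>)"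
      by (rule sum_abs)
    also have "\<dots> \<le> (\<Sum>j<N. \<bar>z j\<bar> * \<epsilon>)"
      unfolding abs_mult using U[OF that] by (intro sum_mono mult_left_mono) auto
    also have "\<dots> \<le> (real N * Z) * \<epsilon>"
      unfolding sum_distrib_right[symmetric] Z_def
      by (intro mult_right_mono sum_abs_le_L2_set \<epsilon>)
    finally show ?thesis by (simp add: mult_ac)
  qed
  have "(\<Sum>i<N. y i * (\<Sum>l\<in>{i<..<N}. y l * ip n (q i) (q l))) \<le> (\<Sum>i<N. \<bar>y i\<bar> * (\<epsilon> * (real N * Z)))"
  proof (rule sum_mono)
    fix i assume "i \<in> {..<N}"
    then have "\<bar>y i * (\<Sum>l\<in>{i<..<N}. y l * ip n (q i) (q l))\<bar> \<le> \<bar>y i\<bar> * (\<epsilon> * (real N * Z))"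
      unfolding abs_mult using 2 by (intro mult_left_mono) auto
    then show "y i * (\<Sum>l\<in>{i<..<N}. y l * ip n (q i) (q l)) \<le> \<bar>y i\<bar> * (\<epsilon> * (real N * Z))"
      by linarith
  qed
  also have "\<dots> \<le> (real N * Y) * (\<epsilon> * (real N * Z))"
    unfolding sum_distrib_right[symmetric] Y_def using \<epsilon> Z0
    by (intro mult_right_mono sum_abs_le_L2_set) auto
  also have "\<dots> = ((real N)\<^sup>2 * \<epsilon>) * (Y * Z)"
    by (simp add: power2_eq_square)
  also have "\<dots> \<le> 1/20 * (Y * Z)"
    using \<epsilon>1(3) Y0 Z0 by (intro mult_right_mono) auto
  finally have "(nrm n V)\<^sup>2 \<le> 21/20 * Y\<^sup>2 + 1/10 * (Y * Z)"
    using 1 unfolding V_def nrm_lincomb_square by simp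
  also have "\<dots> \<le> 21/20 * (Z/4)\<^sup>2 + 1/10 * (Z/4 * Z)"
    using YZ Y0 Z0 by (intro add_mono mult_left_mono mult_right_mono power_mono) auto
  \<comment> \<open>21/320 + 1/40 is about 0.091, whereas (9/20)^2 = 0.2025. The 9/20 is the lower
    bound 1/2 of \<open>x\<close> less the backward error 1/20.\<close>
  also have "\<dots> < (9/20 * Z)\<^sup>2"
    using Z0 by (simp add: power2_eq_square)
  finally show False
    using lower by simp
qed

text \<open>The lower bound excludes a kernel, so the determinant is nonzero and the inverse matrix
  supplies a preimage of every \<open>y\<close>.\<close>

lemma linear_system_solvable:
  fixes R :: "nat \<Rightarrow> nat \<Rightarrow> real"
  assumes inj: "\<And>z. L2_set z {..<n} \<le> c * L2_set (\<lambda>l. \<Sum>j<n. R l j * z j) {..<n}"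
  obtains z where "\<And>l. l < n \<Longrightarrow> (\<Sum>j<n. R l j * z j) = y l"
proof -
  define A where "A = mat n n (\<lambda>(l,j). R l j)"
  have A: "A \<in> carrier_mat n n"
    by (simp add: A_def)
  have Av: "(A *\<^sub>v v) $ l = (\<Sum>j<n. R l j * v $ j)" if "v \<in> carrier_vec n" "l < n" for v l
    using that by (simp add: A_def scalar_prod_def atLeast0LessThan)
  have "det A \<noteq> 0"
  proof
    assume "det A = 0"
    then obtain v where v: "v \<in> carrier_vec n" "v \<noteq> 0\<^sub>v n" "A *\<^sub>v v = 0\<^sub>v n"
      using det_0_iff_vec_prod_zero[OF A] by auto
    have "L2_set (\<lambda>l. \<Sum>j<n. R l j * v $ j) {..<n} = 0"
      using Av[OF v(1)] v(3) by (simp add: L2_set_eq_0_iff)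
    then have "L2_set (\<lambda>j. v $ j) {..<n} \<le> 0"
      using inj[of "\<lambda>j. v $ j"] by simp
    then have "L2_set (\<lambda>j. v $ j) {..<n} = 0"
      using L2_set_nonneg[of "\<lambda>j. v $ j" "{..<n}"] by linarith
    then have "v = 0\<^sub>v n"
      using v(1) by (auto simp: L2_set_eq_0_iff)
    with v show False by simp
  qed
  then obtain B where B: "B \<in> carrier_mat n n" "A * B = 1\<^sub>m n"
    using det_non_zero_imp_unit[OF A, where b = "()"] unfolding Units_def ring_mat_def by auto
  define z where "z = B *\<^sub>v vec n y"
  have z: "z \<in> carrier_vec n"
    using B by (simp add: z_def)
  have "A *\<^sub>v z = (A * B) *\<^sub>v vec n y"
    unfolding z_def by (rule assoc_mult_mat_vec[OF A B(1) vec_carrier, symmetric])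
  also have "\<dots> = vec n y"
    unfolding B(2) by (rule one_mult_mat_vec[OF vec_carrier])
  finally have "A *\<^sub>v z = vec n y" .
  then have "(\<Sum>j<n. R l j * z $ j) = y l" if "l < n" for l
    using Av[OF z that] that by simp
  then show ?thesis
    using that[of "\<lambda>j. z $ j"] by blast
qed

text \<open>Let y be row \<open>i\<close> of \<open>U\<close> and solve R z = y. Then |y|^2 = y^T R
  z is row \<open>i\<close> of U R applied to \<open>z\<close>, hence at most n \<epsilon> |z|, and
  the lower bound on \<open>R\<close> gives |z| at most 4 |y|. Dividing by |y| removes
  \<open>R\<close> from the smallness of U R.\<close>

lemma gram_schmidt_orthogonality:
  fixes q :: "nat \<Rightarrow> nat \<Rightarrow> real" and R :: "nat \<Rightarrow> nat \<Rightarrow> real"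
  assumes lower: "\<And>z. L2_set z {..<n} \<le> 4 * L2_set (\<lambda>l. \<Sum>j<n. R l j * z j) {..<n}"
    and U: "\<And>i j. i < n \<Longrightarrow> j < n \<Longrightarrow> \<bar>\<Sum>l\<in>{i<..<n}. R l j * ip n (q i) (q l)\<bar> \<le> \<epsilon>"
    and i: "i < n" and l: "i < l" "l < n" and \<epsilon>: "0 \<le> \<epsilon>"
  shows "\<bar>ip n (q i) (q l)\<bar> \<le> 4 * real n * \<epsilon>"
proof -
  define y where "y = (\<lambda>l. if i < l then ip n (q i) (q l) else 0)"
  define Y where "Y = L2_set y {..<n}"
  obtain z where z: "\<And>l. l < n \<Longrightarrow> (\<Sum>j<n. R l j * z j) = y l"
    using linear_system_solvable[OF lower] by blast
  have Z: "L2_set z {..<n} \<le> 4 * Y"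
  proof -
    have "L2_set (\<lambda>l. \<Sum>j<n. R l j * z j) {..<n} = Y"
      unfolding Y_def using z by (intro L2_set_cong) auto
    then show ?thesis
      using lower[of z] by simp
  qed
  have "Y\<^sup>2 = (\<Sum>l<n. \<Sum>j<n. z j * (R l j * y l))"
  proof -
    have "(y l)\<^sup>2 = (\<Sum>j<n. z j * (R l j * y l))" if "l < n" for l
    proof -
      have "(y l)\<^sup>2 = (\<Sum>j<n. R l j * z j) * y l"
        using z[OF that] by (simp add: power2_eq_square)
      then show ?thesis
        by (simp add: sum_distrib_left mult_ac)
    qed
    then show ?thesis
      unfolding Y_def by (subst L2_set_square) simp
  qed
  also have "\<dots> = (\<Sum>j<n. \<Sum>l<n. z j * (R l j * y l))"
    by (rule sum.swap)
  also have "\<dots> = (\<Sum>j<n. z j * (\<Sum>l\<in>{i<..<n}. R l j * ip n (q i) (q l)))"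
  proof (rule sum.cong[OF refl])
    fix j
    have "(\<Sum>l<n. R l j * y l) = (\<Sum>l\<in>{i<..<n}. R l j * ip n (q i) (q l))"
      by (rule sum.mono_neutral_cong_right) (auto simp: y_def)
    then show "(\<Sum>l<n. z j * (R l j * y l)) = z j * (\<Sum>l\<in>{i<..<n}. R l j * ip n (q i) (q l))"
      by (simp add: sum_distrib_left[symmetric])
  qed
  also have "\<dots> \<le> (\<Sum>j<n. \<bar>z j\<bar> * \<epsilon>)"
  proof (rule sum_mono)
    fix j assume "j \<in> {..<n}"
    then have "\<bar>z j * (\<Sum>l\<in>{i<..<n}. R l j * ip n (q i) (q l))\<bar> \<le> \<bar>z j\<bar> * \<epsilon>"
      unfolding abs_mult using U[OF i] by (intro mult_left_mono) auto
    then show "z j * (\<Sum>l\<in>{i<..<n}. R l j * ip n (q i) (q l)) \<le> \<bar>z j\<bar> * \<epsilon>"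
      by linarith
  qed
  also have "\<dots> \<le> (real n * L2_set z {..<n}) * \<epsilon>"
    unfolding sum_distrib_right[symmetric] by (intro mult_right_mono sum_abs_le_L2_set \<epsilon>)
  also have "\<dots> \<le> (real n * (4 * Y)) * \<epsilon>"
    using Z \<epsilon> by (intro mult_right_mono mult_left_mono) auto
  finally have "Y * Y \<le> (4 * real n * \<epsilon>) * Y"
    by (simp add: power2_eq_square mult_ac)
  moreover have "0 \<le> Y" "0 \<le> 4 * real n * \<epsilon>"
    using \<epsilon> by (auto simp: Y_def)
  ultimately have "Y \<le> 4 * real n * \<epsilon>"
    by (cases "Y = 0") (auto simp: mult_le_cancel_right)
  moreover have "\<bar>y l\<bar> \<le> Y"
    using member_le_L2_set[of "{..<n}" l "\<lambda>i. \<bar>y i\<bar>"] L2_set_abs[of y "{..<n}"] l by (simp add: Y_def)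
  ultimately show ?thesis
    using l by (simp add: y_def)
qed


section \<open>Rounding errors of normalisation and of one orthogonalization\<close>

context fl_model begin

lemma fl_dot_nrm_error: "\<bar>fl_dot F x y [0..<n] - ip n x y\<bar> \<le> \<gamma> * (nrm n x * nrm n y)"
  using fl_dot_error[of x y 0] by (simp add: atLeast0LessThan)

text \<open>Division is by the computed norm \<open>r\<close>, which is within 2 \<gamma> |a| of
  |a|, so it vanishes only together with \<open>a\<close>. The division adds another \<gamma> |a|;
  hence |q| is within 4 \<gamma> of 1, and passing to the square costs the factor |q| + 1, at most
  3.\<close>

lemma mgs_normalize:
  fixes a :: "nat \<Rightarrow> real"
  defines "r \<equiv> fsqrt F (fl_dot F a a [0..<n])"
  defines "q \<equiv> \<lambda>i. fdiv F (a i) r"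
  shows "r = 0 \<Longrightarrow> nrm n a = 0"
    and "r \<noteq> 0 \<Longrightarrow> \<bar>ip n q q - 1\<bar> \<le> 12 * \<gamma>"
    and "r \<noteq> 0 \<Longrightarrow> nrm n (\<lambda>i. r * q i - a i) \<le> \<gamma> * nrm n a"
proof -
  define \<alpha> where "\<alpha> = nrm n a"
  have \<alpha>: "0 \<le> \<alpha>"
    by (simp add: \<alpha>_def)
  have r: "\<bar>r - \<alpha>\<bar> \<le> 2 * (\<gamma> * \<alpha>)"
    using fl_norm_error[of a 0] by (simp add: r_def \<alpha>_def atLeast0LessThan)
  have small: "\<gamma> * \<alpha> \<le> \<alpha> / 100" and nn: "0 \<le> \<gamma> * \<alpha>"
    using mult_right_mono[OF \<gamma>_small \<alpha>] \<gamma>_nonneg \<alpha> by auto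
  show "nrm n a = 0" if "r = 0"
  proof -
    have "\<alpha> \<le> 2 * (\<gamma> * \<alpha>)"
      using r that by linarith
    then show ?thesis
      using small \<alpha> unfolding \<alpha>_def[symmetric] by linarith
  qed
  assume r0: "r \<noteq> 0"
  have qa: "\<bar>r * q i - a i\<bar> \<le> \<gamma> * \<bar>a i\<bar>" for i
  proof -
    have "\<bar>r * q i - a i\<bar> = \<bar>q i - a i / r\<bar> * \<bar>r\<bar>"
      using r0 by (simp add: abs_mult[symmetric] algebra_simps)
    also have "\<dots> \<le> w * \<bar>a i / r\<bar> * \<bar>r\<bar>"
      unfolding q_def by (intro mult_right_mono fdiv_error r0) auto
    also have "\<dots> = w * \<bar>a i\<bar>"
      using r0 by (simp add: abs_divide)
    also have "\<dots> \<le> \<gamma> * \<bar>a i\<bar>"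
      using w_le \<gamma>_nonneg by (intro mult_right_mono) auto
    finally show ?thesis .
  qed
  show 1: "nrm n (\<lambda>i. r * q i - a i) \<le> \<gamma> * nrm n a"
  proof -
    have "nrm n (\<lambda>i. r * q i - a i) \<le> nrm n (\<lambda>i. \<gamma> * \<bar>a i\<bar>)"
      using qa by (intro L2_set_mono_abs)
    then show ?thesis
      using \<gamma>_nonneg by (simp add: L2_set_scale L2_set_abs)
  qed
  define b where "b = nrm n q"
  have b0: "0 \<le> b" by (simp add: b_def)
  have "\<bar>r\<bar> * b = nrm n (\<lambda>i. a i + (r * q i - a i))"
    by (simp add: b_def L2_set_scale)
  then have up: "\<bar>r\<bar> * b \<le> \<alpha> + \<gamma> * \<alpha>"
    using L2_set_triangle_ineq[of a "\<lambda>i. r * q i - a i" "{..<n}"] 1 by (simp add: \<alpha>_def)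
  have "\<alpha> = nrm n (\<lambda>i. r * q i + - (r * q i - a i))"
    by (simp add: \<alpha>_def)
  also have "\<dots> \<le> nrm n (\<lambda>i. r * q i) + nrm n (\<lambda>i. - (r * q i - a i))"
    by (rule L2_set_triangle_ineq)
  also have "\<dots> \<le> \<bar>r\<bar> * b + \<gamma> * \<alpha>"
    using 1 L2_set_scale[of r q "{..<n}"] L2_set_scale[of "-1" "\<lambda>i. r * q i - a i" "{..<n}"]
    by (simp add: b_def \<alpha>_def)
  finally have lo: "\<alpha> \<le> \<bar>r\<bar> * b + \<gamma> * \<alpha>" .
  have \<alpha>0: "0 < \<alpha>"
  proof (rule ccontr)
    assume "\<not> 0 < \<alpha>"
    then have "\<alpha> = 0" using \<alpha> by simp
    then show False using r r0 by simp
  qed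
  have rpos: "0 < r"
    using r small \<alpha>0 by linarith
  have b: "\<bar>b - 1\<bar> \<le> 4 * \<gamma>"
  proof -
    have "\<bar>r * b - r\<bar> \<le> 3 * (\<gamma> * \<alpha>)"
      using up lo r rpos by (simp add: abs_le_iff)
    moreover have "\<alpha> \<le> 100/98 * r"
      using r small by linarith
    then have "\<gamma> * \<alpha> \<le> \<gamma> * (100/98 * r)"
      using \<gamma>_nonneg by (rule mult_left_mono)
    ultimately have "\<bar>b - 1\<bar> * r \<le> (300/98 * \<gamma>) * r"
    proof -
      assume *: "\<bar>r * b - r\<bar> \<le> 3 * (\<gamma> * \<alpha>)" "\<gamma> * \<alpha> \<le> \<gamma> * (100/98 * r)"
      have "(b - 1) * r = r * b - r"
        by (simp add: algebra_simps)
      then have "\<bar>b - 1\<bar> * r = \<bar>r * b - r\<bar>"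
        using rpos by (metis abs_mult abs_of_pos)
      then show ?thesis
        using * by linarith
    qed
    then have "\<bar>b - 1\<bar> \<le> 300/98 * \<gamma>"
      using rpos by (simp only: mult_le_cancel_right_pos)
    then show ?thesis
      using \<gamma>_nonneg by linarith
  qed
  have "ip n q q - 1 = (b - 1) * (b + 1)"
    using L2_set_square[of q "{..<n}"] by (simp add: b_def power2_eq_square algebra_simps)
  also have "\<bar>\<dots>\<bar> \<le> (4 * \<gamma>) * 3"
    unfolding abs_mult using b b0 \<gamma>_small by (intro mult_mono) auto
  finally show "\<bar>ip n q q - 1\<bar> \<le> 12 * \<gamma>" by simp
qed

text \<open>Orthogonality of the new column is measured against the norm of the old one. If most of
  the column cancels, the remainder may have a large component along \<open>q\<close> relative to
  its own size; the absolute bound is what survives and what the estimate of U R needs.\<close>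

lemma mgs_orthogonalize:
  fixes a q :: "nat \<Rightarrow> real"
  defines "s \<equiv> fl_dot F q a [0..<n]"
  defines "a' \<equiv> \<lambda>i. fsub F (a i) (fmul F s (q i))"
  assumes q: "\<bar>ip n q q - 1\<bar> \<le> 12 * \<gamma>"
  shows "nrm n (\<lambda>i. a' i - (a i - s * q i)) \<le> 4 * \<gamma> * nrm n a"
    and "nrm n a' \<le> (1 + 10 * \<gamma>) * nrm n a"
    and "\<bar>ip n q a'\<bar> \<le> 30 * \<gamma> * nrm n a"
    and "nrm n q \<le> 11/10"
proof -
  define \<alpha> where "\<alpha> = nrm n a"
  define b where "b = nrm n q"
  have \<alpha>: "0 \<le> \<alpha>" and b0: "0 \<le> b"
    by (auto simp: \<alpha>_def b_def)
  have g: "0 \<le> \<gamma> * \<alpha>" "\<gamma> * \<alpha> \<le> \<alpha> / 100"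
    using mult_right_mono[OF \<gamma>_small \<alpha>] \<gamma>_nonneg \<alpha> by auto
  have bb: "b\<^sup>2 = ip n q q"
    unfolding b_def L2_set_square by (simp add: power2_eq_square)
  have "b\<^sup>2 \<le> (11/10)\<^sup>2"
    using q \<gamma>_small unfolding bb by (simp add: power2_eq_square abs_le_iff)
  then have b: "b \<le> 11/10"
    using power2_le_imp_le by fastforce
  then show "nrm n q \<le> 11/10"
    by (simp add: b_def)
  define t where "t = ip n q a"
  have t: "\<bar>t\<bar> \<le> b * \<alpha>"
    unfolding t_def b_def \<alpha>_def by (rule L2_set_Cauchy_Schwarz)
  have ba: "b * \<alpha> \<le> 11/10 * \<alpha>"
    using b \<alpha> by (rule mult_right_mono)
  have st: "\<bar>s - t\<bar> \<le> 11/10 * (\<gamma> * \<alpha>)"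
    using fl_dot_nrm_error[of q a] mult_left_mono[OF ba \<gamma>_nonneg] by (simp add: s_def t_def b_def \<alpha>_def)
  have s: "\<bar>s\<bar> \<le> 12/10 * \<alpha>"
    using t ba st g by linarith
  show 1: "nrm n (\<lambda>i. a' i - (a i - s * q i)) \<le> 4 * \<gamma> * nrm n a"
  proof -
    have "nrm n (\<lambda>i. a' i - (a i - s * q i)) \<le> nrm n (\<lambda>i. \<gamma> * \<bar>a i\<bar> + 2 * \<gamma> * \<bar>s\<bar> * \<bar>q i\<bar>)"
    proof (rule L2_set_mono_abs)
      fix i
      show "\<bar>a' i - (a i - s * q i)\<bar> \<le> \<gamma> * \<bar>a i\<bar> + 2 * \<gamma> * \<bar>s\<bar> * \<bar>q i\<bar>"
        unfolding a'_def using fl_axpy_error[of "q i" "q i" 0 "a i" s] by (simp add: mult_ac)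
    qed
    also have "\<dots> \<le> nrm n (\<lambda>i. \<gamma> * \<bar>a i\<bar>) + nrm n (\<lambda>i. 2 * \<gamma> * \<bar>s\<bar> * \<bar>q i\<bar>)"
      by (rule L2_set_triangle_ineq)
    also have "\<dots> = \<gamma> * \<alpha> + 2 * \<gamma> * (\<bar>s\<bar> * b)"
      using \<gamma>_nonneg by (simp only: L2_set_scale L2_set_abs \<alpha>_def b_def) (simp add: abs_mult)
    also have "\<dots> \<le> \<gamma> * \<alpha> + 2 * \<gamma> * (12/10 * \<alpha> * (11/10))"
      using s b b0 \<alpha> \<gamma>_nonneg by (intro add_left_mono mult_left_mono mult_mono) auto
    also have "\<dots> \<le> 4 * \<gamma> * \<alpha>"
      using g by (simp add: mult_ac)
    finally show ?thesis
      by (simp add: \<alpha>_def)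
  qed
  \<comment> \<open>Expansion gives |a|^2 - 2 t^2 + t^2 |q|^2, so subtracting the exact multiple
    does not increase the norm even for a non-unit \<open>q\<close> with |q|^2 at most 2.\<close>
  have 2: "(nrm n (\<lambda>i. a i - t * q i))\<^sup>2 \<le> \<alpha>\<^sup>2"
  proof -
    have "(nrm n (\<lambda>i. a i - t * q i))\<^sup>2 = (\<Sum>i<n. (a i)\<^sup>2 - 2 * t * (q i * a i) + t\<^sup>2 * (q i * q i))"
      unfolding L2_set_square by (intro sum.cong) (auto simp: power2_eq_square algebra_simps)
    also have "\<dots> = \<alpha>\<^sup>2 - 2 * t * t + t\<^sup>2 * ip n q q"
      unfolding \<alpha>_def L2_set_square t_def by (simp add: sum.distrib sum_subtractf sum_distrib_left)
    also have "\<dots> \<le> \<alpha>\<^sup>2 - 2 * t * t + t\<^sup>2 * 2"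
      using q \<gamma>_small by (intro add_left_mono mult_left_mono) (auto simp: abs_le_iff)
    finally show ?thesis
      by (simp add: power2_eq_square)
  qed
  then have 2: "nrm n (\<lambda>i. a i - t * q i) \<le> \<alpha>"
    using \<alpha> power2_le_imp_le by blast
  have "nrm n a' = nrm n (\<lambda>i. (a' i - (a i - s * q i)) + ((a i - t * q i) + (t - s) * q i))"
    by (intro L2_set_cong) (auto simp: algebra_simps)
  also have "\<dots> \<le> nrm n (\<lambda>i. a' i - (a i - s * q i)) + (nrm n (\<lambda>i. a i - t * q i) + nrm n (\<lambda>i. (t - s) * q i))"
    by (intro order_trans[OF L2_set_triangle_ineq] add_left_mono L2_set_triangle_ineq)
  also have "\<dots> \<le> 4 * (\<gamma> * \<alpha>) + (\<alpha> + 2 * (\<gamma> * \<alpha>))"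
  proof (intro add_mono 2)
    show "nrm n (\<lambda>i. a' i - (a i - s * q i)) \<le> 4 * (\<gamma> * \<alpha>)"
      using 1 by (simp add: \<alpha>_def)
    have "nrm n (\<lambda>i. (t - s) * q i) = \<bar>s - t\<bar> * b"
      by (simp add: L2_set_scale b_def abs_minus_commute)
    also have "\<dots> \<le> (11/10 * (\<gamma> * \<alpha>)) * (11/10)"
      using st b b0 g by (intro mult_mono) auto
    finally show "nrm n (\<lambda>i. (t - s) * q i) \<le> 2 * (\<gamma> * \<alpha>)"
      using g by simp
  qed
  finally show "nrm n a' \<le> (1 + 10 * \<gamma>) * nrm n a"
    using g by (simp add: \<alpha>_def algebra_simps)
  have "ip n q a' = ip n q (\<lambda>i. a' i - (a i - s * q i)) + (t - s * ip n q q)"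
    unfolding t_def sum_distrib_left sum_subtractf[symmetric] sum.distrib[symmetric]
    by (intro sum.cong) (auto simp: algebra_simps)
  moreover have "\<bar>ip n q (\<lambda>i. a' i - (a i - s * q i))\<bar> \<le> 11/10 * (4 * (\<gamma> * \<alpha>))"
    using order_trans[OF L2_set_Cauchy_Schwarz mult_mono[OF b[unfolded b_def] 1]] by (simp add: \<alpha>_def)
  moreover have "\<bar>t - s * ip n q q\<bar> \<le> 11/10 * (\<gamma> * \<alpha>) + 15 * (\<gamma> * \<alpha>)"
  proof -
    have "\<bar>s * (ip n q q - 1)\<bar> \<le> (12/10 * \<alpha>) * (12 * \<gamma>)"
      unfolding abs_mult using s q \<alpha> by (intro mult_mono) auto
    also have "\<dots> \<le> 15 * (\<gamma> * \<alpha>)"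
      using g by (simp add: mult_ac)
    finally have "\<bar>s * (ip n q q - 1)\<bar> \<le> 15 * (\<gamma> * \<alpha>)" .
    moreover have "t - s * ip n q q = - (s - t) - s * (ip n q q - 1)"
      by (simp add: algebra_simps)
    ultimately show ?thesis
      using st by linarith
  qed
  ultimately have "\<bar>ip n q a'\<bar> \<le> 30 * (\<gamma> * \<alpha>)"
    using g by linarith
  then show "\<bar>ip n q a'\<bar> \<le> 30 * \<gamma> * nrm n a"
    by (simp add: \<alpha>_def)
qed

end

text \<open>\<open>X_lower\<close> and \<open>X_cols\<close> express that the singular values of
  \<open>X\<close> are at least 1/2 and its columns of bounded norm. The 3000 arises as 20 N^2 times
  150 n \<gamma> in \<open>factor_lower\<close>.\<close>

locale mgs_run = fl_model +
  fixes X :: "real mat"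
  assumes X: "X \<in> carrier_mat n n"
    and X_lower: "\<And>z. z \<in> carrier_vec n \<Longrightarrow> vec_norm2 z / 2 \<le> vec_norm2 (X *\<^sub>v z)"
    and X_cols: "\<And>j. j < n \<Longrightarrow> vec_norm2 (col X j) \<le> 2"
    and gamma_n3: "3000 * real n ^ 3 * \<gamma> \<le> 1"
begin

text \<open>\<open>c k j\<close> is column \<open>j\<close> on entry to step \<open>k\<close>: still
  being reduced while k is at most j, and equal to the finished \<open>q j\<close>
  afterwards.\<close>

definition c :: "nat \<Rightarrow> nat \<Rightarrow> nat \<Rightarrow> real" where "c k j = (\<lambda>i. mgs_iter F n X k $$ (i,j))"
definition r :: "nat \<Rightarrow> real" where "r k = fsqrt F (fl_dot F (c k k) (c k k) [0..<n])"
definition q :: "nat \<Rightarrow> nat \<Rightarrow> real" where "q k = (\<lambda>i. fdiv F (c k k i) (r k))"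
definition s :: "nat \<Rightarrow> nat \<Rightarrow> real" where "s k j = fl_dot F (q k) (c k j) [0..<n]"

lemma c_Suc:
  "i < n \<Longrightarrow> j < n \<Longrightarrow> c (Suc k) j i = (if j < k then c k j i else if j = k then q k i
     else fsub F (c k j i) (fmul F (s k j) (q k i)))"
  by (simp add: c_def q_def r_def s_def mgs_step_def Let_def)

lemma n_gamma: "real n * \<gamma> \<le> 1/3000" "(real n)\<^sup>2 * \<gamma> \<le> 1/3000" "real n ^ 3 * \<gamma> \<le> 1/3000"
proof -
  have "real n ^ 1 \<le> real n ^ 3" "real n ^ 2 \<le> real n ^ 3"
    using n_pos by (intro power_increasing; simp)+
  then have "real n * \<gamma> \<le> real n ^ 3 * \<gamma>" "(real n)\<^sup>2 * \<gamma> \<le> real n ^ 3 * \<gamma>"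
    using \<gamma>_nonneg by (auto intro: mult_right_mono)
  then show "real n * \<gamma> \<le> 1/3000" "(real n)\<^sup>2 * \<gamma> \<le> 1/3000" "real n ^ 3 * \<gamma> \<le> 1/3000"
    using gamma_n3 by auto
qed

lemma q_near_unit: "r k \<noteq> 0 \<Longrightarrow> \<bar>ip n (q k) (q k) - 1\<bar> \<le> 12 * \<gamma>"
  unfolding r_def q_def by (rule mgs_normalize(2))

lemma q_scaled: "r k \<noteq> 0 \<Longrightarrow> nrm n (\<lambda>i. r k * q k i - c k k i) \<le> \<gamma> * nrm n (c k k)"
  unfolding r_def q_def by (rule mgs_normalize(3))

lemma c_zero_if: "r k = 0 \<Longrightarrow> nrm n (c k k) = 0"
  unfolding r_def by (rule mgs_normalize(1))

lemma c_step:
  assumes "r k \<noteq> 0" "k < j" "j < n"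
  shows "nrm n (\<lambda>i. c (Suc k) j i - (c k j i - s k j * q k i)) \<le> 4 * \<gamma> * nrm n (c k j)"
    and "nrm n (c (Suc k) j) \<le> (1 + 10 * \<gamma>) * nrm n (c k j)"
    and "\<bar>ip n (q k) (c (Suc k) j)\<bar> \<le> 30 * \<gamma> * nrm n (c k j)"
    and "nrm n (q k) \<le> 11/10"
proof -
  note M = mgs_orthogonalize(1-3)[OF q_near_unit[OF assms(1)], of "c k j", folded s_def]
  have eq: "c (Suc k) j i = fsub F (c k j i) (fmul F (s k j) (q k i))" if "i < n" for i
    using c_Suc[OF that assms(3), of k] assms by simp
  have "nrm n (\<lambda>i. c (Suc k) j i - (c k j i - s k j * q k i))
    = nrm n (\<lambda>i. fsub F (c k j i) (fmul F (s k j) (q k i)) - (c k j i - s k j * q k i))"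
    using eq by (intro L2_set_cong) auto
  then show "nrm n (\<lambda>i. c (Suc k) j i - (c k j i - s k j * q k i)) \<le> 4 * \<gamma> * nrm n (c k j)"
    using M(1) by simp
  have "nrm n (c (Suc k) j) = nrm n (\<lambda>i. fsub F (c k j i) (fmul F (s k j) (q k i)))"
    using eq by (intro L2_set_cong) auto
  then show "nrm n (c (Suc k) j) \<le> (1 + 10 * \<gamma>) * nrm n (c k j)"
    using M(2) by simp
  have "ip n (q k) (c (Suc k) j) = ip n (q k) (\<lambda>i. fsub F (c k j i) (fmul F (s k j) (q k i)))"
    using eq by (intro sum.cong) auto
  then show "\<bar>ip n (q k) (c (Suc k) j)\<bar> \<le> 30 * \<gamma> * nrm n (c k j)"
    using M(3) by simp
  show "nrm n (q k) \<le> 11/10"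
    by (rule mgs_orthogonalize(4)[OF q_near_unit[OF assms(1)]])
qed

text \<open>Initial columns have norm at most 2, and the growth factors 1 + 10 \<gamma> compound to
  at most another 2.\<close>

lemma c_bound:
  assumes good: "\<And>l. l < k \<Longrightarrow> r l \<noteq> 0" and "k \<le> j" "j < n"
  shows "nrm n (c k j) \<le> 4"
proof -
  have "nrm n (c k j) \<le> (1 + 10 * \<gamma>) ^ k * nrm n (c 0 j)"
    using good \<open>k \<le> j\<close>
  proof (induction k)
    case (Suc k)
    have "nrm n (c (Suc k) j) \<le> (1 + 10 * \<gamma>) * nrm n (c k j)"
      using Suc.prems assms(3) by (intro c_step) auto
    also have "\<dots> \<le> (1 + 10 * \<gamma>) * ((1 + 10 * \<gamma>) ^ k * nrm n (c 0 j))"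
      using Suc \<gamma>_nonneg by (intro mult_left_mono) auto
    finally show ?case by (simp add: mult.assoc)
  qed simp
  also have "\<dots> \<le> 2 * 2"
  proof (rule mult_mono)
    have "real k * \<gamma> \<le> real n * \<gamma>"
      using assms \<gamma>_nonneg by (intro mult_right_mono) auto
    then have "2 * real k * (10 * \<gamma>) \<le> 1"
      using n_gamma by simp
    then show "(1 + 10 * \<gamma>) ^ k \<le> 2"
      using one_plus_power_le[of "10 * \<gamma>" k] \<gamma>_nonneg by simp
    show "nrm n (c 0 j) \<le> 2"
      using X_cols[OF assms(3)] by (simp add: vec_norm2_col[OF X assms(3)] c_def)
  qed auto
  finally show ?thesis by simp
qed

text \<open>Unrolls the steps from \<open>k\<close> to \<open>m\<close>. Each contributes 4 \<gamma>
  times the column norm, which is at most 4.\<close>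

lemma c_telescope:
  assumes "\<And>l. l < m \<Longrightarrow> r l \<noteq> 0" and "k \<le> m" "m \<le> j" "j < n"
  shows "nrm n (\<lambda>i. c m j i - (c k j i - (\<Sum>l\<in>{k..<m}. s l j * q l i))) \<le> 16 * \<gamma> * real (m - k)"
  using \<open>k \<le> m\<close> assms(1,3)
proof (induction m rule: dec_induct)
  case base
  then show ?case by (simp add: L2_set_def)
next
  case (step m)
  let ?E = "\<lambda>i. c m j i - (c k j i - (\<Sum>l\<in>{k..<m}. s l j * q l i))"
  have "nrm n (\<lambda>i. c (Suc m) j i - (c k j i - (\<Sum>l\<in>{k..<Suc m}. s l j * q l i)))
     = nrm n (\<lambda>i. ?E i + (c (Suc m) j i - (c m j i - s m j * q m i)))"
    using step by (intro L2_set_cong) auto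
  also have "\<dots> \<le> nrm n ?E + nrm n (\<lambda>i. c (Suc m) j i - (c m j i - s m j * q m i))"
    by (rule L2_set_triangle_ineq)
  also have "\<dots> \<le> 16 * \<gamma> * real (m - k) + 4 * \<gamma> * 4"
  proof (rule add_mono)
    show "nrm n ?E \<le> 16 * \<gamma> * real (m - k)"
      using step by auto
    have "nrm n (\<lambda>i. c (Suc m) j i - (c m j i - s m j * q m i)) \<le> 4 * \<gamma> * nrm n (c m j)"
      using step assms(4) by (intro c_step) auto
    also have "\<dots> \<le> 4 * \<gamma> * 4"
      using step assms(4) \<gamma>_nonneg by (intro mult_left_mono c_bound) auto
    finally show "nrm n (\<lambda>i. c (Suc m) j i - (c m j i - s m j * q m i)) \<le> 4 * \<gamma> * 4" .
  qed
  also have "\<dots> = 16 * \<gamma> * real (Suc m - k)"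
    using step by (simp add: Suc_diff_le algebra_simps)
  finally show ?case .
qed

definition R :: "nat \<Rightarrow> nat \<Rightarrow> real" where
  "R l j = (if l < j then s l j else if l = j then r j else 0)"

text \<open>A vanishing pivot leaves its column of \<open>Q\<close> undefined (division by zero). Replacing that column
  by a unit vector keeps the factorization valid and leads to a contradiction with nonsingularity.\<close>

definition q' :: "nat \<Rightarrow> nat \<Rightarrow> real" where
  "q' k = (if r k = 0 then (\<lambda>i. if i = 0 then 1 else 0) else q k)"

lemma q'_near_unit: "\<bar>ip n (q' k) (q' k) - 1\<bar> \<le> 12 * \<gamma>"
proof (cases "r k = 0")
  case True
  then have "ip n (q' k) (q' k) = (\<Sum>i<n. if i = 0 then 1 else 0)"
    by (intro sum.cong) (auto simp: q'_def)
  then show ?thesis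
    using n_pos \<gamma>_nonneg by simp
qed (use q_near_unit in \<open>simp add: q'_def\<close>)

lemma q'_scaled:
  assumes "\<And>l. l < j \<Longrightarrow> r l \<noteq> 0" "j < n"
  shows "nrm n (\<lambda>i. r j * q' j i - c j j i) \<le> 4 * \<gamma>"
proof (cases "r j = 0")
  case True
  then have "nrm n (\<lambda>i. r j * q' j i - c j j i) = nrm n (c j j)"
    by (simp add: L2_set_def)
  then show ?thesis
    using c_zero_if[OF True] \<gamma>_nonneg by simp
next
  case False
  have "\<gamma> * nrm n (c j j) \<le> \<gamma> * 4"
    using assms \<gamma>_nonneg by (intro mult_left_mono c_bound) auto
  then show ?thesis
    using q_scaled[OF False] False by (simp add: q'_def)
qed

text \<open>The part of the factorization from row \<open>k\<close> on reproduces column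
  \<open>j\<close> as it stood before step \<open>k\<close>. For k = 0 this is the backward error of
  the whole factorization; for k = i + 1 it yields the rows of U R.\<close>

lemma factor_tail:
  assumes "\<And>l. l < j \<Longrightarrow> r l \<noteq> 0" "k \<le> j" "j < n"
  shows "nrm n (\<lambda>i. (\<Sum>l\<in>{k..<Suc j}. R l j * q' l i) - c k j i) \<le> 20 * real n * \<gamma>"
proof -
  let ?E = "\<lambda>i. c j j i - (c k j i - (\<Sum>l\<in>{k..<j}. s l j * q l i))"
  have "(\<Sum>l\<in>{k..<j}. R l j * q' l i) = (\<Sum>l\<in>{k..<j}. s l j * q l i)" for i
    using assms(1) by (intro sum.cong) (auto simp: R_def q'_def)
  then have "(\<Sum>l\<in>{k..<Suc j}. R l j * q' l i) = (\<Sum>l\<in>{k..<j}. s l j * q l i) + r j * q' j i" for i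
    using assms(2) by (simp add: R_def)
  then have "nrm n (\<lambda>i. (\<Sum>l\<in>{k..<Suc j}. R l j * q' l i) - c k j i)
      = nrm n (\<lambda>i. ?E i + (r j * q' j i - c j j i))"
    by (intro L2_set_cong) auto
  also have "\<dots> \<le> nrm n ?E + nrm n (\<lambda>i. r j * q' j i - c j j i)"
    by (rule L2_set_triangle_ineq)
  also have "\<dots> \<le> 16 * \<gamma> * real (j - k) + 4 * \<gamma>"
    using assms by (intro add_mono c_telescope q'_scaled) auto
  also have "\<dots> \<le> 16 * \<gamma> * real n + 4 * \<gamma> * real n"
    using assms n_pos \<gamma>_nonneg mult_left_mono[of 1 "real n" "4 * \<gamma>"] by (intro add_mono mult_left_mono) auto
  finally show ?thesis
    by (simp add: algebra_simps)
qed

text \<open>By \<open>factor_tail\<close>, the sum over l > i is the inner product of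
  \<open>q i\<close> with column \<open>j\<close> right after it was orthogonalized against
  \<open>q i\<close>, up to the tail error. The two contributions are 120 \<gamma> and 22 n
  \<gamma>; the conditioning of \<open>R\<close> does not enter.\<close>

lemma small_UR:
  assumes good: "\<And>l. l < j \<Longrightarrow> r l \<noteq> 0" and j: "j < N" "N \<le> n" and i: "i < N"
  shows "\<bar>\<Sum>l\<in>{i<..<N}. R l j * ip n (q' i) (q' l)\<bar> \<le> 150 * real n * \<gamma>"
proof (cases "i < j")
  case False
  then have "(\<Sum>l\<in>{i<..<N}. R l j * ip n (q' i) (q' l)) = 0"
    by (intro sum.neutral) (auto simp: R_def)
  then show ?thesis
    using \<gamma>_nonneg by simp
next
  case True
  have qi: "q' i = q i" and ri: "r i \<noteq> 0"
    using good True by (auto simp: q'_def)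
  define D where "D = (\<lambda>m. (\<Sum>l\<in>{Suc i..<Suc j}. R l j * q' l m) - c (Suc i) j m)"
  have "(\<Sum>l\<in>{i<..<N}. R l j * ip n (q' i) (q' l)) = (\<Sum>l\<in>{Suc i..<Suc j}. R l j * ip n (q' i) (q' l))"
    using j by (intro sum.mono_neutral_right) (auto simp: R_def)
  also have "\<dots> = (\<Sum>l\<in>{Suc i..<Suc j}. \<Sum>m<n. q i m * (R l j * q' l m))"
    by (simp add: sum_distrib_left qi mult_ac)
  also have "\<dots> = (\<Sum>m<n. \<Sum>l\<in>{Suc i..<Suc j}. q i m * (R l j * q' l m))"
    by (rule sum.swap)
  also have "\<dots> = (\<Sum>m<n. q i m * (c (Suc i) j m + D m))"
    by (intro sum.cong refl) (simp add: D_def sum_distrib_left[symmetric])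
  also have "\<dots> = ip n (q i) (c (Suc i) j) + ip n (q i) D"
    by (simp add: distrib_left sum.distrib)
  finally have eq: "(\<Sum>l\<in>{i<..<N}. R l j * ip n (q' i) (q' l)) = ip n (q i) (c (Suc i) j) + ip n (q i) D" .
  have jn: "j < n" using j by simp
  have "\<bar>ip n (q i) (c (Suc i) j)\<bar> \<le> 30 * \<gamma> * nrm n (c i j)"
    using ri True jn by (intro c_step)
  also have "\<dots> \<le> 30 * \<gamma> * 4"
    using good True jn \<gamma>_nonneg by (intro mult_left_mono c_bound) auto
  finally have 1: "\<bar>ip n (q i) (c (Suc i) j)\<bar> \<le> 120 * \<gamma>" by simp
  have "\<bar>ip n (q i) D\<bar> \<le> nrm n (q i) * nrm n D"
    by (rule L2_set_Cauchy_Schwarz)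
  also have "\<dots> \<le> 11/10 * (20 * real n * \<gamma>)"
    unfolding D_def using good True jn ri by (intro mult_mono factor_tail c_step(4)[of i j]) auto
  finally have 2: "\<bar>ip n (q i) D\<bar> \<le> 22 * (real n * \<gamma>)" by (simp add: mult_ac)
  have "1 * \<gamma> \<le> real n * \<gamma>"
    using n_pos \<gamma>_nonneg by (intro mult_right_mono) auto
  then show ?thesis
    unfolding eq using 1 2 by linarith
qed

text \<open>Formulated for the leading \<open>N\<close> columns and with the last pivot left open,
  so that it can serve in the induction that shows the pivots to be nonzero.\<close>

lemma factor_lower:
  assumes good: "\<And>l. Suc l < N \<Longrightarrow> r l \<noteq> 0" and N: "N \<le> n"
  shows "L2_set z {..<N} \<le> 4 * L2_set (\<lambda>l. \<Sum>j<N. R l j * z j) {..<N}"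
proof (rule gram_schmidt_factor_lower_bound[where n = n and q = q' and \<epsilon> = "150 * real n * \<gamma>"
      and x = "\<lambda>j i. X $$ (i,j)" and e = "\<lambda>j i. (\<Sum>l\<in>{0..<Suc j}. R l j * q' l i) - c 0 j i"])
  fix i j assume ij: "i < n" "j < N"
  have "(\<Sum>l\<in>{0..<Suc j}. R l j * q' l i) = (\<Sum>l<N. R l j * q' l i)"
    using ij by (intro sum.mono_neutral_left) (auto simp: R_def)
  then show "X $$ (i,j) + ((\<Sum>l\<in>{0..<Suc j}. R l j * q' l i) - c 0 j i) = (\<Sum>l<N. R l j * q' l i)"
    by (simp add: c_def)
next
  fix j assume j: "j < N"
  have "nrm n (\<lambda>i. (\<Sum>l\<in>{0..<Suc j}. R l j * q' l i) - c 0 j i) \<le> 20 * real n * \<gamma>"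
    using j N good by (intro factor_tail) auto
  also have "\<dots> \<le> 150 * real n * \<gamma>"
    using \<gamma>_nonneg by (intro mult_right_mono) auto
  finally show "nrm n (\<lambda>i. (\<Sum>l\<in>{0..<Suc j}. R l j * q' l i) - c 0 j i) \<le> 150 * real n * \<gamma>" .
next
  fix l
  have "12 * \<gamma> \<le> (150 * real n) * \<gamma>"
    using n_pos \<gamma>_nonneg by (intro mult_right_mono) auto
  then show "\<bar>ip n (q' l) (q' l) - 1\<bar> \<le> 150 * real n * \<gamma>"
    using q'_near_unit[of l] by linarith
next
  fix i j assume "i < N" "j < N"
  then show "\<bar>\<Sum>l\<in>{i<..<N}. R l j * ip n (q' i) (q' l)\<bar> \<le> 150 * real n * \<gamma>"
    using good N by (intro small_UR) auto
next
  fix z :: "nat \<Rightarrow> real"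
  define v where "v = vec n (\<lambda>j. if j < N then z j else 0)"
  have v: "v \<in> carrier_vec n" by (simp add: v_def)
  have "vec_norm2 v = L2_set z {..<N}"
    unfolding vec_norm2_L2_set L2_set_def using N
    by (intro arg_cong[of _ _ sqrt] sum.mono_neutral_cong_right) (auto simp: v_def)
  moreover have "vec_norm2 (X *\<^sub>v v) = nrm n (\<lambda>i. \<Sum>j<N. z j * X $$ (i,j))"
  proof -
    have "(X *\<^sub>v v) $ i = (\<Sum>j<N. z j * X $$ (i,j))" if "i < n" for i
    proof -
      have "(X *\<^sub>v v) $ i = (\<Sum>j<n. X $$ (i,j) * v $ j)"
        using X that v by (simp add: scalar_prod_def atLeast0LessThan)
      also have "\<dots> = (\<Sum>j<N. z j * X $$ (i,j))"
        using N by (intro sum.mono_neutral_cong_right) (auto simp: v_def)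
      finally show ?thesis .
    qed
    then show ?thesis
      unfolding vec_norm2_L2_set using X by (intro L2_set_cong) auto
  qed
  ultimately show "L2_set z {..<N} / 2 \<le> nrm n (\<lambda>i. \<Sum>j<N. z j * X $$ (i,j))"
    using X_lower[OF v] by simp
next
  have "(real N)\<^sup>2 * (real n * \<gamma>) \<le> (real n)\<^sup>2 * (real n * \<gamma>)"
    using N \<gamma>_nonneg by (intro mult_right_mono power_mono) auto
  also have "\<dots> = real n ^ 3 * \<gamma>"
    by (simp add: power2_eq_square power3_eq_cube)
  finally have "(real N)\<^sup>2 * (real n * \<gamma>) \<le> 1/3000"
    using n_gamma(3) by simp
  then show "20 * (real N)\<^sup>2 * (150 * real n * \<gamma>) \<le> 1"
    by (simp add: mult_ac)
qed (use \<gamma>_nonneg in simp)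

text \<open>If \<open>r k\<close> vanished, the last row of the leading triangular block of order k
  + 1 would be zero. But the lower bound makes that block invertible, so that R z can be prescribed
  as a unit vector with a 1 in that row.\<close>

lemma r_nonzero: "k < n \<Longrightarrow> r k \<noteq> 0"
proof (induction k rule: less_induct)
  case (less k)
  show ?case
  proof
    assume r0: "r k = 0"
    have lower: "L2_set z {..<Suc k} \<le> 4 * L2_set (\<lambda>l. \<Sum>j<Suc k. R l j * z j) {..<Suc k}" for z
      using less by (intro factor_lower) auto
    obtain z where z: "\<And>l. l < Suc k \<Longrightarrow> (\<Sum>j<Suc k. R l j * z j) = (if l = k then 1 else 0)"
      using linear_system_solvable[OF lower, where y = "\<lambda>l. if l = k then 1 else 0"] by blast
    have "(\<Sum>j<Suc k. R k j * z j) = 0"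
      using r0 by (intro sum.neutral) (auto simp: R_def)
    then show False
      using z[of k] by simp
  qed
qed

lemma c_final: "i < n \<Longrightarrow> j < n \<Longrightarrow> j < k \<Longrightarrow> c k j i = q j i"
proof (induction k)
  case (Suc k)
  then show ?case
    by (cases "j = k") (auto simp: c_Suc)
qed simp

text \<open>600 = 4 times 150 by \<open>gram_schmidt_orthogonality\<close>; the third power of
  \<open>n\<close> combines one factor from U R, one from solving with \<open>R\<close> and one from
  passing from entries to the Frobenius norm.\<close>

lemma mgs_error:
  obtains S where "S \<in> carrier_mat n n" "upper_triangular S" "mgs F X \<in> carrier_mat n n"
    "frobenius_norm (transpose_mat (mgs F X) * mgs F X - 1\<^sub>m n) \<le> 600 * real n ^ 3 * \<gamma>"
    "frobenius_norm (mgs F X * S - X) \<le> 20 * (real n)\<^sup>2 * \<gamma>"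
proof -
  define Q where "Q = mgs F X"
  define S where "S = mat n n (\<lambda>(l,j). R l j)"
  have Q: "Q \<in> carrier_mat n n"
    using X n_pos unfolding Q_def mgs_def by (cases n) (auto simp: mgs_step_def Let_def)
  have Qij: "Q $$ (i,j) = q j i" if "i < n" "j < n" for i j
    using c_final[OF that that(2)] X by (simp add: c_def Q_def mgs_def)
  have good: "l < n \<Longrightarrow> r l \<noteq> 0" for l
    by (rule r_nonzero)
  have q': "q' l = q l" if "l < n" for l
    using good[OF that] by (simp add: q'_def)
  have lower: "L2_set z {..<n} \<le> 4 * L2_set (\<lambda>l. \<Sum>j<n. R l j * z j) {..<n}" for z
    using good by (intro factor_lower) auto
  have UR: "\<bar>\<Sum>l\<in>{i<..<n}. R l j * ip n (q' i) (q' l)\<bar> \<le> 150 * real n * \<gamma>" if "i < n" "j < n" for i j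
    using good that by (intro small_UR) auto
  have off: "\<bar>ip n (q i) (q l)\<bar> \<le> 600 * (real n)\<^sup>2 * \<gamma>" if "i < l" "l < n" for i l
  proof -
    have "\<bar>ip n (q' i) (q' l)\<bar> \<le> 4 * real n * (150 * real n * \<gamma>)"
      using that \<gamma>_nonneg by (intro gram_schmidt_orthogonality[OF lower UR]) auto
    then show ?thesis
      using q'[of i] q'[of l] that by (simp add: power2_eq_square mult_ac)
  qed
  have "frobenius_norm (transpose_mat Q * Q - 1\<^sub>m n) \<le> real n * (600 * (real n)\<^sup>2 * \<gamma>)"
  proof (rule frobenius_norm_le_entries)
    fix i j assume ij: "i < n" "j < n"
    have e: "(transpose_mat Q * Q - 1\<^sub>m n) $$ (i,j) = ip n (q i) (q j) - (if i = j then 1 else 0)"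
    proof -
      have "(transpose_mat Q * Q - 1\<^sub>m n) $$ (i,j) = (\<Sum>l<n. Q $$ (l,i) * Q $$ (l,j)) - (if i = j then 1 else 0)"
        using Q ij by (simp add: scalar_prod_def atLeast0LessThan)
      then show ?thesis
        using Qij ij by simp
    qed
    consider "i = j" | "i < j" | "j < i" by linarith
    then show "\<bar>(transpose_mat Q * Q - 1\<^sub>m n) $$ (i,j)\<bar> \<le> 600 * (real n)\<^sup>2 * \<gamma>"
    proof cases
      case 1
      have "1 \<le> (real n)\<^sup>2"
        using n_pos by simp
      then have "12 * \<gamma> \<le> (600 * (real n)\<^sup>2) * \<gamma>"
        using \<gamma>_nonneg by (intro mult_right_mono) auto
      then show ?thesis
        using order_trans[OF q_near_unit[OF good[OF ij(1)]]] e 1 by simp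
    next
      case 2
      then show ?thesis
        using off[of i j] e ij by simp
    next
      case 3
      then show ?thesis
        using off[of j i] e ij by (simp add: mult.commute[of "q j _"])
    qed
  qed (use Q \<gamma>_nonneg in auto)
  then have 1: "frobenius_norm (transpose_mat Q * Q - 1\<^sub>m n) \<le> 600 * real n ^ 3 * \<gamma>"
    by (simp add: power2_eq_square power3_eq_cube mult_ac)
  have S: "S \<in> carrier_mat n n"
    by (simp add: S_def)
  have QS: "Q * S - X \<in> carrier_mat n n"
    using X by simp
  have "frobenius_norm (Q * S - X) \<le> real n * (20 * real n * \<gamma>)"
  proof -
    have "vec_norm2 (col (Q * S - X) j) \<le> 20 * real n * \<gamma>" if j: "j < n" for j
    proof -
      have "vec_norm2 (col (Q * S - X) j) = nrm n (\<lambda>i. (\<Sum>l\<in>{0..<Suc j}. R l j * q' l i) - c 0 j i)"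
        unfolding vec_norm2_col[OF QS j]
      proof (rule L2_set_cong[OF refl])
        fix i assume "i \<in> {..<n}"
        then have i: "i < n" by simp
        have "(Q * S - X) $$ (i,j) = (\<Sum>l<n. q l i * R l j) - X $$ (i,j)"
          using Q S X i j Qij by (simp add: scalar_prod_def atLeast0LessThan S_def)
        also have "(\<Sum>l<n. q l i * R l j) = (\<Sum>l\<in>{0..<Suc j}. R l j * q' l i)"
          using j q' by (intro sum.mono_neutral_cong_right) (auto simp: R_def)
        finally show "(Q * S - X) $$ (i,j) = (\<Sum>l\<in>{0..<Suc j}. R l j * q' l i) - c 0 j i"
          by (simp add: c_def)
      qed
      also have "\<dots> \<le> 20 * real n * \<gamma>"
        using j good by (intro factor_tail) auto
      finally show ?thesis .
    qed
    then have "(\<Sum>j<n. vec_norm2 (col (Q * S - X) j)) \<le> (\<Sum>j<n. 20 * real n * \<gamma>)"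
      by (intro sum_mono) auto
    moreover have "frobenius_norm (Q * S - X) \<le> (\<Sum>j<n. vec_norm2 (col (Q * S - X) j))"
      using QS X unfolding frobenius_norm_cols by (auto intro!: L2_set_le_sum)
    ultimately show ?thesis by simp
  qed
  then have 2: "frobenius_norm (Q * S - X) \<le> 20 * (real n)\<^sup>2 * \<gamma>"
    by (simp add: power2_eq_square mult_ac)
  have "upper_triangular S"
    by (auto simp: S_def R_def)
  then show ?thesis
    using that[of S] S Q 1 2 by (simp add: Q_def)
qed

end

section \<open>Newton--Schulz iteration\<close>

definition defect :: "nat \<Rightarrow> real mat \<Rightarrow> real mat" where
  "defect n X = 1\<^sub>m n - transpose_mat X * X"

lemma defect_carrier [simp]: "X \<in> carrier_mat n n \<Longrightarrow> defect n X \<in> carrier_mat n n"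
  by (simp add: defect_def mult_carrier_mat[of _ n n])

lemma orthogonality_defect_eq:
  assumes "X \<in> carrier_mat n n" shows "orthogonality_defect X = spectral_norm (defect n X)"
  unfolding orthogonality_defect_def defect_def
  using assms by (subst spectral_norm_minus_commute[of _ n n]) (auto simp: mult_carrier_mat[of _ n n])

lemma defect_transpose:
  assumes "X \<in> carrier_mat n n" shows "transpose_mat (defect n X) = defect n X"
  using assms
  by (simp add: defect_def transpose_minus[of _ n n] transpose_mult[of _ n n _ n] mult_carrier_mat[of _ n n])

lemma defect_quadratic_form:
  assumes X: "X \<in> carrier_mat n n" and z: "z \<in> carrier_vec n"
  shows "z \<bullet> (defect n X *\<^sub>v z) = (vec_norm2 z)\<^sup>2 - (vec_norm2 (X *\<^sub>v z))\<^sup>2"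
proof -
  have XX: "transpose_mat X * X \<in> carrier_mat n n"
    using X by (simp add: mult_carrier_mat[of _ n n])
  have "defect n X *\<^sub>v z = z - transpose_mat X *\<^sub>v (X *\<^sub>v z)"
    unfolding defect_def using X z XX
    by (simp add: minus_mult_distrib_mat_vec[of _ n n] assoc_mult_mat_vec[of _ n n _ n])
  also have "z \<bullet> \<dots> = z \<bullet> z - z \<bullet> (transpose_mat X *\<^sub>v (X *\<^sub>v z))"
    using X z by (intro scalar_prod_minus_distrib[of _ n]) (auto intro!: mult_mat_vec_carrier[of _ n n])
  also have "z \<bullet> (transpose_mat X *\<^sub>v (X *\<^sub>v z)) = (X *\<^sub>v z) \<bullet> (X *\<^sub>v z)"
    using X z by (intro scalar_prod_transpose[symmetric, of _ n n]) auto
  finally show ?thesis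
    by (simp add: vec_norm2_square)
qed

text \<open>A defect of norm at most 1 gives |X z|^2 at most 2 |z|^2; 3/2 is a rational bound for
  the square root of 2.\<close>

lemma spectral_norm_le_of_defect:
  assumes X: "X \<in> carrier_mat n n" and E: "spectral_norm (defect n X) \<le> 1"
  shows "spectral_norm X \<le> 3/2"
proof (rule spectral_norm_leI[OF X])
  fix z :: "real vec" assume z: "z \<in> carrier_vec n"
  have "\<bar>z \<bullet> (defect n X *\<^sub>v z)\<bar> \<le> vec_norm2 z * vec_norm2 (defect n X *\<^sub>v z)"
    using X z by (intro scalar_prod_le_vec_norm2[of _ n]) (auto intro!: mult_mat_vec_carrier[of _ n n])
  also have "\<dots> \<le> vec_norm2 z * (1 * vec_norm2 z)"
  proof (rule mult_left_mono)
    have "vec_norm2 (defect n X *\<^sub>v z) \<le> spectral_norm (defect n X) * vec_norm2 z"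
      using X z by (intro vec_norm2_mult_le_spectral[of _ n n]) auto
    also have "\<dots> \<le> 1 * vec_norm2 z"
      using E by (intro mult_right_mono) auto
    finally show "vec_norm2 (defect n X *\<^sub>v z) \<le> 1 * vec_norm2 z" .
  qed simp
  finally have "(vec_norm2 (X *\<^sub>v z))\<^sup>2 \<le> 2 * (vec_norm2 z)\<^sup>2"
    unfolding defect_quadratic_form[OF X z] by (simp add: power2_eq_square)
  also have "\<dots> \<le> (3/2 * vec_norm2 z)\<^sup>2"
    by (simp add: power2_eq_square)
  finally show "vec_norm2 (X *\<^sub>v z) \<le> 3/2 * vec_norm2 z"
    by (rule power2_le_imp_le) simp
qed simp

lemma defect_perturbation:
  assumes Y: "Y \<in> carrier_mat n n" and Z: "Z \<in> carrier_mat n n"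
  shows "spectral_norm (defect n Z - defect n Y) \<le> 2 * spectral_norm Y * spectral_norm (Z - Y) + (spectral_norm (Z - Y))\<^sup>2"
proof -
  define D where "D = Z - Y"
  have D: "D \<in> carrier_mat n n"
    using Y by (simp add: D_def)
  note [simp] = mult_carrier_mat[of _ n n _ n]
  have Zeq: "Z = Y + D"
    using Y Z by (auto simp: D_def)
  have "transpose_mat Z * Z = transpose_mat Y * Y + transpose_mat Y * D + (transpose_mat D * Y + transpose_mat D * D)"
    unfolding Zeq using Y D
    by (simp add: transpose_add[of _ n n] add_mult_distrib_mat[of _ n n _ _ n] mult_add_distrib_mat[of _ n n _ n])
      (intro eq_matI; auto simp del: index_mult_mat(1))
  then have "defect n Z - defect n Y = - (transpose_mat Y * D + (transpose_mat D * Y + transpose_mat D * D))"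
    using Y Z D unfolding defect_def by (intro eq_matI) auto
  then have "spectral_norm (defect n Z - defect n Y) = spectral_norm (transpose_mat Y * D + (transpose_mat D * Y + transpose_mat D * D))"
    using Y D by (simp add: spectral_norm_uminus[of _ n n])
  also have "\<dots> \<le> spectral_norm (transpose_mat Y * D) + (spectral_norm (transpose_mat D * Y) + spectral_norm (transpose_mat D * D))"
    using Y D by (intro order_trans[OF spectral_norm_triangle[of _ n n]] add_left_mono spectral_norm_triangle[of _ n n]) auto
  also have "\<dots> \<le> spectral_norm (transpose_mat Y) * spectral_norm D + (spectral_norm (transpose_mat D) * spectral_norm Y
      + spectral_norm (transpose_mat D) * spectral_norm D)"
    using Y D by (intro add_mono spectral_norm_mult[of _ n n _ n]) auto
  also have "\<dots> = 2 * spectral_norm Y * spectral_norm D + (spectral_norm D)\<^sup>2"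
    using Y D by (simp add: spectral_norm_transpose[of _ n n] power2_eq_square algebra_simps)
  finally show ?thesis
    by (simp add: D_def)
qed

definition ns_map :: "real mat \<Rightarrow> real mat" where
  "ns_map E = (3/4) \<cdot>\<^sub>m (E * E) + (1/4) \<cdot>\<^sub>m (E * (E * E))"

lemma ns_map_carrier [simp]: "E \<in> carrier_mat n n \<Longrightarrow> ns_map E \<in> carrier_mat n n"
  by (simp add: ns_map_def mult_carrier_mat[of _ n n])

lemma newton_schulz_exact_carrier [simp]:
  "X \<in> carrier_mat n n \<Longrightarrow> newton_schulz_exact_step X \<in> carrier_mat n n"
  by (auto simp: newton_schulz_exact_step_def)

lemma newton_schulz_exact_eq:
  assumes X: "X \<in> carrier_mat n n"
  shows "newton_schulz_exact_step X = (1/2) \<cdot>\<^sub>m (X * (2 \<cdot>\<^sub>m 1\<^sub>m n + defect n X))"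
proof -
  have "3 \<cdot>\<^sub>m 1\<^sub>m n - transpose_mat X * X = 2 \<cdot>\<^sub>m 1\<^sub>m n + defect n X"
    using X by (intro eq_matI) (auto simp: defect_def)
  then show ?thesis
    using X by (simp add: newton_schulz_exact_step_def)
qed

text \<open>One step multiplies \<open>X\<close> by M / 2 with M = 2 I + E, and X^T X = I - E. The
  new Gram matrix is M (I - E) M / 4, a polynomial in the single matrix \<open>E\<close>: (2 + E)^2
  (1 - E) = 4 - 3 E^2 - E^3.\<close>

lemma defect_newton_schulz:
  assumes X: "X \<in> carrier_mat n n"
  shows "defect n (newton_schulz_exact_step X) = ns_map (defect n X)"
proof -
  define E where "E = defect n X"
  define M where "M = 2 \<cdot>\<^sub>m 1\<^sub>m n + E"
  note [simp] = mult_carrier_mat[of _ n n _ n]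
  have E [simp]: "E \<in> carrier_mat n n" and M [simp]: "M \<in> carrier_mat n n"
    using X by (auto simp: E_def M_def)
  have ET: "transpose_mat E = E"
    unfolding E_def by (rule defect_transpose[OF X])
  have "transpose_mat M = M"
  proof (rule eq_matI)
    fix i j assume "i < dim_row M" "j < dim_col M"
    then have ij: "i < n" "j < n"
      using M by auto
    have "E $$ (j,i) = E $$ (i,j)"
      using arg_cong[OF ET, of "\<lambda>A. A $$ (i,j)"] ij carrier_matD[OF E] by simp
    then show "transpose_mat M $$ (i,j) = M $$ (i,j)"
      using ij carrier_matD[OF E] by (simp add: M_def)
  qed (use carrier_matD[OF M] in auto)
  then have YY: "transpose_mat (newton_schulz_exact_step X) * newton_schulz_exact_step X
      = (1/4) \<cdot>\<^sub>m (M * ((transpose_mat X * X) * M))"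
    unfolding newton_schulz_exact_eq[OF X] E_def[symmetric] M_def[symmetric]
  proof -
    assume MT: "transpose_mat M = M"
    have "transpose_mat ((1/2) \<cdot>\<^sub>m (X * M)) = (1/2) \<cdot>\<^sub>m (M * transpose_mat X)"
    proof -
      have "transpose_mat ((1/2) \<cdot>\<^sub>m (X * M)) = (1/2) \<cdot>\<^sub>m transpose_mat (X * M)"
        by (intro eq_matI) (auto simp del: index_mult_mat(1))
      then show ?thesis
        using X MT by (simp add: transpose_mult[of _ n n _ n])
    qed
    then have "transpose_mat ((1/2) \<cdot>\<^sub>m (X * M)) * ((1/2) \<cdot>\<^sub>m (X * M))
        = (1/2) \<cdot>\<^sub>m ((1/2) \<cdot>\<^sub>m ((M * transpose_mat X) * (X * M)))"
      using X by (simp add: mult_smult_assoc_mat[of _ n n _ n] mult_smult_distrib[of _ n n _ n])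
    also have "(M * transpose_mat X) * (X * M) = M * ((transpose_mat X * X) * M)"
      using X by (simp add: assoc_mult_mat[of _ n n _ n _ n])
    also have "(1/2) \<cdot>\<^sub>m ((1/2) \<cdot>\<^sub>m (M * ((transpose_mat X * X) * M))) = (1/4) \<cdot>\<^sub>m (M * ((transpose_mat X * X) * M))"
      by (intro eq_matI) (auto simp del: index_mult_mat(1))
    finally show "transpose_mat ((1/2) \<cdot>\<^sub>m (X * M)) * ((1/2) \<cdot>\<^sub>m (X * M)) = (1/4) \<cdot>\<^sub>m (M * ((transpose_mat X * X) * M))" .
  qed
  define E2 where "E2 = E * E"
  define E3 where "E3 = E * E2"
  have c [simp]: "E2 \<in> carrier_mat n n" "E3 \<in> carrier_mat n n"
    by (auto simp: E2_def E3_def)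
  note [simp] = carrier_matD[OF E] carrier_matD[OF M] carrier_matD[OF c(1)] carrier_matD[OF c(2)]
  have G: "transpose_mat X * X = 1\<^sub>m n - E"
    using X unfolding E_def defect_def by (intro eq_matI) auto
  have EM: "E * M = 2 \<cdot>\<^sub>m E + E2"
    unfolding M_def E2_def
    by (simp add: mult_add_distrib_mat[of _ n n _ n] mult_smult_distrib[of _ n n _ n] right_mult_one_mat[of _ n n])
  have "(1\<^sub>m n - E) * M = M - E * M"
    by (simp add: minus_mult_distrib_mat[of _ n n _ _ n] left_mult_one_mat[of _ n n])
  also have "\<dots> = 2 \<cdot>\<^sub>m 1\<^sub>m n - E - E2"
    unfolding EM unfolding M_def by (intro eq_matI) auto
  finally have GM: "(transpose_mat X * X) * M = 2 \<cdot>\<^sub>m 1\<^sub>m n - E - E2"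
    unfolding G .
  have ME2: "M * E2 = 2 \<cdot>\<^sub>m E2 + E3"
    unfolding M_def E3_def
    by (simp add: add_mult_distrib_mat[of _ n n _ _ n] mult_smult_assoc_mat[of _ n n _ n] left_mult_one_mat[of _ n n])
  have ME: "M * E = 2 \<cdot>\<^sub>m E + E2"
    unfolding M_def E2_def
    by (simp add: add_mult_distrib_mat[of _ n n _ _ n] mult_smult_assoc_mat[of _ n n _ n] left_mult_one_mat[of _ n n])
  have "M * (2 \<cdot>\<^sub>m 1\<^sub>m n - E - E2) = 2 \<cdot>\<^sub>m M - M * E - M * E2"
    by (simp add: mult_minus_distrib_mat[of _ n n _ n] mult_smult_distrib[of _ n n _ n] right_mult_one_mat[of _ n n])
  also have "\<dots> = 4 \<cdot>\<^sub>m 1\<^sub>m n - 3 \<cdot>\<^sub>m E2 - E3"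
    unfolding ME ME2 unfolding M_def by (intro eq_matI) auto
  finally have "transpose_mat (newton_schulz_exact_step X) * newton_schulz_exact_step X
      = (1/4) \<cdot>\<^sub>m (4 \<cdot>\<^sub>m 1\<^sub>m n - 3 \<cdot>\<^sub>m E2 - E3)"
    unfolding YY GM by simp
  then have "defect n (newton_schulz_exact_step X) = 1\<^sub>m n - (1/4) \<cdot>\<^sub>m (4 \<cdot>\<^sub>m 1\<^sub>m n - 3 \<cdot>\<^sub>m E2 - E3)"
    unfolding defect_def by simp
  also have "\<dots> = (3/4) \<cdot>\<^sub>m E2 + (1/4) \<cdot>\<^sub>m E3"
    by (intro eq_matI) (auto simp: field_simps)
  finally show ?thesis
    by (simp add: ns_map_def E2_def E3_def E_def)
qed

lemma spectral_norm_smult_leI: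
  assumes "A \<in> carrier_mat nr nc" "spectral_norm A \<le> x" "0 \<le> c"
  shows "spectral_norm (c \<cdot>\<^sub>m A) \<le> c * x"
  using order_trans[OF spectral_norm_smult_le[OF assms(1), of c] mult_left_mono[OF assms(2), of "\<bar>c\<bar>"]] assms(3)
  by simp

lemma ns_map_norm:
  assumes E: "E \<in> carrier_mat n n" and e: "spectral_norm E \<le> e"
  shows "spectral_norm (ns_map E) \<le> 3/4 * e\<^sup>2 + 1/4 * e ^ 3"
proof -
  note [simp] = mult_carrier_mat[of _ n n _ n]
  define s where "s = spectral_norm E"
  have s: "0 \<le> s" "s \<le> e"
    using spectral_norm_nonneg[OF E] e by (auto simp: s_def)
  have 2: "spectral_norm (E * E) \<le> s * s"
    unfolding s_def by (rule spectral_norm_mult[OF E E])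
  have "spectral_norm (E * (E * E)) \<le> s * spectral_norm (E * E)"
    unfolding s_def using E by (intro spectral_norm_mult[of _ n n _ n]) auto
  then have 3: "spectral_norm (E * (E * E)) \<le> s * (s * s)"
    using 2 s(1) by (meson mult_left_mono order_trans)
  have "spectral_norm (ns_map E) \<le> spectral_norm ((3/4) \<cdot>\<^sub>m (E * E)) + spectral_norm ((1/4) \<cdot>\<^sub>m (E * (E * E)))"
    unfolding ns_map_def using E by (intro spectral_norm_triangle[of _ n n]) auto
  also have "\<dots> \<le> 3/4 * (s * s) + 1/4 * (s * (s * s))"
    using E 2 3 by (intro add_mono spectral_norm_smult_leI[of _ n n]) auto
  also have "\<dots> \<le> 3/4 * (e * e) + 1/4 * (e * (e * e))"
    using s by (intro add_mono mult_left_mono mult_mono) auto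
  finally show ?thesis
    by (simp add: power2_eq_square power3_eq_cube)
qed

text \<open>The splitting A^2 - B^2 = A (A - B) + (A - B) B, and its cubic analogue, do not
  presuppose that the matrices commute. The Lipschitz constant is given in terms of the radii,
  because contraction holds only near 0.\<close>

lemma ns_map_diff:
  assumes A: "A \<in> carrier_mat n n" and B: "B \<in> carrier_mat n n"
    and a: "spectral_norm A \<le> a" and b: "spectral_norm B \<le> b"
  shows "spectral_norm (ns_map A - ns_map B)
    \<le> (3/4 * (a + b) + 1/4 * (a * (a + b) + b * b)) * spectral_norm (A - B)"
proof -
  note [simp] = mult_carrier_mat[of _ n n _ n]
  define d where "d = spectral_norm (A - B)"
  have AB: "A - B \<in> carrier_mat n n"
    using B by simp
  have nn: "0 \<le> a" "0 \<le> b" "0 \<le> d"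
    using spectral_norm_nonneg[OF A] spectral_norm_nonneg[OF B] spectral_norm_nonneg[OF AB] a b by (auto simp: d_def)
  have mul: "spectral_norm (P * Q) \<le> x * y"
    if "P \<in> carrier_mat n n" "Q \<in> carrier_mat n n" "spectral_norm P \<le> x" "spectral_norm Q \<le> y" for P Q x y
  proof -
    have "spectral_norm (P * Q) \<le> spectral_norm P * spectral_norm Q"
      by (rule spectral_norm_mult[OF that(1,2)])
    also have "\<dots> \<le> x * y"
      using that spectral_norm_nonneg[OF that(1)] spectral_norm_nonneg[OF that(2)] by (intro mult_mono) auto
    finally show ?thesis .
  qed
  have "A * A - B * B = A * (A - B) + (A - B) * B"
    using A B by (simp add: mult_minus_distrib_mat[of _ n n _ n] minus_mult_distrib_mat[of _ n n _ _ n])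
      (intro eq_matI; auto)
  then have 2: "spectral_norm (A * A - B * B) \<le> a * d + d * b"
    using A B AB a b mul[of A "A - B" a d] mul[of "A - B" B d b]
      spectral_norm_triangle[of "A * (A - B)" n n "(A - B) * B"] by (simp add: d_def)
  have "A * (A * A) - B * (B * B) = A * (A * A - B * B) + (A - B) * (B * B)"
    using A B by (simp add: mult_minus_distrib_mat[of _ n n _ n] minus_mult_distrib_mat[of _ n n _ _ n])
      (intro eq_matI; auto)
  then have 3: "spectral_norm (A * (A * A) - B * (B * B)) \<le> a * (a * d + d * b) + d * (b * b)"
    using A B AB a b 2 mul[of A "A * A - B * B" a "a * d + d * b"] mul[of "A - B" "B * B" d "b * b"] mul[of B B b b]
      spectral_norm_triangle[of "A * (A * A - B * B)" n n "(A - B) * (B * B)"] by (simp add: d_def)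
  have "ns_map A - ns_map B = (3/4) \<cdot>\<^sub>m (A * A - B * B) + (1/4) \<cdot>\<^sub>m (A * (A * A) - B * (B * B))"
    using A B unfolding ns_map_def by (intro eq_matI) (auto simp: algebra_simps simp del: index_mult_mat(1))
  then have "spectral_norm (ns_map A - ns_map B)
      \<le> spectral_norm ((3/4) \<cdot>\<^sub>m (A * A - B * B)) + spectral_norm ((1/4) \<cdot>\<^sub>m (A * (A * A) - B * (B * B)))"
    using A B by (simp add: spectral_norm_triangle[of _ n n])
  also have "\<dots> \<le> 3/4 * (a * d + d * b) + 1/4 * (a * (a * d + d * b) + d * (b * b))"
    using A B 2 3 by (intro add_mono spectral_norm_smult_leI[of _ n n]) auto
  also have "\<dots> = (3/4 * (a + b) + 1/4 * (a * (a + b) + b * b)) * d"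
    by (simp add: algebra_simps)
  finally show ?thesis
    by (simp add: d_def)
qed

text \<open>Lets a two-sided bound on the quadratic form of a symmetric matrix be read as a norm
  bound without recourse to eigenvalues.\<close>

lemma spectral_norm_psd:
  assumes S: "S \<in> carrier_mat n n" and sym: "transpose_mat S = S" and \<theta>: "0 \<le> \<theta>"
    and lo: "\<And>z. z \<in> carrier_vec n \<Longrightarrow> 0 \<le> z \<bullet> (S *\<^sub>v z)"
    and hi: "\<And>z. z \<in> carrier_vec n \<Longrightarrow> z \<bullet> (S *\<^sub>v z) \<le> \<theta> * (vec_norm2 z)\<^sup>2"
  shows "spectral_norm S \<le> \<theta>"
proof (rule spectral_norm_leI[OF S \<theta>])
  fix z :: "real vec" assume z: "z \<in> carrier_vec n"
  define y where "y = S *\<^sub>v z"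
  define a where "a = vec_norm2 z"
  define b where "b = vec_norm2 y"
  have y: "y \<in> carrier_vec n" and Sy: "S *\<^sub>v y \<in> carrier_vec n"
    using S z by (auto simp: y_def intro!: mult_mat_vec_carrier[of _ n n])
  have ab: "0 \<le> a" "0 \<le> b"
    by (auto simp: a_def b_def)
  have zSy: "z \<bullet> (S *\<^sub>v y) = b\<^sup>2"
  proof -
    have "z \<bullet> (S *\<^sub>v y) = (S *\<^sub>v z) \<bullet> y"
      using scalar_prod_transpose[OF S z y] sym by simp
    then show ?thesis
      by (simp add: y_def b_def vec_norm2_square)
  qed
  text \<open>Nonnegativity at \<open>b z - a S z\<close> is the Cauchy--Schwarz inequality for the form of \<open>S\<close>.\<close>
  define x where "x = b \<cdot>\<^sub>v z - a \<cdot>\<^sub>v y"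
  have x: "x \<in> carrier_vec n"
    using z y by (simp add: x_def)
  have Sx: "S *\<^sub>v x = b \<cdot>\<^sub>v y - a \<cdot>\<^sub>v (S *\<^sub>v y)"
    unfolding x_def using S z y
    by (simp add: mult_minus_distrib_mat_vec[of _ n n] mult_mat_vec[of _ n n] y_def)
  have "0 \<le> x \<bullet> (S *\<^sub>v x)"
    by (rule lo[OF x])
  also have "x \<bullet> (S *\<^sub>v x) = b\<^sup>2 * (z \<bullet> y) + a\<^sup>2 * (y \<bullet> (S *\<^sub>v y)) - 2 * a * b * b\<^sup>2"
  proof -
    have yy: "y \<bullet> y = b\<^sup>2"
      by (simp add: b_def vec_norm2_square)
    show ?thesis
      unfolding Sx unfolding x_def using z y Sy
      by (simp add: minus_scalar_prod_distrib[of _ n] scalar_prod_minus_distrib[of _ n] zSy yy)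
        (simp add: algebra_simps power2_eq_square)
  qed
  finally have "2 * a * b * b\<^sup>2 \<le> b\<^sup>2 * (z \<bullet> y) + a\<^sup>2 * (y \<bullet> (S *\<^sub>v y))"
    by simp
  also have "\<dots> \<le> b\<^sup>2 * (\<theta> * a\<^sup>2) + a\<^sup>2 * (\<theta> * b\<^sup>2)"
    using hi[OF z] hi[OF y] by (intro add_mono mult_left_mono) (auto simp: y_def a_def b_def)
  finally have ineq: "a * b\<^sup>2 * b \<le> a * b\<^sup>2 * (\<theta> * a)"
    by (simp add: power2_eq_square algebra_simps)
  show "vec_norm2 (S *\<^sub>v z) \<le> \<theta> * vec_norm2 z"
  proof (cases "a = 0 \<or> b = 0")
    case True
    then show ?thesis
    proof
      assume "a = 0"
      then have "z = 0\<^sub>v n"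
        using z by (simp add: a_def vec_norm2_eq_0_iff)
      then have "b = 0"
        using S unfolding b_def y_def by (simp add: vec_norm2_def scalar_prod_def)
      then show ?thesis
        using \<theta> by (simp add: b_def y_def)
    next
      assume "b = 0"
      then show ?thesis
        using \<theta> by (simp add: b_def y_def)
    qed
  next
    case False
    then have "0 < a * b\<^sup>2"
      using ab by simp
    then show ?thesis
      using ineq by (simp add: a_def b_def y_def mult_le_cancel_left_pos del: mult_le_cancel_left)
  qed
qed

lemma near_orthonormal_bounds:
  assumes X: "X \<in> carrier_mat n n" and U: "orthonormal_mat n U" and XU: "spectral_norm (X - U) \<le> 1/2"
    and z: "z \<in> carrier_vec n"
  shows "vec_norm2 (X *\<^sub>v z) \<le> 3/2 * vec_norm2 z" "vec_norm2 z / 2 \<le> vec_norm2 (X *\<^sub>v z)"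
proof -
  have [simp]: "U \<in> carrier_mat n n"
    by (rule orthonormal_mat_carrier[OF U])
  have eq: "(X - U) *\<^sub>v z = X *\<^sub>v z - U *\<^sub>v z"
    using X z by (simp add: minus_mult_distrib_mat_vec[of _ n n])
  have "vec_norm2 ((X - U) *\<^sub>v z) \<le> spectral_norm (X - U) * vec_norm2 z"
    using z by (intro vec_norm2_mult_le_spectral[of _ n n]) auto
  also have "\<dots> \<le> 1/2 * vec_norm2 z"
    using XU by (intro mult_right_mono) auto
  finally have "vec_norm2 (X *\<^sub>v z - U *\<^sub>v z) \<le> 1/2 * vec_norm2 z"
    unfolding eq .
  moreover have "\<bar>vec_norm2 (X *\<^sub>v z) - vec_norm2 (U *\<^sub>v z)\<bar> \<le> vec_norm2 (X *\<^sub>v z - U *\<^sub>v z)"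
    using X z by (intro vec_norm2_triangle_rev[of _ n]) (auto intro!: mult_mat_vec_carrier[of _ n n])
  ultimately show "vec_norm2 (X *\<^sub>v z) \<le> 3/2 * vec_norm2 z" "vec_norm2 z / 2 \<le> vec_norm2 (X *\<^sub>v z)"
    using orthonormal_mat_preserves_norm[OF U z] by linarith+
qed

lemma smult_mult_mat_vec:
  fixes c :: real
  assumes "P \<in> carrier_mat nr nc" "z \<in> carrier_vec nc"
  shows "(c \<cdot>\<^sub>m P) *\<^sub>v z = c \<cdot>\<^sub>v (P *\<^sub>v z)"
  using assms by (intro eq_vecI) (auto simp: scalar_prod_def sum_distrib_left algebra_simps)

text \<open>With singular values in [1/2, 3/2] the defect of \<open>X\<close> may have norm up to
  5/4, where the bound on the defect map exceeds 1. One exact step moves the singular values below 1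
  and keeps them away from 0: the new defect is positive semidefinite with norm below 1, and the
  recursion for defects can start.\<close>

lemma newton_schulz_first_step:
  assumes X: "X \<in> carrier_mat n n"
    and hi: "\<And>z. z \<in> carrier_vec n \<Longrightarrow> vec_norm2 (X *\<^sub>v z) \<le> 3/2 * vec_norm2 z"
    and lo: "\<And>z. z \<in> carrier_vec n \<Longrightarrow> vec_norm2 z / 2 \<le> vec_norm2 (X *\<^sub>v z)"
  shows "spectral_norm (defect n (newton_schulz_exact_step X)) \<le> 97/100"
proof -
  define E where "E = defect n X"
  define Y where "Y = newton_schulz_exact_step X"
  have E: "E \<in> carrier_mat n n" and ET: "transpose_mat E = E"
    using defect_transpose[OF X] X by (auto simp: E_def)
  have Y: "Y \<in> carrier_mat n n"
    using X by (simp add: Y_def)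
  note Ev = mult_mat_vec_carrier[OF E]
  have hi2: "(vec_norm2 (X *\<^sub>v z))\<^sup>2 \<le> 9/4 * (vec_norm2 z)\<^sup>2" if "z \<in> carrier_vec n" for z
    using power_mono[OF hi[OF that], of 2] by (simp add: power_mult_distrib power2_eq_square)
  show ?thesis
    unfolding Y_def[symmetric]
  proof (rule spectral_norm_psd)
    show "defect n Y \<in> carrier_mat n n" "transpose_mat (defect n Y) = defect n Y"
      using Y defect_transpose[OF Y] by auto
    fix z :: "real vec" assume z: "z \<in> carrier_vec n"
    define y where "y = E *\<^sub>v z"
    have y: "y \<in> carrier_vec n"
      using Ev[OF z] by (simp add: y_def)
    have "defect n Y *\<^sub>v z = (3/4) \<cdot>\<^sub>v (E *\<^sub>v y) + (1/4) \<cdot>\<^sub>v (E *\<^sub>v (E *\<^sub>v y))"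
    proof -
      note sm = smult_mult_mat_vec[OF _ z, of _ n]
      show ?thesis
        unfolding Y_def defect_newton_schulz[OF X] E_def[symmetric] ns_map_def y_def
        using E z by (simp add: add_mult_distrib_mat_vec[of _ n n] sm mult_carrier_mat[of _ n n] assoc_mult_mat_vec[of _ n n _ n])
    qed
    then have "z \<bullet> (defect n Y *\<^sub>v z) = 3/4 * (z \<bullet> (E *\<^sub>v y)) + 1/4 * (z \<bullet> (E *\<^sub>v (E *\<^sub>v y)))"
      using z y Ev by (simp add: scalar_prod_add_distrib[of _ n])
    also have "z \<bullet> (E *\<^sub>v y) = y \<bullet> y"
      using scalar_prod_transpose[OF E z y] ET by (simp add: y_def)
    also have "z \<bullet> (E *\<^sub>v (E *\<^sub>v y)) = y \<bullet> (E *\<^sub>v y)"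
      using scalar_prod_transpose[OF E z Ev[OF y]] ET by (simp add: y_def)
    also have "y \<bullet> (E *\<^sub>v y) = (vec_norm2 y)\<^sup>2 - (vec_norm2 (X *\<^sub>v y))\<^sup>2"
      unfolding E_def by (rule defect_quadratic_form[OF X y])
    finally have "z \<bullet> (defect n Y *\<^sub>v z) = (vec_norm2 y)\<^sup>2 - 1/4 * (vec_norm2 (X *\<^sub>v y))\<^sup>2"
      by (simp add: vec_norm2_square field_simps)
    \<comment> \<open>The form equals |y|^2 - |X y|^2 / 4, and |X y|^2 is at most 9/4 |y|^2.\<close>
    then show "0 \<le> z \<bullet> (defect n Y *\<^sub>v z)"
      using hi2[OF y] zero_le_power2[of "vec_norm2 y"] by linarith
    \<comment> \<open>\<open>M\<close> is 3 I - X^T X, bounded below by 3 - 9/4 = 3/4. With the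
      lower bound 1/2 for \<open>X\<close>, the matrix Y = X M / 2 is bounded below by 3/16, and 1 -
      9/256 is less than 97/100.\<close>
    define M where "M = 2 \<cdot>\<^sub>m 1\<^sub>m n + E"
    have M: "M \<in> carrier_mat n n"
      using E by (simp add: M_def)
    have Mz: "M *\<^sub>v z = 2 \<cdot>\<^sub>v z + E *\<^sub>v z"
    proof -
      have "(2 \<cdot>\<^sub>m 1\<^sub>m n) *\<^sub>v z = 2 \<cdot>\<^sub>v z"
        using z by (intro eq_vecI) auto
      then show ?thesis
        unfolding M_def using E z by (simp add: add_mult_distrib_mat_vec[of _ n n])
    qed
    have "z \<bullet> (M *\<^sub>v z) = 2 * (z \<bullet> z) + z \<bullet> (E *\<^sub>v z)"
      unfolding Mz using z Ev[OF z] by (simp add: scalar_prod_add_distrib[of _ n])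
    also have "\<dots> = 3 * (vec_norm2 z)\<^sup>2 - (vec_norm2 (X *\<^sub>v z))\<^sup>2"
      unfolding E_def defect_quadratic_form[OF X z] by (simp add: vec_norm2_square)
    finally have "3/4 * (vec_norm2 z)\<^sup>2 \<le> z \<bullet> (M *\<^sub>v z)"
      using hi2[OF z] by simp
    also have "\<dots> \<le> vec_norm2 z * vec_norm2 (M *\<^sub>v z)"
      using scalar_prod_le_vec_norm2[of z n "M *\<^sub>v z"] z M by auto
    finally have "vec_norm2 z * (3/4 * vec_norm2 z) \<le> vec_norm2 z * vec_norm2 (M *\<^sub>v z)"
      by (simp add: power2_eq_square)
    then have Mlow: "3/4 * vec_norm2 z \<le> vec_norm2 (M *\<^sub>v z)"
      by (cases "vec_norm2 z = 0") (auto simp: mult_le_cancel_left less_le)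
    have "Y *\<^sub>v z = (1/2) \<cdot>\<^sub>v (X *\<^sub>v (M *\<^sub>v z))"
    proof -
      have "((1/2) \<cdot>\<^sub>m (X * M)) *\<^sub>v z = (1/2) \<cdot>\<^sub>v ((X * M) *\<^sub>v z)"
        using X M z by (intro smult_mult_mat_vec[of _ n n]) (auto simp: mult_carrier_mat[of _ n n])
      then show ?thesis
        unfolding Y_def newton_schulz_exact_eq[OF X] E_def[symmetric] M_def[symmetric]
        using X M z by (simp add: assoc_mult_mat_vec[of _ n n _ n])
    qed
    then have "3/16 * vec_norm2 z \<le> vec_norm2 (Y *\<^sub>v z)"
      using lo[of "M *\<^sub>v z"] Mlow M z by (simp add: vec_norm2_smult mult_mat_vec_carrier[of _ n n])
    then have "(3/16 * vec_norm2 z)\<^sup>2 \<le> (vec_norm2 (Y *\<^sub>v z))\<^sup>2"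
      by (intro power_mono) auto
    then have "9/256 * (vec_norm2 z)\<^sup>2 \<le> (vec_norm2 (Y *\<^sub>v z))\<^sup>2"
      by (simp add: power2_eq_square)
    moreover have "(3/100) * (vec_norm2 z)\<^sup>2 \<le> 9/256 * (vec_norm2 z)\<^sup>2"
      by (intro mult_right_mono) auto
    ultimately show "z \<bullet> (defect n Y *\<^sub>v z) \<le> 97/100 * (vec_norm2 z)\<^sup>2"
      unfolding defect_quadratic_form[OF Y z] by linarith
  qed simp
qed

section \<open>Rounding error of one Newton--Schulz step\<close>

context fl_model begin

lemma fl_mat_mult_entry_error:
  assumes A: "A \<in> carrier_mat n n" and B: "B \<in> carrier_mat n n" and ij: "i < n" "j < n"
  shows "\<bar>fl_mat_mult F A B $$ (i,j) - (A * B) $$ (i,j)\<bar>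
    \<le> \<gamma> * (vec_norm2 (col (transpose_mat A) i) * vec_norm2 (col B j))"
proof -
  have "(A * B) $$ (i,j) = ip n (\<lambda>k. A $$ (i,k)) (\<lambda>k. B $$ (k,j))"
    using A B ij by (simp add: scalar_prod_def atLeast0LessThan)
  moreover have "fl_mat_mult F A B $$ (i,j) = fl_dot F (\<lambda>k. A $$ (i,k)) (\<lambda>k. B $$ (k,j)) [0..<n]"
    using A B ij by (simp add: fl_mat_mult_def)
  moreover have "vec_norm2 (col (transpose_mat A) i) = nrm n (\<lambda>k. A $$ (i,k))"
    using A ij by (subst vec_norm2_col[of _ n]) (auto intro!: L2_set_cong)
  moreover have "vec_norm2 (col B j) = nrm n (\<lambda>k. B $$ (k,j))"
    using vec_norm2_col[OF B ij(2)] .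
  ultimately show ?thesis
    using fl_dot_nrm_error[of "\<lambda>k. A $$ (i,k)" "\<lambda>k. B $$ (k,j)"] by (simp only:)
qed

lemma fl_mat_mult_carrier: "A \<in> carrier_mat n n \<Longrightarrow> B \<in> carrier_mat n n \<Longrightarrow> fl_mat_mult F A B \<in> carrier_mat n n"
  by (simp add: fl_mat_mult_def)

lemma newton_schulz_step_carrier: "X \<in> carrier_mat n n \<Longrightarrow> newton_schulz_step F X \<in> carrier_mat n n"
  by (simp add: newton_schulz_step_def Let_def fl_mat_mult_def)

text \<open>Rounding errors are collected entrywise and converted to norms at the price of a factor
  \<open>n\<close>. The error of \<open>S\<close> reaches the result through X / 2, that is as 8 n
  \<gamma>; the second product and the halving add at most 14 n \<gamma>.\<close>

lemma newton_schulz_step_error: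
  assumes X: "X \<in> carrier_mat n n" and X2: "spectral_norm X \<le> 2" and small: "8 * real n * \<gamma> \<le> 1"
  shows "spectral_norm (newton_schulz_step F X - newton_schulz_exact_step X) \<le> 30 * real n * \<gamma>"
proof -
  note [simp] = mult_carrier_mat[of _ n n _ n]
  define XT where "XT = transpose_mat X"
  define G where "G = fl_mat_mult F XT X"
  define S where "S = mat n n (\<lambda>(i,j). fsub F (if i = j then 3 else 0) (G $$ (i,j)))"
  define S' where "S' = 3 \<cdot>\<^sub>m 1\<^sub>m n - XT * X"
  define P where "P = fl_mat_mult F X S"
  have XT [simp]: "XT \<in> carrier_mat n n"
    using X by (simp add: XT_def)
  have G [simp]: "G \<in> carrier_mat n n" and S [simp]: "S \<in> carrier_mat n n" and S' [simp]: "S' \<in> carrier_mat n n"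
    using X by (auto simp: G_def S_def S'_def fl_mat_mult_carrier)
  have P [simp]: "P \<in> carrier_mat n n"
    unfolding P_def using X by (intro fl_mat_mult_carrier) auto
  have step: "newton_schulz_step F X = map_mat (fmul F (1/2)) P"
    using X by (simp add: newton_schulz_step_def Let_def P_def S_def G_def XT_def)
  have exact: "newton_schulz_exact_step X = (1/2) \<cdot>\<^sub>m (X * S')"
    using X by (simp add: newton_schulz_exact_step_def S'_def XT_def)
  have sX: "0 \<le> spectral_norm X"
    by (rule spectral_norm_nonneg[OF X])
  have XT2: "spectral_norm XT \<le> 2"
    using X2 spectral_norm_transpose[OF X] by (simp add: XT_def)
  have colX: "vec_norm2 (col X j) \<le> 2" "vec_norm2 (col (transpose_mat X) j) \<le> 2" if "j < n" for j
    using order_trans[OF vec_norm2_col_le_spectral[OF X that] X2]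
      order_trans[OF vec_norm2_col_le_spectral[OF XT that] XT2] by (auto simp: XT_def)
  have n\<gamma>: "\<gamma> \<le> real n * \<gamma>"
    using n_pos mult_right_mono[of 1 "real n" \<gamma>] \<gamma>_nonneg by simp
  have Gij: "\<bar>G $$ (i,j) - (XT * X) $$ (i,j)\<bar> \<le> 4 * \<gamma>" if ij: "i < n" "j < n" for i j
  proof -
    have "\<bar>G $$ (i,j) - (XT * X) $$ (i,j)\<bar> \<le> \<gamma> * (vec_norm2 (col (transpose_mat XT) i) * vec_norm2 (col X j))"
      unfolding G_def by (rule fl_mat_mult_entry_error[OF XT X ij])
    also have "\<dots> \<le> \<gamma> * (2 * 2)"
      using colX ij \<gamma>_nonneg by (intro mult_left_mono mult_mono) (auto simp: XT_def)
    finally show ?thesis by simp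
  qed
  have XTX: "\<bar>(XT * X) $$ (i,j)\<bar> \<le> 4" if ij: "i < n" "j < n" for i j
  proof -
    have "\<bar>(XT * X) $$ (i,j)\<bar> = \<bar>col X i \<bullet> col X j\<bar>"
      using X ij by (simp add: XT_def)
    also have "\<dots> \<le> vec_norm2 (col X i) * vec_norm2 (col X j)"
      using X ij by (intro scalar_prod_le_vec_norm2[of _ n]) auto
    also have "\<dots> \<le> 2 * 2"
      using colX ij by (intro mult_mono) auto
    finally show ?thesis by simp
  qed
  have Sij: "\<bar>(S - S') $$ (i,j)\<bar> \<le> 8 * \<gamma>" if ij: "i < n" "j < n" for i j
  proof -
    define t :: real where "t = (if i = j then 3 else 0)"
    have S'ij: "S' $$ (i,j) = t - (XT * X) $$ (i,j)"
      unfolding S'_def using ij carrier_matD[OF X] carrier_matD[OF XT] by (simp add: t_def del: index_mult_mat(1))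
    have e: "(S - S') $$ (i,j) = (fsub F t (G $$ (i,j)) - (t - G $$ (i,j))) - (G $$ (i,j) - (XT * X) $$ (i,j))"
      using ij carrier_matD[OF S'] S'ij by (simp add: S_def t_def del: index_mult_mat(1))
    have "\<bar>t - G $$ (i,j)\<bar> \<le> 8"
      using Gij[OF ij] XTX[OF ij] \<gamma>_small by (auto simp: t_def)
    then have "w * \<bar>t - G $$ (i,j)\<bar> \<le> \<gamma> / 2 * 8"
      using w_le w_nonneg \<gamma>_nonneg by (intro mult_mono) auto
    then show ?thesis
      using fsub_error[of t "G $$ (i,j)"] Gij[OF ij] unfolding e by linarith
  qed
  have SS: "frobenius_norm (S - S') \<le> real n * (8 * \<gamma>)"
    using Sij \<gamma>_nonneg by (intro frobenius_norm_le_entries) auto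
  have S'7: "spectral_norm S' \<le> 7"
  proof -
    have "spectral_norm S' \<le> spectral_norm (3 \<cdot>\<^sub>m 1\<^sub>m n) + spectral_norm (XT * X)"
      unfolding S'_def using X by (intro spectral_norm_minus_triangle[of _ n n]) auto
    also have "\<dots> \<le> 3 * 1 + 2 * 2"
    proof (intro add_mono)
      show "spectral_norm (3 \<cdot>\<^sub>m 1\<^sub>m n) \<le> 3 * 1"
        by (intro spectral_norm_smult_leI[of _ n n] spectral_norm_orthonormal[of n]) auto
      show "spectral_norm (XT * X) \<le> 2 * 2"
        using spectral_norm_mult[OF XT X] XT2 X2 sX
        by (meson mult_mono order_trans spectral_norm_nonneg[OF XT] zero_le_numeral)
    qed
    finally show ?thesis by simp
  qed
  have S8: "spectral_norm S \<le> 8"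
  proof -
    have "spectral_norm S \<le> spectral_norm S' + spectral_norm (S - S')"
      by (rule spectral_norm_le_add_diff[OF S S'])
    also have "spectral_norm (S - S') \<le> frobenius_norm (S - S')"
      by (rule spectral_norm_le_frobenius[of _ n n]) simp
    finally show ?thesis
      using SS S'7 small by simp
  qed
  have Pij: "\<bar>P $$ (i,j) - (X * S) $$ (i,j)\<bar> \<le> 16 * \<gamma>" if ij: "i < n" "j < n" for i j
  proof -
    have "\<bar>P $$ (i,j) - (X * S) $$ (i,j)\<bar> \<le> \<gamma> * (vec_norm2 (col (transpose_mat X) i) * vec_norm2 (col S j))"
      unfolding P_def by (rule fl_mat_mult_entry_error[OF X S ij])
    also have "\<dots> \<le> \<gamma> * (2 * 8)"
      using colX ij \<gamma>_nonneg order_trans[OF vec_norm2_col_le_spectral[OF S ij(2)] S8]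
      by (intro mult_left_mono mult_mono) auto
    finally show ?thesis by simp
  qed
  have XS: "\<bar>(X * S) $$ (i,j)\<bar> \<le> 16" if ij: "i < n" "j < n" for i j
  proof -
    have "\<bar>(X * S) $$ (i,j)\<bar> = \<bar>col (transpose_mat X) i \<bullet> col S j\<bar>"
      using X S ij carrier_matD[OF S] carrier_matD[OF X] by simp
    also have "\<dots> \<le> vec_norm2 (col (transpose_mat X) i) * vec_norm2 (col S j)"
      using X S ij by (intro scalar_prod_le_vec_norm2[of _ n]) auto
    also have "\<dots> \<le> 2 * 8"
      using colX ij order_trans[OF vec_norm2_col_le_spectral[OF S ij(2)] S8] by (intro mult_mono) auto
    finally show ?thesis by simp
  qed
  define Y where "Y = (1/2) \<cdot>\<^sub>m (X * S)"
  have Y [simp]: "Y \<in> carrier_mat n n"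
    using X by (simp add: Y_def)
  define N where "N = newton_schulz_step F X"
  have N [simp]: "N \<in> carrier_mat n n"
    using newton_schulz_step_carrier[OF X] by (simp add: N_def)
  have "frobenius_norm (N - Y) \<le> real n * (14 * \<gamma>)"
  proof (rule frobenius_norm_le_entries)
    fix i j assume ij: "i < n" "j < n"
    have e: "(N - Y) $$ (i,j) = (fmul F (1/2) (P $$ (i,j)) - 1/2 * P $$ (i,j)) + 1/2 * (P $$ (i,j) - (X * S) $$ (i,j))"
      unfolding N_def step Y_def using ij X carrier_matD[OF S] carrier_matD[OF X] carrier_matD[OF P] by (simp add: right_diff_distrib del: index_mult_mat(1))
    have "\<bar>1/2 * P $$ (i,j)\<bar> \<le> 9"
      using Pij[OF ij] XS[OF ij] \<gamma>_small by (auto simp: abs_le_iff)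
    then have "w * \<bar>1/2 * P $$ (i,j)\<bar> \<le> \<gamma> / 2 * 9"
      using w_le w_nonneg \<gamma>_nonneg by (intro mult_mono) auto
    moreover have "\<bar>1/2 * (P $$ (i,j) - (X * S) $$ (i,j))\<bar> \<le> 8 * \<gamma>"
      using Pij[OF ij] by (simp add: abs_mult)
    ultimately show "\<bar>(N - Y) $$ (i,j)\<bar> \<le> 14 * \<gamma>"
      using fmul_error[of "1/2" "P $$ (i,j)"] \<gamma>_nonneg unfolding e by linarith
  qed (use \<gamma>_nonneg in auto)
  then have NY: "spectral_norm (N - Y) \<le> 14 * (real n * \<gamma>)"
    using spectral_norm_le_frobenius[of "N - Y" n n] by simp
  have "Y - newton_schulz_exact_step X = (1/2) \<cdot>\<^sub>m (X * (S - S'))"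
    unfolding exact Y_def using X
    by (simp add: mult_minus_distrib_mat[of _ n n _ n]) (intro eq_matI; auto simp: right_diff_distrib carrier_matD[OF S] carrier_matD[OF S'] simp del: index_mult_mat(1))
  moreover have "spectral_norm (X * (S - S')) \<le> 16 * (real n * \<gamma>)"
  proof -
    have "spectral_norm (X * (S - S')) \<le> spectral_norm X * spectral_norm (S - S')"
      using X by (intro spectral_norm_mult[of _ n n _ n]) auto
    also have "\<dots> \<le> 2 * (real n * (8 * \<gamma>))"
      using X2 sX SS spectral_norm_le_frobenius[of "S - S'" n n] spectral_norm_nonneg[of "S - S'" n n]
      by (intro mult_mono) auto
    finally show ?thesis by simp
  qed
  ultimately have YE: "spectral_norm (Y - newton_schulz_exact_step X) \<le> 1/2 * (16 * (real n * \<gamma>))"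
    using X by (simp only:) (intro spectral_norm_smult_leI[of _ n n]; simp)
  have "spectral_norm (N - newton_schulz_exact_step X) \<le> spectral_norm (N - Y) + spectral_norm (Y - newton_schulz_exact_step X)"
    using X by (intro spectral_norm_triangle_diff[of _ n n]) auto
  also have "\<dots> \<le> 14 * (real n * \<gamma>) + 1/2 * (16 * (real n * \<gamma>))"
    by (rule add_mono[OF NY YE])
  also have "\<dots> \<le> 30 * real n * \<gamma>"
    using \<gamma>_nonneg by (simp add: mult_ac)
  finally show ?thesis
    by (simp add: N_def)
qed

end

lemma spectral_norm_newton_schulz_exact:
  assumes X: "X \<in> carrier_mat n n" and X32: "spectral_norm X \<le> 3/2"
  shows "spectral_norm (newton_schulz_exact_step X) \<le> 4"
proof -
  note [simp] = mult_carrier_mat[of _ n n _ n]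
  have sX: "0 \<le> spectral_norm X"
    by (rule spectral_norm_nonneg[OF X])
  have "spectral_norm (transpose_mat X * X) \<le> 3/2 * (3/2)"
    using spectral_norm_mult[of "transpose_mat X" n n X n] X X32 sX spectral_norm_transpose[OF X]
      mult_mono[OF X32 X32] by auto
  moreover have "spectral_norm (3 \<cdot>\<^sub>m 1\<^sub>m n) \<le> 3 * 1"
    by (intro spectral_norm_smult_leI[of _ n n] spectral_norm_orthonormal[of n]) auto
  ultimately have "spectral_norm (3 \<cdot>\<^sub>m 1\<^sub>m n - transpose_mat X * X) \<le> 21/4"
    using spectral_norm_minus_triangle[of "3 \<cdot>\<^sub>m 1\<^sub>m n" n n "transpose_mat X * X"] X by simp
  then have "spectral_norm (X * (3 \<cdot>\<^sub>m 1\<^sub>m n - transpose_mat X * X)) \<le> 3/2 * (21/4)"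
    using spectral_norm_mult[of X n n "3 \<cdot>\<^sub>m 1\<^sub>m n - transpose_mat X * X" n] X X32 sX
      spectral_norm_nonneg[of "3 \<cdot>\<^sub>m 1\<^sub>m n - transpose_mat X * X" n n]
      mult_mono[of "spectral_norm X" "3/2" "spectral_norm (3 \<cdot>\<^sub>m 1\<^sub>m n - transpose_mat X * X)" "21/4"] by simp
  then have "spectral_norm ((1/2) \<cdot>\<^sub>m (X * (3 \<cdot>\<^sub>m 1\<^sub>m n - transpose_mat X * X))) \<le> 1/2 * (3/2 * (21/4))"
    using X by (intro spectral_norm_smult_leI[of _ n n]) auto
  then show ?thesis
    using X by (simp add: newton_schulz_exact_step_def)
qed

text \<open>\<delta> is the rounding error of one step. Its limit keeps even 30000 \<delta> below
  3/100, so a defect of at most 97/100 plus the accumulated error stays within the unit ball, where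
  the norm of the iterate is controlled.\<close>

locale newton_schulz_run = fl_model +
  fixes X U :: "real mat" and \<delta> :: real
  assumes X: "X \<in> carrier_mat n n" and U: "orthonormal_mat n U" and XU: "spectral_norm (X - U) \<le> 1/2"
    and \<delta>_def: "\<delta> = 30 * real n * \<gamma>" and \<delta>_small: "1000000 * \<delta> \<le> 1"
begin

definition Xe :: "nat \<Rightarrow> real mat" where "Xe k = (newton_schulz_exact_step ^^ k) X"
definition Xc :: "nat \<Rightarrow> real mat" where "Xc k = (newton_schulz_step F ^^ k) X"
text \<open>\<open>e\<close> is the norm of the exact defect and \<open>d\<close> the distance of
  the computed defect from it. The defect determines its successor, so these two numbers obey
  recursions of their own.\<close>

definition e :: "nat \<Rightarrow> real" where "e k = spectral_norm (defect n (Xe k))"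
definition d :: "nat \<Rightarrow> real" where "d k = spectral_norm (defect n (Xc k) - defect n (Xe k))"

lemma \<delta>_nonneg: "0 \<le> \<delta>"
  using \<gamma>_nonneg by (simp add: \<delta>_def)

lemma Xe_carrier [simp]: "Xe k \<in> carrier_mat n n"
  by (induction k) (auto simp: Xe_def X)

lemma Xc_carrier [simp]: "Xc k \<in> carrier_mat n n"
  by (induction k) (auto simp: Xc_def X intro: newton_schulz_step_carrier)

lemma Xe_Suc: "Xe (Suc k) = newton_schulz_exact_step (Xe k)"
  by (simp add: Xe_def)

lemma Xc_Suc: "Xc (Suc k) = newton_schulz_step F (Xc k)"
  by (simp add: Xc_def)

lemma e_nonneg: "0 \<le> e k" and d_nonneg: "0 \<le> d k"
  unfolding e_def d_def by (auto intro!: spectral_norm_nonneg[of _ n n])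

lemma defect_Xc_le: "spectral_norm (defect n (Xc k)) \<le> e k + d k"
  unfolding e_def d_def by (rule spectral_norm_le_add_diff[of _ n n]) auto

lemma e_Suc: "e k \<le> b \<Longrightarrow> e (Suc k) \<le> 3/4 * b\<^sup>2 + 1/4 * b ^ 3"
  using ns_map_norm[of "defect n (Xe k)" n b] defect_newton_schulz[OF Xe_carrier, of k] by (simp add: e_def Xe_Suc)

lemma U_carrier [simp]: "U \<in> carrier_mat n n"
  using U by (simp add: orthonormal_mat_def)

lemma X_bounds:
  assumes z: "z \<in> carrier_vec n"
  shows "vec_norm2 (X *\<^sub>v z) \<le> 3/2 * vec_norm2 z" "vec_norm2 z / 2 \<le> vec_norm2 (X *\<^sub>v z)"
  using near_orthonormal_bounds[OF X U XU z] .

lemma X_norm: "spectral_norm X \<le> 3/2"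
  by (rule spectral_norm_leI[OF X]) (use X_bounds in auto)

lemma e1: "e (Suc 0) \<le> 97/100"
proof -
  have "Xe (Suc 0) = newton_schulz_exact_step X"
    by (simp add: Xe_def)
  then show ?thesis
    unfolding e_def using newton_schulz_first_step[OF X X_bounds] by simp
qed

text \<open>9 = 2 times 4 + 1 by \<open>defect_perturbation\<close>: the exact step has norm at most
  4, and the squared distance is at most \<delta>.\<close>

lemma local_defect_error:
  assumes "spectral_norm (Xc k) \<le> 3/2"
  shows "spectral_norm (defect n (Xc (Suc k)) - defect n (newton_schulz_exact_step (Xc k))) \<le> 9 * \<delta>"
    and "spectral_norm (Xc (Suc k) - newton_schulz_exact_step (Xc k)) \<le> \<delta>"
proof -
  let ?Y = "newton_schulz_exact_step (Xc k)"
  let ?D = "spectral_norm (Xc (Suc k) - ?Y)"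
  have "8 * real n * \<gamma> \<le> 1"
    using \<delta>_small unfolding \<delta>_def by simp
  then show D: "?D \<le> \<delta>"
    using newton_schulz_step_error[of "Xc k"] assms by (simp add: Xc_Suc \<delta>_def)
  have Y4: "spectral_norm ?Y \<le> 4"
    by (rule spectral_norm_newton_schulz_exact[OF Xc_carrier assms])
  have D0: "0 \<le> ?D"
    by (rule spectral_norm_nonneg[of _ n n]) simp
  have "spectral_norm (defect n (Xc (Suc k)) - defect n ?Y) \<le> 2 * spectral_norm ?Y * ?D + ?D\<^sup>2"
    by (rule defect_perturbation) auto
  also have "\<dots> \<le> 2 * 4 * \<delta> + \<delta> * 1"
    unfolding power2_eq_square using Y4 D D0 \<delta>_small \<delta>_nonneg spectral_norm_nonneg[of ?Y n n]
    by (intro add_mono mult_mono) auto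
  finally show "spectral_norm (defect n (Xc (Suc k)) - defect n ?Y) \<le> 9 * \<delta>"
    by simp
qed

text \<open>The intermediate point is the exact step taken from the computed iterate. Its defect is
  the defect map applied to the computed defect, so the propagated error is a Lipschitz constant
  times \<open>d k\<close>.\<close>

lemma d_Suc:
  assumes "spectral_norm (Xc k) \<le> 3/2" and a: "e k + d k \<le> a" and b: "e k \<le> b"
  shows "d (Suc k) \<le> (3/4 * (a + b) + 1/4 * (a * (a + b) + b * b)) * d k + 9 * \<delta>"
proof -
  let ?Y = "newton_schulz_exact_step (Xc k)"
  have "d (Suc k) \<le> spectral_norm (defect n (Xc (Suc k)) - defect n ?Y) + spectral_norm (defect n ?Y - defect n (Xe (Suc k)))"
    unfolding d_def by (rule spectral_norm_triangle_diff[of _ n n]) auto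
  also have "spectral_norm (defect n (Xc (Suc k)) - defect n ?Y) \<le> 9 * \<delta>"
    by (rule local_defect_error[OF assms(1)])
  also have "spectral_norm (defect n ?Y - defect n (Xe (Suc k))) \<le> (3/4 * (a + b) + 1/4 * (a * (a + b) + b * b)) * d k"
    unfolding Xe_Suc defect_newton_schulz[OF Xc_carrier] defect_newton_schulz[OF Xe_carrier] d_def
    by (rule ns_map_diff[of _ n]) (use a b defect_Xc_le[of k] in \<open>auto simp: e_def\<close>)
  finally show ?thesis
    by simp
qed

lemma Xc_norm:
  assumes "e k + d k \<le> 1" shows "spectral_norm (Xc k) \<le> 3/2"
  using defect_Xc_le[of k] assms by (intro spectral_norm_le_of_defect[of _ n]) auto

lemma d1: "d (Suc 0) \<le> 9 * \<delta>"
proof -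
  have "Xe (Suc 0) = newton_schulz_exact_step (Xc 0)"
    by (simp add: Xe_def Xc_def)
  then show ?thesis
    using local_defect_error(1)[of 0] X_norm by (simp add: d_def Xc_def)
qed

text \<open>The factor 9/4 is the Lipschitz constant of the defect map on the unit ball. It amplifies errors only
  during the first steps; once the defect is below 1/8 the map contracts.\<close>

lemma grow_step:
  assumes e: "e k \<le> b" and d: "d k \<le> c * \<delta>" and b: "b \<le> 97/100" and c: "0 \<le> c" "c \<le> 30000"
    and b': "3/4 * b\<^sup>2 + 1/4 * b ^ 3 \<le> b'" and c': "9/4 * c + 9 \<le> c'"
  shows "e (Suc k) \<le> b' \<and> d (Suc k) \<le> c' * \<delta>"
proof
  have b0: "0 \<le> b"
    using e e_nonneg[of k] by linarith
  show "e (Suc k) \<le> b'"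
    using e_Suc[OF e] b' by linarith
  have "c * \<delta> \<le> 30000 * \<delta>"
    using c \<delta>_nonneg by (intro mult_right_mono) auto
  then have ed: "e k + d k \<le> 1"
    using e d b \<delta>_small by linarith
  have "d (Suc k) \<le> (3/4 * (1 + 1) + 1/4 * (1 * (1 + 1) + 1 * 1)) * d k + 9 * \<delta>"
    using ed e b by (intro d_Suc Xc_norm) auto
  also have "\<dots> \<le> 9/4 * (c * \<delta>) + 9 * \<delta>"
    using d by simp
  also have "\<dots> \<le> c' * \<delta>"
    using mult_right_mono[OF c' \<delta>_nonneg] by (simp add: algebra_simps)
  finally show "d (Suc k) \<le> c' * \<delta>" .
qed

text \<open>At the radii 1/4 and 1/8 the Lipschitz constant is below 1/2, so an error of 20000
  \<delta> becomes at most 10009 \<delta>.\<close>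

lemma settled_step:
  assumes "e k \<le> 1/8" "d k \<le> 20000 * \<delta>"
  shows "e (Suc k) \<le> 1/8 \<and> d (Suc k) \<le> 20000 * \<delta>"
proof
  show "e (Suc k) \<le> 1/8"
    using e_Suc[OF assms(1)] by (simp add: power2_eq_square power3_eq_cube)
  have d4: "d k \<le> 1/8"
    using assms \<delta>_small by linarith
  have "d (Suc k) \<le> (3/4 * (1/4 + 1/8) + 1/4 * (1/4 * (1/4 + 1/8) + 1/8 * (1/8))) * d k + 9 * \<delta>"
    using assms d4 by (intro d_Suc Xc_norm) auto
  also have "\<dots> \<le> 1/2 * d k + 9 * \<delta>"
    using d_nonneg[of k] by (intro add_right_mono mult_right_mono) auto
  finally show "d (Suc k) \<le> 20000 * \<delta>"
    using assms \<delta>_nonneg by linarith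
qed

text \<open>Starting after the first step, six more bring the exact defect from 97/100 below 1/8
  while the error grows from 9 \<delta> to 2163 \<delta>; from then on \<open>settled_step\<close>
  repeats indefinitely.\<close>

lemma invariant: "e (Suc k) \<le> 97/100 \<and> d (Suc k) \<le> 20000 * \<delta>"
proof -
  note num = power2_eq_square power3_eq_cube
  \<comment> \<open>Each of the following lines iterates b to 3/4 b^2 + 1/4 b^3 and c to 9/4 c + 9,
    rounded upwards.\<close>
  have s1: "e 1 \<le> 97/100 \<and> d 1 \<le> 9 * \<delta>"
    using e1 d1 by simp
  have s2: "e 2 \<le> 935/1000 \<and> d 2 \<le> 30 * \<delta>"
    using grow_step[of 1 "97/100" 9 "935/1000" 30] s1 by (simp add: num numeral_2_eq_2)
  have s3: "e 3 \<le> 861/1000 \<and> d 3 \<le> 77 * \<delta>"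
    using grow_step[of 2 "935/1000" 30 "861/1000" 77] s2 by (simp add: num eval_nat_numeral)
  have s4: "e 4 \<le> 717/1000 \<and> d 4 \<le> 183 * \<delta>"
    using grow_step[of 3 "861/1000" 77 "717/1000" 183] s3 by (simp add: num eval_nat_numeral)
  have s5: "e 5 \<le> 479/1000 \<and> d 5 \<le> 421 * \<delta>"
    using grow_step[of 4 "717/1000" 183 "479/1000" 421] s4 by (simp add: num eval_nat_numeral)
  have s6: "e 6 \<le> 200/1000 \<and> d 6 \<le> 957 * \<delta>"
    using grow_step[of 5 "479/1000" 421 "200/1000" 957] s5 by (simp add: num eval_nat_numeral)
  have s7: "e 7 \<le> 1/8 \<and> d 7 \<le> 2163 * \<delta>"
    using grow_step[of 6 "200/1000" 957 "1/8" 2163] s6 by (simp add: num eval_nat_numeral)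
  have late: "e (k + 7) \<le> 1/8 \<and> d (k + 7) \<le> 20000 * \<delta>" for k
  proof (induction k)
    case 0
    then show ?case using s7 \<delta>_nonneg by simp
  next
    case (Suc k)
    then show ?case using settled_step[of "k + 7"] by simp
  qed
  have late': "e (Suc k) \<le> 1/8 \<and> d (Suc k) \<le> 20000 * \<delta>" if "6 \<le> k"
  proof -
    have "Suc k = k - 6 + 7"
      using that by simp
    then show ?thesis
      using late[of "k - 6"] by metis
  qed
  have "k = 0 \<or> k = 1 \<or> k = 2 \<or> k = 3 \<or> k = 4 \<or> k = 5 \<or> 6 \<le> k"
    by linarith
  then show ?thesis
    using s1 s2[unfolded numeral_2_eq_2] s3 s4 s5 s6 late' \<delta>_nonneg by (elim disjE) auto
qed

lemma d0: "d 0 = 0"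
proof -
  have "defect n (Xc 0) - defect n (Xe 0) = 0\<^sub>m n n"
    using X by (simp add: Xc_def Xe_def minus_r_inv_mat[of _ n n])
  then have "d 0 \<le> 0"
    using spectral_norm_le_frobenius[of "0\<^sub>m n n" n n] by (simp add: d_def frobenius_norm_def)
  then show ?thesis
    using d_nonneg[of 0] by simp
qed

lemma d_le: "d k \<le> 20000 * \<delta>"
  using d0 invariant[of "k - 1"] \<delta>_nonneg by (cases k) auto

lemma newton_schulz_P1:
  assumes "e k \<le> u"
  shows "spectral_norm (transpose_mat (Xc k) * Xc k - 1\<^sub>m n) \<le> u + 20000 * \<delta>"
proof -
  have "spectral_norm (transpose_mat (Xc k) * Xc k - 1\<^sub>m n) = spectral_norm (defect n (Xc k))"
    using orthogonality_defect_eq[of "Xc k" n] carrier_matD[OF Xc_carrier, of k] by (simp add: orthogonality_defect_def)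
  then show ?thesis
    using defect_Xc_le[of k] d_le[of k] assms by linarith
qed

text \<open>The start satisfies e_0 at most 2 \<epsilon> + \<epsilon>^2, hence at most 3 \<epsilon>,
  which is at most 1/8 for \<epsilon> up to 1/24. Below 1/8 the map shrinks by at least 4. This
  linear rate is weaker than the quadratic one but has a summable geometric series and suffices to
  limit the number of steps.\<close>

lemma e_decay:
  assumes \<epsilon>: "spectral_norm (X - U) \<le> \<epsilon>" "\<epsilon> \<le> 1/24"
  shows "e k * 4 ^ k \<le> 3 * \<epsilon>"
proof -
  have e0: "e 0 \<le> 3 * \<epsilon>"
  proof -
    have nn: "0 \<le> spectral_norm (X - U)"
      by (rule spectral_norm_nonneg[of _ n n]) simp
    have "defect n U = 0\<^sub>m n n"
      using orthonormal_mat_transpose_mult[OF U] by (simp add: defect_def minus_r_inv_mat[of _ n n])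
    then have "e 0 = spectral_norm (defect n X - defect n U)"
    proof -
      assume "defect n U = 0\<^sub>m n n"
      moreover have "defect n X - 0\<^sub>m n n = defect n X"
        using carrier_matD[OF defect_carrier[OF X]] by (intro eq_matI) auto
      ultimately show ?thesis
        by (simp add: e_def Xe_def)
    qed
    also have "\<dots> \<le> 2 * spectral_norm U * spectral_norm (X - U) + (spectral_norm (X - U))\<^sup>2"
      by (rule defect_perturbation) (use X in auto)
    also have "\<dots> \<le> 2 * 1 * \<epsilon> + \<epsilon> * 1"
      unfolding power2_eq_square
      using spectral_norm_orthonormal[OF U] \<epsilon> nn spectral_norm_nonneg[OF U_carrier]
      by (intro add_mono mult_mono) auto
    finally show ?thesis by simp
  qed
  have "e k * 4 ^ k \<le> 3 * \<epsilon> \<and> e k \<le> 1/8"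
  proof (induction k)
    case 0
    then show ?case using e0 \<epsilon> by simp
  next
    case (Suc k)
    have "e (Suc k) \<le> 3/4 * (e k)\<^sup>2 + 1/4 * e k ^ 3"
      by (rule e_Suc) simp
    also have "\<dots> = e k * (3/4 * e k + 1/4 * (e k * e k))"
      by (simp add: power2_eq_square power3_eq_cube algebra_simps)
    also have "\<dots> \<le> e k * (3/4 * (1/8) + 1/4 * (1/8 * (1/8)))"
      using Suc e_nonneg[of k] by (intro mult_left_mono add_mono mult_mono) auto
    also have "\<dots> \<le> e k / 4"
      using e_nonneg[of k] by simp
    finally have *: "e (Suc k) \<le> e k / 4" .
    have "e (Suc k) * 4 ^ Suc k \<le> e k / 4 * 4 ^ Suc k"
      by (rule mult_right_mono[OF *]) simp
    also have "e k / 4 * 4 ^ Suc k = e k * 4 ^ k"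
      by simp
    finally show ?case
      using Suc * e_nonneg[of k] by linarith
  qed
  then show ?thesis by simp
qed

text \<open>An exact step changes \<open>X\<close> by X E / 2, of norm at most 3/4 times the
  computed defect. What remains besides \<open>e k\<close> is of order \<delta>: the only part of
  the movement that does not die out.\<close>

lemma increment:
  assumes "e k \<le> 97/100"
  shows "spectral_norm (Xc (Suc k) - Xc k) \<le> e k + 20001 * \<delta>"
proof -
  note [simp] = mult_carrier_mat[of _ n n _ n]
  let ?Y = "newton_schulz_exact_step (Xc k)"
  have ed: "e k + d k \<le> 1"
    using assms d_le[of k] \<delta>_small by linarith
  have Xk: "spectral_norm (Xc k) \<le> 3/2"
    by (rule Xc_norm[OF ed])
  have "?Y - Xc k = (1/2) \<cdot>\<^sub>m (Xc k * defect n (Xc k))"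
    unfolding newton_schulz_exact_eq[OF Xc_carrier]
    by (simp add: mult_add_distrib_mat[of _ n n _ n] mult_smult_distrib[of _ n n _ n])
      (intro eq_matI; auto simp: carrier_matD[OF Xc_carrier] carrier_matD[OF defect_carrier[OF Xc_carrier]] algebra_simps simp del: index_mult_mat(1))
  moreover have "spectral_norm (Xc k * defect n (Xc k)) \<le> 3/2 * (e k + d k)"
  proof -
    have "spectral_norm (Xc k * defect n (Xc k)) \<le> spectral_norm (Xc k) * spectral_norm (defect n (Xc k))"
      by (rule spectral_norm_mult[of _ n n _ n]) auto
    also have "\<dots> \<le> 3/2 * (e k + d k)"
      using Xk defect_Xc_le[of k] spectral_norm_nonneg[of "Xc k" n n] spectral_norm_nonneg[of "defect n (Xc k)" n n]
      by (intro mult_mono) auto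
    finally show ?thesis .
  qed
  ultimately have "spectral_norm (?Y - Xc k) \<le> 1/2 * (3/2 * (e k + d k))"
    by (simp only:) (intro spectral_norm_smult_leI[of _ n n]; simp)
  moreover have "spectral_norm (Xc (Suc k) - Xc k) \<le> spectral_norm (Xc (Suc k) - ?Y) + spectral_norm (?Y - Xc k)"
    by (rule spectral_norm_triangle_diff[of _ n n]) auto
  ultimately have "spectral_norm (Xc (Suc k) - Xc k) \<le> \<delta> + 1/2 * (3/2 * (e k + d k))"
    using order_trans[OF _ add_mono[OF local_defect_error(2)[OF Xk]]] by blast
  also have "\<dots> \<le> e k + 20001 * \<delta>"
    using d_le[of k] e_nonneg[of k] d_nonneg[of k] \<delta>_nonneg by simp
  finally show ?thesis .
qed

text \<open>The increments 3 \<epsilon> / 4^i sum to 4 \<epsilon> (1 - 4^(-k)), the form in which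
  the induction closes; the second term is the drift, linear in the number of steps.\<close>

lemma distance_from_start:
  assumes \<epsilon>: "spectral_norm (X - U) \<le> \<epsilon>" "\<epsilon> \<le> 1/24"
  shows "spectral_norm (Xc k - X) \<le> 4 * \<epsilon> * (1 - 1 / 4 ^ k) + real k * (20001 * \<delta>)"
proof (induction k)
  case 0
  have "Xc 0 - X = 0\<^sub>m n n"
    using X by (simp add: Xc_def minus_r_inv_mat[of _ n n])
  then show ?case
    using spectral_norm_le_frobenius[of "0\<^sub>m n n" n n] by (simp add: frobenius_norm_def)
next
  case (Suc k)
  have ek: "e k \<le> 3 * \<epsilon> / 4 ^ k"
    using e_decay[OF \<epsilon>, of k] by (simp add: field_simps)
  have "0 \<le> spectral_norm (X - U)"
    by (rule spectral_norm_nonneg[of _ n n]) simp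
  then have \<epsilon>0: "0 \<le> \<epsilon>"
    using \<epsilon> by linarith
  have "3 * \<epsilon> / 4 ^ k \<le> 3 * \<epsilon> / 1"
    using \<epsilon>0 by (intro divide_left_mono) auto
  then have "e k \<le> 97/100"
    using ek \<epsilon> by simp
  then have "spectral_norm (Xc (Suc k) - Xc k) \<le> 3 * \<epsilon> / 4 ^ k + 20001 * \<delta>"
    using increment[of k] ek by linarith
  moreover have "spectral_norm (Xc (Suc k) - X) \<le> spectral_norm (Xc (Suc k) - Xc k) + spectral_norm (Xc k - X)"
    by (rule spectral_norm_triangle_diff[of _ n n]) (use X in auto)
  moreover have "4 * \<epsilon> * (1 - 1 / 4 ^ k) + 3 * \<epsilon> / 4 ^ k = 4 * \<epsilon> * (1 - 1 / 4 ^ Suc k)"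
    by (simp add: field_simps)
  moreover have "real (Suc k) * (20001 * \<delta>) = real k * (20001 * \<delta>) + 20001 * \<delta>"
    by (simp add: algebra_simps)
  ultimately show ?case
    using Suc.IH by linarith
qed

lemma step_count_bound:
  assumes \<epsilon>: "spectral_norm (X - U) \<le> \<epsilon>" "\<epsilon> \<le> 1/24" and u: "0 \<le> u" and count: "newton_schulz_count m u X k"
  shows "real k * u \<le> real (m + 1) * u + 3 * \<epsilon>"
proof -
  have def: "orthogonality_defect ((newton_schulz_exact_step ^^ j) X) = e j" for j
    using orthogonality_defect_eq[OF Xe_carrier, of j] by (simp add: e_def Xe_def)
  have ek: "e k \<le> u" and later: "\<And>j. j + m < k \<Longrightarrow> u < e j"
    using count by (auto simp: newton_schulz_count_def def)
  define j where "j = (LEAST j. e j \<le> u)"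
  have ej: "e j \<le> u"
    unfolding j_def using ek by (rule LeastI)
  have kj: "k \<le> j + m"
    using later[of j] ej by force
  have "0 \<le> spectral_norm (X - U)"
    by (rule spectral_norm_nonneg[of _ n n]) simp
  then have \<epsilon>0: "0 \<le> \<epsilon>"
    using \<epsilon> by linarith
  have "real j * u \<le> u + 3 * \<epsilon>"
  proof (cases j)
    case 0
    then show ?thesis using u \<epsilon>0 by simp
  next
    \<comment> \<open>By minimality u < e_i, which is at most 3 \<epsilon> / 4^i. The crude
      comparison of \<open>i\<close> with 4^i replaces a logarithmic count of steps.\<close>
    case (Suc i)
    then have "i < j" by simp
    then have "\<not> e i \<le> u"
      unfolding j_def by (rule not_less_Least)
    then have "u \<le> e i" by simp
    moreover have "real i \<le> 4 ^ i"
    proof -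
      have "i < 2 ^ i" by (rule less_exp)
      then have "real i \<le> 2 ^ i"
        by (metis less_imp_le of_nat_le_iff of_nat_numeral of_nat_power)
      also have "(2::real) ^ i \<le> 4 ^ i"
        by (rule power_mono) auto
      finally show ?thesis .
    qed
    ultimately have "real i * u \<le> 4 ^ i * e i"
      using u by (intro mult_mono) auto
    then have "real i * u \<le> 3 * \<epsilon>"
      using e_decay[OF \<epsilon>, of i] by (simp add: mult.commute)
    then show ?thesis
      using Suc by (simp add: algebra_simps)
  qed
  moreover have "real k * u \<le> (real j + real m) * u"
    using kj u by (intro mult_right_mono) auto
  ultimately show ?thesis
    by (simp add: algebra_simps)
qed

end

section \<open>Orthogonality and off-diagonal part\<close>

text \<open>Subtracting a diagonal matrix leaves the off-diagonal entries unchanged, so the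
  approximate eigenvalues need not be identified.\<close>

lemma off_le_frobenius:
  assumes B: "B \<in> carrier_mat n n" and L: "L \<in> carrier_mat n n" "diagonal_mat L"
  shows "off B \<le> frobenius_norm (B - L)"
proof -
  have "(\<Sum>i<n. \<Sum>j\<in>{..<n} - {i}. (B $$ (i,j))\<^sup>2) \<le> (\<Sum>i<n. \<Sum>j<n. ((B - L) $$ (i,j))\<^sup>2)"
  proof (rule sum_mono)
    fix i assume i: "i \<in> {..<n}"
    have "(\<Sum>j\<in>{..<n} - {i}. (B $$ (i,j))\<^sup>2) = (\<Sum>j\<in>{..<n} - {i}. ((B - L) $$ (i,j))\<^sup>2)"
      using L i by (intro sum.cong) (auto simp: diagonal_mat_def)
    also have "\<dots> \<le> (\<Sum>j<n. ((B - L) $$ (i,j))\<^sup>2)"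
      by (intro sum_mono2) auto
    finally show "(\<Sum>j\<in>{..<n} - {i}. (B $$ (i,j))\<^sup>2) \<le> (\<Sum>j<n. ((B - L) $$ (i,j))\<^sup>2)" .
  qed
  then show ?thesis
    using B L unfolding off_def frobenius_norm_def by simp
qed

lemma off_le_frobenius_self: "B \<in> carrier_mat n n \<Longrightarrow> off B \<le> frobenius_norm B"
proof -
  assume B: "B \<in> carrier_mat n n"
  have "B - 0\<^sub>m n n = B"
    using B by (intro eq_matI) auto
  then show ?thesis
    using off_le_frobenius[OF B, of "0\<^sub>m n n"] by (auto simp: diagonal_mat_def)
qed

text \<open>With D = Q - W the difference of the two congruences is D^T A Q + W^T A D. As \<eta> is
  at most 1, \<open>Q\<close> has norm at most 2, so the two terms give 2 \<eta> + \<eta>.\<close>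

lemma off_near_diagonalizer:
  assumes A: "A \<in> carrier_mat n n" and Q: "Q \<in> carrier_mat n n" and W: "orthonormal_mat n W"
    and L: "L \<in> carrier_mat n n" "diagonal_mat L"
    and diag: "frobenius_norm (transpose_mat W * A * W - L) \<le> \<mu> * frobenius_norm A"
    and near: "frobenius_norm (Q - W) \<le> \<eta>" and \<eta>: "\<eta> \<le> 1"
  shows "off (transpose_mat Q * A * Q) \<le> (\<mu> + 3 * \<eta>) * frobenius_norm A"
proof -
  note [simp] = mult_carrier_mat[of _ n n _ n]
  have W' [simp]: "W \<in> carrier_mat n n"
    by (rule orthonormal_mat_carrier[OF W])
  define D where "D = Q - W"
  have D [simp]: "D \<in> carrier_mat n n" by (simp add: D_def)
  have DT: "frobenius_norm (transpose_mat D) \<le> \<eta>"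
    using near by (simp add: D_def frobenius_norm_transpose)
  have sD: "spectral_norm D \<le> \<eta>"
    using spectral_norm_le_frobenius[OF D] near by (simp add: D_def)
  have \<eta>0: "0 \<le> \<eta>"
    using near frobenius_norm_nonneg order_trans by blast
  have sQ: "spectral_norm Q \<le> 2"
    using spectral_norm_le_add_diff[OF Q W'] spectral_norm_orthonormal[OF W] sD \<eta> by (simp add: D_def)
  let ?f = "frobenius_norm A"
  have "transpose_mat Q * A * Q - transpose_mat W * A * W = transpose_mat D * A * Q + transpose_mat W * A * D"
    using A Q unfolding D_def
    by (simp add: transpose_minus[of _ n n] minus_mult_distrib_mat[of _ n n _ _ n] mult_minus_distrib_mat[of _ n n _ n]
        del: assoc_mult_mat)
      (intro eq_matI; auto simp: carrier_matD[OF W'] simp del: index_mult_mat(1) assoc_mult_mat)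
  then have "frobenius_norm (transpose_mat Q * A * Q - transpose_mat W * A * W)
      \<le> frobenius_norm (transpose_mat D * A * Q) + frobenius_norm (transpose_mat W * A * D)"
    using A Q frobenius_norm_triangle[of "transpose_mat D * A * Q" n n "transpose_mat W * A * D"] by simp
  also have "\<dots> \<le> \<eta> * ?f * 2 + ?f * \<eta>"
  proof (rule add_mono)
    have "frobenius_norm (transpose_mat D * A * Q) \<le> frobenius_norm (transpose_mat D * A) * spectral_norm Q"
      using A Q by (intro frobenius_norm_mult_right[of _ n n _ n]) auto
    also have "\<dots> \<le> \<eta> * ?f * 2"
    proof (intro mult_mono sQ)
      have "frobenius_norm (transpose_mat D * A) \<le> frobenius_norm (transpose_mat D) * ?f"
        using A by (intro frobenius_norm_mult[of _ n n _ n]) auto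
      also have "\<dots> \<le> \<eta> * ?f"
        using DT by (intro mult_right_mono) auto
      finally show "frobenius_norm (transpose_mat D * A) \<le> \<eta> * ?f" .
    qed (use \<eta>0 spectral_norm_nonneg[OF Q] in auto)
    finally show "frobenius_norm (transpose_mat D * A * Q) \<le> \<eta> * ?f * 2" .
    have "frobenius_norm (transpose_mat W * A * D) \<le> frobenius_norm (transpose_mat W * A) * frobenius_norm D"
      using A by (intro frobenius_norm_mult[of _ n n _ n]) auto
    also have "\<dots> \<le> ?f * \<eta>"
      using near frobenius_norm_orthonormal_mult_le[OF orthonormal_mat_transpose[OF W] A]
      by (intro mult_mono) (auto simp: D_def)
    finally show "frobenius_norm (transpose_mat W * A * D) \<le> ?f * \<eta>" .
  qed
  finally have 1: "frobenius_norm (transpose_mat Q * A * Q - transpose_mat W * A * W) \<le> 3 * \<eta> * ?f"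
    by simp
  have "off (transpose_mat Q * A * Q) \<le> frobenius_norm (transpose_mat Q * A * Q - L)"
    using A Q L by (intro off_le_frobenius[of _ n]) auto
  also have "\<dots> \<le> frobenius_norm (transpose_mat Q * A * Q - transpose_mat W * A * W) + frobenius_norm (transpose_mat W * A * W - L)"
    using A Q L by (intro frobenius_norm_triangle_diff[of _ n n]) auto
  also have "\<dots> \<le> (\<mu> + 3 * \<eta>) * ?f"
    using 1 diag by (simp add: algebra_simps)
  finally show ?thesis .
qed

text \<open>The trivial bound by |Q|^2 |A|, with 9/4 rounded up to 3. It covers the range of low
  precisions in which no approximation of eigenvectors can be expected.\<close>

lemma off_le_if_defect_le_1:
  assumes A: "A \<in> carrier_mat n n" and Q: "Q \<in> carrier_mat n n"
    and P1: "spectral_norm (transpose_mat Q * Q - 1\<^sub>m n) \<le> 1"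
  shows "off (transpose_mat Q * A * Q) \<le> 3 * frobenius_norm A"
proof -
  note [simp] = mult_carrier_mat[of _ n n _ n]
  have "spectral_norm (defect n Q) \<le> 1"
    using P1 orthogonality_defect_eq[OF Q] carrier_matD[OF Q] by (simp add: orthogonality_defect_def)
  then have sQ: "spectral_norm Q \<le> 3/2"
    by (rule spectral_norm_le_of_defect[OF Q])
  have "off (transpose_mat Q * A * Q) \<le> frobenius_norm (transpose_mat Q * A * Q)"
    using A Q by (intro off_le_frobenius_self[of _ n]) auto
  also have "\<dots> \<le> frobenius_norm (transpose_mat Q * A) * spectral_norm Q"
    using A Q by (intro frobenius_norm_mult_right[of _ n n _ n]) auto
  also have "\<dots> \<le> (3/2 * frobenius_norm A) * (3/2)"
  proof (intro mult_mono sQ)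
    have "frobenius_norm (transpose_mat Q * A) \<le> spectral_norm (transpose_mat Q) * frobenius_norm A"
      using A Q by (intro frobenius_norm_mult_left[of _ n n _ n]) auto
    also have "\<dots> \<le> 3/2 * frobenius_norm A"
      using sQ spectral_norm_transpose[OF Q] by (intro mult_right_mono) auto
    finally show "frobenius_norm (transpose_mat Q * A) \<le> 3/2 * frobenius_norm A" .
  qed (use spectral_norm_nonneg[OF Q] in auto)
  also have "\<dots> \<le> 3 * frobenius_norm A"
    using frobenius_norm_nonneg[of A] by linarith
  finally show ?thesis .
qed

lemma gram_near_orthonormal:
  assumes Y: "Y \<in> carrier_mat n n" and U: "orthonormal_mat n U" and b: "frobenius_norm (Y - U) \<le> b" "b \<le> 1"
  shows "frobenius_norm (transpose_mat Y * Y - 1\<^sub>m n) \<le> 3 * b"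
proof -
  note [simp] = mult_carrier_mat[of _ n n _ n]
  have U' [simp]: "U \<in> carrier_mat n n"
    by (rule orthonormal_mat_carrier[OF U])
  define D where "D = Y - U"
  have D [simp]: "D \<in> carrier_mat n n" by (simp add: D_def)
  have Db: "frobenius_norm D \<le> b" "frobenius_norm (transpose_mat D) \<le> b"
    using b by (auto simp: D_def frobenius_norm_transpose)
  have b0: "0 \<le> b"
    using b(1) frobenius_norm_nonneg order_trans by blast
  have "Y = U + D"
    using Y carrier_matD[OF U'] by (intro eq_matI) (auto simp: D_def)
  then have "transpose_mat Y * Y = transpose_mat U * U + transpose_mat U * D + (transpose_mat D * U + transpose_mat D * D)"
    by (simp add: transpose_add[of _ n n] add_mult_distrib_mat[of _ n n _ _ n] mult_add_distrib_mat[of _ n n _ n])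
      (intro eq_matI; auto simp: carrier_matD[OF D] carrier_matD[OF U'] simp del: index_mult_mat(1))
  then have "transpose_mat Y * Y - 1\<^sub>m n = transpose_mat U * D + (transpose_mat D * U + transpose_mat D * D)"
    unfolding orthonormal_mat_transpose_mult[OF U]
    by (simp only:) (intro eq_matI; auto simp: carrier_matD[OF D] carrier_matD[OF U'] simp del: index_mult_mat(1))
  then have "frobenius_norm (transpose_mat Y * Y - 1\<^sub>m n)
      \<le> frobenius_norm (transpose_mat U * D) + (frobenius_norm (transpose_mat D * U) + frobenius_norm (transpose_mat D * D))"
    by (simp only:) (intro order_trans[OF frobenius_norm_triangle[of _ n n]] add_left_mono frobenius_norm_triangle[of _ n n]; simp)
  also have "\<dots> \<le> b + (b + b * 1)"
  proof (intro add_mono)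
    show "frobenius_norm (transpose_mat U * D) \<le> b"
      using frobenius_norm_orthonormal_mult_le[OF orthonormal_mat_transpose[OF U] D] Db by simp
    show "frobenius_norm (transpose_mat D * U) \<le> b"
      using frobenius_norm_mult_orthonormal_le[OF U, of "transpose_mat D" n] Db by simp
    have "frobenius_norm (transpose_mat D * D) \<le> frobenius_norm (transpose_mat D) * frobenius_norm D"
      by (rule frobenius_norm_mult[of _ n n _ n]) auto
    also have "\<dots> \<le> b * 1"
      using Db b b0 by (intro mult_mono) auto
    finally show "frobenius_norm (transpose_mat D * D) \<le> b * 1" .
  qed
  finally show ?thesis by simp
qed

lemma diagonal_mat_mult:
  assumes "A \<in> carrier_mat n n" "B \<in> carrier_mat n n" "diagonal_mat A" "diagonal_mat (B :: real mat)"
  shows "diagonal_mat (A * B)"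
  unfolding diagonal_mat_def
proof (intro allI impI)
  fix i j assume ij: "i < dim_row (A * B)" "j < dim_col (A * B)" "i \<noteq> j"
  have "(A * B) $$ (i,j) = (\<Sum>l\<in>{0..<n}. A $$ (i,l) * B $$ (l,j))"
    using assms ij by (simp add: scalar_prod_def)
  also have "\<dots> = 0"
  proof (intro sum.neutral ballI)
    fix l assume "l \<in> {0..<n}"
    then show "A $$ (i,l) * B $$ (l,j) = 0"
      using assms ij by (cases "l = i") (auto simp: diagonal_mat_def)
  qed
  finally show "(A * B) $$ (i,j) = 0" .
qed

text \<open>QR factors of a nearly orthonormal matrix: the triangular factor is close to a diagonal matrix
  \<open>D\<close> of signs, so the orthogonal factor agrees with the original matrix up to column signs.\<close>

lemma orthogonal_factor_near:
  assumes Q: "Q \<in> carrier_mat n n" and S: "S \<in> carrier_mat n n" "upper_triangular S" and U: "orthonormal_mat n U"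
    and b: "frobenius_norm (Q * S - U) \<le> b" "b \<le> 1"
    and \<eta>: "frobenius_norm (transpose_mat Q * Q - 1\<^sub>m n) \<le> \<eta>" "\<eta> \<le> 1/4"
    and small: "8 * real n * (3 * b + 9 * \<eta>) \<le> 1" and n: "1 \<le> n"
  obtains D where "orthonormal_mat n D" "diagonal_mat D" "transpose_mat D = D"
    "frobenius_norm (Q - U * D) \<le> 5 * real n * (3 * b + 9 * \<eta>)"
proof -
  note [simp] = mult_carrier_mat[of _ n n _ n]
  have U' [simp]: "U \<in> carrier_mat n n"
    by (rule orthonormal_mat_carrier[OF U])
  define Y where "Y = Q * S"
  have Y [simp]: "Y \<in> carrier_mat n n"
    using Q S by (simp add: Y_def)
  have b0: "0 \<le> b" and \<eta>0: "0 \<le> \<eta>"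
    using b \<eta> frobenius_norm_nonneg order_trans by blast+
  define G where "G = transpose_mat Q * Q - 1\<^sub>m n"
  have G [simp]: "G \<in> carrier_mat n n" by (simp add: G_def)
  have sG: "spectral_norm (defect n Q) \<le> \<eta>"
  proof -
    have "spectral_norm (defect n Q) = spectral_norm G"
      using orthogonality_defect_eq[OF Q] carrier_matD[OF Q] by (simp add: orthogonality_defect_def G_def)
    then show ?thesis
      using spectral_norm_le_frobenius[OF G] \<eta> by (simp add: G_def)
  qed
  have sQ: "spectral_norm Q \<le> 3/2"
    using sG \<eta> by (intro spectral_norm_le_of_defect[OF Q]) auto
  \<comment> \<open>The defect of \<open>Q\<close> is at most 1/4, so |Q y|^2 is at least 3/4 |y|^2.
    With |Q S| at most 2 this bounds |S| by the square root of 16/3.\<close>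
  have sS: "spectral_norm S \<le> 3"
  proof (rule spectral_norm_leI[OF S(1)])
    fix z :: "real vec" assume z: "z \<in> carrier_vec n"
    define y where "y = S *\<^sub>v z"
    have y: "y \<in> carrier_vec n"
      using S z by (auto simp: y_def intro!: mult_mat_vec_carrier[of _ n n])
    have "\<bar>y \<bullet> (defect n Q *\<^sub>v y)\<bar> \<le> vec_norm2 y * vec_norm2 (defect n Q *\<^sub>v y)"
      using Q y by (intro scalar_prod_le_vec_norm2[of _ n]) (auto intro!: mult_mat_vec_carrier[of _ n n])
    also have "\<dots> \<le> vec_norm2 y * (1/4 * vec_norm2 y)"
    proof (intro mult_left_mono)
      have "vec_norm2 (defect n Q *\<^sub>v y) \<le> spectral_norm (defect n Q) * vec_norm2 y"
        using Q y by (intro vec_norm2_mult_le_spectral[of _ n n]) auto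
      also have "\<dots> \<le> 1/4 * vec_norm2 y"
        using sG \<eta> by (intro mult_right_mono) auto
      finally show "vec_norm2 (defect n Q *\<^sub>v y) \<le> 1/4 * vec_norm2 y" .
    qed simp
    finally have "(vec_norm2 y)\<^sup>2 - (vec_norm2 (Q *\<^sub>v y))\<^sup>2 \<le> vec_norm2 y * (1/4 * vec_norm2 y)"
      unfolding defect_quadratic_form[OF Q y] by (rule order_trans[OF abs_ge_self])
    then have "3/4 * (vec_norm2 y)\<^sup>2 \<le> (vec_norm2 (Q *\<^sub>v y))\<^sup>2"
      by (simp add: power2_eq_square)
    also have "Q *\<^sub>v y = Y *\<^sub>v z"
      using Q S z by (simp add: Y_def y_def assoc_mult_mat_vec[of _ n n _ n])
    also have "(vec_norm2 (Y *\<^sub>v z))\<^sup>2 \<le> (2 * vec_norm2 z)\<^sup>2"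
    proof (rule power_mono)
      have "spectral_norm Y \<le> spectral_norm U + spectral_norm (Y - U)"
        by (rule spectral_norm_le_add_diff[of _ n n]) auto
      also have "\<dots> \<le> 1 + 1"
        using spectral_norm_orthonormal[OF U] b order_trans[OF spectral_norm_le_frobenius[of "Y - U" n n]]
        by (intro add_mono) (auto simp: Y_def)
      finally show "vec_norm2 (Y *\<^sub>v z) \<le> 2 * vec_norm2 z"
        using order_trans[OF vec_norm2_mult_le_spectral[OF Y z] mult_right_mono[of "spectral_norm Y" 2 "vec_norm2 z"]]
        by simp
    qed simp
    also have "\<dots> \<le> 3/4 * (3 * vec_norm2 z)\<^sup>2"
      by (simp add: power2_eq_square)
    finally have "(vec_norm2 y)\<^sup>2 \<le> (3 * vec_norm2 z)\<^sup>2"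
      by simp
    then show "vec_norm2 (S *\<^sub>v z) \<le> 3 * vec_norm2 z"
      unfolding y_def by (rule power2_le_imp_le) simp
  qed simp
  have YY: "frobenius_norm (transpose_mat Y * Y - 1\<^sub>m n) \<le> 3 * b"
    using b by (intro gram_near_orthonormal[OF Y U]) (auto simp: Y_def)
  have GS: "frobenius_norm (transpose_mat S * G * S) \<le> 9 * \<eta>"
  proof -
    have "frobenius_norm (transpose_mat S * G * S) \<le> frobenius_norm (transpose_mat S * G) * spectral_norm S"
      using S by (intro frobenius_norm_mult_right[of _ n n _ n]) auto
    also have "\<dots> \<le> (3 * \<eta>) * 3"
    proof (intro mult_mono sS)
      have "frobenius_norm (transpose_mat S * G) \<le> spectral_norm (transpose_mat S) * frobenius_norm G"
        using S by (intro frobenius_norm_mult_left[of _ n n _ n]) auto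
      also have "\<dots> \<le> 3 * \<eta>"
        using sS spectral_norm_transpose[OF S(1)] \<eta> by (intro mult_mono) (auto simp: G_def)
      finally show "frobenius_norm (transpose_mat S * G) \<le> 3 * \<eta>" .
    qed (use \<eta>0 spectral_norm_nonneg[OF S(1)] in auto)
    finally show ?thesis by simp
  qed
  have "transpose_mat Y * Y = transpose_mat S * (transpose_mat Q * Q) * S"
    using Q S by (simp add: Y_def transpose_mult[of _ n n _ n] assoc_mult_mat[of _ n n _ n _ n])
  moreover have "transpose_mat S * G * S = transpose_mat S * (transpose_mat Q * Q) * S - transpose_mat S * S"
    using Q S unfolding G_def
    by (simp add: minus_mult_distrib_mat[of _ n n _ _ n] mult_minus_distrib_mat[of _ n n _ n] right_mult_one_mat[of _ n n])
  ultimately have "transpose_mat S * S - 1\<^sub>m n = (transpose_mat Y * Y - 1\<^sub>m n) - transpose_mat S * G * S"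
    using Q S by (simp only:) (intro eq_matI; auto simp del: index_mult_mat(1))
  then have "frobenius_norm (transpose_mat S * S - 1\<^sub>m n) \<le> frobenius_norm (transpose_mat Y * Y - 1\<^sub>m n) + frobenius_norm (transpose_mat S * G * S)"
    using S by (simp only:) (intro frobenius_norm_minus_triangle[of _ n n]; simp)
  then have gram: "frobenius_norm (transpose_mat S * S - 1\<^sub>m n) \<le> 3 * b + 9 * \<eta>"
    using YY GS by linarith
  obtain D where D: "orthonormal_mat n D" "diagonal_mat D" "transpose_mat D = D"
    "frobenius_norm (S - D) \<le> 2 * real n * (3 * b + 9 * \<eta>)"
    using upper_triangular_near_orthonormal[OF S gram small] by blast
  have D' [simp]: "D \<in> carrier_mat n n"
    by (rule orthonormal_mat_carrier[OF D(1)])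
  have DD: "D * D = 1\<^sub>m n"
    using orthonormal_mat_transpose_mult[OF D(1)] D(3) by simp
  have "Q * D - U = (Y - U) - Q * (S - D)"
    using Q S unfolding Y_def
    by (simp add: mult_minus_distrib_mat[of _ n n _ n]) (intro eq_matI; auto simp: carrier_matD[OF D'] carrier_matD[OF U'] simp del: index_mult_mat(1))
  then have "frobenius_norm (Q * D - U) \<le> frobenius_norm (Y - U) + frobenius_norm (Q * (S - D))"
    using Q S by (simp only:) (intro frobenius_norm_minus_triangle[of _ n n]; simp)
  also have "\<dots> \<le> b + 2 * (2 * real n * (3 * b + 9 * \<eta>))"
  proof (rule add_mono)
    show "frobenius_norm (Y - U) \<le> b"
      using b by (simp add: Y_def)
    have "frobenius_norm (Q * (S - D)) \<le> spectral_norm Q * frobenius_norm (S - D)"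
      using Q by (intro frobenius_norm_mult_left[of _ n n _ n]) auto
    also have "\<dots> \<le> 2 * (2 * real n * (3 * b + 9 * \<eta>))"
      using sQ D(4) by (intro mult_mono) auto
    finally show "frobenius_norm (Q * (S - D)) \<le> 2 * (2 * real n * (3 * b + 9 * \<eta>))" .
  qed
  also have "\<dots> \<le> 5 * real n * (3 * b + 9 * \<eta>)"
  proof -
    have "b \<le> real n * (3 * b + 9 * \<eta>)"
      using n b0 \<eta>0 mult_mono[of 1 "real n" b "3 * b + 9 * \<eta>"] by simp
    then show ?thesis
      by (simp add: mult.assoc)
  qed
  finally have 1: "frobenius_norm (Q * D - U) \<le> 5 * real n * (3 * b + 9 * \<eta>)" .
  \<comment> \<open>\<open>D\<close> is its own inverse, so it moves from \<open>Q\<close> to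
    \<open>U\<close> without changing the distance.\<close>
  have "Q - U * D = (Q * D - U) * D"
    using Q DD by (simp add: minus_mult_distrib_mat[of _ n n _ _ n] assoc_mult_mat[of _ n n _ n _ n] right_mult_one_mat[of _ n n])
  then have "frobenius_norm (Q - U * D) \<le> frobenius_norm (Q * D - U)"
    using frobenius_norm_mult_orthonormal_le[OF D(1), of "Q * D - U" n] by simp
  then show ?thesis
    using that[OF D(1-3)] 1 by simp
qed

text \<open>Takes the orthonormal Q + \<Delta>Q of the backward error as \<open>U\<close>. Then U^T
  B U - L is -U^T \<Delta>B U, whose norm is that of the backward error; the factor \<open>n\<close>
  is the passage from the spectral to the Frobenius norm.\<close>

lemma eigensolver_diagonalizes:
  assumes eig: "backward_stable_eigensolver p n w eig" and w: "0 < w"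
    and B: "B \<in> carrier_mat n n" "symmetric_mat B"
  obtains U L where "fst (eig B) \<in> carrier_mat n n" "orthonormal_mat n U" "L \<in> carrier_mat n n" "diagonal_mat L"
    "spectral_norm (fst (eig B) - U) \<le> poly p (real n) * w"
    "frobenius_norm (transpose_mat U * B * U - L) \<le> real n * (poly p (real n) * w) * frobenius_norm B"
    "0 \<le> poly p (real n)"
proof -
  note [simp] = mult_carrier_mat[of _ n n _ n]
  obtain Q L E D where *: "eig B = (Q, L)" "Q \<in> carrier_mat n n" "L \<in> carrier_mat n n" "diagonal_mat L"
     "E \<in> carrier_mat n n" "D \<in> carrier_mat n n" "B + E = (Q + D) * L * transpose_mat (Q + D)"
     "orthonormal_mat n (Q + D)" "spectral_norm E \<le> poly p (real n) * w * spectral_norm B"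
     "spectral_norm D \<le> poly p (real n) * w"
    using eig B unfolding backward_stable_eigensolver_def by blast
  define U where "U = Q + D"
  have U: "orthonormal_mat n U"
    using * by (simp add: U_def)
  have U' [simp]: "U \<in> carrier_mat n n"
    by (rule orthonormal_mat_carrier[OF U])
  have "0 \<le> poly p (real n) * w"
    using *(10) spectral_norm_nonneg[OF *(6)] by linarith
  \<comment> \<open>Backward stability forces this sign: a norm is bounded by p(n) w with w >
    0.\<close>
  then have pi: "0 \<le> poly p (real n)"
    using w by (simp add: zero_le_mult_iff)
  have "Q - U = - D"
    using * by (intro eq_matI) (auto simp: U_def)
  then have near: "spectral_norm (Q - U) \<le> poly p (real n) * w"
    using * spectral_norm_uminus[OF *(6)] by simp
  have "transpose_mat U * (B + E) * U = (transpose_mat U * U) * L * (transpose_mat U * U)"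
    unfolding *(7) U_def[symmetric] using *(3) by (simp add: assoc_mult_mat[of _ n n _ n _ n])
  also have "\<dots> = L"
    unfolding orthonormal_mat_transpose_mult[OF U] using *(3) by (simp add: left_mult_one_mat[of _ n n] right_mult_one_mat[of _ n n])
  finally have "transpose_mat U * B * U - L = - (transpose_mat U * E * U)"
  proof -
    assume eq: "transpose_mat U * (B + E) * U = L"
    have "transpose_mat U * (B + E) * U = transpose_mat U * B * U + transpose_mat U * E * U"
      using B *(5) by (simp add: add_mult_distrib_mat[of _ n n _ _ n] mult_add_distrib_mat[of _ n n _ n])
    then show ?thesis
      unfolding eq[symmetric] using B *(5) by (simp only:) (intro eq_matI; auto simp del: index_mult_mat(1))
  qed
  then have "frobenius_norm (transpose_mat U * B * U - L) = frobenius_norm (transpose_mat U * E * U)"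
    by (simp add: frobenius_norm_uminus)
  also have "\<dots> \<le> frobenius_norm (transpose_mat U * E)"
    using *(5) by (intro frobenius_norm_mult_orthonormal_le[OF U, of _ n]) simp
  also have "\<dots> \<le> frobenius_norm E"
    by (rule frobenius_norm_orthonormal_mult_le[OF orthonormal_mat_transpose[OF U] *(5)])
  also have "\<dots> \<le> real n * spectral_norm E"
    by (rule frobenius_norm_le_spectral[OF *(5)])
  also have "\<dots> \<le> real n * (poly p (real n) * w * frobenius_norm B)"
    using *(9) spectral_norm_le_frobenius[OF B(1)] pi w
    by (intro mult_left_mono order_trans[OF *(9)]) auto
  finally show ?thesis
    using that[of U L] * U near pi by (simp add: mult.assoc)
qed

lemma defect_near_orthonormal:
  assumes Q: "Q \<in> carrier_mat n n" and W: "orthonormal_mat n W" and near: "frobenius_norm (Q - W) \<le> \<eta>" "\<eta> \<le> 1"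
  shows "spectral_norm (transpose_mat Q * Q - 1\<^sub>m n) \<le> 3 * \<eta>"
  using spectral_norm_le_frobenius[of "transpose_mat Q * Q - 1\<^sub>m n" n n] gram_near_orthonormal[OF Q W near] Q
  by (simp add: mult_carrier_mat[of _ n n])

text \<open>Column signs are invisible to approximate diagonalization: conjugation by
  \<open>D\<close> keeps \<open>L\<close> diagonal and the residual no larger. The sign ambiguity of
  a QR factorization is therefore harmless.\<close>

lemma diagonalizer_signs:
  assumes A: "A \<in> carrier_mat n n" and U: "orthonormal_mat n U" and L: "L \<in> carrier_mat n n" "diagonal_mat L"
    and D: "orthonormal_mat n D" "diagonal_mat D" "transpose_mat D = D"
    and diag: "frobenius_norm (transpose_mat U * A * U - L) \<le> c"
  shows "orthonormal_mat n (U * D)" "D * L * D \<in> carrier_mat n n" "diagonal_mat (D * L * D)"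
    "frobenius_norm (transpose_mat (U * D) * A * (U * D) - D * L * D) \<le> c"
proof -
  note [simp] = mult_carrier_mat[of _ n n _ n]
  have c [simp]: "U \<in> carrier_mat n n" "D \<in> carrier_mat n n"
    using U D by (auto intro: orthonormal_mat_carrier)
  show "orthonormal_mat n (U * D)"
    by (rule orthonormal_mat_mult[OF U D(1)])
  show "D * L * D \<in> carrier_mat n n"
    using L by simp
  show "diagonal_mat (D * L * D)"
    using L D by (intro diagonal_mat_mult[of _ n]) auto
  have "transpose_mat (U * D) * A * (U * D) - D * L * D = D * (transpose_mat U * A * U - L) * D"
    using A L D(3)
    by (simp add: transpose_mult[of _ n n _ n] assoc_mult_mat[of _ n n _ n _ n] mult_minus_distrib_mat[of _ n n _ n]
        minus_mult_distrib_mat[of _ n n _ _ n])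
  then have "frobenius_norm (transpose_mat (U * D) * A * (U * D) - D * L * D) = frobenius_norm (D * (transpose_mat U * A * U - L) * D)"
    by simp
  also have "\<dots> \<le> frobenius_norm (D * (transpose_mat U * A * U - L))"
    using A L by (intro frobenius_norm_mult_orthonormal_le[OF D(1), of _ n]) simp
  also have "\<dots> \<le> frobenius_norm (transpose_mat U * A * U - L)"
    using A L by (intro frobenius_norm_orthonormal_mult_le[OF D(1), of _ n]) simp
  finally show "frobenius_norm (transpose_mat (U * D) * A * (U * D) - D * L * D) \<le> c"
    using diag by simp
qed

text \<open>The power n^5 comes from Gram--Schmidt, whose defect of order n^4 u gains another
  \<open>n\<close> in the comparison of triangular factors. The factor \<open>m + 1\<close> pays for
  surplus Newton--Schulz steps, and 10^8 covers the smallness condition on 6 10^7 n^2 u for the same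
  iteration.\<close>

definition bound_at :: "nat \<Rightarrow> real \<Rightarrow> nat \<Rightarrow> real" where
  "bound_at m \<pi> n = 100000000 * real (m + 1) * (real n ^ 5 + real n ^ 4 * \<pi>)"

text \<open>The guard \<open>\<kappa> u\<^sub>l \<le> 1\<close> is harmless, since otherwise the second bound follows from the first one.\<close>

definition orthogonalizes :: "nat \<Rightarrow> real \<Rightarrow> real \<Rightarrow> real \<Rightarrow> real mat \<Rightarrow> real mat \<Rightarrow> bool" where
  "orthogonalizes n \<kappa> u ul A Q \<longleftrightarrow> Q \<in> carrier_mat n n \<and>
     spectral_norm (transpose_mat Q * Q - 1\<^sub>m n) \<le> \<kappa> * u \<and>
     (\<kappa> * ul \<le> 1 \<longrightarrow> off (transpose_mat Q * A * Q) \<le> \<kappa> * ul * frobenius_norm A)"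

text \<open>The common form in which every method delivers (P2): \<mu> is the residual of the exact
  orthonormal \<open>W\<close>, \<eta> the distance of the computed matrix from it, and the weight 3
  is that of \<open>off_near_diagonalizer\<close>.\<close>

definition near_diagonalizer :: "nat \<Rightarrow> real mat \<Rightarrow> real mat \<Rightarrow> real \<Rightarrow> bool" where
  "near_diagonalizer n A Q \<kappa> \<longleftrightarrow> (\<exists>W L \<mu> \<eta>. orthonormal_mat n W \<and> L \<in> carrier_mat n n \<and> diagonal_mat L \<and>
     frobenius_norm (transpose_mat W * A * W - L) \<le> \<mu> * frobenius_norm A \<and>
     frobenius_norm (Q - W) \<le> \<eta> \<and> 0 \<le> \<mu> \<and> \<mu> + 3 * \<eta> \<le> \<kappa>)"

text \<open>\<pi> stands for the value of the eigensolver polynomial at \<open>n\<close>. Smallness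
  is imposed on \<open>u\<close> alone; the same multiple of \<open>ul\<close> may exceed 1.\<close>

locale two_precisions =
  fixes F :: fparith and u ul :: real and n m :: nat and \<pi> :: real and A :: "real mat"
  assumes model: "standard_model u F" and u_pos: "0 < u" and u_le: "u \<le> ul" and n_pos: "1 \<le> n"
    and \<pi>_nonneg: "0 \<le> \<pi>" and A: "A \<in> carrier_mat n n" and u_small: "bound_at m \<pi> n * u \<le> 1"
begin

definition c :: real where "c = real n ^ 5 + real n ^ 4 * \<pi>"

lemma ul_pos: "0 < ul"
  using u_pos u_le by simp

lemma power_le_c: "k \<le> 5 \<Longrightarrow> real n ^ k \<le> c"
proof -
  assume "k \<le> 5"
  then have "real n ^ k \<le> real n ^ 5"
    using n_pos by (intro power_increasing) auto
  then show ?thesis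
    using \<pi>_nonneg by (simp add: c_def add_increasing2)
qed

lemma power_pi_le_c: "k \<le> 4 \<Longrightarrow> real n ^ k * \<pi> \<le> c"
proof -
  assume "k \<le> 4"
  then have "real n ^ k \<le> real n ^ 4"
    using n_pos by (intro power_increasing) auto
  then show ?thesis
    using \<pi>_nonneg by (simp add: c_def add_increasing mult_right_mono)
qed

lemma power_u: "k \<le> 5 \<Longrightarrow> real n ^ k * u \<le> c * u"
  using power_le_c u_pos by (intro mult_right_mono) auto

lemma power_ul: "k \<le> 5 \<Longrightarrow> real n ^ k * ul \<le> c * ul"
  using power_le_c ul_pos by (intro mult_right_mono) auto

lemma power_pi_u: "k \<le> 4 \<Longrightarrow> real n ^ k * (\<pi> * u) \<le> c * u"
  using mult_right_mono[OF power_pi_le_c, of k u] u_pos by simp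

lemma power_pi_ul: "k \<le> 4 \<Longrightarrow> real n ^ k * (\<pi> * ul) \<le> c * ul"
  using mult_right_mono[OF power_pi_le_c, of k ul] ul_pos by simp

lemma cu_le: "c * u \<le> c * ul"
  using power_le_c[of 0] u_le by (intro mult_left_mono) auto

lemma c_pos: "0 < c * u" "0 < c * ul"
  using power_le_c[of 0] u_pos ul_pos by auto

lemma bound_at_eq: "bound_at m \<pi> n * x = real (m + 1) * (100000000 * (c * x))"
  by (simp add: bound_at_def c_def algebra_simps)

lemma bound_at_ge:
  assumes "0 \<le> c * x" shows "100000000 * (c * x) \<le> bound_at m \<pi> n * x"
  unfolding bound_at_eq using mult_right_mono[of 1 "real (m + 1)" "100000000 * (c * x)"] assms by simp

lemma cu_small: "100000000 * (c * u) \<le> 1"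
  using bound_at_ge[of u] u_small c_pos by simp

sublocale fl_model F u n "2 * real n * u"
proof
  show "2 * real n * u \<le> 1/100"
    using power_u[of 1] cu_small by simp
qed (use model u_pos n_pos in auto)

text \<open>Reduces (P2) to exhibiting a nearby approximate diagonalizer. The guard on
  \<open>ul\<close> also yields \<eta> at most 1, as \<open>off_near_diagonalizer\<close>
  requires.\<close>

lemma orthogonalizesI:
  assumes Q: "Q \<in> carrier_mat n n"
    and P1: "spectral_norm (transpose_mat Q * Q - 1\<^sub>m n) \<le> 100000000 * (c * u)"
    and P2: "bound_at m \<pi> n * ul \<le> 1 \<Longrightarrow> 100000000 * (c * ul) \<le> 1 \<Longrightarrow>
      near_diagonalizer n A Q (bound_at m \<pi> n * ul)"
  shows "orthogonalizes n (bound_at m \<pi> n) u ul A Q"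
  unfolding orthogonalizes_def
proof (intro conjI impI Q)
  show "spectral_norm (transpose_mat Q * Q - 1\<^sub>m n) \<le> bound_at m \<pi> n * u"
    using P1 bound_at_ge[of u] c_pos by simp
  assume ul: "bound_at m \<pi> n * ul \<le> 1"
  then have "100000000 * (c * ul) \<le> 1"
    using bound_at_ge[of ul] c_pos by simp
  from P2[OF ul this] obtain W L \<mu> \<eta> where *: "orthonormal_mat n W" "L \<in> carrier_mat n n" "diagonal_mat L"
    "frobenius_norm (transpose_mat W * A * W - L) \<le> \<mu> * frobenius_norm A"
    "frobenius_norm (Q - W) \<le> \<eta>" "0 \<le> \<mu>" "\<mu> + 3 * \<eta> \<le> bound_at m \<pi> n * ul"
    unfolding near_diagonalizer_def by blast
  have "0 \<le> \<eta>"
    using *(5) frobenius_norm_nonneg order_trans by blast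
  then have "\<eta> \<le> 1"
    using * ul by linarith
  then have "off (transpose_mat Q * A * Q) \<le> (\<mu> + 3 * \<eta>) * frobenius_norm A"
    by (intro off_near_diagonalizer[OF A Q *(1-5)])
  also have "\<dots> \<le> bound_at m \<pi> n * ul * frobenius_norm A"
    using * by (intro mult_right_mono) auto
  finally show "off (transpose_mat Q * A * Q) \<le> bound_at m \<pi> n * ul * frobenius_norm A" .
qed

end

text \<open>\<open>U\<close> is the exactly orthonormal matrix behind the low-precision eigenvectors
  \<open>X\<close>. It is close to \<open>X\<close> and diagonalizes \<open>A\<close>, both up to
  the low-precision backward error.\<close>

locale low_precision_eigenvectors = two_precisions +
  fixes X U L :: "real mat"
  assumes X: "X \<in> carrier_mat n n" and U: "orthonormal_mat n U"
    and L: "L \<in> carrier_mat n n" "diagonal_mat L" and near: "spectral_norm (X - U) \<le> \<pi> * ul"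
    and diag: "frobenius_norm (transpose_mat U * A * U - L) \<le> real n * (\<pi> * ul) * frobenius_norm A"
begin

lemma U_carrier [simp]: "U \<in> carrier_mat n n"
  by (rule orthonormal_mat_carrier[OF U])

lemma XU_frobenius: "frobenius_norm (X - U) \<le> real n * (\<pi> * ul)"
proof -
  have "frobenius_norm (X - U) \<le> real n * spectral_norm (X - U)"
    by (rule frobenius_norm_le_spectral[of _ n]) simp
  also have "\<dots> \<le> real n * (\<pi> * ul)"
    using near by (intro mult_left_mono) auto
  finally show ?thesis .
qed

lemma near_signed_eigenvectors:
  assumes D: "orthonormal_mat n D" "diagonal_mat D" "transpose_mat D = D"
    and near: "frobenius_norm (Q - U * D) \<le> \<eta>" and small: "real n * (\<pi> * ul) + 3 * \<eta> \<le> bound_at m \<pi> n * ul"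
  shows "near_diagonalizer n A Q (bound_at m \<pi> n * ul)"
  unfolding near_diagonalizer_def
  using diagonalizer_signs[OF A U L D diag] near small \<pi>_nonneg ul_pos
  by (intro exI[of _ "U * D"] exI[of _ "D * L * D"] exI[of _ "real n * (\<pi> * ul)"] exI[of _ \<eta>]) auto

text \<open>For (P1), \<open>half\<close> enters only through the singular values of
  \<open>X\<close>. For (P2), the backward error makes Q S close to \<open>U\<close>, and
  \<open>orthogonal_factor_near\<close> removes the triangular factor up to signs.\<close>

lemma mgs_orthogonalizes:
  assumes half: "\<pi> * ul \<le> 1/2"
  shows "orthogonalizes n (bound_at m \<pi> n) u ul A (mgs F X)"
proof -
  have XU: "spectral_norm (X - U) \<le> 1/2"
    using near half by linarith
  interpret run: mgs_run F u n "2 * real n * u" X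
  proof
    show "vec_norm2 z / 2 \<le> vec_norm2 (X *\<^sub>v z)" if "z \<in> carrier_vec n" for z
      by (rule near_orthonormal_bounds(2)[OF X U XU that])
    show "vec_norm2 (col X j) \<le> 2" if "j < n" for j
    proof -
      have "spectral_norm X \<le> 3/2"
        by (rule spectral_norm_leI[OF X]) (use near_orthonormal_bounds(1)[OF X U XU] in auto)
      then show ?thesis
        using vec_norm2_col_le_spectral[OF X that] by linarith
    qed
    have eq: "3000 * real n ^ 3 * (2 * real n * u) = 6000 * (real n ^ 4 * u)"
      by (simp add: eval_nat_numeral)
    show "3000 * real n ^ 3 * (2 * real n * u) \<le> 1"
      unfolding eq using power_u[of 4] cu_small by simp
  qed (rule X)
  obtain S where S: "S \<in> carrier_mat n n" "upper_triangular S" "mgs F X \<in> carrier_mat n n"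
    "frobenius_norm (transpose_mat (mgs F X) * mgs F X - 1\<^sub>m n) \<le> 600 * real n ^ 3 * (2 * real n * u)"
    "frobenius_norm (mgs F X * S - X) \<le> 20 * (real n)\<^sup>2 * (2 * real n * u)"
    by (rule run.mgs_error)
  define \<eta> where "\<eta> = 1200 * (real n ^ 4 * u)"
  have G: "frobenius_norm (transpose_mat (mgs F X) * mgs F X - 1\<^sub>m n) \<le> \<eta>"
    using S(4) by (simp add: \<eta>_def eval_nat_numeral)
  have \<eta>: "\<eta> \<le> 1200 * (c * u)"
    using power_u[of 4] by (simp add: \<eta>_def)
  show ?thesis
  proof (rule orthogonalizesI)
    have "spectral_norm (transpose_mat (mgs F X) * mgs F X - 1\<^sub>m n) \<le> frobenius_norm (transpose_mat (mgs F X) * mgs F X - 1\<^sub>m n)"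
      using S(3) by (intro spectral_norm_le_frobenius[of _ n n]) (auto intro!: minus_carrier_mat)
    then show "spectral_norm (transpose_mat (mgs F X) * mgs F X - 1\<^sub>m n) \<le> 100000000 * (c * u)"
      using G \<eta> c_pos by linarith
  next
    assume ul: "100000000 * (c * ul) \<le> 1"
    \<comment> \<open>The backward error 20 n^2 \<gamma> with \<gamma> = 2 n u, plus the distance of
      \<open>X\<close> from the exact eigenvectors.\<close>
    define b where "b = 40 * (real n ^ 3 * u) + real n * (\<pi> * ul)"
    have QS: "mgs F X * S \<in> carrier_mat n n"
      using S by (simp add: mult_carrier_mat[of _ n n])
    have "frobenius_norm (mgs F X * S - U) \<le> frobenius_norm (mgs F X * S - X) + frobenius_norm (X - U)"
      by (rule frobenius_norm_triangle_diff[OF QS X U_carrier])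
    also have "\<dots> \<le> 20 * (real n)\<^sup>2 * (2 * real n * u) + real n * (\<pi> * ul)"
      by (rule add_mono[OF S(5) XU_frobenius])
    also have "\<dots> = b"
      by (simp add: b_def eval_nat_numeral)
    finally have b: "frobenius_norm (mgs F X * S - U) \<le> b" .
    have e: "real n * (3 * b + 9 * \<eta>) = 120 * (real n ^ 4 * u) + 3 * (real n ^ 2 * (\<pi> * ul)) + 10800 * (real n ^ 5 * u)"
      by (simp add: b_def \<eta>_def eval_nat_numeral algebra_simps)
    have nb: "real n * (3 * b + 9 * \<eta>) \<le> 11000 * (c * ul)"
      unfolding e using power_u[of 4] power_u[of 5] power_pi_ul[of 2] cu_le c_pos by linarith
    have b1: "b \<le> 1"
      using power_u[of 3] power_pi_ul[of 1] cu_le ul unfolding b_def power_one_right by linarith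
    have \<eta>1: "\<eta> \<le> 1/4"
      using \<eta> cu_small by linarith
    have small: "8 * real n * (3 * b + 9 * \<eta>) \<le> 1"
      using nb ul by linarith
    obtain D where D: "orthonormal_mat n D" "diagonal_mat D" "transpose_mat D = D"
      "frobenius_norm (mgs F X - U * D) \<le> 5 * real n * (3 * b + 9 * \<eta>)"
      using orthogonal_factor_near[OF S(3) S(1,2) U b b1 G \<eta>1 small n_pos] by blast
    show "near_diagonalizer n A (mgs F X) (bound_at m \<pi> n * ul)"
    proof (rule near_signed_eigenvectors[OF D])
      have "real n * (\<pi> * ul) + 3 * (5 * real n * (3 * b + 9 * \<eta>)) \<le> 100000000 * (c * ul)"
        using nb power_pi_ul[of 1] c_pos unfolding power_one_right by linarith
      then show "real n * (\<pi> * ul) + 3 * (5 * real n * (3 * b + 9 * \<eta>)) \<le> bound_at m \<pi> n * ul"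
        using bound_at_ge[of ul] c_pos by linarith
    qed
  qed (rule S(3))
qed

text \<open>(P1) follows from the closeness of \<open>Q\<close> to the exactly orthonormal
  \<open>W\<close>, whatever \<open>X\<close> is. The low-precision eigenvectors matter only for
  (P2), through W R being close to \<open>X\<close> and hence to \<open>U\<close>.\<close>

lemma householder_qr_orthogonalizes: "orthogonalizes n (bound_at m \<pi> n) u ul A (householder_qr_Q F X)"
proof -
  have e50: "50 * real n * (2 * real n * u) = 100 * (real n ^ 2 * u)"
    by (simp add: power2_eq_square)
  have small: "50 * real n * (2 * real n * u) \<le> 1"
    unfolding e50 using power_u[of 2] cu_small by simp
  obtain W R where W: "orthonormal_mat n W" "R \<in> carrier_mat n n" "upper_triangular R"
    "householder_qr_Q F X \<in> carrier_mat n n"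
    "frobenius_norm (householder_qr_Q F X - W) \<le> 50 * (real n)\<^sup>2 * (2 * real n * u)"
    "frobenius_norm (R - transpose_mat W * X) \<le> 50 * real n * (2 * real n * u) * frobenius_norm X"
    by (rule householder_qr_error[OF X small])
  have W' [simp]: "W \<in> carrier_mat n n"
    by (rule orthonormal_mat_carrier[OF W(1)])
  define Q where "Q = householder_qr_Q F X"
  have Q: "Q \<in> carrier_mat n n"
    using W by (simp add: Q_def)
  have QW: "frobenius_norm (Q - W) \<le> 100 * (real n ^ 3 * u)"
    using W(5) by (simp add: Q_def eval_nat_numeral)
  have QW1: "100 * (real n ^ 3 * u) \<le> 100 * (c * u)"
    using power_u[of 3] by simp
  show ?thesis
    unfolding Q_def[symmetric]
  proof (rule orthogonalizesI)
    have "spectral_norm (transpose_mat Q * Q - 1\<^sub>m n) \<le> 3 * (100 * (real n ^ 3 * u))"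
      by (rule defect_near_orthonormal[OF Q W(1) QW]) (use QW1 cu_small in linarith)
    then show "spectral_norm (transpose_mat Q * Q - 1\<^sub>m n) \<le> 100000000 * (c * u)"
      using QW1 c_pos by linarith
  next
    assume ul: "100000000 * (c * ul) \<le> 1"
    define b where "b = 200 * (real n ^ 3 * u) + real n * (\<pi> * ul)"
    have XF: "frobenius_norm X \<le> 2 * real n"
    proof -
      have "frobenius_norm X \<le> frobenius_norm U + frobenius_norm (X - U)"
        by (rule frobenius_norm_le_add_diff[OF X U_carrier])
      also have "\<dots> \<le> real n + real n * (\<pi> * ul)"
        by (rule add_mono[OF frobenius_norm_orthonormal_le[OF U] XU_frobenius])
      also have "real n * (\<pi> * ul) \<le> real n * 1"
        using power_pi_ul[of 0] ul by (intro mult_left_mono) auto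
      finally show ?thesis by simp
    qed
    have "frobenius_norm (R - transpose_mat W * X) \<le> 50 * real n * (2 * real n * u) * (2 * real n)"
      using W(6) XF u_pos by (meson mult_left_mono mult_nonneg_nonneg of_nat_0_le_iff order_trans less_imp_le zero_le_numeral)
    then have RW: "frobenius_norm (R - transpose_mat W * X) \<le> 200 * (real n ^ 3 * u)"
      by (simp add: eval_nat_numeral mult_ac)
    have WR: "W * R \<in> carrier_mat n n"
      using W by (simp add: mult_carrier_mat[of _ n n])
    have "W * R - X = W * (R - transpose_mat W * X)"
    proof -
      have "W * (transpose_mat W * X) = (W * transpose_mat W) * X"
        using X by (intro assoc_mult_mat[symmetric, of _ n n _ n _ n]) auto
      also have "\<dots> = X"
        unfolding orthonormal_mat_mult_transpose[OF W(1)] using X by simp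
      finally show ?thesis
        using W(2) X by (subst mult_minus_distrib_mat[of _ n n _ n]) (auto simp: mult_carrier_mat[of _ n n])
    qed
    then have "frobenius_norm (W * R - X) \<le> frobenius_norm (R - transpose_mat W * X)"
      using frobenius_norm_orthonormal_mult_le[OF W(1), of "R - transpose_mat W * X" n] X
      by (simp add: mult_carrier_mat[of _ n n])
    then have b: "frobenius_norm (W * R - U) \<le> b"
      unfolding b_def using order_trans[OF frobenius_norm_triangle_diff[OF WR X U_carrier] add_mono[OF _ XU_frobenius]] RW
      by (meson order_trans)
    \<comment> \<open>\<open>orthogonal_factor_near\<close> is applied to the exactly orthonormal
      \<open>W\<close>, hence with defect bound 0; the computed \<open>Q\<close> enters afterwards
      through its distance from \<open>W\<close>.\<close>
    have gram: "frobenius_norm (transpose_mat W * W - 1\<^sub>m n) \<le> 0"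
    proof -
      have "transpose_mat W * W - 1\<^sub>m n = 0\<^sub>m n n"
        unfolding orthonormal_mat_transpose_mult[OF W(1)] by (rule minus_r_inv_mat[of _ n n]) simp
      then show ?thesis
        by (simp add: frobenius_norm_def)
    qed
    have e: "real n * (3 * b + 9 * 0) = 600 * (real n ^ 4 * u) + 3 * (real n ^ 2 * (\<pi> * ul))"
      by (simp add: b_def eval_nat_numeral algebra_simps)
    have nb: "real n * (3 * b + 9 * 0) \<le> 603 * (c * ul)"
      unfolding e using power_u[of 4] power_pi_ul[of 2] cu_le by linarith
    have b1: "b \<le> 1"
      using power_u[of 3] power_pi_ul[of 1] cu_le ul unfolding b_def power_one_right by linarith
    have small': "8 * real n * (3 * b + 9 * 0) \<le> 1"
      using nb ul by linarith
    obtain D where D: "orthonormal_mat n D" "diagonal_mat D" "transpose_mat D = D"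
      "frobenius_norm (W - U * D) \<le> 5 * real n * (3 * b + 9 * 0)"
      using orthogonal_factor_near[OF W' W(2,3) U b b1 gram _ small' n_pos] by auto
    have UD: "U * D \<in> carrier_mat n n"
      using orthonormal_mat_carrier[OF D(1)] by (simp add: mult_carrier_mat[of _ n n])
    have near': "frobenius_norm (Q - U * D) \<le> 100 * (real n ^ 3 * u) + 5 * real n * (3 * b + 9 * 0)"
      by (rule order_trans[OF frobenius_norm_triangle_diff[OF Q W' UD] add_mono[OF QW D(4)]])
    show "near_diagonalizer n A Q (bound_at m \<pi> n * ul)"
    proof (rule near_signed_eigenvectors[OF D(1-3) near'])
      have "real n * (\<pi> * ul) + 3 * (100 * (real n ^ 3 * u) + 5 * real n * (3 * b + 9 * 0))
          = real n * (\<pi> * ul) + (3 * (100 * (real n ^ 3 * u)) + 15 * (real n * (3 * b + 9 * 0)))"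
        by simp
      also have "\<dots> \<le> c * ul + (3 * (100 * (c * ul)) + 15 * (603 * (c * ul)))"
        using order_trans[OF QW1 mult_left_mono[OF cu_le, of 100]] nb power_pi_ul[of 1]
        by (intro add_mono mult_left_mono) auto
      also have "\<dots> \<le> 100000000 * (c * ul)"
        using c_pos by (simp add: mult_ac)
      finally have "real n * (\<pi> * ul) + 3 * (100 * (real n ^ 3 * u) + 5 * real n * (3 * b + 9 * 0)) \<le> 100000000 * (c * ul)" .
      then show "real n * (\<pi> * ul) + 3 * (100 * (real n ^ 3 * u) + 5 * real n * (3 * b + 9 * 0)) \<le> bound_at m \<pi> n * ul"
        using bound_at_ge[of ul] c_pos by linarith
    qed
  qed (rule Q)
qed

lemma newton_schulz_orthogonalizes:
  assumes half: "\<pi> * ul \<le> 1/2" and count: "newton_schulz_count m u X k"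
  shows "orthogonalizes n (bound_at m \<pi> n) u ul A ((newton_schulz_step F ^^ k) X)"
proof -
  have XU: "spectral_norm (X - U) \<le> 1/2"
    using near half by linarith
  have \<delta>: "30 * real n * (2 * real n * u) = 60 * (real n ^ 2 * u)"
    by (simp add: power2_eq_square)
  interpret run: newton_schulz_run F u n "2 * real n * u" X U "60 * (real n ^ 2 * u)"
  proof
    show "1000000 * (60 * (real n ^ 2 * u)) \<le> 1"
      using power_u[of 2] cu_small by simp
  qed (use X U XU \<delta> in auto)
  define Q where "Q = (newton_schulz_step F ^^ k) X"
  have Q: "Q = run.Xc k" "Q \<in> carrier_mat n n"
    using run.Xc_carrier[of k] by (auto simp: Q_def run.Xc_def)
  show ?thesis
    unfolding Q_def[symmetric]
  proof (rule orthogonalizesI)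
    have "run.e k \<le> u"
      using count orthogonality_defect_eq[OF run.Xe_carrier, of k]
      by (simp add: newton_schulz_count_def run.e_def run.Xe_def)
    from run.newton_schulz_P1[OF this]
    show "spectral_norm (transpose_mat Q * Q - 1\<^sub>m n) \<le> 100000000 * (c * u)"
      using power_u[of 0] power_u[of 2] c_pos unfolding Q(1) by simp
  next
    assume ul: "100000000 * (c * ul) \<le> 1"
    define \<epsilon> where "\<epsilon> = \<pi> * ul"
    have \<epsilon>: "spectral_norm (X - U) \<le> \<epsilon>" "\<epsilon> \<le> 1/24"
      using near power_pi_ul[of 0] ul by (auto simp: \<epsilon>_def)
    have \<epsilon>0: "0 \<le> \<epsilon>"
      using \<pi>_nonneg ul_pos by (simp add: \<epsilon>_def)
    have ku: "real k * u \<le> real (m + 1) * u + 3 * \<epsilon>"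
      by (rule run.step_count_bound[OF \<epsilon> _ count]) (use u_pos in simp)
    \<comment> \<open>5 = 4 + 1 adds the convergent movement of the iterates and the initial
      distance from \<open>U\<close>. 1200060 = 20001 times 60 is the drift per step, multiplied by
      the bound on k u; one power of \<open>n\<close> converts to the Frobenius norm.\<close>
    define \<eta> where "\<eta> = 5 * (real n * \<epsilon>) + 1200060 * (real n ^ 3 * (real (m + 1) * u + 3 * \<epsilon>))"
    have "spectral_norm (Q - X) \<le> 4 * \<epsilon> * (1 - 1 / 4 ^ k) + real k * (20001 * (60 * (real n ^ 2 * u)))"
      unfolding Q(1) by (rule run.distance_from_start[OF \<epsilon>])
    also have "\<dots> \<le> 4 * \<epsilon> + 1200060 * (real n ^ 2 * (real (m + 1) * u + 3 * \<epsilon>))"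
    proof (rule add_mono)
      show "4 * \<epsilon> * (1 - 1 / 4 ^ k) \<le> 4 * \<epsilon>"
        using \<epsilon>0 by (intro mult_left_le) auto
      have "real k * (20001 * (60 * (real n ^ 2 * u))) = 1200060 * (real n ^ 2 * (real k * u))"
        by simp
      also have "\<dots> \<le> 1200060 * (real n ^ 2 * (real (m + 1) * u + 3 * \<epsilon>))"
        using ku by (intro mult_left_mono) auto
      finally show "real k * (20001 * (60 * (real n ^ 2 * u))) \<le> 1200060 * (real n ^ 2 * (real (m + 1) * u + 3 * \<epsilon>))" .
    qed
    finally have QX: "spectral_norm (Q - X) \<le> 4 * \<epsilon> + 1200060 * (real n ^ 2 * (real (m + 1) * u + 3 * \<epsilon>))" .
    have "spectral_norm (Q - U) \<le> (4 * \<epsilon> + 1200060 * (real n ^ 2 * (real (m + 1) * u + 3 * \<epsilon>))) + \<epsilon>"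
      by (rule order_trans[OF spectral_norm_triangle_diff[OF Q(2) X U_carrier] add_mono[OF QX \<epsilon>(1)]])
    then have "real n * spectral_norm (Q - U) \<le> real n * ((4 * \<epsilon> + 1200060 * (real n ^ 2 * (real (m + 1) * u + 3 * \<epsilon>))) + \<epsilon>)"
      by (rule mult_left_mono) simp
    also have "\<dots> = \<eta>"
      by (simp add: \<eta>_def eval_nat_numeral algebra_simps)
    finally have "frobenius_norm (Q - U) \<le> \<eta>"
      using frobenius_norm_le_spectral[of "Q - U" n n] by simp
    \<comment> \<open>The iterates stay near \<open>U\<close> itself, so the matrix of column signs
      is the identity here.\<close>
    then have near': "frobenius_norm (Q - U * 1\<^sub>m n) \<le> \<eta>"
      by (simp add: right_mult_one_mat[OF U_carrier])
    have D: "diagonal_mat (1\<^sub>m n :: real mat)"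
      by (auto simp: diagonal_mat_def)
    show "near_diagonalizer n A Q (bound_at m \<pi> n * ul)"
    proof (rule near_signed_eigenvectors[OF orthonormal_mat_one D transpose_one near'])
      define M where "M = real (m + 1)"
      have M: "1 \<le> M" by (simp add: M_def)
      have "M * (real n ^ 3 * u) \<le> M * (c * ul)"
        using order_trans[OF power_u[of 3] cu_le] M by (intro mult_left_mono) auto
      moreover have "c * ul \<le> M * (c * ul)"
        using mult_right_mono[OF M, of "c * ul"] c_pos by simp
      moreover have "\<eta> = 5 * (real n ^ 1 * (\<pi> * ul)) + 1200060 * (M * (real n ^ 3 * u)) + 3600180 * (real n ^ 3 * (\<pi> * ul))"
        by (simp add: \<eta>_def \<epsilon>_def M_def algebra_simps)
      ultimately have "real n ^ 1 * (\<pi> * ul) + 3 * \<eta> \<le> 100000000 * (M * (c * ul))"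
        using power_pi_ul[of 1] power_pi_ul[of 3] c_pos by linarith
      also have "\<dots> = bound_at m \<pi> n * ul"
        unfolding bound_at_eq M_def by simp
      finally show "real n * (\<pi> * ul) + 3 * \<eta> \<le> bound_at m \<pi> n * ul"
        by simp
    qed
  qed (rule Q(2))
qed

end

section \<open>Low-precision tridiagonalization as a whole\<close>

context two_precisions begin

text \<open>\<open>P\<close> is orthonormal for whatever vectors the low precision has produced.
  Hence (P1) involves only the eigensolver and the back-transformation, both at precision
  \<open>u\<close>. The low precision enters (P2) alone, in the comparison of P A P^T with
  \<open>T\<close>.\<close>

lemma algorithm_T_orthogonalizes:
  assumes model_l: "standard_model ul Fl" and sym: "symmetric_mat A"
    and eig: "backward_stable_eigensolver p n u eig" and p: "poly p (real n) = \<pi>"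
  shows "orthogonalizes n (bound_at m \<pi> n) u ul A (algorithm_T Fl F eig A)"
proof -
  note [simp] = mult_carrier_mat[of _ n n _ n]
  define Al where "Al = map_mat (fround Fl) A"
  define T where "T = tridiag_T Fl Al"
  define V where "V = tridiag_V Fl Al"
  define P where "P = rev_prod n (\<lambda>j. reflector n (j+1) (\<lambda>i. V $$ (i,j))) (n - 2)"
  have Al: "Al \<in> carrier_mat n n" "symmetric_mat Al"
    using A sym unfolding Al_def symmetric_mat_def by (auto intro!: eq_matI) (metis carrier_matD index_transpose_mat(1))
  have P: "orthonormal_mat n P"
    unfolding P_def by (rule rev_prod_orthonormal) (rule reflector_orthonormal)
  have P' [simp]: "P \<in> carrier_mat n n"
    by (rule orthonormal_mat_carrier[OF P])
  have T: "T \<in> carrier_mat n n" "symmetric_mat T"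
  proof -
    \<comment> \<open>Shape and symmetry hold for arbitrary arithmetic. The low-precision error
      model is not at hand here, since \<open>ul\<close> may still be large.\<close>
    have iter: "tridiag_iter Fl n Al k \<in> carrier_mat n n \<and> symmetric_mat (tridiag_iter Fl n Al k)" for k
    proof (induction k)
      case 0
      then show ?case using Al by simp
    next
      case (Suc k)
      then show ?case
        using tridiag_step_carrier[of _ n] tridiag_step_symmetric[of _ n] by simp
    qed
    show "T \<in> carrier_mat n n" "symmetric_mat T"
      using iter[of "n - 2"] Al by (auto simp: T_def tridiag_T_def)
  qed
  obtain U L where eigU: "fst (eig T) \<in> carrier_mat n n" "orthonormal_mat n U" "L \<in> carrier_mat n n" "diagonal_mat L"
    "spectral_norm (fst (eig T) - U) \<le> \<pi> * u"
    "frobenius_norm (transpose_mat U * T * U - L) \<le> real n * (\<pi> * u) * frobenius_norm T"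
    using eigensolver_diagonalizes[OF eig u_pos T] unfolding p by blast
  have U' [simp]: "U \<in> carrier_mat n n"
    by (rule orthonormal_mat_carrier[OF eigU(2)])
  define S where "S = fst (eig T)"
  have S [simp]: "S \<in> carrier_mat n n"
    using eigU by (simp add: S_def)
  define Q where "Q = algorithm_T Fl F eig A"
  have Qeq: "Q = foldr (\<lambda>j. fl_reflect F n (j+1) (\<lambda>i. V $$ (i,j))) [0..<n - 2] S"
    using A by (simp add: Q_def algorithm_T_def Let_def V_def S_def T_def Al_def)
  define W where "W = transpose_mat P * U"
  have W: "orthonormal_mat n W"
    unfolding W_def by (rule orthonormal_mat_mult[OF orthonormal_mat_transpose[OF P] eigU(2)])
  have W' [simp]: "W \<in> carrier_mat n n"
    by (rule orthonormal_mat_carrier[OF W])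
  have e50: "50 * real n * (2 * real n * u) = 100 * (real n ^ 2 * u)"
    by (simp add: power2_eq_square)
  have small: "50 * real n * (2 * real n * u) \<le> 1"
    unfolding e50 using power_u[of 2] cu_small by simp
  have Q: "Q \<in> carrier_mat n n" and QP: "frobenius_norm (Q - transpose_mat P * S) \<le> 50 * real n * (2 * real n * u) * frobenius_norm S"
    using apply_reflectors_error[OF small, of "n - 2" S "\<lambda>j i. V $$ (i,j)"] by (auto simp: Qeq P_def)
  have SU: "frobenius_norm (S - U) \<le> real n * (\<pi> * u)"
  proof -
    have "frobenius_norm (S - U) \<le> real n * spectral_norm (S - U)"
      by (rule frobenius_norm_le_spectral[of _ n]) simp
    also have "\<dots> \<le> real n * (\<pi> * u)"
      using eigU(5) by (intro mult_left_mono) (auto simp: S_def)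
    finally show ?thesis .
  qed
  have SF: "frobenius_norm S \<le> 2 * real n"
  proof -
    have "frobenius_norm S \<le> frobenius_norm U + frobenius_norm (S - U)"
      by (rule frobenius_norm_le_add_diff[of _ n n]) auto
    also have "\<dots> \<le> real n + real n * (\<pi> * u)"
      by (rule add_mono[OF frobenius_norm_orthonormal_le[OF eigU(2)] SU])
    also have "real n * (\<pi> * u) \<le> real n * 1"
      using power_pi_u[of 0] cu_small by (intro mult_left_mono) auto
    finally show ?thesis by simp
  qed
  have QW: "frobenius_norm (Q - W) \<le> 200 * (real n ^ 3 * u) + real n * (\<pi> * u)"
  proof -
    have "frobenius_norm (Q - transpose_mat P * S) \<le> 100 * (real n ^ 2 * u) * (2 * real n)"
      using QP unfolding e50 by (rule order_trans) (use SF u_pos in \<open>intro mult_left_mono; simp\<close>)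
    also have "\<dots> = 200 * (real n ^ 3 * u)"
      by (simp add: eval_nat_numeral)
    finally have 1: "frobenius_norm (Q - transpose_mat P * S) \<le> 200 * (real n ^ 3 * u)" .
    have "transpose_mat P * S - W = transpose_mat P * (S - U)"
      unfolding W_def by (subst mult_minus_distrib_mat[of _ n n _ n]) auto
    then have 2: "frobenius_norm (transpose_mat P * S - W) \<le> real n * (\<pi> * u)"
      using frobenius_norm_orthonormal_mult_le[OF orthonormal_mat_transpose[OF P], of "S - U" n] SU by simp
    have "frobenius_norm (Q - W) \<le> frobenius_norm (Q - transpose_mat P * S) + frobenius_norm (transpose_mat P * S - W)"
      by (rule frobenius_norm_triangle_diff[OF Q]) auto
    also have "\<dots> \<le> 200 * (real n ^ 3 * u) + real n * (\<pi> * u)"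
      by (rule add_mono[OF 1 2])
    finally show ?thesis .
  qed
  have QW1: "200 * (real n ^ 3 * u) + real n * (\<pi> * u) \<le> 201 * (c * u)"
    using power_u[of 3] power_pi_u[of 1] unfolding power_one_right by linarith
  show ?thesis
    unfolding Q_def[symmetric]
  proof (rule orthogonalizesI[OF Q])
    have "spectral_norm (transpose_mat Q * Q - 1\<^sub>m n) \<le> 3 * (200 * (real n ^ 3 * u) + real n * (\<pi> * u))"
      by (rule defect_near_orthonormal[OF Q W QW]) (use QW1 cu_small in linarith)
    also have "\<dots> \<le> 3 * (201 * (c * u))"
      by (rule mult_left_mono[OF QW1]) simp
    also have "\<dots> \<le> 100000000 * (c * u)"
      using c_pos by (simp add: mult_ac)
    finally show "spectral_norm (transpose_mat Q * Q - 1\<^sub>m n) \<le> 100000000 * (c * u)" .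
  next
    assume ul: "100000000 * (c * ul) \<le> 1"
    \<comment> \<open>Under the guard, \<open>ul\<close> is small enough for the error model of the
      low precision.\<close>
    interpret low: fl_model Fl ul n "2 * real n * ul"
    proof
      show "2 * real n * ul \<le> 1/100"
        using power_ul[of 1] ul by simp
    qed (use model_l ul_pos n_pos in auto)
    let ?f = "frobenius_norm A"
    have e600: "600 * real n * (2 * real n * ul) = 1200 * (real n ^ 2 * ul)"
      by (simp add: power2_eq_square)
    have small': "600 * real n * (2 * real n * ul) \<le> 1"
      unfolding e600 using power_ul[of 2] ul by simp
    have AlA: "frobenius_norm (Al - A) \<le> ul * ?f"
    proof -
      have "frobenius_norm (Al - A) \<le> L2_set (\<lambda>z. ul * \<bar>case z of (i,j) \<Rightarrow> A $$ (i,j)\<bar>) ({..<n} \<times> {..<n})"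
        using A low.fround_error unfolding frobenius_norm_L2_set
        by (auto simp: Al_def intro!: L2_set_mono_abs)
      also have "\<dots> = ul * ?f"
        using A ul_pos by (simp add: L2_set_scale L2_set_abs frobenius_norm_L2_set)
      finally show ?thesis .
    qed
    have AlF: "frobenius_norm Al \<le> 2 * ?f"
    proof -
      have "ul * ?f \<le> 1 * ?f"
        using power_ul[of 0] ul by (intro mult_right_mono) auto
      then show ?thesis
        using frobenius_norm_le_add_diff[OF Al(1) A] AlA by linarith
    qed
    have TP: "frobenius_norm (T - P * Al * transpose_mat P) \<le> 2400 * (real n ^ 2 * ul) * ?f"
    proof -
      have "frobenius_norm (T - P * Al * transpose_mat P) \<le> 1200 * (real n ^ 2 * ul) * frobenius_norm Al"
        using low.tridiag_error[OF Al small'] unfolding e600 by (simp add: T_def P_def V_def)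
      also have "\<dots> \<le> 1200 * (real n ^ 2 * ul) * (2 * ?f)"
        using AlF ul_pos by (intro mult_left_mono) auto
      finally show ?thesis by simp
    qed
    have conj: "frobenius_norm (P * Z * transpose_mat P) \<le> frobenius_norm Z" if "Z \<in> carrier_mat n n" for Z
      using frobenius_norm_mult_orthonormal_le[OF orthonormal_mat_transpose[OF P], of "P * Z" n]
        frobenius_norm_orthonormal_mult_le[OF P that] that by simp
    have TF: "frobenius_norm T \<le> 3 * ?f"
    proof -
      have "frobenius_norm T \<le> frobenius_norm (P * Al * transpose_mat P) + frobenius_norm (T - P * Al * transpose_mat P)"
        by (rule frobenius_norm_le_add_diff[OF T(1)]) (use Al in auto)
      also have "\<dots> \<le> 2 * ?f + 1 * ?f"
      proof (rule add_mono)
        show "frobenius_norm (P * Al * transpose_mat P) \<le> 2 * ?f"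
          using conj[OF Al(1)] AlF by linarith
        have "2400 * (real n ^ 2 * ul) * ?f \<le> 1 * ?f"
          using power_ul[of 2] ul by (intro mult_right_mono) auto
        then show "frobenius_norm (T - P * Al * transpose_mat P) \<le> 1 * ?f"
          using TP by linarith
      qed
      finally show ?thesis by simp
    qed
    have TA: "frobenius_norm (P * A * transpose_mat P - T) \<le> (ul + 2400 * (real n ^ 2 * ul)) * ?f"
    proof -
      have "P * A * transpose_mat P - P * Al * transpose_mat P = P * (A - Al) * transpose_mat P"
        using A Al by (simp add: mult_minus_distrib_mat[of _ n n _ n] minus_mult_distrib_mat[of _ n n _ _ n] del: assoc_mult_mat)
      then have "frobenius_norm (P * A * transpose_mat P - P * Al * transpose_mat P) \<le> frobenius_norm (A - Al)"
        using conj[of "A - Al"] Al by simp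
      then have 1: "frobenius_norm (P * A * transpose_mat P - P * Al * transpose_mat P) \<le> ul * ?f"
        using AlA frobenius_norm_minus_commute[OF A Al(1)] by simp
      have PA: "P * A * transpose_mat P \<in> carrier_mat n n" "P * Al * transpose_mat P \<in> carrier_mat n n"
        using A Al by (auto simp del: assoc_mult_mat)
      have 2: "frobenius_norm (P * Al * transpose_mat P - T) \<le> 2400 * (real n ^ 2 * ul) * ?f"
        using TP frobenius_norm_minus_commute[OF T(1) PA(2)] by simp
      have "frobenius_norm (P * A * transpose_mat P - T) \<le> ul * ?f + 2400 * (real n ^ 2 * ul) * ?f"
        by (rule order_trans[OF frobenius_norm_triangle_diff[OF PA T(1)] add_mono[OF 1 2]])
      then show ?thesis
        by (simp add: algebra_simps)
    qed
    define \<mu> where "\<mu> = ul + 2400 * (real n ^ 2 * ul) + 3 * (real n * (\<pi> * u))"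
    have WL: "frobenius_norm (transpose_mat W * A * W - L) \<le> \<mu> * ?f"
    proof -
      define B where "B = P * A * transpose_mat P"
      have B [simp]: "B \<in> carrier_mat n n"
        using A by (simp add: B_def del: assoc_mult_mat)
      have eq: "transpose_mat W * A * W = transpose_mat U * B * U"
        unfolding W_def B_def using A
        by (simp add: transpose_mult[of _ n n _ n] transpose_transpose assoc_mult_mat[of _ n n _ n _ n])
      have "transpose_mat U * B * U - transpose_mat U * T * U = transpose_mat U * (B - T) * U"
        using T by (simp add: mult_minus_distrib_mat[of _ n n _ n] minus_mult_distrib_mat[of _ n n _ _ n] del: assoc_mult_mat)
      then have 1: "frobenius_norm (transpose_mat U * B * U - transpose_mat U * T * U) \<le> frobenius_norm (B - T)"
        using T frobenius_norm_mult_orthonormal_le[OF eigU(2), of "transpose_mat U * (B - T)" n]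
          frobenius_norm_orthonormal_mult_le[OF orthonormal_mat_transpose[OF eigU(2)], of "B - T" n]
        by (simp del: assoc_mult_mat)
      have 2: "frobenius_norm (transpose_mat U * T * U - L) \<le> real n * (\<pi> * u) * (3 * ?f)"
        using eigU(6) by (rule order_trans) (use TF \<pi>_nonneg u_pos in \<open>intro mult_left_mono; simp\<close>)
      have "frobenius_norm (transpose_mat U * B * U - L)
          \<le> frobenius_norm (transpose_mat U * B * U - transpose_mat U * T * U) + frobenius_norm (transpose_mat U * T * U - L)"
        by (rule frobenius_norm_triangle_diff[of _ n n]) (use T eigU in \<open>auto simp del: assoc_mult_mat\<close>)
      also have "\<dots> \<le> (ul + 2400 * (real n ^ 2 * ul)) * ?f + real n * (\<pi> * u) * (3 * ?f)"
        using 1 2 TA by (intro add_mono) (auto simp: B_def)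
      also have "\<dots> = \<mu> * ?f"
        by (simp add: \<mu>_def algebra_simps)
      finally show ?thesis
        unfolding eq .
    qed
    have "\<mu> + 3 * (200 * (real n ^ 3 * u) + real n * (\<pi> * u))
        \<le> (c * ul + 2400 * (c * ul) + 3 * (c * ul)) + 3 * (201 * (c * ul))"
      using power_ul[of 0] power_ul[of 2] order_trans[OF power_pi_u[of 1] cu_le]
        order_trans[OF QW1 mult_left_mono[OF cu_le, of 201]]
      unfolding \<mu>_def by (intro add_mono mult_left_mono) auto
    also have "\<dots> \<le> 100000000 * (c * ul)"
      using c_pos by (simp add: mult_ac)
    finally have "\<mu> + 3 * (200 * (real n ^ 3 * u) + real n * (\<pi> * u)) \<le> 100000000 * (c * ul)" .
    then have "\<mu> + 3 * (200 * (real n ^ 3 * u) + real n * (\<pi> * u)) \<le> bound_at m \<pi> n * ul"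
      using bound_at_ge[of ul] c_pos by linarith
    moreover have "0 \<le> \<mu>"
      using ul_pos u_pos \<pi>_nonneg by (simp add: \<mu>_def)
    ultimately show "near_diagonalizer n A Q (bound_at m \<pi> n * ul)"
      unfolding near_diagonalizer_def using W eigU(3,4) WL QW by blast
  qed
qed

end

theorem corollary3p3:
  fixes p :: "real poly" and m :: nat
  shows "\<exists>p\<^sub>1 p\<^sub>4 :: real poly.
    degree p\<^sub>1 \<le> degree p + 8 \<and> degree p\<^sub>4 \<le> degree p + 8 \<and>
    (\<forall>(n::nat) (A::real mat) (u::real) (u\<^sub>l::real) (F::fparith) (F\<^sub>l::fparith) eig eig\<^sub>l Q.
       1 \<le> n \<longrightarrow> A \<in> carrier_mat n n \<longrightarrow> symmetric_mat A \<longrightarrow>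
       0 < u \<longrightarrow> u < u\<^sub>l \<longrightarrow> poly p\<^sub>1 (real n) * u < 1 \<longrightarrow>
       standard_model u F \<longrightarrow> standard_model u\<^sub>l F\<^sub>l \<longrightarrow>
       backward_stable_eigensolver p n u eig \<longrightarrow>
       backward_stable_eigensolver p n u\<^sub>l eig\<^sub>l \<longrightarrow>
       (\<exists>meth. method_applicable meth m u (poly p (real n) * u\<^sub>l) (fst (eig\<^sub>l A)) \<and>
               Q = algorithm_O F eig\<^sub>l meth A) \<or>
       Q = algorithm_T F\<^sub>l F eig A \<longrightarrow>
       property_P1 p\<^sub>1 n u Q \<and> property_P2 p\<^sub>4 n u\<^sub>l A Q)"
proof -
  \<comment> \<open>Three times \<open>bound_at\<close>, read as a polynomial in \<open>n\<close>;
    it serves for both properties. The 3 is the constant of \<open>off_le_if_defect_le_1\<close>,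
    and with it the hypothesis on \<open>u\<close> becomes 3 \<kappa> u < 1.\<close>
  define P where "P = Polynomial.smult (300000000 * real (m + 1)) (monom 1 5 + monom 1 4 * p)"
  have "degree (monom (1::real) 5 + monom 1 4 * p) \<le> degree p + 8"
    by (intro degree_add_le) (auto simp: degree_monom_eq intro: order_trans[OF degree_mult_le])
  then have deg: "degree P \<le> degree p + 8"
    unfolding P_def by (meson degree_smult_le order_trans)
  have poly_P: "poly P (real n) = 3 * bound_at m (poly p (real n)) n" for n
    by (simp add: P_def bound_at_def poly_monom)
  have main: "property_P1 P n u Q \<and> property_P2 P n u\<^sub>l A Q"
    if n: "1 \<le> n" and sym: "A \<in> carrier_mat n n" "symmetric_mat A" and u: "0 < u" "u < u\<^sub>l" "poly P (real n) * u < 1"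
      and arith: "standard_model u F" "standard_model u\<^sub>l F\<^sub>l"
      and eig: "backward_stable_eigensolver p n u eig" "backward_stable_eigensolver p n u\<^sub>l eig\<^sub>l"
      and Q: "(\<exists>meth. method_applicable meth m u (poly p (real n) * u\<^sub>l) (fst (eig\<^sub>l A)) \<and>
               Q = algorithm_O F eig\<^sub>l meth A) \<or> Q = algorithm_T F\<^sub>l F eig A"
    for n :: nat and A Q :: "real mat" and u u\<^sub>l :: real and F F\<^sub>l :: fparith and eig eig\<^sub>l
  proof -
    define \<pi> where "\<pi> = poly p (real n)"
    define \<kappa> where "\<kappa> = bound_at m \<pi> n"
    have ul: "0 < u\<^sub>l"
      using u by simp
    obtain U L where EU: "fst (eig\<^sub>l A) \<in> carrier_mat n n" "orthonormal_mat n U" "L \<in> carrier_mat n n" "diagonal_mat L"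
      "spectral_norm (fst (eig\<^sub>l A) - U) \<le> \<pi> * u\<^sub>l"
      "frobenius_norm (transpose_mat U * A * U - L) \<le> real n * (\<pi> * u\<^sub>l) * frobenius_norm A" "0 \<le> \<pi>"
      using eigensolver_diagonalizes[OF eig(2) ul sym] unfolding \<pi>_def by blast
    have \<kappa>0: "0 \<le> \<kappa>"
      using EU(7) by (simp add: \<kappa>_def bound_at_def)
    have \<kappa>u0: "0 \<le> \<kappa> * u"
      using \<kappa>0 u by simp
    have \<kappa>u: "3 * (\<kappa> * u) < 1"
      using u(3) by (simp add: poly_P \<kappa>_def \<pi>_def)
    interpret two_precisions F u u\<^sub>l n m \<pi> A
      by unfold_locales (use n sym u arith EU(7) \<kappa>u \<kappa>u0 in \<open>auto simp: \<kappa>_def\<close>)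
    have "orthogonalizes n \<kappa> u u\<^sub>l A Q"
      using Q
    proof
      assume "Q = algorithm_T F\<^sub>l F eig A"
      then show ?thesis
        using algorithm_T_orthogonalizes[OF arith(2) sym(2) eig(1)] by (simp add: \<kappa>_def \<pi>_def)
    next
      assume "\<exists>meth. method_applicable meth m u (poly p (real n) * u\<^sub>l) (fst (eig\<^sub>l A)) \<and>
               Q = algorithm_O F eig\<^sub>l meth A"
      then obtain meth where meth: "method_applicable meth m u (\<pi> * u\<^sub>l) (fst (eig\<^sub>l A))"
        "Q = orthogonalize F meth (fst (eig\<^sub>l A))"
        by (auto simp: algorithm_O_def \<pi>_def)
      interpret low_precision_eigenvectors F u u\<^sub>l n m \<pi> A "fst (eig\<^sub>l A)" U L
        by unfold_locales (use EU in auto)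
      show ?thesis
      proof (cases meth)
        case MGS
        then show ?thesis
          using mgs_orthogonalizes meth by (simp add: \<kappa>_def)
      next
        case Householder_QR
        then show ?thesis
          using householder_qr_orthogonalizes meth by (simp add: \<kappa>_def)
      next
        case (Newton_Schulz k)
        then show ?thesis
          using newton_schulz_orthogonalizes meth by (simp add: \<kappa>_def)
      qed
    qed
    then have o: "Q \<in> carrier_mat n n" "spectral_norm (transpose_mat Q * Q - 1\<^sub>m n) \<le> \<kappa> * u"
      "\<kappa> * u\<^sub>l \<le> 1 \<Longrightarrow> off (transpose_mat Q * A * Q) \<le> \<kappa> * u\<^sub>l * frobenius_norm A"
      by (auto simp: orthogonalizes_def)
    have P_eq: "poly P (real n) = 3 * \<kappa>"
      by (simp add: poly_P \<kappa>_def \<pi>_def)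
    have "property_P1 P n u Q"
      unfolding property_P1_def P_eq using o(2) \<kappa>u \<kappa>u0 by simp
    moreover have "off (transpose_mat Q * A * Q) \<le> 3 * \<kappa> * u\<^sub>l * frobenius_norm A"
    proof (cases "\<kappa> * u\<^sub>l \<le> 1")
      case True
      have "\<kappa> * u\<^sub>l * frobenius_norm A \<le> 3 * \<kappa> * u\<^sub>l * frobenius_norm A"
        using \<kappa>0 ul by (intro mult_right_mono) auto
      then show ?thesis
        using o(3)[OF True] by linarith
    next
      case False
      \<comment> \<open>As \<kappa> times the low-precision roundoff exceeds 1 here, the trivial
        bound already implies the claim; it rests on (P1).\<close>
      have "off (transpose_mat Q * A * Q) \<le> 3 * frobenius_norm A"
        using o(2) \<kappa>u \<kappa>u0 by (intro off_le_if_defect_le_1[OF sym(1) o(1)]) linarith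
      also have "\<dots> \<le> 3 * \<kappa> * u\<^sub>l * frobenius_norm A"
        using False by (intro mult_right_mono) auto
      finally show ?thesis .
    qed
    ultimately show ?thesis
      unfolding property_P2_def P_eq by simp
  qed
  show ?thesis
    using deg main by blast
qed

end
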